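(* For any Poisson measure $M(dt,dx)$ on $[0,\infty)\times\mathbb{R}$ with intensity measure $dt\,dx$, there a.s. exists a unique limit forest fire process (LFFP) $(Z_t(x),D_t(x),H_t(x))_{t\ge 0,x\in\mathbb{R}}$ associated with $M$. Furthermore, it can be constructed graphically and thus its restriction to any finite box $[0,T]\times[-n,n]$ can be perfectly simulated.
   Context: Let $\mathcal{I}=\{[a,b]: a\le b\}$ be the set of all closed finite intervals of $\mathbb{R}$. For the Poisson measure $M$ set $\mathcal{F}^M_t=\sigma(M(B), B\in\mathcal{B}([0,t]\times\mathbb{R}))$. The subscript $s-$ denotes left limits in time. An $(\mathcal{F}^M_t)_{t\ge0}$-adapted process $(Z_t(x),D_t(x),H_t(x))_{t\ge0,x\in\mathbb{R}}$ with values in $\mathbb{R}_+\times\mathcal{I}\times\mathbb{R}_+$ is a limit forest fire process (LFFP) associated with $M$ if a.s., for all $t\ge0$ and all $x\in\mathbb{R}$, $$Z_t(x)=\int_0^t \mathbf{1}_{\{Z_s(x)<1\}}\,ds-\int_0^t\int_{\mathbb{R}}\mathbf{1}_{\{Z_{s-}(x)=1,\ y\in D_{s-}(x)\}}M(ds,dy),$$ $$H_t(x)=\int_0^t Z_{s-}(x)\mathbf{1}_{\{Z_{s-}(x)<1\}}M(ds\times\{x\})-\int_0^t\mathbf{1}_{\{H_s(x)>0\}}\,ds,$$ where $D_t(x)=[L_t(x),R_t(x)]$ with $L_t(x)=\sup\{y\le x: Z_t(y)<1\text{ or }H_t(y)>0\}$ and $R_t(x)=\inf\{y\ge x: Z_t(y)<1\text{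 or }H_t(y)>0\}$. *)

theory Defs
  imports "HOL-Probability.Probability"
begin

section \<open>Poisson measures\<close>

definition poisson_measure :: "'w measure \<Rightarrow> 'a measure \<Rightarrow> ('w \<Rightarrow> 'a measure) \<Rightarrow> bool" where
  "poisson_measure P \<mu> M \<longleftrightarrow>
     (\<forall>\<omega>\<in>space P. sets (M \<omega>) = sets \<mu> \<and>
        (\<forall>B\<in>sets \<mu>. emeasure (M \<omega>) B \<in> range of_nat \<union> {\<top>})) \<and>
     (\<forall>B\<in>sets \<mu>. (\<lambda>\<omega>. emeasure (M \<omega>) B) \<in> borel_measurable P) \<and>
     (\<forall>B\<in>sets \<mu>. emeasure \<mu> B < \<infinity> \<longrightarrow>
        (\<forall>j::nat. measure P {\<omega> \<in> space P. emeasure (M \<omega>) B = of_nat j}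
                  = measure \<mu> B ^ j / fact j * exp (- measure \<mu> B))) \<and>
     (\<forall>(B :: nat \<Rightarrow> 'a set) J. finite J \<longrightarrow> B ` J \<subseteq> sets \<mu> \<longrightarrow> disjoint_family_on B J \<longrightarrow>
        prob_space.indep_vars P (\<lambda>_. borel) (\<lambda>j \<omega>. emeasure (M \<omega>) (B j)) J)"

text \<open>Points are pairs (time, position).\<close>

definition half_plane_lebesgue :: "(real \<times> real) measure" where
  "half_plane_lebesgue = restrict_space lborel ({0..} \<times> UNIV)"

definition poisson_filtration ::
    "'w measure \<Rightarrow> ('w \<Rightarrow> (real \<times> real) measure) \<Rightarrow> real \<Rightarrow> 'w measure" where
  "poisson_filtration P M t = sigma (space P)
     {(\<lambda>\<omega>. emeasure (M \<omega>) B) -` C \<inter> space P | B C.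
        B \<in> sets borel \<and> B \<subseteq> {0..t} \<times> UNIV \<and> C \<in> sets borel}"


section \<open>Limit forest fire processes\<close>

definition closed_intervals :: "real set set" where
  "closed_intervals = {{a..b} | a b. a \<le> b}"

definition barriers :: "(real \<Rightarrow> real) \<Rightarrow> (real \<Rightarrow> real) \<Rightarrow> real set" where
  "barriers z h = {y. z y < 1 \<or> h y > 0}"

text \<open>The endpoints are extended reals: they are infinite if there is no barrier on that side.\<close>

definition left_end :: "(real \<Rightarrow> real) \<Rightarrow> (real \<Rightarrow> real) \<Rightarrow> real \<Rightarrow> ereal" where
  "left_end z h x = (SUP y\<in>{y \<in> barriers z h. y \<le> x}. ereal y)"

definition right_end :: "(real \<Rightarrow> real) \<Rightarrow> (real \<Rightarrow> real) \<Rightarrow> real \<Rightarrow> ereal" where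
  "right_end z h x = (INF y\<in>{y \<in> barriers z h. x \<le> y}. ereal y)"

definition cluster :: "(real \<Rightarrow> real) \<Rightarrow> (real \<Rightarrow> real) \<Rightarrow> real \<Rightarrow> real set" where
  "cluster z h x = {y. left_end z h x \<le> ereal y \<and> ereal y \<le> right_end z h x}"

definition has_left_limits :: "(real \<Rightarrow> real) \<Rightarrow> bool" where
  "has_left_limits f \<longleftrightarrow> (\<forall>s>0. \<exists>l. (f \<longlongrightarrow> l) (at_left s))"

definition left_limit :: "(real \<Rightarrow> real) \<Rightarrow> real \<Rightarrow> real" where
  "left_limit f s = Lim (at_left s) f"

text \<open>Intervals carry the topology of their pairs of endpoints.\<close>

definition left_limit_interval :: "(real \<Rightarrow> real set) \<Rightarrow> real \<Rightarrow> real set" where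
  "left_limit_interval I s = {left_limit (\<lambda>r. Inf (I r)) s .. left_limit (\<lambda>r. Sup (I r)) s}"

text \<open>
  The equations for one realisation \<open>m\<close> of the Poisson measure. Stochastic integrals from
  \<open>0\<close> to \<open>t\<close> are over \<open>(0,t]\<close>; integrability with respect to \<open>m\<close> and existence of the left
  limits are required so that no term takes a default value.
\<close>

definition lffp_path :: "(real \<times> real) measure \<Rightarrow> (real \<Rightarrow> real \<Rightarrow> real) \<Rightarrow>
    (real \<Rightarrow> real \<Rightarrow> real set) \<Rightarrow> (real \<Rightarrow> real \<Rightarrow> real) \<Rightarrow> bool" where
  "lffp_path m Z D H \<longleftrightarrow>
     (\<forall>x. has_left_limits (\<lambda>t. Z t x) \<and> has_left_limits (\<lambda>t. H t x) \<and>
          has_left_limits (\<lambda>t. Inf (D t x)) \<and> has_left_limits (\<lambda>t. Sup (D t x))) \<and>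
     (\<forall>t\<ge>0. \<forall>x.
        (let Zl = left_limit (\<lambda>r. Z r x);
             Dl = left_limit_interval (\<lambda>r. D r x);
             fire = (\<lambda>(s, y). of_bool (Zl s = 1 \<and> y \<in> Dl s) :: real);
             spark = (\<lambda>(s, y). Zl s * of_bool (Zl s < 1) :: real)
         in set_integrable m ({0<..t} \<times> UNIV) fire \<and>
            Z t x = (LBINT s:{0..t}. of_bool (Z s x < 1)) - (LINT p:({0<..t} \<times> UNIV)|m. fire p) \<and>
            set_integrable m ({0<..t} \<times> {x}) spark \<and>
            H t x = (LINT p:({0<..t} \<times> {x})|m. spark p) - (LBINT s:{0..t}. of_bool (H s x > 0)) \<and>
            D t x = cluster (Z t) (H t) x))"

definition lffp :: "'w measure \<Rightarrow> ('w \<Rightarrow> (real \<times> real) measure) \<Rightarrow>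
    ('w \<Rightarrow> real \<Rightarrow> real \<Rightarrow> real) \<Rightarrow> ('w \<Rightarrow> real \<Rightarrow> real \<Rightarrow> real set) \<Rightarrow>
    ('w \<Rightarrow> real \<Rightarrow> real \<Rightarrow> real) \<Rightarrow> bool" where
  "lffp P M Z D H \<longleftrightarrow>
     (\<forall>\<omega>\<in>space P. \<forall>t\<ge>0. \<forall>x. 0 \<le> Z \<omega> t x \<and> D \<omega> t x \<in> closed_intervals \<and> 0 \<le> H \<omega> t x) \<and>
     (\<forall>t\<ge>0. \<forall>x.
        (\<lambda>\<omega>. Z \<omega> t x) \<in> borel_measurable (poisson_filtration P M t) \<and>
        (\<lambda>\<omega>. Inf (D \<omega> t x)) \<in> borel_measurable (poisson_filtration P M t) \<and>
        (\<lambda>\<omega>. Sup (D \<omega> t x)) \<in> borel_measurable (poisson_filtration P M t) \<and>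
        (\<lambda>\<omega>. H \<omega> t x) \<in> borel_measurable (poisson_filtration P M t)) \<and>
     (AE \<omega> in P. lffp_path (M \<omega>) (Z \<omega>) (D \<omega>) (H \<omega>))"


section \<open>Graphical construction in a finite box\<close>

text \<open>
  The construction processes, in order of time, a finite list of marks with positions in
  \<open>[-a,a]\<close>. A state is a triple (current time, \<open>Z\<close>, \<open>H\<close>). Between marks \<open>Z\<close> grows at unit
  speed up to \<open>1\<close> and \<open>H\<close> decays at unit speed down to \<open>0\<close>; a mark at \<open>y\<close> either burns all
  \<open>x\<close> with \<open>Z = 1\<close> whose cluster contains \<open>y\<close>, or, if \<open>Z < 1\<close> at \<open>y\<close>, raises \<open>H\<close> at \<open>y\<close>. The walls \<open>-a\<close> and \<open>a\<close>
  bound all clusters.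
\<close>

type_synonym state = "real \<times> (real \<Rightarrow> real) \<times> (real \<Rightarrow> real)"

definition box_cluster :: "real \<Rightarrow> (real \<Rightarrow> real) \<Rightarrow> (real \<Rightarrow> real) \<Rightarrow> real \<Rightarrow> real set" where
  "box_cluster a z h x =
     {Sup (insert (-a) {y \<in> barriers z h. -a \<le> y \<and> y \<le> x}) ..
      Inf (insert a {y \<in> barriers z h. x \<le> y \<and> y \<le> a})}"

fun evolve :: "real \<Rightarrow> state \<Rightarrow> state" where
  "evolve t (s, z, h) = (t, \<lambda>x. min 1 (z x + (t - s)), \<lambda>x. max 0 (h x - (t - s)))"

fun ignite :: "real \<Rightarrow> real \<Rightarrow> state \<Rightarrow> state" where
  "ignite a y (s, z, h) =
     (s, \<lambda>x. if z x = 1 \<and> y \<in> box_cluster a z h x then 0 else z x,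
      if z y < 1 then h(y := h y + z y) else h)"

definition graphical :: "real \<Rightarrow> (real \<times> real) list \<Rightarrow> real \<Rightarrow> state" where
  "graphical a ms t =
     evolve t (fold (\<lambda>(s, y). ignite a y \<circ> evolve s) [p \<leftarrow> ms. fst p \<le> t] (0, \<lambda>_. 0, \<lambda>_. 0))"

text \<open>
  The construction is finitary: at every time, \<open>Z\<close> is constant and \<open>H\<close> vanishes on each open
  interval between consecutive mark positions and walls, so the suprema and infima above are
  finite searches.
\<close>

lemma box_cluster_eq:
  assumes "x \<in> I" "x' \<in> I" "is_interval I" "I \<inter> barriers z h = {}"
  shows "box_cluster a z h x = box_cluster a z h x'"
proof -
  have *: "w \<in> I" if "u \<in> I" "v \<in> I" "u \<le> w" "w \<le> v" for u v w
    using assms(3) that unfolding is_interval_1 by blast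
  have "y \<le> x \<longleftrightarrow> y \<le> x'" "x \<le> y \<longleftrightarrow> x' \<le> y" if "y \<in> barriers z h" for y
    using that assms(1,2,4) *[of x x' y] *[of x' x y] by fastforce+
  then have "{y \<in> barriers z h. -a \<le> y \<and> y \<le> x} = {y \<in> barriers z h. -a \<le> y \<and> y \<le> x'}"
    "{y \<in> barriers z h. x \<le> y \<and> y \<le> a} = {y \<in> barriers z h. x' \<le> y \<and> y \<le> a}"
    by blast+
  then show ?thesis by (simp only: box_cluster_def)
qed

definition flat_on :: "real set \<Rightarrow> state \<Rightarrow> bool" where
  "flat_on I st \<longleftrightarrow> (case st of (_, z, h) \<Rightarrow> \<exists>c. \<forall>x\<in>I. z x = c \<and> h x = 0)"

lemma flat_on_evolve: "flat_on I st \<Longrightarrow> s \<ge> fst st \<Longrightarrow> flat_on I (evolve s st)"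
  by (cases st) (force simp: flat_on_def)

lemma flat_on_ignite:
  assumes "flat_on I st" "is_interval I" "y \<notin> I"
  shows "flat_on I (ignite a y st)"
proof -
  obtain s z h where st: "st = (s, z, h)" by (cases st)
  from assms(1) obtain c where c: "\<And>x. x \<in> I \<Longrightarrow> z x = c" "\<And>x. x \<in> I \<Longrightarrow> h x = 0"
    by (auto simp: flat_on_def st)
  have h: "\<forall>x\<in>I. (if z y < 1 then h(y := h y + z y) else h) x = 0"
    using c assms(3) by auto
  have "\<exists>d. \<forall>x\<in>I. (if z x = 1 \<and> y \<in> box_cluster a z h x then 0 else z x) = d"
  proof (cases "c = 1")
    case True
    then have "I \<inter> barriers z h = {}" using c by (force simp: barriers_def)
    then have "box_cluster a z h x = box_cluster a z h x'" if "x \<in> I" "x' \<in> I" for x x'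
      using box_cluster_eq[OF that assms(2)] by simp
    then show ?thesis using c(1) by (metis (no_types, lifting))
  qed (use c in auto)
  with h show ?thesis by (auto simp: flat_on_def st)
qed

lemma graphical_flat_on:
  assumes "sorted (map fst ms)" "\<forall>p\<in>set ms. 0 \<le> fst p" "0 \<le> t"
    and "is_interval I" "I \<inter> snd ` set ms = {}"
  shows "flat_on I (graphical a ms t)"
proof -
  define f where "f = (\<lambda>(s, y). ignite a y \<circ> evolve s :: state \<Rightarrow> state)"
  have fst_f: "fst (f p st) = fst p" for p st
    by (cases p; cases st) (simp add: f_def)
  have "flat_on I (fold f qs st) \<and> fst (fold f qs st) \<le> t"
    if "flat_on I st" "fst st \<le> t" "\<forall>p\<in>set qs. fst st \<le> fst p \<and> fst p \<le> t \<and> snd p \<notin> I"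
      "sorted (map fst qs)" for qs st
    using that
  proof (induction qs arbitrary: st)
    case (Cons p qs)
    have "flat_on I (f p st)"
      using Cons.prems flat_on_ignite[OF flat_on_evolve assms(4)] by (cases p) (auto simp: f_def)
    then show ?case using Cons.prems Cons.IH[of "f p st"] fst_f by auto
  qed auto
  moreover have "flat_on I (0, \<lambda>_. 0, \<lambda>_. 0)" by (simp add: flat_on_def)
  moreover have "\<forall>p\<in>set [p \<leftarrow> ms. fst p \<le> t]. 0 \<le> fst p \<and> fst p \<le> t \<and> snd p \<notin> I"
  proof
    fix p assume "p \<in> set [p \<leftarrow> ms. fst p \<le> t]"
    then have p: "p \<in> set ms" "fst p \<le> t" by simp_all
    then have "snd p \<in> snd ` set ms" by (intro imageI)
    then have "snd p \<notin> I" using assms(5) by (simp only: disjoint_iff) blast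
    then show "0 \<le> fst p \<and> fst p \<le> t \<and> snd p \<notin> I" using p assms(2) by simp
  qed
  moreover have "sorted (map fst [p \<leftarrow> ms. fst p \<le> t])"
    using assms(1) by (rule sorted_filter)
  ultimately have *: "flat_on I (fold f [p \<leftarrow> ms. fst p \<le> t] (0, \<lambda>_. 0, \<lambda>_. 0)) \<and>
      fst (fold f [p \<leftarrow> ms. fst p \<le> t] (0, \<lambda>_. 0, \<lambda>_. 0)) \<le> t"
    using assms(3) by (metis fst_conv)
  then show ?thesis unfolding graphical_def f_def[symmetric] using flat_on_evolve by blast
qed


section \<open>Perfect simulation\<close>

text \<open>
  Effective tests on a finite set of marks: first-order formulas with quantifiers ranging over
  the marks (de Bruijn indices) and with comparisons of affine expressions in their coordinates.
  Such a test is decided by finitely many additions, scalings and comparisons of real numbers.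
\<close>

datatype aff = Const real | Time nat | Pos nat | Plus aff aff | Scale real aff

datatype test = Leq aff aff | Neg test | Conj test test | SomeMark test

primrec aff_val :: "(nat \<Rightarrow> real \<times> real) \<Rightarrow> aff \<Rightarrow> real" where
  "aff_val e (Const c) = c"
| "aff_val e (Time i) = fst (e i)"
| "aff_val e (Pos i) = snd (e i)"
| "aff_val e (Plus u v) = aff_val e u + aff_val e v"
| "aff_val e (Scale c u) = c * aff_val e u"

primrec test_val :: "(real \<times> real) set \<Rightarrow> (nat \<Rightarrow> real \<times> real) \<Rightarrow> test \<Rightarrow> bool" where
  "test_val S e (Leq u v) \<longleftrightarrow> aff_val e u \<le> aff_val e v"
| "test_val S e (Neg \<phi>) \<longleftrightarrow> \<not> test_val S e \<phi>"
| "test_val S e (Conj \<phi> \<psi>) \<longleftrightarrow> test_val S e \<phi> \<and> test_val S e \<psi>"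
| "test_val S e (SomeMark \<phi>) \<longleftrightarrow> (\<exists>p\<in>S. test_val S (case_nat p e) \<phi>)"

definition passes :: "(real \<times> real) set \<Rightarrow> test \<Rightarrow> bool" where
  "passes S \<phi> \<longleftrightarrow> test_val S (\<lambda>_. (0, 0)) \<phi>"

definition marks :: "(real \<times> real) measure \<Rightarrow> real \<Rightarrow> nat \<Rightarrow> (real \<times> real) set" where
  "marks m T k = {p \<in> {0..T} \<times> {- real k..real k}. emeasure m {p} \<noteq> 0}"

text \<open>
  Simulation of the restriction to \<open>[0,T] \<times> [-n,n]\<close>: draw the marks in the boxes
  \<open>[0,T] \<times> [-k,k]\<close>, \<open>k = n, n+1, \<dots>\<close>, until the stopping test, which only sees the marks drawn
  so far, succeeds; then run the graphical construction in that box. Almost surely this stops,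
  and its output is exactly the given process on \<open>[0,T] \<times> [-n,n]\<close>.
\<close>

definition perfectly_simulated :: "'w measure \<Rightarrow> ('w \<Rightarrow> (real \<times> real) measure) \<Rightarrow>
    ('w \<Rightarrow> real \<Rightarrow> real \<Rightarrow> real) \<Rightarrow> ('w \<Rightarrow> real \<Rightarrow> real \<Rightarrow> real set) \<Rightarrow>
    ('w \<Rightarrow> real \<Rightarrow> real \<Rightarrow> real) \<Rightarrow> real \<Rightarrow> nat \<Rightarrow> bool" where
  "perfectly_simulated P M Z D H T n \<longleftrightarrow>
     (\<exists>\<phi>. AE \<omega> in P.
        (\<forall>k. finite (marks (M \<omega>) T k) \<and> inj_on fst (marks (M \<omega>) T k)) \<and>
        (\<exists>k\<ge>n. passes (marks (M \<omega>) T k) \<phi>) \<and>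
        (\<forall>k\<ge>n. passes (marks (M \<omega>) T k) \<phi> \<longrightarrow>
           (\<forall>t\<in>{0..T}. \<forall>x\<in>{- real n..real n}.
              (case graphical (real k) (sorted_key_list_of_set fst (marks (M \<omega>) T k)) t of
                 (_, z, h) \<Rightarrow>
                   Z \<omega> t x = z x \<and> D \<omega> t x = box_cluster (real k) z h x \<and> H \<omega> t x = h x))))"

end

theory Submission imports Defs begin

text \<open>
  Marks far away influence a bounded region only through clusters reaching it. Two almost
  simultaneous sparks leave two barriers; if the next mark between them falls right after
  the region between them has filled up, it burns exactly that region, which restarts the picture
  there. Repeating this keeps barriers near by up to any time, and by independence such
  walls occur almost surely on both sides of any point. Between two walls every solution, on the
  line or in a finite box, is determined by the finitely many marks there, because almost surely
  the times of the marks satisfy none of the affine coincidences excluded by \<open>generic\<close>. Existence,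
  uniqueness and the stopping test all follow. The limit of the box constructions is adapted
  because the marks are limits of the occupied cells of finer and finer grids.
\<close>

section \<open>Fire processes and walls\<close>

text \<open>On the line there is no first mark and clusters might be unbounded, so no induction on
  time can start before walls are known, and these have to be recognised from the marks alone.
  \<open>fire_process\<close> is therefore an axiomatic interface, satisfied by solutions of the
  integral equations and by box constructions; walls are proved from it once for both. The
  constants: a region reset at time \<open>b\<close> is full at \<open>b + 1\<close>. A spark at
  \<open>s\<close> with \<open>b + 3/4 < s < b + 1\<close> leaves a barrier of height
  \<open>s - b\<close>, which vanishes at \<open>2 * s - b > b + 3/2\<close>. If the first later
  mark between two such sparks comes between \<open>b + 1\<close> and \<open>b + 3/2\<close>, it
  burns exactly the region between them. The same two instants explain \<open>generic\<close>: a
  mark at \<open>b + 1\<close> or at \<open>2 * s - b\<close> would come just when a point fills up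
  or a barrier vanishes, where the left limits and the values before disagree about the barriers.
  Here \<open>b\<close> is the time of a reset, with \<open>0\<close> for the initial state.\<close>

definition generic :: "(real \<times> real) set \<Rightarrow> bool" where
  "generic A \<longleftrightarrow> (\<forall>T k. finite (A \<inter> {0..T} \<times> {-k..k})) \<and> inj_on fst A \<and> inj_on snd A \<and>
     (\<forall>u\<in>fst ` A. 0 < u \<and> (\<forall>b\<in>insert 0 (fst ` A). u \<noteq> b + 1 \<and>
        (\<forall>s\<in>fst ` A. b < s \<longrightarrow> u \<noteq> 2 * s - b)))"

text \<open>\<open>E\<close> holds artificial barriers: the walls \<open>{-k, k}\<close> of a box,
  and nothing on the line. Both kinds of process are then compared through one set.\<close>

definition bar :: "real set \<Rightarrow> (real \<Rightarrow> real \<Rightarrow> real) \<Rightarrow> (real \<Rightarrow> real \<Rightarrow> real) \<Rightarrow> real \<Rightarrow> real set" where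
  "bar E Z H t = barriers (Z t) (H t) \<union> E"

text \<open>A fire at \<open>x\<close> is read off the path of \<open>Z\<close> alone, as a fall
  from the left limit 1 to 0, without reference to clusters. For a solution on the line this turns
  out to be the same as a jump of the fire integral.\<close>

definition burnt :: "(real \<Rightarrow> real \<Rightarrow> real) \<Rightarrow> real \<Rightarrow> real \<Rightarrow> bool" where
  "burnt Z s x \<longleftrightarrow> ((\<lambda>r. Z r x) \<longlongrightarrow> 1) (at_left s) \<and> Z s x = 0"

text \<open>The spread of fire enters through a necessary condition on each side
  (\<open>burnt_left\<close>, \<open>burnt_right\<close>) and a sufficient one
  (\<open>burn\<close>). All of them speak of what happens eventually before the mark, so no left
  limit of a cluster is presupposed. Clusters are closed, so a barrier at \<open>y\<close> itself
  does not separate \<open>x\<close> from \<open>y\<close>; hence \<open>y < u\<close> in the former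
  and the half-open intervals in the latter.\<close>

locale fire_process =
  fixes T :: real and A :: "(real \<times> real) set" and E X :: "real set"
    and Z H :: "real \<Rightarrow> real \<Rightarrow> real"
  assumes init: "x \<in> X \<Longrightarrow> Z 0 x = 0" "x \<in> X \<Longrightarrow> H 0 x = 0"
    and grow: "\<lbrakk>x \<in> X; 0 \<le> s; s \<le> t; t \<le> T;
        \<And>r. r \<in> fst ` A \<Longrightarrow> s < r \<Longrightarrow> r \<le> t \<Longrightarrow> \<not> burnt Z r x\<rbrakk> \<Longrightarrow> Z t x = min 1 (Z s x + (t - s))"
    and finite_burnt: "x \<in> X \<Longrightarrow> finite {r \<in> fst ` A. r \<le> T \<and> burnt Z r x}"
    and decay: "\<lbrakk>x \<in> X; 0 \<le> s; s \<le> t; t \<le> T;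
        \<And>r. (r, x) \<in> A \<Longrightarrow> s < r \<Longrightarrow> r \<le> t \<Longrightarrow> False\<rbrakk> \<Longrightarrow> H t x = max 0 (H s x - (t - s))"
    and spark: "\<lbrakk>(s, x) \<in> A; x \<in> X; s \<le> T\<rbrakk> \<Longrightarrow> \<exists>z h. ((\<lambda>r. Z r x) \<longlongrightarrow> z) (at_left s) \<and>
        ((\<lambda>r. H r x) \<longlongrightarrow> h) (at_left s) \<and> H s x = h + (if z < 1 then z else 0)"
    and burnt_left: "\<lbrakk>(s, y) \<in> A; x \<in> X; s \<le> T; burnt Z s x; y < u; u \<le> x\<rbrakk> \<Longrightarrow>
        \<not> (\<forall>\<^sub>F r in at_left s. bar E Z H r \<inter> {u..x} \<noteq> {})"
    and burnt_right: "\<lbrakk>(s, y) \<in> A; x \<in> X; s \<le> T; burnt Z s x; u < y; x \<le> u\<rbrakk> \<Longrightarrow>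
        \<not> (\<forall>\<^sub>F r in at_left s. bar E Z H r \<inter> {x..u} \<noteq> {})"
    and burn: "\<lbrakk>(s, y) \<in> A; x \<in> X; s \<le> T;
        \<forall>\<^sub>F r in at_left s. Z r x = 1 \<and> bar E Z H r \<inter> ({y<..x} \<union> {x..<y}) = {}\<rbrakk> \<Longrightarrow> burnt Z s x"

lemma eventually_at_leftI: "a < (s::real) \<Longrightarrow> (\<And>r. a < r \<Longrightarrow> r < s \<Longrightarrow> P r) \<Longrightarrow> eventually P (at_left s)"
  by (auto simp: eventually_at_left_field intro!: exI[of _ a])

lemma tendsto_at_leftI:
  fixes f :: "real \<Rightarrow> real"
  assumes "a < s" "\<And>r. a < r \<Longrightarrow> r < s \<Longrightarrow> f r = g r" "(g \<longlongrightarrow> l) (at_left s)"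
  shows "(f \<longlongrightarrow> l) (at_left s)"
proof -
  have "\<forall>\<^sub>F r in at_left s. f r = g r"
    using assms(1,2) by (rule eventually_at_leftI)
  with assms(3) show ?thesis using filterlim_cong[OF refl refl] by blast
qed

lemma generic_pos: "generic A \<Longrightarrow> (s, y) \<in> A \<Longrightarrow> 0 < s"
  unfolding generic_def by force

lemma generic_fst: "generic A \<Longrightarrow> (s, y) \<in> A \<Longrightarrow> (s, z) \<in> A \<Longrightarrow> y = z"
  unfolding generic_def inj_on_def by force

lemma generic_snd: "generic A \<Longrightarrow> (s, y) \<in> A \<Longrightarrow> (t, y) \<in> A \<Longrightarrow> s = t"
  unfolding generic_def inj_on_def by force

context fire_process
begin

text \<open>Up to the first fire after \<open>s\<close> the growth is undisturbed, so the left limit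
  1 at that fire forces enough time to have passed. Finiteness of the set of fires provides a first
  one.\<close>

lemma first_burnt:
  assumes "x \<in> X" "0 \<le> s" "s < r" "r \<le> T" "r \<in> fst ` A" "burnt Z r x"
  obtains r' where "r' \<in> fst ` A" "s < r'" "r' \<le> r" "burnt Z r' x" "1 \<le> Z s x + (r' - s)"
    "\<And>t. s \<le> t \<Longrightarrow> t < r' \<Longrightarrow> Z t x = min 1 (Z s x + (t - s))"
proof -
  let ?Q = "{r \<in> fst ` A. r \<le> T \<and> burnt Z r x} \<inter> {s<..r}"
  have fin: "finite ?Q" and ne: "?Q \<noteq> {}" using finite_burnt assms by auto
  define r' where "r' = Min ?Q"
  have r': "r' \<in> ?Q" using Min_in[OF fin ne] by (simp add: r'_def)
  have no: "\<not> burnt Z q x" if "q \<in> fst ` A" "s < q" "q < r'" for q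
  proof
    assume "burnt Z q x"
    then have "q \<in> ?Q" using that r' by auto
    then have "r' \<le> q" using fin by (simp add: r'_def)
    then show False using that by simp
  qed
  have eq: "Z t x = min 1 (Z s x + (t - s))" if "s \<le> t" "t < r'" for t
    by (rule grow) (use that r' no assms in auto)
  have "((\<lambda>t. Z t x) \<longlongrightarrow> min 1 (Z s x + (r' - s))) (at_left r')"
  proof (rule tendsto_at_leftI)
    show "s < r'" using r' by simp
    show "Z t x = min 1 (Z s x + (t - s))" if "s < t" "t < r'" for t using that by (intro eq) simp_all
    show "((\<lambda>t. min 1 (Z s x + (t - s))) \<longlongrightarrow> min 1 (Z s x + (r' - s))) (at_left r')"
      by (intro tendsto_intros)
  qed
  moreover have "((\<lambda>t. Z t x) \<longlongrightarrow> 1) (at_left r')" using r' by (simp add: burnt_def)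
  ultimately have "min 1 (Z s x + (r' - s)) = 1"
    using tendsto_unique[OF trivial_limit_at_left_real] by blast
  then have "1 \<le> Z s x + (r' - s)" by linarith
  with r' show ?thesis by (intro that[of r'] eq) auto
qed

text \<open>Growth since the last fire, or since time 0, starts from 0.\<close>

lemma Z_bounds:
  assumes "x \<in> X" "0 \<le> t" "t \<le> T"
  shows "0 \<le> Z t x" "Z t x \<le> 1"
proof -
  let ?Q = "{r \<in> fst ` A. r \<le> T \<and> burnt Z r x} \<inter> {0<..t}"
  have fin: "finite ?Q" using finite_burnt assms by auto
  have "\<exists>s. 0 \<le> s \<and> s \<le> t \<and> Z s x = 0 \<and> (\<forall>r\<in>fst ` A. s < r \<longrightarrow> r \<le> t \<longrightarrow> \<not> burnt Z r x)"
  proof (cases "?Q = {}")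
    case True
    then show ?thesis using assms init by (intro exI[of _ 0]) auto
  next
    case False
    have "Max ?Q \<in> ?Q" using Max_in[OF fin False] .
    moreover have "\<not> burnt Z r x" if "r \<in> fst ` A" "Max ?Q < r" "r \<le> t" for r
    proof
      assume "burnt Z r x"
      then have "r \<in> ?Q" using that assms \<open>Max ?Q \<in> ?Q\<close> by auto
      then show False using Max_ge[OF fin] that by force
    qed
    ultimately show ?thesis by (intro exI[of _ "Max ?Q"]) (auto simp: burnt_def)
  qed
  then obtain s where s: "0 \<le> s" "s \<le> t" "Z s x = 0"
      "\<forall>r\<in>fst ` A. s < r \<longrightarrow> r \<le> t \<longrightarrow> \<not> burnt Z r x" by blast
  have "Z t x = min 1 (Z s x + (t - s))"
    by (rule grow) (use assms s in auto)
  with s show "0 \<le> Z t x" "Z t x \<le> 1" by auto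
qed

lemma H_before:
  assumes "x \<in> X" "0 \<le> t" "t \<le> T" "\<And>r. (r, x) \<in> A \<Longrightarrow> r \<le> t \<Longrightarrow> False"
  shows "H t x = 0"
  using decay[of x 0 t] assms init by auto

text \<open>Positions of marks are distinct, so \<open>H\<close> is still 0 when the only mark at
  \<open>x\<close> arrives.\<close>

lemma H_spark:
  assumes "generic A" "(s, x) \<in> A" "x \<in> X" "s \<le> T"
  obtains z where "((\<lambda>r. Z r x) \<longlongrightarrow> z) (at_left s)" "H s x = (if z < 1 then z else 0)"
proof -
  obtain z h where zh: "((\<lambda>r. Z r x) \<longlongrightarrow> z) (at_left s)" "((\<lambda>r. H r x) \<longlongrightarrow> h) (at_left s)"
    "H s x = h + (if z < 1 then z else 0)" using spark assms by blast
  have "0 < s" using generic_pos assms by blast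
  have "((\<lambda>r. H r x) \<longlongrightarrow> 0) (at_left s)"
  proof (rule tendsto_at_leftI)
    fix r assume "0 < r" "r < s"
    have "False" if "(q, x) \<in> A" "q \<le> r" for q
      using generic_snd[OF assms(1,2) that(1)] that \<open>r < s\<close> by simp
    then show "H r x = 0" using \<open>0 < r\<close> \<open>r < s\<close> assms(3,4) by (intro H_before) auto
  qed (use \<open>0 < s\<close> in \<open>simp_all add: tendsto_const\<close>)
  then have "h = 0" using zh(2) tendsto_unique[OF trivial_limit_at_left_real] by blast
  with zh show ?thesis by (intro that[of z]) auto
qed

lemma H_after:
  assumes "generic A" "(s, x) \<in> A" "x \<in> X" "s \<le> t" "t \<le> T"
  shows "H t x = max 0 (H s x - (t - s))"
proof (rule decay)
  fix r assume "(r, x) \<in> A" "s < r"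
  then show False using generic_snd[OF assms(1,2), of r] by simp
qed (use assms generic_pos[OF assms(1,2)] in auto)

text \<open>A spark adds \<open>z\<close> only when \<open>z < 1\<close>, and each position sees at
  most one spark.\<close>

lemma H_less_1:
  assumes "generic A" "x \<in> X" "0 \<le> t" "t \<le> T"
  shows "H t x < 1"
proof (cases "\<exists>s. (s, x) \<in> A \<and> s \<le> t")
  case True
  then obtain s where s: "(s, x) \<in> A" "s \<le> t" by blast
  have "s \<le> T" using s assms by simp
  obtain z where "H s x = (if z < 1 then z else 0)"
    using H_spark[OF assms(1) s(1) assms(2) \<open>s \<le> T\<close>] by blast
  then have "H s x < 1" by (simp split: if_splits)
  moreover have "H t x = max 0 (H s x - (t - s))"
    by (rule H_after[OF assms(1) s(1) assms(2) s(2) assms(4)])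
  ultimately show ?thesis using s(2) by linarith
next
  case False
  then have "H t x = 0" using assms by (intro H_before) blast+
  then show ?thesis by simp
qed

text \<open>One round of a wall: the points of \<open>]l,u[\<close> burn at time \<open>b\<close>; two sparks at \<open>p\<close> and \<open>q\<close>
  then protect \<open>]p,q[\<close> until it is full, and no mark falls into \<open>]p,q[\<close> before time \<open>e\<close>.\<close>

context
  fixes l u b :: real
  assumes gen: "generic A" and b: "0 \<le> b" and lu: "{l<..<u} \<subseteq> X" "E \<inter> {l<..<u} = {}"
    and zero: "\<And>x. x \<in> {l<..<u} \<Longrightarrow> Z b x = 0"
begin

text \<open>By \<open>first_burnt\<close> a fire needs a full unit of time after a reset.\<close>

lemma round_young:
  assumes "x \<in> {l<..<u}" "b \<le> t" "t < b + 1" "t \<le> T"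
  shows "Z t x = t - b"
proof -
  have "Z t x = min 1 (Z b x + (t - b))"
  proof (rule grow)
    fix r assume r: "r \<in> fst ` A" "b < r" "r \<le> t"
    show "\<not> burnt Z r x"
    proof
      assume "burnt Z r x"
      moreover have "x \<in> X" "r \<le> T" using assms r lu by auto
      ultimately obtain r' where "r' \<le> r" "1 \<le> Z b x + (r' - b)"
        using first_burnt[OF _ b r(2) _ r(1)] by blast
      then show False using zero[OF assms(1)] assms r by linarith
    qed
  qed (use assms b lu in auto)
  then show ?thesis using assms zero[OF assms(1)] by simp
qed

lemma round_spark:
  assumes "(s, p) \<in> A" "p \<in> {l<..<u}" "b + 3/4 < s" "s < b + 1" "s \<le> t" "t < b + 3/2" "t \<le> T"
  shows "H t p > 0"
proof -
  have pX: "p \<in> X" "s \<le> T" using assms(2,5,7) lu(1) by (blast, linarith)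
  obtain z where z: "((\<lambda>r. Z r p) \<longlongrightarrow> z) (at_left s)" "H s p = (if z < 1 then z else 0)"
    using H_spark[OF gen assms(1) pX] by blast
  have "((\<lambda>r. Z r p) \<longlongrightarrow> s - b) (at_left s)"
  proof (rule tendsto_at_leftI)
    show "b < s" using assms by simp
    show "Z r p = r - b" if "b < r" "r < s" for r
      using round_young[OF assms(2), of r] that assms(4,5,7) by simp
    show "((\<lambda>r. r - b) \<longlongrightarrow> s - b) (at_left s)" by (intro tendsto_intros)
  qed
  then have "z = s - b" using z(1) tendsto_unique[OF trivial_limit_at_left_real] by blast
  then have "H s p = s - b" using z assms by simp
  moreover have "H t p = max 0 (H s p - (t - s))" using H_after[OF gen assms(1) pX(1) assms(5,7)] .
  ultimately show ?thesis using assms by simp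
qed

context
  fixes p q sp sq e :: real
  assumes pq: "l < p" "p < q" "q < u"
    and sp: "(sp, p) \<in> A" "b + 3/4 < sp" "sp < b + 1"
    and sq: "(sq, q) \<in> A" "b + 3/4 < sq" "sq < b + 1"
    and e: "e \<le> b + 3/2"
    and quiet: "\<And>s y. (s, y) \<in> A \<Longrightarrow> y \<in> {p<..<q} \<Longrightarrow> b < s \<Longrightarrow> s < e \<Longrightarrow> s \<le> T \<Longrightarrow> False"
begin

lemma round_ends:
  assumes "b + 1 \<le> t" "t < e" "t \<le> T"
  shows "p \<in> bar E Z H t" "q \<in> bar E Z H t"
  using round_spark[OF sp(1), of t] round_spark[OF sq(1), of t] pq sp(2,3) sq(2,3) assms e
  by (simp_all add: bar_def barriers_def)

text \<open>A mark that burns a point of \<open>]p,q[\<close> lies outside it because of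
  \<open>quiet\<close>, and then the spark at \<open>p\<close> or at \<open>q\<close> separates the
  two.\<close>

lemma round_full:
  assumes x: "x \<in> {p<..<q}" and t: "b + 1 \<le> t" "t < e" "t \<le> T"
  shows "Z t x = 1"
proof -
  have xX: "x \<in> X" "x \<in> {l<..<u}" using x pq lu by auto
  have "Z t x = min 1 (Z b x + (t - b))"
  proof (rule grow)
    fix r assume r: "r \<in> fst ` A" "b < r" "r \<le> t"
    show "\<not> burnt Z r x"
    proof
      assume "burnt Z r x"
      have "r \<le> T" using r t by simp
      obtain r' where r': "r' \<in> fst ` A" "r' \<le> r" "1 \<le> Z b x + (r' - b)" "burnt Z r' x"
        by (rule first_burnt[OF xX(1) b r(2) \<open>r \<le> T\<close> r(1) \<open>burnt Z r x\<close>])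
      then have "b + 1 \<le> r'" "r' \<le> T" using zero[OF xX(2)] r t by linarith+
      obtain y where y: "(r', y) \<in> A" using r'(1) by force
      \<comment> \<open>The range begins at the sparks and not at \<open>b + 1\<close>, since the
        fire might come exactly at \<open>r' = b + 1\<close>.\<close>
      have ev: "\<forall>\<^sub>F s in at_left r'. p \<in> bar E Z H s \<and> q \<in> bar E Z H s"
      proof (rule eventually_at_leftI[of "max sp sq"])
        fix s assume "max sp sq < s" "s < r'"
        then show "p \<in> bar E Z H s \<and> q \<in> bar E Z H s"
          using round_spark[OF sp(1), of s] round_spark[OF sq(1), of s] pq sp(2,3) sq(2,3) t e r'(2) r(3)
          by (simp add: bar_def barriers_def)
      qed (use sp(3) sq(3) \<open>b + 1 \<le> r'\<close> in simp)
      have "y \<noteq> p" using generic_snd[OF gen y, of sp] sp \<open>b + 1 \<le> r'\<close> by auto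
      have "y \<noteq> q" using generic_snd[OF gen y, of sq] sq \<open>b + 1 \<le> r'\<close> by auto
      have "\<not> y < p"
      proof
        assume "y < p"
        then have "\<not> (\<forall>\<^sub>F s in at_left r'. bar E Z H s \<inter> {p..x} \<noteq> {})"
          using burnt_left[OF y xX(1) \<open>r' \<le> T\<close> r'(4), of p] x by auto
        moreover have "\<forall>\<^sub>F s in at_left r'. bar E Z H s \<inter> {p..x} \<noteq> {}"
          using ev by eventually_elim (use x in force)
        ultimately show False by blast
      qed
      moreover have "\<not> q < y"
      proof
        assume "q < y"
        then have "\<not> (\<forall>\<^sub>F s in at_left r'. bar E Z H s \<inter> {x..q} \<noteq> {})"
          using burnt_right[OF y xX(1) \<open>r' \<le> T\<close> r'(4), of q] x by auto
        moreover have "\<forall>\<^sub>F s in at_left r'. bar E Z H s \<inter> {x..q} \<noteq> {}"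
          using ev by eventually_elim (use x in force)
        ultimately show False by blast
      qed
      ultimately have "y \<in> {p<..<q}" using \<open>y \<noteq> p\<close> \<open>y \<noteq> q\<close> by simp
      then show False using quiet[OF y] \<open>b + 1 \<le> r'\<close> \<open>r' \<le> T\<close> r'(2) r(3) t by simp
    qed
  qed (use xX t b in auto)
  then show ?thesis using zero[OF xX(2)] t by simp
qed

lemma round_clear:
  assumes x: "x \<in> {p<..<q}" and t: "b + 1 \<le> t" "t < e" "t \<le> T"
  shows "x \<notin> bar E Z H t"
proof -
  have xX: "x \<in> X" "x \<notin> E" using x pq lu by auto
  have "H t x = max 0 (H b x - (t - b))"
  proof (rule decay)
    fix r assume "(r, x) \<in> A" "b < r" "r \<le> t"
    then show False using quiet[of r x] x t by simp
  qed (use x t b xX in auto)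
  \<comment> \<open>Whatever barrier is left at time \<open>b\<close> has height below 1, hence is
    gone by \<open>b + 1\<close>.\<close>
  moreover have "H b x < 1" using H_less_1[OF gen xX(1) b] t by simp
  ultimately show ?thesis using round_full[OF assms] xX t by (simp add: bar_def barriers_def)
qed

text \<open>By time \<open>e\<close> the region \<open>]p,q[\<close> is full and free of barriers,
  so the fire reaches all of it. The reset at \<open>e\<close> starts the next round.\<close>

lemma round_burn:
  assumes y: "(e, y) \<in> A" "y \<in> {p<..<q}" and e': "b + 1 < e" "e \<le> T" and x: "x \<in> {p<..<q}"
  shows "Z e x = 0"
proof -
  have "\<forall>\<^sub>F r in at_left e. Z r x = 1 \<and> bar E Z H r \<inter> ({y<..x} \<union> {x..<y}) = {}"
  proof (rule eventually_at_leftI[OF e'(1)])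
    fix r assume r: "b + 1 < r" "r < e"
    have "v \<notin> bar E Z H r" if "v \<in> {y<..x} \<union> {x..<y}" for v
      using round_clear[of v r] that x y r e' by auto
    then show "Z r x = 1 \<and> bar E Z H r \<inter> ({y<..x} \<union> {x..<y}) = {}"
      using round_full[OF x, of r] r e' by auto
  qed
  moreover have "x \<in> X" using x pq lu by auto
  ultimately have "burnt Z e x" using burn[OF y(1) _ e'(2)] by blast
  then show ?thesis by (simp add: burnt_def)
qed

end
end
end

text \<open>\<open>n\<close> bounds the number of rounds still allowed and \<open>b\<close> is the
  time at which \<open>]l,u[\<close> was last reset; marks at or before \<open>b\<close> belong to
  the past. A further round takes place in the smaller region between the two sparks and starts at
  the time of the fire \<open>f\<close>. Every condition is a comparison of coordinates of marks, so
  that a wall can be expressed as a \<open>test\<close>.\<close>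

fun wall :: "real \<Rightarrow> (real \<times> real) set \<Rightarrow> nat \<Rightarrow> real \<Rightarrow> real \<Rightarrow> real \<Rightarrow> bool" where
  "wall T S 0 b l u \<longleftrightarrow> T < b + 1"
| "wall T S (Suc n) b l u \<longleftrightarrow> T < b + 1 \<or>
    (\<exists>p\<in>S. \<exists>q\<in>S. l < snd p \<and> snd p < snd q \<and> snd q < u \<and>
       b + 3/4 < fst p \<and> fst p < b + 1 \<and> b + 3/4 < fst q \<and> fst q < b + 1 \<and>
       (T < b + 3/2 \<and> (\<forall>g\<in>S. snd p < snd g \<and> snd g < snd q \<longrightarrow> fst g \<le> b) \<or>
        (\<exists>f\<in>S. snd p < snd f \<and> snd f < snd q \<and> b + 1 < fst f \<and> fst f < b + 3/2 \<and>
           (\<forall>g\<in>S. snd p < snd g \<and> snd g < snd q \<longrightarrow> fst g \<le> b \<or> fst f \<le> fst g) \<and>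
           wall T S n (fst f) (snd p) (snd q))))"

text \<open>The gap of \<open>B\<close> around \<open>c\<close>; the degenerate case
  \<open>l = c = r\<close> means that \<open>c\<close> itself is a barrier. A cluster arriving at
  \<open>c\<close> from one side is stopped at the far end of the gap.\<close>

definition encloses :: "real set \<Rightarrow> real \<Rightarrow> real \<Rightarrow> real \<Rightarrow> bool" where
  "encloses B l c r \<longleftrightarrow> l \<le> c \<and> c \<le> r \<and> l \<in> B \<and> r \<in> B \<and> {l<..<r} \<inter> B = {}"

text \<open>The order of the quantifiers is the point: \<open>c\<close>, \<open>lb\<close> and
  \<open>rb\<close> are found from the marks before any process is mentioned, so two processes with
  the same marks share the same barriers around \<open>c\<close>. The position \<open>c\<close> is
  the same for all times, although the barriers around it change.\<close>

lemma wall_encloses: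
  assumes "wall T S n b l u" "generic A" "S = A \<inter> {0..T} \<times> {-k..k}" "0 \<le> b" "-k \<le> l" "l < u" "u \<le> k"
  shows "\<exists>c lb rb. l < c \<and> c < u \<and> (\<forall>E X Z H. fire_process T A E X Z H \<longrightarrow> {l<..<u} \<subseteq> X \<longrightarrow>
    E \<inter> {l<..<u} = {} \<longrightarrow> (\<forall>x\<in>{l<..<u}. Z b x = 0) \<longrightarrow>
    (\<forall>t\<in>{b..T}. l < lb t \<and> rb t < u \<and> encloses (bar E Z H t) (lb t) c (rb t)))"
proof -
  \<comment> \<open>Nothing in \<open>]l,u[\<close> gets full before \<open>T\<close>, so every
    point there is its own barrier; the midpoint is taken.\<close>
  have young: "\<exists>c lb rb. l < c \<and> c < u \<and> (\<forall>E X Z H. fire_process T A E X Z H \<longrightarrow> {l<..<u} \<subseteq> X \<longrightarrow>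
    E \<inter> {l<..<u} = {} \<longrightarrow> (\<forall>x\<in>{l<..<u}. Z b x = 0) \<longrightarrow>
    (\<forall>t\<in>{b..T}. l < lb t \<and> rb t < u \<and> encloses (bar E Z H t) (lb t) c (rb t)))"
    if "T < b + 1" "0 \<le> b" "l < u" for b l u
  proof -
    let ?c = "(l + u) / 2"
    have "?c \<in> bar E Z H t" if fp: "fire_process T A E X Z H" "{l<..<u} \<subseteq> X"
      "E \<inter> {l<..<u} = {}" "\<forall>x\<in>{l<..<u}. Z b x = 0" "b \<le> t" "t \<le> T" for E X Z H t
      using fire_process.round_young[OF fp(1) assms(2), of b l u ?c t] that \<open>T < b + 1\<close> \<open>0 \<le> b\<close> \<open>l < u\<close>
      by (auto simp: bar_def barriers_def)
    then show ?thesis using \<open>l < u\<close>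
      by (intro exI[of _ ?c] exI[of _ "\<lambda>_. ?c"]) (auto simp: encloses_def)
  qed
  show ?thesis using assms
  proof (induction n arbitrary: b l u)
    case 0
    then show ?case using young[of b l u] by simp
  next
    case (Suc n)
    show ?case
    proof (cases "T < b + 1")
      case True
      then show ?thesis using young[of b l u] Suc.prems by simp
    next
      case False
      then obtain P Q where PQ: "P \<in> S" "Q \<in> S" and pq: "l < snd P" "snd P < snd Q" "snd Q < u"
        and t: "b + 3/4 < fst P" "fst P < b + 1" "b + 3/4 < fst Q" "fst Q < b + 1"
        and alt: "T < b + 3/2 \<and> (\<forall>g\<in>S. snd P < snd g \<and> snd g < snd Q \<longrightarrow> fst g \<le> b) \<or>
        (\<exists>f\<in>S. snd P < snd f \<and> snd f < snd Q \<and> b + 1 < fst f \<and> fst f < b + 3/2 \<and>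
           (\<forall>g\<in>S. snd P < snd g \<and> snd g < snd Q \<longrightarrow> fst g \<le> b \<or> fst f \<le> fst g) \<and>
           wall T S n (fst f) (snd P) (snd Q))"
        using Suc.prems(1) by (simp only: wall.simps simp_thms False) (elim bexE conjE, rule that)
      define p q sp sq where d: "p = snd P" "q = snd Q" "sp = fst P" "sq = fst Q"
      have PQ': "(sp, p) \<in> A" "(sq, q) \<in> A" using PQ assms(3) by (auto simp: d)
      have inS: "(s, y) \<in> S" if "(s, y) \<in> A" "y \<in> {p<..<q}" "b < s" "s \<le> T" for s y
        using that pq Suc.prems by (auto simp: d)
      from alt show ?thesis
      proof
        assume *: "T < b + 3/2 \<and> (\<forall>g\<in>S. snd P < snd g \<and> snd g < snd Q \<longrightarrow> fst g \<le> b)"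
        \<comment> \<open>Before \<open>b + 1\<close> the point \<open>c\<close> is young and is its
          own barrier; from then on the two sparks enclose it.\<close>
        define c where "c = (p + q) / 2"
        define lb where "lb t = (if t < b + 1 then c else p)" for t
        define rb where "rb t = (if t < b + 1 then c else q)" for t
        have c: "p < c" "c < q" using pq by (auto simp: d c_def)
        have "l < lb t \<and> rb t < u \<and> encloses (bar E Z H t) (lb t) c (rb t)"
          if fp: "fire_process T A E X Z H" and X: "{l<..<u} \<subseteq> X"
          "E \<inter> {l<..<u} = {}" "\<And>x. x\<in>{l<..<u} \<Longrightarrow> Z b x = 0" and bt: "b \<le> t" "t \<le> T" for E X Z H t
        proof (cases "t < b + 1")
          case True
          then have "Z t c = t - b"
            using fire_process.round_young[OF fp assms(2) _ X, of c t] Suc.prems c pq bt by (auto simp: d)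
          then show ?thesis using True c pq by (auto simp: lb_def rb_def bar_def barriers_def encloses_def d)
        next
          case False
          have q: "False" if "(s, y) \<in> A" "y \<in> {p<..<q}" "b < s" "s < b + 3/2" "s \<le> T" for s y
            using inS[of s y] that * by (auto simp: d)
          note R = fp assms(2) \<open>0 \<le> b\<close> X pq[folded d] PQ'(1) t(1,2)[folded d] PQ'(2) t(3,4)[folded d]
          have "p \<in> bar E Z H t" "q \<in> bar E Z H t"
            using fire_process.round_ends[OF R, of "b+3/2" t] q False bt * by auto
          moreover have "x \<notin> bar E Z H t" if "x \<in> {p<..<q}" for x
            using fire_process.round_clear[OF R, of "b+3/2" x t] q False bt * that by auto
          ultimately show ?thesis using False c pq by (auto simp: lb_def rb_def encloses_def d)
        qed
        then show ?thesis using c pq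
          by (intro exI[of _ c] exI[of _ lb] exI[of _ rb]) (auto simp: d)
      next
        assume "\<exists>f\<in>S. snd P < snd f \<and> snd f < snd Q \<and> b + 1 < fst f \<and> fst f < b + 3/2 \<and>
           (\<forall>g\<in>S. snd P < snd g \<and> snd g < snd Q \<longrightarrow> fst g \<le> b \<or> fst f \<le> fst g) \<and>
           wall T S n (fst f) (snd P) (snd Q)"
        then obtain e y where f: "(e, y) \<in> S" "p < y" "y < q" "b + 1 < e" "e < b + 3/2"
          and *: "\<forall>g\<in>S. snd P < snd g \<and> snd g < snd Q \<longrightarrow> fst g \<le> b \<or> e \<le> fst g"
          and w: "wall T S n e p q" by (auto simp: d)
        have e: "(e, y) \<in> A" "e \<le> T" using f assms(3) by auto
        have pqk: "0 \<le> e" "-k \<le> p" "p < q" "q \<le> k" using f pq Suc.prems(4-7) by (simp_all add: d)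
        \<comment> \<open>\<open>c\<close> is taken from the inner round, as it has to serve until
          \<open>T\<close>; lying in \<open>]p,q[\<close>, it also works before the fire at
          \<open>e\<close>.\<close>
        obtain c lb' rb' where c: "p < c" "c < q" and IH: "\<forall>E X Z H. fire_process T A E X Z H \<longrightarrow>
            {p<..<q} \<subseteq> X \<longrightarrow> E \<inter> {p<..<q} = {} \<longrightarrow> (\<forall>x\<in>{p<..<q}. Z e x = 0) \<longrightarrow>
            (\<forall>t\<in>{e..T}. p < lb' t \<and> rb' t < q \<and> encloses (bar E Z H t) (lb' t) c (rb' t))"
          using Suc.IH[OF w assms(2,3) pqk] by (elim exE conjE) (rule that)
        define lb where "lb t = (if t < b + 1 then c else if t < e then p else lb' t)" for t
        define rb where "rb t = (if t < b + 1 then c else if t < e then q else rb' t)" for t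
        have "l < lb t \<and> rb t < u \<and> encloses (bar E Z H t) (lb t) c (rb t)"
          if fp: "fire_process T A E X Z H" and X: "{l<..<u} \<subseteq> X"
          "E \<inter> {l<..<u} = {}" "\<And>x. x\<in>{l<..<u} \<Longrightarrow> Z b x = 0" and bt: "b \<le> t" "t \<le> T" for E X Z H t
        proof (cases "t < b + 1")
          case True
          then have "Z t c = t - b"
            using fire_process.round_young[OF fp assms(2) _ X, of c t] Suc.prems c pq bt by (auto simp: d)
          then show ?thesis using True c pq by (auto simp: lb_def rb_def bar_def barriers_def encloses_def d)
        next
          case False
          have q: "False" if "(s, y) \<in> A" "y \<in> {p<..<q}" "b < s" "s < e" "s \<le> T" for s y
            using inS[of s y] that * by (auto simp: d)
          note R = fp assms(2) \<open>0 \<le> b\<close> X pq[folded d] PQ'(1) t(1,2)[folded d] PQ'(2) t(3,4)[folded d]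
          show ?thesis
          proof (cases "t < e")
            case te: True
            have "p \<in> bar E Z H t" "q \<in> bar E Z H t"
              using fire_process.round_ends[OF R, of e t] q False bt f te by auto
            moreover have "x \<notin> bar E Z H t" if "x \<in> {p<..<q}" for x
              using fire_process.round_clear[OF R, of e x t] q False bt f te that by auto
            ultimately show ?thesis using False te c pq by (auto simp: lb_def rb_def encloses_def d)
          next
            case te: False
            have "Z e x = 0" if "x \<in> {p<..<q}" for x
              using fire_process.round_burn[OF R, of e y x] q f e that by auto
            moreover have "{p<..<q} \<subseteq> X" "E \<inter> {p<..<q} = {}" using X(1,2) pq by (auto simp: d)
            ultimately have "p < lb' t \<and> rb' t < q \<and> encloses (bar E Z H t) (lb' t) c (rb' t)"
              using fp te bt by (intro IH[rule_format]) simp_all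
            then show ?thesis using pq False te by (simp add: lb_def rb_def d)
          qed
        qed
        then show ?thesis using c pq
          by (intro exI[of _ c] exI[of _ lb] exI[of _ rb]) (auto simp: d)
      qed
    qed
  qed
qed

section \<open>The construction in a box\<close>

lemma (in linorder) sorted_key_list_of_set_strict:
  assumes "inj_on f B" "finite B"
  shows "sorted_wrt (<) (map f (sorted_key_list_of_set f B))" "set (sorted_key_list_of_set f B) = B"
    "sorted_wrt (<) (map f xs) \<Longrightarrow> set xs = B \<Longrightarrow> sorted_key_list_of_set f B = xs"
proof -
  interpret F: folding_insort_key less_eq less B f by unfold_locales (rule assms)
  show "sorted_wrt (<) (map f (sorted_key_list_of_set f B))"
    by (rule F.strict_sorted_key_list_of_set[OF subset_refl])
  show "set (sorted_key_list_of_set f B) = B"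
    by (rule F.set_sorted_key_list_of_set[OF subset_refl assms(2)])
  assume xs: "sorted_wrt (<) (map f xs)" "set xs = B"
  then have "distinct xs" by (simp add: strict_sorted_iff distinct_map)
  then show "sorted_key_list_of_set f B = xs"
    using F.sorted_key_list_of_set_unique[OF subset_refl assms(2), of xs] xs distinct_card by force
qed

lemma filter_le_split:
  assumes "sorted (map f xs)" "a \<le> (b::real)"
  shows "[x \<leftarrow> xs. f x \<le> b] = [x \<leftarrow> xs. f x \<le> a] @ [x \<leftarrow> xs. a < f x \<and> f x \<le> b]"
  using assms
proof (induction xs)
  case (Cons x xs)
  have "[y \<leftarrow> xs. f y \<le> a] = []" if "a < f x"
    using Cons.prems(1) that by (fastforce simp: filter_empty_conv)
  then show ?case using Cons by auto
qed simp

lemma filter_eq_singleton: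
  assumes "distinct xs" "p \<in> set xs" "P p" "\<And>q. q \<in> set xs \<Longrightarrow> P q \<Longrightarrow> q = p"
  shows "filter P xs = [p]"
proof -
  have "set (filter P xs) = {p}" unfolding set_filter using assms(2-4) by blast
  moreover have "distinct (filter P xs)" using assms(1) by simp
  ultimately have "length (filter P xs) = 1"
    using distinct_card[of "filter P xs"] by simp
  then obtain q where "filter P xs = [q]" by (auto simp: length_Suc_conv)
  then show ?thesis using \<open>set (filter P xs) = {p}\<close> by simp
qed

lemma evolve_evolve: "s \<le> t \<Longrightarrow> evolve t (evolve s st) = evolve t st"
  by (cases st) (auto simp: min_def max_def fun_eq_iff)

text \<open>Membership becomes the absence of a separating barrier. This removes all questions of
  attainment of \<open>Sup\<close> and \<open>Inf\<close> and has the same form as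
  \<open>mem_cluster\<close> on the line.\<close>

lemma mem_box_cluster:
  assumes "-k \<le> x" "x \<le> k"
  shows "y \<in> box_cluster k z h x \<longleftrightarrow> -k \<le> y \<and> y \<le> k \<and>
    (\<forall>v\<in>barriers z h. \<not> (y < v \<and> v \<le> x) \<and> \<not> (x \<le> v \<and> v < y))"
proof -
  have "Sup (insert (-k) {v \<in> barriers z h. -k \<le> v \<and> v \<le> x}) \<le> y \<longleftrightarrow>
      (\<forall>v\<in>insert (-k) {v \<in> barriers z h. -k \<le> v \<and> v \<le> x}. v \<le> y)"
    by (rule cSup_le_iff) (use assms in \<open>auto intro!: bdd_aboveI[of _ x]\<close>)
  also have "\<dots> \<longleftrightarrow> -k \<le> y \<and> (\<forall>v\<in>barriers z h. \<not> (y < v \<and> v \<le> x))"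
    by (smt (verit, best) insert_iff mem_Collect_eq)
  finally have 1: "Sup (insert (-k) {v \<in> barriers z h. -k \<le> v \<and> v \<le> x}) \<le> y \<longleftrightarrow>
      -k \<le> y \<and> (\<forall>v\<in>barriers z h. \<not> (y < v \<and> v \<le> x))" .
  have "y \<le> Inf (insert k {v \<in> barriers z h. x \<le> v \<and> v \<le> k}) \<longleftrightarrow>
      (\<forall>v\<in>insert k {v \<in> barriers z h. x \<le> v \<and> v \<le> k}. y \<le> v)"
    by (rule le_cInf_iff) (use assms in \<open>auto intro!: bdd_belowI[of _ x]\<close>)
  also have "\<dots> \<longleftrightarrow> y \<le> k \<and> (\<forall>v\<in>barriers z h. \<not> (x \<le> v \<and> v < y))"
    by (smt (verit, best) insert_iff mem_Collect_eq)
  finally have 2: "y \<le> Inf (insert k {v \<in> barriers z h. x \<le> v \<and> v \<le> k}) \<longleftrightarrow>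
      y \<le> k \<and> (\<forall>v\<in>barriers z h. \<not> (x \<le> v \<and> v < y))" .
  show ?thesis unfolding box_cluster_def atLeastAtMost_iff 1 2 by blast
qed

lemma generic_finite: "generic A \<Longrightarrow> finite (A \<inter> {0..T} \<times> {-k..k})"
  unfolding generic_def by blast

definition box_state :: "(real \<times> real) set \<Rightarrow> real \<Rightarrow> real \<Rightarrow> real \<Rightarrow> state" where
  "box_state A k T t = graphical k (sorted_key_list_of_set fst (A \<inter> {0..T} \<times> {-k..k})) t"

definition box_Z :: "(real \<times> real) set \<Rightarrow> real \<Rightarrow> real \<Rightarrow> real \<Rightarrow> real \<Rightarrow> real" where
  "box_Z A k T t = fst (snd (box_state A k T t))"

definition box_H :: "(real \<times> real) set \<Rightarrow> real \<Rightarrow> real \<Rightarrow> real \<Rightarrow> real \<Rightarrow> real" where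
  "box_H A k T t = snd (snd (box_state A k T t))"

locale box =
  fixes A :: "(real \<times> real) set" and k T :: real
  assumes gen: "generic A"
begin

definition "S = A \<inter> {0..T} \<times> {-k..k}"
abbreviation "st \<equiv> box_state A k T"
abbreviation "Z \<equiv> box_Z A k T"
abbreviation "H \<equiv> box_H A k T"

lemma finite_S: "finite S" unfolding S_def by (rule generic_finite[OF gen])

lemma S_pos: "p \<in> S \<Longrightarrow> 0 < fst p"
  using gen unfolding generic_def S_def by blast

lemma mark_list: "sorted (map fst (sorted_key_list_of_set fst S))"
  "distinct (sorted_key_list_of_set fst S)" "set (sorted_key_list_of_set fst S) = S"
proof -
  have "inj_on fst A" using gen unfolding generic_def by (elim conjE)
  then have inj: "inj_on fst S" by (rule inj_on_subset) (simp add: S_def)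
  have "sorted (map fst (sorted_key_list_of_set fst S)) \<and> distinct (map fst (sorted_key_list_of_set fst S))"
    using sorted_key_list_of_set_strict(1)[OF inj finite_S] by (simp add: strict_sorted_iff)
  then show "sorted (map fst (sorted_key_list_of_set fst S))" "distinct (sorted_key_list_of_set fst S)"
    by (simp_all add: distinct_map)
  show "set (sorted_key_list_of_set fst S) = S" by (rule sorted_key_list_of_set_strict(2)[OF inj finite_S])
qed

lemma st_eq: "st t = evolve t (fold (\<lambda>(s, y). ignite k y \<circ> evolve s)
    [p \<leftarrow> sorted_key_list_of_set fst S. fst p \<le> t] (0, \<lambda>_. 0, \<lambda>_. 0))"
  by (simp add: box_state_def graphical_def S_def)

lemma fst_st: "fst (st t) = t"
proof -
  have "fst (evolve t a) = t" for a by (cases a) simp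
  then show ?thesis by (simp only: st_eq)
qed

lemma st_0: "st 0 = (0, \<lambda>_. 0, \<lambda>_. 0)"
proof -
  have "[p \<leftarrow> sorted_key_list_of_set fst S. fst p \<le> 0] = []"
    using S_pos by (force simp: filter_empty_conv mark_list(3))
  then show ?thesis by (simp only: st_eq fold.simps id_apply) simp
qed

lemma st_advance:
  assumes "s \<le> t" "\<And>p. p \<in> S \<Longrightarrow> s < fst p \<Longrightarrow> fst p \<le> t \<Longrightarrow> False"
  shows "st t = evolve t (st s)"
proof -
  have "[p \<leftarrow> sorted_key_list_of_set fst S. fst p \<le> t] = [p \<leftarrow> sorted_key_list_of_set fst S. fst p \<le> s]"
    by (rule filter_cong[OF refl]) (use assms in \<open>force simp: mark_list(3)\<close>)
  then show ?thesis by (simp only: st_eq evolve_evolve[OF assms(1)])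
qed

lemma st_jump:
  assumes "(s, y) \<in> S" "r < s" "\<And>p. p \<in> S \<Longrightarrow> r < fst p \<Longrightarrow> fst p < s \<Longrightarrow> False"
  shows "st s = evolve s (ignite k y (evolve s (st r)))"
proof -
  let ?l = "sorted_key_list_of_set fst S"
  \<comment> \<open>Marks have distinct times, so exactly one mark is processed at
    \<open>s\<close>.\<close>
  have "[p \<leftarrow> ?l. r < fst p \<and> fst p \<le> s] = [(s, y)]"
  proof (rule filter_eq_singleton)
    fix q assume q: "q \<in> set ?l" "r < fst q \<and> fst q \<le> s"
    then have "q \<in> S" by (simp add: mark_list(3))
    then have "fst q = s" using assms(3)[of q] q(2) by (cases "fst q < s") auto
    then show "q = (s, y)" using \<open>q \<in> S\<close> assms(1) generic_fst[OF gen, of s "snd q" y]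
      by (cases q) (simp add: S_def)
  qed (use assms(1,2) in \<open>simp_all add: mark_list\<close>)
  then have "[p \<leftarrow> ?l. fst p \<le> s] = [p \<leftarrow> ?l. fst p \<le> r] @ [(s, y)]"
    using filter_le_split[OF mark_list(1), of r s] assms(2) by simp
  then show ?thesis by (simp only: st_eq evolve_evolve[OF less_imp_le[OF assms(2)]] fold_append) simp
qed

lemma st_split: "st t = (t, Z t, H t)"
  using fst_st[of t] by (simp add: box_Z_def box_H_def prod_eq_iff)

lemma Z_0: "Z 0 x = 0" and H_0: "H 0 x = 0"
  by (simp_all add: box_Z_def box_H_def st_0)

lemma advance:
  assumes "s \<le> t" "\<And>p. p \<in> S \<Longrightarrow> s < fst p \<Longrightarrow> fst p \<le> t \<Longrightarrow> False"
  shows "Z t x = min 1 (Z s x + (t - s))" "H t x = max 0 (H s x - (t - s))"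
  using st_advance[OF assms] by (simp_all add: st_split)

text \<open>The state just before \<open>s\<close> when no mark falls strictly between
  \<open>r\<close> and \<open>s\<close>: pure evolution from \<open>r\<close>, without the effect of
  a mark at \<open>s\<close>.\<close>

definition "Zl r s x = min 1 (Z r x + (s - r))"
definition "Hl r s x = max 0 (H r x - (s - r))"

lemma jump:
  assumes "(s, y) \<in> S" "r < s" "\<And>p. p \<in> S \<Longrightarrow> r < fst p \<Longrightarrow> fst p < s \<Longrightarrow> False"
  shows "Z s x = (if Zl r s x = 1 \<and> y \<in> box_cluster k (Zl r s) (Hl r s) x then 0 else Zl r s x)"
    "0 \<le> Zl r s y \<Longrightarrow> H s x = (if x = y \<and> Zl r s y < 1 then Hl r s y + Zl r s y else Hl r s x)"
proof -
  have *: "evolve s (st r) = (s, Zl r s, Hl r s)"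
    unfolding st_split[of r] evolve.simps Zl_def Hl_def by simp
  \<comment> \<open>The outer \<open>evolve s\<close> lasts no time but still truncates at 1 and at
    0; with these bounds the truncation changes nothing.\<close>
  have Hl: "0 \<le> Hl r s v" "Zl r s v \<le> 1" for v by (simp_all add: Hl_def Zl_def)
  have J: "(s, Z s, H s) = evolve s (ignite k y (s, Zl r s, Hl r s))"
    using st_jump[OF assms] unfolding st_split[of s] * .
  show "Z s x = (if Zl r s x = 1 \<and> y \<in> box_cluster k (Zl r s) (Hl r s) x then 0 else Zl r s x)"
    using J Hl(2)[of x] by (simp add: min_def)
  show "H s x = (if x = y \<and> Zl r s y < 1 then Hl r s y + Zl r s y else Hl r s x)" if "0 \<le> Zl r s y"
    using J Hl(1)[of x] that by (auto simp: max_def)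
qed

lemma last_mark:
  assumes "a < s"
  obtains r where "a \<le> r" "r < s" "\<And>p. p \<in> S \<Longrightarrow> r < fst p \<Longrightarrow> fst p < s \<Longrightarrow> False"
proof -
  let ?Q = "insert a {q \<in> fst ` S. a < q \<and> q < s}"
  have f: "finite ?Q" using finite_S by simp
  have "False" if "p \<in> S" "Max ?Q < fst p" "fst p < s" for p
  proof -
    have "a \<le> Max ?Q" by (rule Max_ge[OF f]) simp
    then have "a < fst p" using that(2) by (rule le_less_trans)
    then have "fst p \<in> ?Q" using that(1,3) by simp
    then have "fst p \<le> Max ?Q" by (rule Max_ge[OF f])
    then show False using that(2) by (rule leD[THEN notE])
  qed
  moreover have "a \<le> Max ?Q" by (rule Max_ge[OF f]) simp
  moreover have "Max ?Q < s" by (subst Max_less_iff[OF f]) (use assms in auto)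
  ultimately show ?thesis using that[of "Max ?Q"] by blast
qed

text \<open>A box contains finitely many marks, so time decomposes into stretches without marks and
  single marks. The induction is on the number of marks up to \<open>t\<close>.\<close>

lemma time_induct [consumes 1, case_names base adv jmp]:
  assumes "a \<le> t" "P a"
    and adv: "\<And>r t. a \<le> r \<Longrightarrow> r \<le> t \<Longrightarrow> (\<And>p. p \<in> S \<Longrightarrow> r < fst p \<Longrightarrow> fst p \<le> t \<Longrightarrow> False) \<Longrightarrow> P r \<Longrightarrow> P t"
    and jmp: "\<And>r s y. a \<le> r \<Longrightarrow> r < s \<Longrightarrow> (s, y) \<in> S \<Longrightarrow>
       (\<And>p. p \<in> S \<Longrightarrow> r < fst p \<Longrightarrow> fst p < s \<Longrightarrow> False) \<Longrightarrow> P r \<Longrightarrow> P s"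
  shows "P t"
proof -
  show ?thesis using assms(1)
  proof (induction "card {p \<in> S. fst p \<le> t}" arbitrary: t rule: less_induct)
    case (less t')
    let ?Q = "{q \<in> fst ` S. a < q \<and> q \<le> t'}"
    have f: "finite ?Q" using finite_S by simp
    show ?case
    proof (cases "?Q = {}")
      case True
      show ?thesis by (rule adv[OF order_refl less.prems _ assms(2)]) (use True in blast)
    next
      case False
      define s where "s = Max ?Q"
      have s: "s \<in> ?Q" unfolding s_def using f False by (rule Max_in)
      then obtain y where y: "(s, y) \<in> S" by auto
      obtain r where r: "a \<le> r" "r < s" "\<And>p. p \<in> S \<Longrightarrow> r < fst p \<Longrightarrow> fst p < s \<Longrightarrow> False"
        using last_mark[of a s] s by blast
      have "{p \<in> S. fst p \<le> r} \<subset> {p \<in> S. fst p \<le> t'}" using y r s by force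
      then have "card {p \<in> S. fst p \<le> r} < card {p \<in> S. fst p \<le> t'}"
        using finite_S by (intro psubset_card_mono) auto
      then have "P r" using less.hyps r(1) by blast
      have "P s" by (rule jmp[OF r(1,2) y r(3) \<open>P r\<close>])
      show ?thesis
      proof (rule adv[of s])
        fix p assume p: "p \<in> S" "s < fst p" "fst p \<le> t'"
        then have "fst p \<in> ?Q" using s by auto
        then have "fst p \<le> s" unfolding s_def by (rule Max_ge[OF f])
        then show False using p(2) by simp
      qed (use s \<open>P s\<close> in auto)
    qed
  qed
qed

text \<open>A value below 1 is the age \<open>t - b\<close> since a reset, and resets happen at time
  0 or at marks. This finite list of values links \<open>generic\<close> with the times at which
  points fill up.\<close>

lemma Z_values: "0 \<le> t \<Longrightarrow> Z t x = 1 \<or> (\<exists>b\<in>insert 0 (fst ` S). b \<le> t \<and> t - b \<le> 1 \<and> Z t x = t - b)"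
proof (induction t rule: time_induct)
  case base
  show "Z 0 x = 1 \<or> (\<exists>b\<in>insert 0 (fst ` S). b \<le> 0 \<and> 0 - b \<le> 1 \<and> Z 0 x = 0 - b)"
    by (simp add: Z_0)
next
  case (adv r t)
  have eq: "Z t x = min 1 (Z r x + (t - r))" by (rule advance(1)) (use adv in blast)+
  from adv(4) show ?case
  proof
    assume "Z r x = 1" then show ?case using eq adv(2) by simp
  next
    assume "\<exists>b\<in>insert 0 (fst ` S). b \<le> r \<and> r - b \<le> 1 \<and> Z r x = r - b"
    then obtain b where "b \<in> insert 0 (fst ` S)" "b \<le> r" "Z r x = r - b" by blast
    then have "Z t x = 1 \<or> t - b \<le> 1 \<and> Z t x = t - b" "b \<le> t" using eq adv(2) by simp_all linarith
    with \<open>b \<in> insert 0 (fst ` S)\<close> show ?case by blast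
  qed
next
  case (jmp r s y)
  have *: "Zl r s x = 1 \<or> (\<exists>b\<in>insert 0 (fst ` S). b \<le> s \<and> s - b \<le> 1 \<and> Zl r s x = s - b)"
    using jmp(5)
  proof
    assume "Z r x = 1" then show ?thesis using jmp(2) by (simp add: Zl_def)
  next
    assume "\<exists>b\<in>insert 0 (fst ` S). b \<le> r \<and> r - b \<le> 1 \<and> Z r x = r - b"
    then obtain b where "b \<in> insert 0 (fst ` S)" "b \<le> r" "Z r x = r - b" by blast
    then have "Zl r s x = 1 \<or> s - b \<le> 1 \<and> Zl r s x = s - b" "b \<le> s"
      using jmp(2) by (simp_all add: Zl_def) linarith
    with \<open>b \<in> insert 0 (fst ` S)\<close> show ?thesis by blast
  qed
  have "Z s x = (if Zl r s x = 1 \<and> y \<in> box_cluster k (Zl r s) (Hl r s) x then 0 else Zl r s x)"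
    by (rule jump(1)[OF jmp(3,2)]) (use jmp(4) in blast)
  then have "Z s x = 0 \<or> Z s x = Zl r s x" by presburger
  moreover have "\<exists>b\<in>insert 0 (fst ` S). b \<le> s \<and> s - b \<le> 1 \<and> 0 = s - b"
    using jmp(3) by force
  ultimately show ?case using * by metis
qed

lemma Z_bounds: "0 \<le> t \<Longrightarrow> 0 \<le> Z t x" "0 \<le> t \<Longrightarrow> Z t x \<le> 1"
  using Z_values[of t x] by auto

lemma Zl_bounds: "0 \<le> r \<Longrightarrow> r \<le> s \<Longrightarrow> 0 \<le> Zl r s x" "Zl r s x \<le> 1"
  using Z_bounds(1)[of r x] by (auto simp: Zl_def)

text \<open>A spark at \<open>s\<close> on a point of age \<open>s - b\<close> has height
  \<open>s - b\<close> and has lost \<open>t - s\<close> by time \<open>t\<close>.\<close>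

lemma H_values: "0 \<le> t \<Longrightarrow> H t x = 0 \<or> (\<exists>s\<in>fst ` S. \<exists>b\<in>insert 0 (fst ` S). (s, x) \<in> S \<and> b < s \<and> s \<le> t \<and>
    0 < H t x \<and> H t x = 2 * s - b - t)"
proof (induction t rule: time_induct)
  case base
  show "H 0 x = 0 \<or> (\<exists>s\<in>fst ` S. \<exists>b\<in>insert 0 (fst ` S). (s, x) \<in> S \<and> b < s \<and> s \<le> 0 \<and>
    0 < H 0 x \<and> H 0 x = 2 * s - b - 0)"
    by (simp add: H_0)
next
  case (adv r t)
  have eq: "H t x = max 0 (H r x - (t - r))" by (rule advance(2)) (use adv in blast)+
  from adv(4) show ?case
  proof
    assume "H r x = 0" then show ?case using eq adv(2) by simp
  next
    assume "\<exists>s\<in>fst ` S. \<exists>b\<in>insert 0 (fst ` S). (s, x) \<in> S \<and> b < s \<and> s \<le> r \<and>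
      0 < H r x \<and> H r x = 2 * s - b - r"
    then obtain s b where sb: "s \<in> fst ` S" "b \<in> insert 0 (fst ` S)" "(s, x) \<in> S" "b < s" "s \<le> r" "H r x = 2 * s - b - r"
      by blast
    show ?case
    proof (cases "H t x = 0")
      case False
      then have "0 < H t x" "H t x = 2 * s - b - t" using eq sb(6) by linarith+
      then show ?thesis using sb adv(2) order_trans by blast
    qed simp
  qed
next
  case (jmp r s y)
  have H: "H s x = (if x = y \<and> Zl r s y < 1 then Hl r s y + Zl r s y else Hl r s x)"
    by (rule jump(2)[OF jmp(3,2) _ Zl_bounds(1)]) (use jmp(1,2,4) in \<open>blast | simp\<close>)+
  show ?case
  proof (cases "x = y")
    case False
    from jmp(5) show ?thesis
    proof
      assume "H r x = 0" then show ?thesis using H False jmp(2) by (simp add: Hl_def)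
    next
      assume "\<exists>s\<in>fst ` S. \<exists>b\<in>insert 0 (fst ` S). (s, x) \<in> S \<and> b < s \<and> s \<le> r \<and>
        0 < H r x \<and> H r x = 2 * s - b - r"
      then obtain q b where sb: "q \<in> fst ` S" "b \<in> insert 0 (fst ` S)" "(q, x) \<in> S" "b < q" "q \<le> r" "H r x = 2 * q - b - r"
        by blast
      show ?thesis
      proof (cases "H s x = 0")
        case nz: False
        then have "0 < H s x" "H s x = 2 * q - b - s" using H False sb(6) unfolding Hl_def by auto
        moreover have "q \<le> s" using sb(5) jmp(2) by simp
        ultimately show ?thesis using sb by blast
      qed simp
    qed
  next
    case True
    \<comment> \<open>The position of the mark has seen no earlier mark, so the spark starts from
      0.\<close>
    have "H r y = 0"
    proof (rule ccontr)
      assume "H r y \<noteq> 0"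
      then obtain q where "(q, y) \<in> S" "q \<le> r" using jmp(5) True by blast
      then show False using generic_snd[OF gen, of q y s] jmp(2,3) by (simp add: S_def)
    qed
    then have "Hl r s y = 0" using jmp(2) by (simp add: Hl_def)
    then have Hs: "H s x = (if Zl r s y < 1 then Zl r s y else 0)" using H True by simp
    show ?thesis
    proof (cases "Zl r s y < 1")
      case lt: True
      from Z_values[OF jmp(1), of y] obtain b where b: "b \<in> insert 0 (fst ` S)" "b \<le> r" "Z r y = r - b"
        using lt jmp(2) by (auto simp: Zl_def)
      then have "H s x = 2 * s - b - s" "b < s" using Hs lt jmp(2) by (auto simp: Zl_def)
      moreover from this have "0 < H s x" by simp
      moreover have "(s, x) \<in> S" using True jmp(3) by simp
      moreover from this have "s \<in> fst ` S" by force
      ultimately show ?thesis using b(1) order_refl[of s] by blast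
    qed (use Hs in simp)
  qed
qed

lemma H_nonneg: "0 \<le> t \<Longrightarrow> 0 \<le> H t x"
  using H_values[of t x] by auto

text \<open>Thresholds are crossed at finitely many times, so shortly before \<open>s\<close> none
  is crossed any more. A point filling up exactly at \<open>s\<close> still counts as young before
  \<open>s\<close>, and a barrier vanishing exactly at \<open>s\<close> is still present before;
  hence the inequalities \<open>\<le>\<close> in both criteria.\<close>

lemma before:
  assumes "0 < s"
  obtains r where "0 \<le> r" "r < s" "\<And>p. p \<in> S \<Longrightarrow> r < fst p \<Longrightarrow> fst p < s \<Longrightarrow> False"
    "\<And>q x. r \<le> q \<Longrightarrow> q < s \<Longrightarrow> Z q x = min 1 (Z r x + (q - r))"
    "\<And>q x. r \<le> q \<Longrightarrow> q < s \<Longrightarrow> H q x = max 0 (H r x - (q - r))"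
    "\<And>q x. r \<le> q \<Longrightarrow> q < s \<Longrightarrow> Z q x < 1 \<longleftrightarrow> Z r x + (s - r) \<le> 1"
    "\<And>q x. r \<le> q \<Longrightarrow> q < s \<Longrightarrow> 0 < H q x \<longleftrightarrow> s - r \<le> H r x"
proof -
  obtain a where a: "0 \<le> a" "a < s" "\<And>p. p \<in> S \<Longrightarrow> a < fst p \<Longrightarrow> fst p < s \<Longrightarrow> False"
    using last_mark[OF assms] by blast
  have advZ: "Z t x = min 1 (Z q x + (t - q))" and advH: "H t x = max 0 (H q x - (t - q))"
    if "a \<le> q" "q \<le> t" "t < s" for q t x
    by (rule advance, use that a(3) in force, use that a(3) in force)+
  \<comment> \<open>The times at which, evolving from \<open>a\<close>, some point gets full or some
    barrier vanishes. Finiteness comes from \<open>Z_values\<close> and \<open>H_values\<close>;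
    \<open>r\<close> is the last such time before \<open>s\<close>, or \<open>a\<close>.\<close>
  define C where "C = range (\<lambda>x. a + 1 - Z a x) \<union> range (\<lambda>x. a + H a x)"
  have "range (Z a) \<subseteq> insert 1 ((\<lambda>b. a - b) ` insert 0 (fst ` S))"
    using Z_values[OF a(1)] by blast
  then have "finite (range (Z a))" by (rule finite_subset) (use finite_S in simp)
  moreover have "range (H a) \<subseteq> insert 0 ((\<lambda>(s, b). 2 * s - b - a) ` (fst ` S \<times> insert 0 (fst ` S)))"
  proof
    fix v assume "v \<in> range (H a)"
    then obtain x where v: "v = H a x" by blast
    from H_values[OF a(1), of x] show "v \<in> insert 0 ((\<lambda>(s, b). 2 * s - b - a) ` (fst ` S \<times> insert 0 (fst ` S)))"
    proof
      assume "\<exists>s\<in>fst ` S. \<exists>b\<in>insert 0 (fst ` S). (s, x) \<in> S \<and> b < s \<and> s \<le> a \<and>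
        0 < H a x \<and> H a x = 2 * s - b - a"
      then obtain s b where "s \<in> fst ` S" "b \<in> insert 0 (fst ` S)" "v = 2 * s - b - a" using v by blast
      then show ?thesis by (intro insertI2, intro rev_image_eqI[of "(s, b)"]) (rule SigmaI, assumption+, simp)
    qed (simp add: v)
  qed
  then have "finite (range (H a))" by (rule finite_subset) (use finite_S in simp)
  moreover have "C = (\<lambda>v. a + 1 - v) ` range (Z a) \<union> (\<lambda>v. a + v) ` range (H a)"
    by (auto simp: C_def)
  ultimately have fC: "finite C" by simp
  define r where "r = Max (insert a {c \<in> C. c < s})"
  have f: "finite (insert a {c \<in> C. c < s})" using fC by simp
  then have "r \<in> insert a {c \<in> C. c < s}" unfolding r_def by (intro Max_in) auto
  moreover have "a \<le> r" unfolding r_def by (rule Max_ge[OF f]) simp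
  ultimately have r: "r < s" "a \<le> r" using a(2) by auto
  have rC: "c \<le> r" if "c \<in> C" "c < s" for c unfolding r_def by (rule Max_ge[OF f]) (use that in simp)
  show ?thesis
  proof (rule that[of r])
    show "0 \<le> r" "r < s" using r a by auto
    show "False" if "p \<in> S" "r < fst p" "fst p < s" for p
      by (rule a(3)[OF that(1) _ that(3)]) (use that(2) r(2) in linarith)
    fix q x assume q: "r \<le> q" "q < s"
    show Zq: "Z q x = min 1 (Z r x + (q - r))" and Hq: "H q x = max 0 (H r x - (q - r))"
      by (rule advZ advH, use q r in linarith, use q in linarith, use q in linarith)+
    have "a + 1 - Z a x \<in> C" "a + H a x \<in> C" unfolding C_def by blast+
    then have ZC: "a + 1 - Z a x \<le> r \<or> s \<le> a + 1 - Z a x" and HC: "a + H a x \<le> r \<or> s \<le> a + H a x"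
      using rC not_le by blast+
    have "Z r x = min 1 (Z a x + (r - a))" "H r x = max 0 (H a x - (r - a))"
      by (rule advZ advH, simp, use r in linarith, use r in linarith)+
    then show "Z q x < 1 \<longleftrightarrow> Z r x + (s - r) \<le> 1" "0 < H q x \<longleftrightarrow> s - r \<le> H r x"
      using Zq Hq ZC HC q r by linarith+
  qed
qed

lemma tendsto_left:
  assumes "r < s" "\<And>q. r \<le> q \<Longrightarrow> q < s \<Longrightarrow> Z q x = min 1 (Z r x + (q - r))"
    "\<And>q. r \<le> q \<Longrightarrow> q < s \<Longrightarrow> H q x = max 0 (H r x - (q - r))"
  shows "((\<lambda>q. Z q x) \<longlongrightarrow> Zl r s x) (at_left s)" "((\<lambda>q. H q x) \<longlongrightarrow> Hl r s x) (at_left s)"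
proof -
  show "((\<lambda>q. Z q x) \<longlongrightarrow> Zl r s x) (at_left s)"
  proof (rule tendsto_at_leftI[OF assms(1)])
    show "Z q x = min 1 (Z r x + (q - r))" if "r < q" "q < s" for q by (rule assms(2)) (use that in simp_all)
    show "((\<lambda>q. min 1 (Z r x + (q - r))) \<longlongrightarrow> Zl r s x) (at_left s)"
      unfolding Zl_def by (intro tendsto_intros)
  qed
  show "((\<lambda>q. H q x) \<longlongrightarrow> Hl r s x) (at_left s)"
  proof (rule tendsto_at_leftI[OF assms(1)])
    show "H q x = max 0 (H r x - (q - r))" if "r < q" "q < s" for q by (rule assms(3)) (use that in simp_all)
    show "((\<lambda>q. max 0 (H r x - (q - r))) \<longlongrightarrow> Hl r s x) (at_left s)"
      unfolding Hl_def by (intro tendsto_intros)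
  qed
qed

text \<open>Holds at every positive time and not only at marks, as a solution must have left limits
  of its clusters everywhere.\<close>

lemma bar_const:
  assumes "0 < s"
  obtains r B where "0 \<le> r" "r < s" "\<And>q. r \<le> q \<Longrightarrow> q < s \<Longrightarrow> bar E Z H q = B"
proof -
  obtain r where r: "0 \<le> r" "r < s" "\<And>p. p \<in> S \<Longrightarrow> r < fst p \<Longrightarrow> fst p < s \<Longrightarrow> False"
    "\<And>q x. r \<le> q \<Longrightarrow> q < s \<Longrightarrow> Z q x = min 1 (Z r x + (q - r))"
    "\<And>q x. r \<le> q \<Longrightarrow> q < s \<Longrightarrow> H q x = max 0 (H r x - (q - r))"
    "\<And>q x. r \<le> q \<Longrightarrow> q < s \<Longrightarrow> Z q x < 1 \<longleftrightarrow> Z r x + (s - r) \<le> 1"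
    "\<And>q x. r \<le> q \<Longrightarrow> q < s \<Longrightarrow> 0 < H q x \<longleftrightarrow> s - r \<le> H r x"
    by (rule before[OF assms], rule that; (assumption | blast))
  show ?thesis
    by (rule that[OF r(1,2), of "{x. Z r x + (s - r) \<le> 1 \<or> s - r \<le> H r x} \<union> E"])
       (simp add: bar_def barriers_def r(6,7))
qed

lemma left_limits:
  assumes "0 < s"
  obtains z h where "((\<lambda>q. Z q x) \<longlongrightarrow> z) (at_left s)" "((\<lambda>q. H q x) \<longlongrightarrow> h) (at_left s)"
proof -
  obtain r where r: "0 \<le> r" "r < s" "\<And>p. p \<in> S \<Longrightarrow> r < fst p \<Longrightarrow> fst p < s \<Longrightarrow> False"
    "\<And>q x. r \<le> q \<Longrightarrow> q < s \<Longrightarrow> Z q x = min 1 (Z r x + (q - r))"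
    "\<And>q x. r \<le> q \<Longrightarrow> q < s \<Longrightarrow> H q x = max 0 (H r x - (q - r))"
    "\<And>q x. r \<le> q \<Longrightarrow> q < s \<Longrightarrow> Z q x < 1 \<longleftrightarrow> Z r x + (s - r) \<le> 1"
    "\<And>q x. r \<le> q \<Longrightarrow> q < s \<Longrightarrow> 0 < H q x \<longleftrightarrow> s - r \<le> H r x"
    by (rule before[OF assms], rule that; (assumption | blast))
  show ?thesis by (rule that[OF tendsto_left[OF r(2) r(4) r(5)]])
qed

text \<open>At the time of a mark, genericity makes the status just before agree with the status
  of the limit.\<close>

lemma before_mark:
  assumes "(s, y) \<in> A"
  obtains r where "0 \<le> r" "r < s" "\<And>p. p \<in> S \<Longrightarrow> r < fst p \<Longrightarrow> fst p < s \<Longrightarrow> False"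
    "\<And>x. ((\<lambda>q. Z q x) \<longlongrightarrow> Zl r s x) (at_left s)" "\<And>x. ((\<lambda>q. H q x) \<longlongrightarrow> Hl r s x) (at_left s)"
    "\<And>q x. r \<le> q \<Longrightarrow> q < s \<Longrightarrow> Z q x < 1 \<longleftrightarrow> Zl r s x < 1"
    "\<And>q x. r \<le> q \<Longrightarrow> q < s \<Longrightarrow> 0 < H q x \<longleftrightarrow> 0 < Hl r s x"
proof -
  have s0: "0 < s" using generic_pos[OF gen assms] .
  obtain r where r: "0 \<le> r" "r < s" "\<And>p. p \<in> S \<Longrightarrow> r < fst p \<Longrightarrow> fst p < s \<Longrightarrow> False"
    "\<And>q x. r \<le> q \<Longrightarrow> q < s \<Longrightarrow> Z q x = min 1 (Z r x + (q - r))"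
    "\<And>q x. r \<le> q \<Longrightarrow> q < s \<Longrightarrow> H q x = max 0 (H r x - (q - r))"
    "\<And>q x. r \<le> q \<Longrightarrow> q < s \<Longrightarrow> Z q x < 1 \<longleftrightarrow> Z r x + (s - r) \<le> 1"
    "\<And>q x. r \<le> q \<Longrightarrow> q < s \<Longrightarrow> 0 < H q x \<longleftrightarrow> s - r \<le> H r x"
    by (rule before[OF s0], rule that; (assumption | blast))
  have sA: "s \<in> fst ` A" using assms by force
  have bA: "b \<in> insert 0 (fst ` A)" if "b \<in> insert 0 (fst ` S)" for b
    using that by (auto simp: S_def)
  have g1: "s \<noteq> b + 1" if "b \<in> insert 0 (fst ` S)" for b
    using gen sA bA[OF that] unfolding generic_def by blast
  have g2: "s \<noteq> 2 * q - b" if "b \<in> insert 0 (fst ` S)" "q \<in> fst ` S" "b < q" for b q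
  proof -
    have "q \<in> fst ` A" using that(2) by (auto simp: S_def)
    then show ?thesis using gen sA bA[OF that(1)] that(3) unfolding generic_def by blast
  qed
  \<comment> \<open>Filling up exactly at \<open>s\<close> would mean \<open>s = b + 1\<close>; in
    \<open>hne\<close> below, a barrier vanishing exactly at \<open>s\<close> would mean
    \<open>s = 2 * q - b\<close>. Both are excluded by \<open>generic\<close>.\<close>
  have zne: "Z r x + (s - r) \<noteq> 1" for x
  proof
    assume eq: "Z r x + (s - r) = 1"
    from Z_values[OF r(1), of x] show False
    proof (elim disjE bexE conjE)
      fix b assume "b \<in> insert 0 (fst ` S)" "Z r x = r - b"
      then show False using g1[of b] eq by argo
    qed (use eq r(2) in linarith)
  qed
  have hne: "H r x \<noteq> s - r" for x
  proof
    assume eq: "H r x = s - r"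
    from H_values[OF r(1), of x] show False
    proof (elim disjE bexE conjE)
      fix q b assume "q \<in> fst ` S" "b \<in> insert 0 (fst ` S)" "b < q" "H r x = 2 * q - b - r"
      then show False using g2[of b q] eq by argo
    qed (use eq r(2) in linarith)
  qed
  show ?thesis
  proof (rule that[OF r(1,2,3) tendsto_left(1)[OF r(2) r(4) r(5)] tendsto_left(2)[OF r(2) r(4) r(5)]])
    fix q x assume q: "r \<le> q" "q < s"
    show "Z q x < 1 \<longleftrightarrow> Zl r s x < 1" using r(6)[OF q, of x] zne[of x] by (auto simp: Zl_def)
    show "0 < H q x \<longleftrightarrow> 0 < Hl r s x" using r(7)[OF q, of x] hne[of x] by (auto simp: Hl_def)
  qed
qed

end

section \<open>The box construction as a fire process\<close>

context box
begin

lemma tendsto_before: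
  assumes "r < s" "\<And>p. p \<in> S \<Longrightarrow> r < fst p \<Longrightarrow> fst p < s \<Longrightarrow> False"
  shows "((\<lambda>q. Z q x) \<longlongrightarrow> Zl r s x) (at_left s)" "((\<lambda>q. H q x) \<longlongrightarrow> Hl r s x) (at_left s)"
proof -
  have eq: "Z q x = min 1 (Z r x + (q - r))" "H q x = max 0 (H r x - (q - r))" if "r \<le> q" "q < s" for q
    by (rule advance[OF that(1)], rule assms(2), assumption+, use that in linarith)+
  show "((\<lambda>q. Z q x) \<longlongrightarrow> Zl r s x) (at_left s)" "((\<lambda>q. H q x) \<longlongrightarrow> Hl r s x) (at_left s)"
    by (rule tendsto_left[OF assms(1)]; rule eq; assumption)+
qed

text \<open>Without a mark in the box the path is continuous from the left, so it cannot fall from 1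
  to 0.\<close>

lemma unmarked:
  assumes "0 < s" "s \<notin> fst ` S"
  shows "\<not> burnt Z s x"
proof
  assume b: "burnt Z s x"
  obtain r where r: "0 \<le> r" "r < s" "\<And>p. p \<in> S \<Longrightarrow> r < fst p \<Longrightarrow> fst p < s \<Longrightarrow> False"
    using last_mark[OF assms(1)] by blast
  have "Z s x = min 1 (Z r x + (s - r))"
  proof (rule advance(1))
    fix p assume p: "p \<in> S" "r < fst p" "fst p \<le> s"
    then have "fst p \<noteq> s" using assms(2) by blast
    then show False using r(3)[OF p(1,2)] p(3) by linarith
  qed (use r in simp)
  then have "Z s x = Zl r s x" by (simp add: Zl_def)
  moreover have "((\<lambda>q. Z q x) \<longlongrightarrow> Zl r s x) (at_left s)"
    by (rule tendsto_before(1)[OF r(2)]) (use r(3) in blast)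
  then have "Zl r s x = 1"
    using b tendsto_unique[OF trivial_limit_at_left_real] unfolding burnt_def by blast
  ultimately show False using b by (simp add: burnt_def)
qed

text \<open>\<open>U\<close> collects the points that are full, \<open>B\<close> the barriers just before the mark.\<close>

lemma mark_char:
  assumes "(s, y) \<in> A" "s \<le> T"
  obtains B U where "\<forall>\<^sub>F q in at_left s. barriers (Z q) (H q) = B"
    "\<forall>x\<in>U. \<forall>\<^sub>F q in at_left s. Z q x = 1"
    "\<forall>x\<in>-U. \<not> ((\<lambda>q. Z q x) \<longlongrightarrow> 1) (at_left s)"
    "\<forall>x. -k < x \<longrightarrow> x < k \<longrightarrow> (burnt Z s x \<longleftrightarrow> x \<in> U \<and> -k \<le> y \<and> y \<le> k \<and>
       (\<forall>v\<in>B. \<not> (y < v \<and> v \<le> x) \<and> \<not> (x \<le> v \<and> v < y)))"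
proof -
  obtain r where r: "0 \<le> r" "r < s" "\<And>p. p \<in> S \<Longrightarrow> r < fst p \<Longrightarrow> fst p < s \<Longrightarrow> False"
    "\<And>x. ((\<lambda>q. Z q x) \<longlongrightarrow> Zl r s x) (at_left s)" "\<And>x. ((\<lambda>q. H q x) \<longlongrightarrow> Hl r s x) (at_left s)"
    "\<And>q x. r \<le> q \<Longrightarrow> q < s \<Longrightarrow> Z q x < 1 \<longleftrightarrow> Zl r s x < 1"
    "\<And>q x. r \<le> q \<Longrightarrow> q < s \<Longrightarrow> 0 < H q x \<longleftrightarrow> 0 < Hl r s x"
    by (rule before_mark[OF assms(1)], rule that; (assumption | blast))
  define B where "B = barriers (Zl r s) (Hl r s)"
  define U where "U = {x. Zl r s x = 1}"
  have 1: "\<forall>\<^sub>F q in at_left s. barriers (Z q) (H q) = B"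
    by (rule eventually_at_leftI[OF r(2)]) (simp add: B_def barriers_def r(6,7))
  have 2: "\<forall>x\<in>U. \<forall>\<^sub>F q in at_left s. Z q x = 1"
  proof
    fix x assume "x \<in> U"
    then have "\<not> Zl r s x < 1" by (simp add: U_def)
    then have "Z q x = 1" if "r < q" "q < s" for q
      using r(6)[of q x] Z_bounds(2)[of q x] that r(1) by linarith
    then show "\<forall>\<^sub>F q in at_left s. Z q x = 1" by (rule eventually_at_leftI[OF r(2)])
  qed
  have lim: "((\<lambda>q. Z q x) \<longlongrightarrow> 1) (at_left s) \<longleftrightarrow> x \<in> U" for x
    using r(4)[of x] tendsto_unique[OF trivial_limit_at_left_real r(4)[of x], of 1] unfolding U_def by auto
  have 4: "burnt Z s x \<longleftrightarrow> x \<in> U \<and> -k \<le> y \<and> y \<le> k \<and>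
       (\<forall>v\<in>B. \<not> (y < v \<and> v \<le> x) \<and> \<not> (x \<le> v \<and> v < y))" if x: "-k < x" "x < k" for x
  proof (cases "-k \<le> y \<and> y \<le> k")
    case True
    then have yS: "(s, y) \<in> S" using assms generic_pos[OF gen assms(1)] by (simp add: S_def)
    have "Z s x = (if Zl r s x = 1 \<and> y \<in> box_cluster k (Zl r s) (Hl r s) x then 0 else Zl r s x)"
      by (rule jump(1)[OF yS r(2)]) (use r(3) in blast)
    then have "burnt Z s x \<longleftrightarrow> x \<in> U \<and> y \<in> box_cluster k (Zl r s) (Hl r s) x"
      unfolding burnt_def lim by (auto simp: U_def)
    then show ?thesis using x by (simp add: mem_box_cluster B_def)
  next
    \<comment> \<open>The mark lies outside the box. As times of marks are distinct, no mark inside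
      the box has time \<open>s\<close>.\<close>
    case False
    have "s \<notin> fst ` S"
    proof
      assume "s \<in> fst ` S"
      then obtain y' where "(s, y') \<in> S" by force
      then show False using False generic_fst[OF gen assms(1), of y'] by (simp add: S_def)
    qed
    then show ?thesis using False unmarked[OF generic_pos[OF gen assms(1)]] by blast
  qed
  show ?thesis
    by (rule that[OF 1 2]) (use lim 4 in blast)+
qed

text \<open>The walls act as permanent barriers: by \<open>mark_char\<close> a point strictly inside
  burns only from marks with \<open>-k \<le> y \<le> k\<close>, which is what barriers at
  \<open>-k\<close> and \<open>k\<close> enforce.\<close>

lemma fire_process_box: "fire_process T A {-k, k} {-k<..<k} Z H"
proof (rule fire_process.intro)
  show "Z 0 x = 0" "H 0 x = 0" for x by (simp_all add: Z_0 H_0)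
next
  fix x s t assume x: "x \<in> {-k<..<k}" "0 \<le> s" "s \<le> t" "t \<le> T"
    and nb: "\<And>r. r \<in> fst ` A \<Longrightarrow> s < r \<Longrightarrow> r \<le> t \<Longrightarrow> \<not> burnt Z r x"
  have "(\<forall>q\<in>fst ` A. s < q \<and> q \<le> t \<longrightarrow> \<not> burnt Z q x) \<longrightarrow> Z t x = min 1 (Z s x + (t - s))"
    using \<open>s \<le> t\<close>
  proof (induction t rule: time_induct)
    case base
    show ?case using Z_bounds(2)[OF x(2), of x] by simp
  next
    case (adv r t)
    have "Z t x = min 1 (Z r x + (t - r))" by (rule advance(1)) (use adv in blast)+
    moreover have "\<forall>q\<in>fst ` A. s < q \<and> q \<le> r \<longrightarrow> \<not> burnt Z q x"
      if "\<forall>q\<in>fst ` A. s < q \<and> q \<le> t \<longrightarrow> \<not> burnt Z q x" using adv(2) that by (meson order_trans)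
    moreover have "min 1 (min 1 (Z s x + (r - s)) + (t - r)) = min 1 (Z s x + (t - s))"
      using adv(2) by linarith
    ultimately show ?case using adv(4) by metis
  next
    case (jmp r q y)
    show ?case
    proof
      assume *: "\<forall>p\<in>fst ` A. s < p \<and> p \<le> q \<longrightarrow> \<not> burnt Z p x"
      have "q \<in> fst ` A" using jmp(3) by (force simp: S_def)
      then have nb: "\<not> burnt Z q x" using *[rule_format, of q] jmp(1,2) by simp
      have "Z q x = (if Zl r q x = 1 \<and> y \<in> box_cluster k (Zl r q) (Hl r q) x then 0 else Zl r q x)"
        by (rule jump(1)[OF jmp(3,2)]) (use jmp(4) in blast)
      moreover have "((\<lambda>q. Z q x) \<longlongrightarrow> Zl r q x) (at_left q)"
        by (rule tendsto_before(1)[OF jmp(2)]) (use jmp(4) in blast)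
      \<comment> \<open>Had the mark set the point to 0, its left limit would be 1 and it would be
        burnt.\<close>
      ultimately have "Z q x = min 1 (Z r x + (q - r))"
        using nb unfolding burnt_def Zl_def by (metis (full_types))
      moreover have "Z r x = min 1 (Z s x + (r - s))"
      proof (rule jmp(5)[rule_format])
        fix p assume "p \<in> fst ` A" "s < p \<and> p \<le> r"
        then show "\<not> burnt Z p x" using *[rule_format, of p] jmp(2) by simp
      qed
      ultimately show "Z q x = min 1 (Z s x + (q - s))" using jmp(2) by linarith
    qed
  qed
  then show "Z t x = min 1 (Z s x + (t - s))" using nb by blast
next
  fix x
  have "{r \<in> fst ` A. r \<le> T \<and> burnt Z r x} \<subseteq> fst ` S"
    using unmarked gen unfolding generic_def by blast
  then show "finite {r \<in> fst ` A. r \<le> T \<and> burnt Z r x}"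
    by (rule finite_subset) (use finite_S in simp)
next
  fix x s t assume x: "x \<in> {-k<..<k}" "0 \<le> s" "s \<le> t" "t \<le> T"
    and nm: "\<And>r. (r, x) \<in> A \<Longrightarrow> s < r \<Longrightarrow> r \<le> t \<Longrightarrow> False"
  have "(\<forall>q. (q, x) \<in> S \<longrightarrow> \<not> (s < q \<and> q \<le> t)) \<longrightarrow> H t x = max 0 (H s x - (t - s))"
    using \<open>s \<le> t\<close>
  proof (induction t rule: time_induct)
    case base
    show ?case using H_nonneg[OF x(2), of x] by simp
  next
    case (adv r t)
    have "H t x = max 0 (H r x - (t - r))" by (rule advance(2)) (use adv in blast)+
    moreover have "\<forall>q. (q, x) \<in> S \<longrightarrow> \<not> (s < q \<and> q \<le> r)"
      if "\<forall>q. (q, x) \<in> S \<longrightarrow> \<not> (s < q \<and> q \<le> t)" using adv(2) that by (meson order_trans)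
    moreover have "max 0 (max 0 (H s x - (r - s)) - (t - r)) = max 0 (H s x - (t - s))"
      using adv(2) by linarith
    ultimately show ?case using adv(4) by metis
  next
    case (jmp r q y)
    show ?case
    proof
      assume *: "\<forall>p. (p, x) \<in> S \<longrightarrow> \<not> (s < p \<and> p \<le> q)"
      have "0 \<le> Zl r q y" by (rule Zl_bounds(1)) (use x(2) jmp(1,2) in linarith)+
      have "H q x = (if x = y \<and> Zl r q y < 1 then Hl r q y + Zl r q y else Hl r q x)"
        by (rule jump(2)[OF jmp(3,2) _ \<open>0 \<le> Zl r q y\<close>]) (use jmp(4) in blast)
      moreover have "x \<noteq> y" using *[rule_format, of q] jmp(1-3) by auto
      ultimately have "H q x = max 0 (H r x - (q - r))" by (simp add: Hl_def)
      moreover have "H r x = max 0 (H s x - (r - s))"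
      proof (rule jmp(5)[rule_format])
        fix p assume "(p, x) \<in> S"
        then show "\<not> (s < p \<and> p \<le> r)" using * jmp(2) by force
      qed
      ultimately show "H q x = max 0 (H s x - (q - s))" using jmp(2) by linarith
    qed
  qed
  then show "H t x = max 0 (H s x - (t - s))" using nm unfolding S_def by blast
next
  fix s x assume x: "(s, x) \<in> A" "x \<in> {-k<..<k}" "s \<le> T"
  then have xS: "(s, x) \<in> S" using generic_pos[OF gen x(1)] by (simp add: S_def)
  obtain r where r: "0 \<le> r" "r < s" "\<And>p. p \<in> S \<Longrightarrow> r < fst p \<Longrightarrow> fst p < s \<Longrightarrow> False"
    using last_mark[OF generic_pos[OF gen x(1)]] by blast
  have "H s x = (if x = x \<and> Zl r s x < 1 then Hl r s x + Zl r s x else Hl r s x)"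
    by (rule jump(2)[OF xS r(2) _ Zl_bounds(1)[OF r(1)]]) (use r in \<open>blast | simp\<close>)+
  then have "H s x = Hl r s x + (if Zl r s x < 1 then Zl r s x else 0)" by simp
  then show "\<exists>z h. ((\<lambda>r. Z r x) \<longlongrightarrow> z) (at_left s) \<and> ((\<lambda>r. H r x) \<longlongrightarrow> h) (at_left s) \<and>
      H s x = h + (if z < 1 then z else 0)"
    using tendsto_before[OF r(2)] r(3) by blast
next
  fix s y x u assume a: "(s, y) \<in> A" "x \<in> {-k<..<k}" "s \<le> T" "burnt Z s x" "y < u" "u \<le> x"
  obtain B U where B: "\<forall>\<^sub>F q in at_left s. barriers (Z q) (H q) = B"
    and b: "\<forall>x. -k < x \<longrightarrow> x < k \<longrightarrow> (burnt Z s x \<longleftrightarrow> x \<in> U \<and> -k \<le> y \<and> y \<le> k \<and>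
       (\<forall>v\<in>B. \<not> (y < v \<and> v \<le> x) \<and> \<not> (x \<le> v \<and> v < y)))"
    by (rule mark_char[OF a(1,3)])
  have bx: "-k \<le> y" "\<forall>v\<in>B. \<not> (y < v \<and> v \<le> x) \<and> \<not> (x \<le> v \<and> v < y)"
    using b a(2,4) by auto
  show "\<not> (\<forall>\<^sub>F r in at_left s. bar {-k, k} Z H r \<inter> {u..x} \<noteq> {})"
  proof
    assume "\<forall>\<^sub>F r in at_left s. bar {-k, k} Z H r \<inter> {u..x} \<noteq> {}"
    with B have "\<forall>\<^sub>F r in at_left s. (B \<union> {-k, k}) \<inter> {u..x} \<noteq> {}"
      by eventually_elim (simp add: bar_def)
    then have "(B \<union> {-k, k}) \<inter> {u..x} \<noteq> {}" by (simp add: eventually_const)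
    then show False using bx a(2,5,6) by auto
  qed
next
  fix s y x u assume a: "(s, y) \<in> A" "x \<in> {-k<..<k}" "s \<le> T" "burnt Z s x" "u < y" "x \<le> u"
  obtain B U where B: "\<forall>\<^sub>F q in at_left s. barriers (Z q) (H q) = B"
    and b: "\<forall>x. -k < x \<longrightarrow> x < k \<longrightarrow> (burnt Z s x \<longleftrightarrow> x \<in> U \<and> -k \<le> y \<and> y \<le> k \<and>
       (\<forall>v\<in>B. \<not> (y < v \<and> v \<le> x) \<and> \<not> (x \<le> v \<and> v < y)))"
    by (rule mark_char[OF a(1,3)])
  have bx: "y \<le> k" "\<forall>v\<in>B. \<not> (y < v \<and> v \<le> x) \<and> \<not> (x \<le> v \<and> v < y)"
    using b a(2,4) by auto
  show "\<not> (\<forall>\<^sub>F r in at_left s. bar {-k, k} Z H r \<inter> {x..u} \<noteq> {})"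
  proof
    assume "\<forall>\<^sub>F r in at_left s. bar {-k, k} Z H r \<inter> {x..u} \<noteq> {}"
    with B have "\<forall>\<^sub>F r in at_left s. (B \<union> {-k, k}) \<inter> {x..u} \<noteq> {}"
      by eventually_elim (simp add: bar_def)
    then have "(B \<union> {-k, k}) \<inter> {x..u} \<noteq> {}" by (simp add: eventually_const)
    then show False using bx a(2,5,6) by auto
  qed
next
  fix s y x assume a: "(s, y) \<in> A" "x \<in> {-k<..<k}" "s \<le> T"
    and ev: "\<forall>\<^sub>F r in at_left s. Z r x = 1 \<and> bar {-k, k} Z H r \<inter> ({y<..x} \<union> {x..<y}) = {}"
  obtain B U where B: "\<forall>\<^sub>F q in at_left s. barriers (Z q) (H q) = B"
    and U: "\<forall>x\<in>-U. \<not> ((\<lambda>q. Z q x) \<longlongrightarrow> 1) (at_left s)"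
    and b: "\<forall>x. -k < x \<longrightarrow> x < k \<longrightarrow> (burnt Z s x \<longleftrightarrow> x \<in> U \<and> -k \<le> y \<and> y \<le> k \<and>
       (\<forall>v\<in>B. \<not> (y < v \<and> v \<le> x) \<and> \<not> (x \<le> v \<and> v < y)))"
    by (rule mark_char[OF a(1,3)])
  have "\<forall>\<^sub>F r in at_left s. Z r x = 1" using ev by eventually_elim simp
  then have "((\<lambda>q. Z q x) \<longlongrightarrow> 1) (at_left s)" by (rule tendsto_eventually)
  then have "x \<in> U" using U by blast
  from ev B have "\<forall>\<^sub>F r in at_left s. (B \<union> {-k, k}) \<inter> ({y<..x} \<union> {x..<y}) = {}"
    by eventually_elim (simp add: bar_def)
  then have "(B \<union> {-k, k}) \<inter> ({y<..x} \<union> {x..<y}) = {}" by (simp add: eventually_const)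
  then have 1: "v \<notin> {y<..x} \<union> {x..<y}" if "v \<in> B \<union> {-k, k}" for v using that by blast
  have "-k \<le> y" "y \<le> k" using 1[of "-k"] 1[of k] a(2) by auto
  moreover have "\<forall>v\<in>B. \<not> (y < v \<and> v \<le> x) \<and> \<not> (x \<le> v \<and> v < y)" using 1 by auto
  ultimately show "burnt Z s x" using b a(2) \<open>x \<in> U\<close> by auto
qed

end

section \<open>Comparison of a process with the box construction between two walls\<close>

text \<open>An interval ending in \<open>{c..d}\<close> meets a barrier left of \<open>c\<close>
  only if it reaches down to \<open>l\<close>, and \<open>l\<close> belongs to both sets. Agreement
  on \<open>{c..d}\<close> and a common enclosure of \<open>c\<close> thus decide every such
  interval.\<close>

lemma encloses_left:
  assumes "B \<inter> {c..d} = B' \<inter> {c..d}" "encloses B l c r" "encloses B' l c r" "c \<le> x" "x \<le> d"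
  shows "B \<inter> {y..x} \<noteq> {} \<longleftrightarrow> B' \<inter> {y..x} \<noteq> {}"
proof -
  have *: "C' \<inter> {y..x} \<noteq> {}" if "C \<inter> {c..d} = C' \<inter> {c..d}" "encloses C l c r" "encloses C' l c r" "C \<inter> {y..x} \<noteq> {}" for C C'
  proof -
    from that(4) obtain v where v: "v \<in> C" "y \<le> v" "v \<le> x" by auto
    show ?thesis
    proof (cases "c \<le> v")
      case True
      then have "v \<in> C \<inter> {c..d}" using v assms(5) by simp
      then have "v \<in> C'" unfolding that(1) by blast
      then show ?thesis using v by auto
    next
      case False
      then have "v < r" "v \<in> C" "{l<..<r} \<inter> C = {}" using v that(2) by (simp_all add: encloses_def)
      then have "\<not> l < v" by auto
      then have "y \<le> l" using v by simp
      moreover have "l \<in> C'" "l \<le> x" using that(3) assms(4) by (auto simp: encloses_def)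
      ultimately show ?thesis by auto
    qed
  qed
  show ?thesis using *[OF assms(1-3)] *[OF assms(1)[symmetric] assms(3,2)] by blast
qed

lemma encloses_right:
  assumes "B \<inter> {c..d} = B' \<inter> {c..d}" "encloses B l d r" "encloses B' l d r" "c \<le> x" "x \<le> d"
  shows "B \<inter> {x..y} \<noteq> {} \<longleftrightarrow> B' \<inter> {x..y} \<noteq> {}"
proof -
  have *: "C' \<inter> {x..y} \<noteq> {}" if "C \<inter> {c..d} = C' \<inter> {c..d}" "encloses C l d r" "encloses C' l d r" "C \<inter> {x..y} \<noteq> {}" for C C'
  proof -
    from that(4) obtain v where v: "v \<in> C" "x \<le> v" "v \<le> y" by auto
    show ?thesis
    proof (cases "v \<le> d")
      case True
      then have "v \<in> C \<inter> {c..d}" using v assms(4) by simp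
      then have "v \<in> C'" unfolding that(1) by blast
      then show ?thesis using v by auto
    next
      case False
      then have "l < v" "v \<in> C" "{l<..<r} \<inter> C = {}" using v that(2) by (simp_all add: encloses_def)
      then have "\<not> v < r" by auto
      then have "r \<le> y" using v by simp
      moreover have "r \<in> C'" "x \<le> r" using that(3) assms(5) by (auto simp: encloses_def)
      ultimately show ?thesis by auto
    qed
  qed
  show ?thesis using *[OF assms(1-3)] *[OF assms(1)[symmetric] assms(3,2)] by blast
qed

text \<open>A side without barriers has an infinite end and imposes no condition.\<close>

lemma mem_cluster:
  "y \<in> cluster z h x \<longleftrightarrow> (\<forall>v\<in>barriers z h. \<not> (y < v \<and> v \<le> x) \<and> \<not> (x \<le> v \<and> v < y))"
  unfolding cluster_def left_end_def right_end_def mem_Collect_eq SUP_le_iff le_INF_iff ereal_less_eq(3)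
  by (auto simp: not_less)

definition enclosed :: "real \<Rightarrow> (real \<Rightarrow> real set) \<Rightarrow> real \<Rightarrow> (real \<Rightarrow> real) \<Rightarrow> real \<Rightarrow> (real \<Rightarrow> real) \<Rightarrow> bool" where
  "enclosed T B k l c r \<longleftrightarrow> (\<forall>t\<in>{0..T}. -k < l t \<and> r t < k \<and> encloses (B t) (l t) c (r t))"

text \<open>A mark outside the box would have to reach \<open>x\<close> across the enclosure of
  \<open>c1\<close> or of \<open>c2\<close>, which at every time has an end inside
  \<open>]-k,k[\<close>.\<close>

lemma (in fire_process) not_burnt_between:
  assumes "generic A" "enclosed T (bar E Z H) k l1 c1 r1" "enclosed T (bar E Z H) k l2 c2 r2"
    "x \<in> {c1..c2}" "x \<in> X" "p \<in> fst ` A" "p \<le> T" "p \<notin> fst ` (A \<inter> {0..T} \<times> {-k..k})"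
  shows "\<not> burnt Z p x"
proof
  assume b: "burnt Z p x"
  obtain y where y: "(p, y) \<in> A" using assms(6) by force
  have p: "0 < p" by (rule generic_pos[OF assms(1) y])
  have "y \<notin> {-k..k}" using assms(7,8) y p by force
  then consider "y < -k" | "k < y" by force
  then show False
  proof cases
    case 1
    have "bar E Z H r \<inter> {-k..x} \<noteq> {}" if "0 < r" "r < p" for r
    proof -
      have "-k < l1 r" "encloses (bar E Z H r) (l1 r) c1 (r1 r)"
        using assms(2) that assms(7) by (simp_all add: enclosed_def)
      then have "l1 r \<in> bar E Z H r \<inter> {-k..x}" using assms(4) by (simp add: encloses_def)
      then show ?thesis by blast
    qed
    then have "\<forall>\<^sub>F r in at_left p. bar E Z H r \<inter> {-k..x} \<noteq> {}" by (rule eventually_at_leftI[OF p])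
    moreover have "-k \<le> x"
    proof -
      have "-k < l1 0" "encloses (bar E Z H 0) (l1 0) c1 (r1 0)"
        using assms(2) p assms(7) by (simp_all add: enclosed_def)
      then show ?thesis using assms(4) by (simp add: encloses_def)
    qed
    ultimately show False using burnt_left[OF y assms(5,7) b 1] by blast
  next
    case 2
    have "bar E Z H r \<inter> {x..k} \<noteq> {}" if "0 < r" "r < p" for r
    proof -
      have "r2 r < k" "encloses (bar E Z H r) (l2 r) c2 (r2 r)"
        using assms(3) that assms(7) by (simp_all add: enclosed_def)
      then have "r2 r \<in> bar E Z H r \<inter> {x..k}" using assms(4) by (simp add: encloses_def)
      then show ?thesis by blast
    qed
    then have "\<forall>\<^sub>F r in at_left p. bar E Z H r \<inter> {x..k} \<noteq> {}" by (rule eventually_at_leftI[OF p])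
    moreover have "x \<le> k"
    proof -
      have "r2 0 < k" "encloses (bar E Z H 0) (l2 0) c2 (r2 0)"
        using assms(3) p assms(7) by (simp_all add: enclosed_def)
      then show ?thesis using assms(4) by (simp add: encloses_def)
    qed
    ultimately show False using burnt_right[OF y assms(5,7) b 2] by blast
  qed
qed

text \<open>The primed process is compared with the box. The ends \<open>l1\<close>,
  \<open>r1\<close>, \<open>l2\<close>, \<open>r2\<close> of the enclosures are common to both, as
  \<open>wall_encloses\<close> provides.\<close>

locale enclosed_process = box A k T + P: fire_process T A E X Z' H'
  for A k T E X and Z' H' :: "real \<Rightarrow> real \<Rightarrow> real" +
  fixes l1 r1 l2 r2 :: "real \<Rightarrow> real" and c1 c2 :: real
  assumes XE: "{-k<..<k} \<subseteq> X" "E \<inter> {-k<..<k} = {}"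
    and encl: "enclosed T (bar E Z' H') k l1 c1 r1" "enclosed T (bar E Z' H') k l2 c2 r2"
      "enclosed T (bar {-k, k} (box_Z A k T) (box_H A k T)) k l1 c1 r1"
      "enclosed T (bar {-k, k} (box_Z A k T) (box_H A k T)) k l2 c2 r2"
begin

interpretation B: fire_process T A "{-k, k}" "{-k<..<k}" Z H by (rule fire_process_box)

lemma c_bounds: "0 \<le> T \<Longrightarrow> -k < c1" "0 \<le> T \<Longrightarrow> c2 < k"
  using encl(1,2) by (force simp: enclosed_def encloses_def)+

lemma inside: "x \<in> {c1..c2} \<Longrightarrow> 0 \<le> T \<Longrightarrow> x \<in> {-k<..<k}" "x \<in> {c1..c2} \<Longrightarrow> 0 \<le> T \<Longrightarrow> x \<in> X"
  using c_bounds XE(1) by fastforce+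

definition "agree t \<longleftrightarrow> (\<forall>x\<in>{c1..c2}. Z' t x = Z t x \<and> H' t x = H t x)"

lemma bar_agree:
  assumes "agree t" "t \<in> {0..T}"
  shows "bar E Z' H' t \<inter> {c1..c2} = bar {-k, k} Z H t \<inter> {c1..c2}"
proof -
  have "x \<notin> E" "x \<notin> {-k, k}" if "x \<in> {c1..c2}" for x
    using inside(1)[OF that] XE(2) assms(2) by auto
  then show ?thesis using assms(1) by (fastforce simp: bar_def barriers_def agree_def)
qed

text \<open>Intervals are compared instead of barrier sets, because left of \<open>c1\<close> the
  two processes are only known to share the ends of the enclosure.\<close>

lemma bar_agree_left:
  assumes "agree t" "t \<in> {0..T}" "x \<in> {c1..c2}"
  shows "bar E Z' H' t \<inter> {y..x} \<noteq> {} \<longleftrightarrow> bar {-k, k} Z H t \<inter> {y..x} \<noteq> {}"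
proof (rule encloses_left[OF bar_agree[OF assms(1,2)]])
  show "encloses (bar E Z' H' t) (l1 t) c1 (r1 t)" "encloses (bar {-k, k} Z H t) (l1 t) c1 (r1 t)"
    using encl assms(2) by (simp_all add: enclosed_def)
qed (use assms(3) in simp_all)

lemma bar_agree_right:
  assumes "agree t" "t \<in> {0..T}" "x \<in> {c1..c2}"
  shows "bar E Z' H' t \<inter> {x..y} \<noteq> {} \<longleftrightarrow> bar {-k, k} Z H t \<inter> {x..y} \<noteq> {}"
proof (rule encloses_right[OF bar_agree[OF assms(1,2)]])
  show "encloses (bar E Z' H' t) (l2 t) c2 (r2 t)" "encloses (bar {-k, k} Z H t) (l2 t) c2 (r2 t)"
    using encl assms(2) by (simp_all add: enclosed_def)
qed (use assms(3) in simp_all)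

lemma no_mark_no_burn:
  assumes "x \<in> {c1..c2}" "p \<in> fst ` A" "0 \<le> T" "p \<le> T" "p \<notin> fst ` S"
  shows "\<not> burnt Z' p x" "\<not> burnt Z p x"
proof -
  have S: "p \<notin> fst ` (A \<inter> {0..T} \<times> {-k..k})" using assms(5) by (simp only: S_def not_False_eq_True)
  show "\<not> burnt Z' p x"
    by (rule P.not_burnt_between[OF gen encl(1,2) assms(1) inside(2)[OF assms(1,3)] assms(2,4) S])
  show "\<not> burnt Z p x"
    by (rule B.not_burnt_between[OF gen encl(3,4) assms(1) inside(1)[OF assms(1,3)] assms(2,4) S])
qed

text \<open>Between marks of the box no point of \<open>{c1..c2}\<close> burns, by
  \<open>no_mark_no_burn\<close>, so both processes merely evolve.\<close>

lemma agree_advance: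
  assumes "agree r" "0 \<le> r" "r \<le> t" "t \<le> T"
    "\<And>p. p \<in> S \<Longrightarrow> r < fst p \<Longrightarrow> fst p \<le> t \<Longrightarrow> False"
  shows "agree t"
  unfolding agree_def
proof (intro ballI conjI)
  fix x assume x: "x \<in> {c1..c2}"
  have T: "0 \<le> T" using assms(2-4) by linarith
  note xin = inside[OF x T]
  have nb: "\<not> burnt Z' p x \<and> \<not> burnt Z p x" if "p \<in> fst ` A" "r < p" "p \<le> t" for p
  proof -
    have "p \<notin> fst ` S" using assms(5) that(2,3) by blast
    then show ?thesis using no_mark_no_burn[OF x that(1) T] that(3) assms(4) by simp
  qed
  have "Z' t x = min 1 (Z' r x + (t - r))" by (rule P.grow[OF xin(2) assms(2-4)]) (use nb in blast)
  moreover have "Z t x = min 1 (Z r x + (t - r))" by (rule B.grow[OF xin(1) assms(2-4)]) (use nb in blast)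
  ultimately show "Z' t x = Z t x" using assms(1) x by (simp add: agree_def)
  have nm: "False" if "(p, x) \<in> A" "r < p" "p \<le> t" for p
  proof -
    have "(p, x) \<in> S" using that xin(1) assms(2,4) by (simp add: S_def)
    then show False using assms(5)[of "(p, x)"] that by simp
  qed
  have "H' t x = max 0 (H' r x - (t - r))" by (rule P.decay[OF xin(2) assms(2-4)]) (use nm in blast)
  moreover have "H t x = max 0 (H r x - (t - r))" by (rule B.decay[OF xin(1) assms(2-4)]) (use nm in blast)
  ultimately show "H' t x = H t x" using assms(1) x by (simp add: agree_def)
qed

text \<open>Whether \<open>x\<close> burns depends on the barriers just before \<open>s\<close>.
  Inside \<open>{c1..c2}\<close> they agree, further out they are linked by the common enclosures,
  so the exact description \<open>mark_char\<close> of the box transfers to the other process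
  through its one-sided conditions.\<close>

lemma agree_jump:
  assumes "0 \<le> r" "r < s" "\<And>q. r \<le> q \<Longrightarrow> q < s \<Longrightarrow> agree q" "(s, y) \<in> S"
    "\<And>p. p \<in> S \<Longrightarrow> r < fst p \<Longrightarrow> fst p < s \<Longrightarrow> False"
  shows "agree s"
  unfolding agree_def
proof (intro ballI conjI)
  fix x assume x: "x \<in> {c1..c2}"
  have sT: "(s, y) \<in> A" "s \<le> T" "-k \<le> y" "y \<le> k" and T: "0 \<le> T" using assms(4) by (auto simp: S_def)
  note xin = inside[OF x T]
  have ag: "\<forall>\<^sub>F q in at_left s. agree q \<and> q \<in> {0..T}"
    by (rule eventually_at_leftI[OF assms(2)]) (use assms(1,3) sT(2) in simp)
  have eqZ: "\<forall>\<^sub>F q in at_left s. Z' q x = Z q x"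
    using ag by eventually_elim (use x in \<open>simp add: agree_def\<close>)
  have eqH: "\<forall>\<^sub>F q in at_left s. H' q x = H q x"
    using ag by eventually_elim (use x in \<open>simp add: agree_def\<close>)
  have limZ: "((\<lambda>q. Z' q x) \<longlongrightarrow> a) (at_left s) \<longleftrightarrow> ((\<lambda>q. Z q x) \<longlongrightarrow> a) (at_left s)" for a
    by (rule filterlim_cong[OF refl refl eqZ])
  have limH: "((\<lambda>q. H' q x) \<longlongrightarrow> a) (at_left s) \<longleftrightarrow> ((\<lambda>q. H q x) \<longlongrightarrow> a) (at_left s)" for a
    by (rule filterlim_cong[OF refl refl eqH])
  obtain B U where B: "\<forall>\<^sub>F q in at_left s. barriers (Z q) (H q) = B"
    and U1: "\<forall>x\<in>U. \<forall>\<^sub>F q in at_left s. Z q x = 1"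
    and U: "\<forall>x\<in>-U. \<not> ((\<lambda>q. Z q x) \<longlongrightarrow> 1) (at_left s)"
    and b: "\<forall>x. -k < x \<longrightarrow> x < k \<longrightarrow> (burnt Z s x \<longleftrightarrow> x \<in> U \<and> -k \<le> y \<and> y \<le> k \<and>
       (\<forall>v\<in>B. \<not> (y < v \<and> v \<le> x) \<and> \<not> (x \<le> v \<and> v < y)))"
    by (rule mark_char[OF sT(1,2)])
  have b: "burnt Z s x \<longleftrightarrow> x \<in> U \<and> (\<forall>v\<in>B. \<not> (y < v \<and> v \<le> x) \<and> \<not> (x \<le> v \<and> v < y))"
    using b xin(1) sT by simp
  have ev: "\<forall>\<^sub>F q in at_left s. bar {-k, k} Z H q = B \<union> {-k, k} \<and> agree q \<and> q \<in> {0..T}"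
    using B ag by eventually_elim (simp add: bar_def)
  have burnt: "burnt Z' s x \<longleftrightarrow> burnt Z s x"
  proof (cases "x \<in> U")
    case False
    then show ?thesis using U limZ[of 1] by (auto simp: burnt_def)
  next
    case xU: True
    show ?thesis
    proof (cases "\<forall>v\<in>B. \<not> (y < v \<and> v \<le> x) \<and> \<not> (x \<le> v \<and> v < y)")
      case False
      then obtain v where v: "v \<in> B" "y < v \<and> v \<le> x \<or> x \<le> v \<and> v < y" by blast
      from v(2) have "\<not> burnt Z' s x"
      proof
        \<comment> \<open>The other process need not have a barrier at \<open>v\<close>;
          \<open>bar_agree_left\<close> provides one somewhere in \<open>{v..x}\<close>, which is
          all that \<open>burnt_left\<close> asks for.\<close>
        assume yv: "y < v \<and> v \<le> x"
        have "\<forall>\<^sub>F q in at_left s. bar E Z' H' q \<inter> {v..x} \<noteq> {}"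
          using ev
        proof eventually_elim
          case (elim q)
          then have "bar {-k, k} Z H q \<inter> {v..x} \<noteq> {}" using v(1) yv by auto
          moreover have "agree q" "q \<in> {0..T}" using elim by blast+
          ultimately show ?case using bar_agree_left[OF _ _ x] by blast
        qed
        then show ?thesis using P.burnt_left[OF sT(1) xin(2) sT(2)] yv by blast
      next
        assume yv: "x \<le> v \<and> v < y"
        have "\<forall>\<^sub>F q in at_left s. bar E Z' H' q \<inter> {x..v} \<noteq> {}"
          using ev
        proof eventually_elim
          case (elim q)
          then have "bar {-k, k} Z H q \<inter> {x..v} \<noteq> {}" using v(1) yv by auto
          moreover have "agree q" "q \<in> {0..T}" using elim by blast+
          ultimately show ?case using bar_agree_right[OF _ _ x] by blast
        qed
        then show ?thesis using P.burnt_right[OF sT(1) xin(2) sT(2)] yv by blast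
      qed
      then show ?thesis using b False by blast
    next
      case True
      have "\<forall>\<^sub>F q in at_left s. Z' q x = 1 \<and> bar E Z' H' q \<inter> ({y<..x} \<union> {x..<y}) = {}"
        using ev U1[rule_format, OF xU] eqZ
      proof eventually_elim
        case (elim q)
        \<comment> \<open>A barrier of the other process would give one of the box, possibly
          elsewhere but still between \<open>v\<close> and \<open>x\<close>.\<close>
        have "v \<notin> bar E Z' H' q" if v: "v \<in> {y<..x} \<union> {x..<y}" for v
        proof
          assume vb: "v \<in> bar E Z' H' q"
          show False
          proof (cases "v \<le> x \<and> y < v")
            case vx: True
            then have "bar E Z' H' q \<inter> {v..x} \<noteq> {}" using vb by auto
            moreover have "agree q" "q \<in> {0..T}" using elim by blast+
            ultimately have "bar {-k, k} Z H q \<inter> {v..x} \<noteq> {}"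
              using bar_agree_left[OF _ _ x] by blast
            then obtain w where w: "w \<in> bar {-k, k} Z H q" "v \<le> w" "w \<le> x" by auto
            then have "w \<in> B \<union> {-k, k}" using elim by blast
            then show False using True vx xin(1) sT w(2,3) by auto
          next
            case vx: False
            then have vx: "x \<le> v" "v < y" using v by auto
            then have "bar E Z' H' q \<inter> {x..v} \<noteq> {}" using vb by auto
            moreover have "agree q" "q \<in> {0..T}" using elim by blast+
            ultimately have "bar {-k, k} Z H q \<inter> {x..v} \<noteq> {}"
              using bar_agree_right[OF _ _ x] by blast
            then obtain w where w: "w \<in> bar {-k, k} Z H q" "x \<le> w" "w \<le> v" by auto
            then have "w \<in> B \<union> {-k, k}" using elim by blast
            then show False using True vx xin(1) sT w(2,3) by auto
          qed
        qed
        then show ?case using elim by auto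
      qed
      then have "burnt Z' s x" by (rule P.burn[OF sT(1) xin(2) sT(2)])
      then show ?thesis using b True xU by blast
    qed
  qed
  have rr: "Z' r x = Z r x" "H' r x = H r x" using assms(2) assms(3)[of r] x by (auto simp: agree_def)
  show "Z' s x = Z s x"
  proof (cases "burnt Z s x")
    case True
    then show ?thesis using burnt by (simp add: burnt_def)
  next
    case False
    have nb: "\<not> burnt Z' p x \<and> \<not> burnt Z p x" if "p \<in> fst ` A" "r < p" "p \<le> s" for p
    proof (cases "p = s")
      case ps: False
      have "p \<notin> fst ` S"
      proof
        assume "p \<in> fst ` S"
        then obtain g where "g \<in> S" "p = fst g" by blast
        then show False using assms(5)[of g] that ps by simp
      qed
      then show ?thesis using no_mark_no_burn[OF x that(1) T] that(3) sT(2) by simp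
    qed (use False burnt in simp)
    have "Z' s x = min 1 (Z' r x + (s - r))"
      by (rule P.grow[OF xin(2) assms(1) less_imp_le[OF assms(2)] sT(2)]) (use nb in blast)
    moreover have "Z s x = min 1 (Z r x + (s - r))"
      by (rule B.grow[OF xin(1) assms(1) less_imp_le[OF assms(2)] sT(2)]) (use nb in blast)
    ultimately show ?thesis using rr by simp
  qed
  show "H' s x = H s x"
  proof (cases "x = y")
    case True
    then have m: "(s, x) \<in> A" using sT by simp
    obtain z h where zh: "((\<lambda>r. Z' r x) \<longlongrightarrow> z) (at_left s)" "((\<lambda>r. H' r x) \<longlongrightarrow> h) (at_left s)"
      "H' s x = h + (if z < 1 then z else 0)" using P.spark[OF m xin(2) sT(2)] by blast
    obtain z' h' where zh': "((\<lambda>r. Z r x) \<longlongrightarrow> z') (at_left s)" "((\<lambda>r. H r x) \<longlongrightarrow> h') (at_left s)"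
      "H s x = h' + (if z' < 1 then z' else 0)" using B.spark[OF m xin(1) sT(2)] by blast
    have "z = z'" "h = h'"
      using tendsto_unique[OF trivial_limit_at_left_real] zh(1,2) zh'(1,2) limZ limH by blast+
    then show ?thesis using zh zh' by simp
  next
    case False
    have nm: "False" if "(p, x) \<in> A" "r < p" "p \<le> s" for p
    proof (cases "p = s")
      case True
      then show False using generic_fst[OF gen, of s x y] that sT False by simp
    next
      case ps: False
      have "(p, x) \<in> S" using that xin(1) assms(1) sT(2) by (simp add: S_def)
      then show False using assms(5)[of "(p, x)"] that ps by simp
    qed
    have "H' s x = max 0 (H' r x - (s - r))"
      by (rule P.decay[OF xin(2) assms(1) less_imp_le[OF assms(2)] sT(2)]) (use nm in blast)
    moreover have "H s x = max 0 (H r x - (s - r))"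
      by (rule B.decay[OF xin(1) assms(1) less_imp_le[OF assms(2)] sT(2)]) (use nm in blast)
    ultimately show ?thesis using rr by simp
  qed
qed

lemma agree:
  assumes "t \<in> {0..T}"
  shows "agree t"
proof -
  have "0 \<le> t" using assms by simp
  then have "t \<le> T \<longrightarrow> agree t"
  proof (induction t rule: time_induct)
    case base
    have "Z' 0 x = Z 0 x \<and> H' 0 x = H 0 x" if "x \<in> {c1..c2}" "0 \<le> T" for x
      using P.init[OF inside(2)[OF that]] by (simp add: Z_0 H_0)
    then show ?case by (simp add: agree_def)
  next
    case (adv r t)
    show ?case
    proof
      assume "t \<le> T"
      then have "agree r" using adv(2,4) by simp
      then show "agree t"
        by (rule agree_advance[OF _ adv(1,2) \<open>t \<le> T\<close>]) (use adv(3) in blast)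
    qed
  next
    case (jmp r s y)
    show ?case
    proof
      assume "s \<le> T"
      then have ar: "agree r" using jmp(2,5) by simp
      \<comment> \<open>A jump depends on left limits, so agreement is first extended from
        \<open>r\<close> to the whole stretch before \<open>s\<close>.\<close>
      show "agree s"
      proof (rule agree_jump[OF jmp(1,2) _ jmp(3)])
        fix q assume q: "r \<le> q" "q < s"
        show "agree q"
        proof (rule agree_advance[OF ar jmp(1) q(1)])
          fix p assume "p \<in> S" "r < fst p" "fst p \<le> q"
          then show False using jmp(4)[of p] q by simp
        qed (use q \<open>s \<le> T\<close> in simp)
      qed (use jmp(4) in blast)
    qed
  qed
  then show ?thesis using assms by simp
qed

text \<open>The clusters coincide although only one construction has artificial walls: every
  interval from beyond \<open>-k\<close> or \<open>k\<close> to \<open>x\<close> already meets a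
  barrier of an enclosure.\<close>

lemma cluster_agree:
  assumes "t \<in> {0..T}" "x \<in> {c1..c2}" "E = {}"
  shows "cluster (Z' t) (H' t) x = box_cluster k (Z t) (H t) x"
proof (rule set_eqI)
  fix y
  have x: "-k < x" "x < k" using inside(1)[OF assms(2)] assms(1) by auto
  note ag = agree[OF assms(1)]
  have B: "bar E Z' H' t = barriers (Z' t) (H' t)" using assms(3) by (simp add: bar_def)
  have B': "bar {-k, k} Z H t = barriers (Z t) (H t) \<union> {-k, k}" by (simp add: bar_def)
  \<comment> \<open>Separation of \<open>y\<close> from \<open>x\<close> is rewritten as meeting
    some \<open>{u..x}\<close> with \<open>u > y\<close>, the form in which the two processes are
    known to agree.\<close>
  have L: "(\<exists>v\<in>C. y < v \<and> v \<le> x) \<longleftrightarrow> (\<exists>u>y. C \<inter> {u..x} \<noteq> {})" for C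
  proof
    assume "\<exists>v\<in>C. y < v \<and> v \<le> x"
    then obtain v where v: "v \<in> C" "y < v" "v \<le> x" by blast
    then have "C \<inter> {v..x} \<noteq> {}" by auto
    with v(2) show "\<exists>u>y. C \<inter> {u..x} \<noteq> {}" by blast
  next
    assume "\<exists>u>y. C \<inter> {u..x} \<noteq> {}"
    then obtain u v where "y < u" "v \<in> C" "u \<le> v" "v \<le> x" by auto
    then show "\<exists>v\<in>C. y < v \<and> v \<le> x" by (intro bexI[of _ v]) auto
  qed
  have R: "(\<exists>v\<in>C. x \<le> v \<and> v < y) \<longleftrightarrow> (\<exists>u<y. C \<inter> {x..u} \<noteq> {})" for C
  proof
    assume "\<exists>v\<in>C. x \<le> v \<and> v < y"
    then obtain v where v: "v \<in> C" "x \<le> v" "v < y" by blast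
    then have "C \<inter> {x..v} \<noteq> {}" by auto
    with v(3) show "\<exists>u<y. C \<inter> {x..u} \<noteq> {}" by blast
  next
    assume "\<exists>u<y. C \<inter> {x..u} \<noteq> {}"
    then obtain u v where "u < y" "v \<in> C" "x \<le> v" "v \<le> u" by auto
    then show "\<exists>v\<in>C. x \<le> v \<and> v < y" by (intro bexI[of _ v]) auto
  qed
  have "(\<exists>v\<in>barriers (Z' t) (H' t). y < v \<and> v \<le> x) \<longleftrightarrow> (\<exists>v\<in>barriers (Z t) (H t) \<union> {-k, k}. y < v \<and> v \<le> x)"
    unfolding L B[symmetric] B'[symmetric] bar_agree_left[OF ag assms(1,2)] ..
  also have "\<dots> \<longleftrightarrow> (\<exists>v\<in>barriers (Z t) (H t). y < v \<and> v \<le> x) \<or> y < -k" using x by auto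
  finally have 1: "(\<exists>v\<in>barriers (Z' t) (H' t). y < v \<and> v \<le> x) \<longleftrightarrow>
      (\<exists>v\<in>barriers (Z t) (H t). y < v \<and> v \<le> x) \<or> y < -k" .
  have "(\<exists>v\<in>barriers (Z' t) (H' t). x \<le> v \<and> v < y) \<longleftrightarrow> (\<exists>v\<in>barriers (Z t) (H t) \<union> {-k, k}. x \<le> v \<and> v < y)"
    unfolding R B[symmetric] B'[symmetric] bar_agree_right[OF ag assms(1,2)] ..
  also have "\<dots> \<longleftrightarrow> (\<exists>v\<in>barriers (Z t) (H t). x \<le> v \<and> v < y) \<or> k < y" using x by auto
  finally have 2: "(\<exists>v\<in>barriers (Z' t) (H' t). x \<le> v \<and> v < y) \<longleftrightarrow>
      (\<exists>v\<in>barriers (Z t) (H t). x \<le> v \<and> v < y) \<or> k < y" .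
  show "y \<in> cluster (Z' t) (H' t) x \<longleftrightarrow> y \<in> box_cluster k (Z t) (H t) x"
    unfolding mem_cluster mem_box_cluster[OF less_imp_le[OF x(1)] less_imp_le[OF x(2)]]
    using 1 2 by (meson not_le)
qed

end

text \<open>The outer ends of the walls are marks too, so the condition refers to nothing but the
  marks drawn in the box.\<close>

definition walled :: "real \<Rightarrow> nat \<Rightarrow> (real \<times> real) set \<Rightarrow> real \<Rightarrow> bool" where
  "walled T N S a \<longleftrightarrow>
     (\<exists>p\<in>S. \<exists>q\<in>S. snd p < snd q \<and> snd q < -a \<and> wall T S N 0 (snd p) (snd q)) \<and>
     (\<exists>p\<in>S. \<exists>q\<in>S. a < snd p \<and> snd p < snd q \<and> wall T S N 0 (snd p) (snd q))"

text \<open>Both processes start from 0 on the whole of each wall, so \<open>wall_encloses\<close>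
  applies to both with the same functions. \<open>E\<close> and \<open>X\<close> stay general so
  that a larger box can take the place of the given process.\<close>

lemma walled_agree:
  assumes "generic A" "fire_process T A E X Z H" "walled T N (A \<inter> {0..T} \<times> {-k..k}) a"
    "{-k<..<k} \<subseteq> X" "E \<inter> {-k<..<k} = {}" "t \<in> {0..T}" "x \<in> {-a..a}"
  shows "Z t x = box_Z A k T t x" "H t x = box_H A k T t x"
    "E = {} \<Longrightarrow> cluster (Z t) (H t) x = box_cluster k (box_Z A k T t) (box_H A k T t) x"
proof -
  interpret box A k T by unfold_locales (rule assms)
  have find: "\<exists>c l r. snd p < c \<and> c < snd q \<and> (\<forall>E X Z H. fire_process T A E X Z H \<longrightarrow> {-k<..<k} \<subseteq> X \<longrightarrow>
      E \<inter> {-k<..<k} = {} \<longrightarrow> enclosed T (bar E Z H) k l c r)"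
    if pq: "p \<in> S" "q \<in> S" "snd p < snd q" "wall T S N 0 (snd p) (snd q)" for p q
  proof -
    have b: "-k \<le> snd p" "snd q \<le> k" using pq(1,2) by (auto simp: S_def)
    obtain c l r where c: "snd p < c" "c < snd q" and e: "\<forall>E X Z H. fire_process T A E X Z H \<longrightarrow> {snd p<..<snd q} \<subseteq> X \<longrightarrow>
      E \<inter> {snd p<..<snd q} = {} \<longrightarrow> (\<forall>x\<in>{snd p<..<snd q}. Z 0 x = 0) \<longrightarrow>
      (\<forall>t\<in>{0..T}. snd p < l t \<and> r t < snd q \<and> encloses (bar E Z H t) (l t) c (r t))"
      using wall_encloses[OF pq(4) gen S_def order_refl b(1) pq(3) b(2)] by (elim exE conjE) (rule that)
    have "enclosed T (bar E Z H) k l c r" if fp: "fire_process T A E X Z H" "{-k<..<k} \<subseteq> X"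
      "E \<inter> {-k<..<k} = {}" for E X Z H
    proof -
      have sub: "{snd p<..<snd q} \<subseteq> {-k<..<k}" using b by auto
      have "\<forall>t\<in>{0..T}. snd p < l t \<and> r t < snd q \<and> encloses (bar E Z H t) (l t) c (r t)"
      proof -
        have "{snd p<..<snd q} \<subseteq> X" "E \<inter> {snd p<..<snd q} = {}" using sub fp by blast+
        moreover from this have "\<forall>x\<in>{snd p<..<snd q}. Z 0 x = 0"
          using fire_process.init(1)[OF fp(1)] by blast
        ultimately show ?thesis using e fp(1) by blast
      qed
      then show ?thesis using b unfolding enclosed_def by force
    qed
    then show ?thesis using c by blast
  qed
  obtain c1 l1 r1 where 1: "c1 < -a" and e1: "\<And>E X Z H. fire_process T A E X Z H \<Longrightarrow> {-k<..<k} \<subseteq> X \<Longrightarrow>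
      E \<inter> {-k<..<k} = {} \<Longrightarrow> enclosed T (bar E Z H) k l1 c1 r1"
    using assms(3) find unfolding walled_def S_def[symmetric] by (meson less_trans)
  obtain c2 l2 r2 where 2: "a < c2" and e2: "\<And>E X Z H. fire_process T A E X Z H \<Longrightarrow> {-k<..<k} \<subseteq> X \<Longrightarrow>
      E \<inter> {-k<..<k} = {} \<Longrightarrow> enclosed T (bar E Z H) k l2 c2 r2"
    using assms(3) find unfolding walled_def S_def[symmetric] by (meson less_trans)
  have disj: "{-k, k} \<inter> {-k<..<k} = {}" by simp
  interpret P: fire_process T A E X Z H by (rule assms)
  interpret enclosed_process A k T E X Z H l1 r1 l2 r2 c1 c2
    by unfold_locales (rule assms(4,5) e1[OF assms(2,4,5)] e2[OF assms(2,4,5)]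
        e1[OF fire_process_box subset_refl disj] e2[OF fire_process_box subset_refl disj])+
  have x: "x \<in> {c1..c2}" using 1 2 assms(7) by simp
  show "Z t x = box_Z A k T t x" "H t x = box_H A k T t x"
    using agree[OF assms(6)] x by (simp_all add: agree_def)
  show "cluster (Z t) (H t) x = box_cluster k (box_Z A k T t) (box_H A k T t) x" if "E = {}"
    by (rule cluster_agree[OF assms(6) x that])
qed

section \<open>Paths and stochastic integrals\<close>

lemma left_limit_eq: "(f \<longlongrightarrow> l) (at_left s) \<Longrightarrow> left_limit f s = l"
  unfolding left_limit_def by (rule tendsto_Lim[OF trivial_limit_at_left_real])

text \<open>A left limit is a limit along the grid points \<open>(\<lceil>ns\<rceil> - 1) / n\<close>, hence measurable without
  any assumption on the function itself.\<close>

lemma borel_measurable_left_limit: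
  assumes "has_left_limits f"
  shows "(\<lambda>s. if 0 < s then left_limit f s else 0) \<in> borel_measurable borel"
proof -
  define u where "u n s = (if 0 < s then f ((of_int \<lceil>s * real (Suc n)\<rceil> - 1) / real (Suc n)) else 0)" for n s
  show ?thesis
  proof (rule borel_measurable_LIMSEQ_real)
    fix s :: real
    show "(\<lambda>n. u n s) \<longlonglongrightarrow> (if 0 < s then left_limit f s else 0)"
    proof (cases "0 < s")
      case True
      then obtain l where l: "(f \<longlongrightarrow> l) (at_left s)" using assms unfolding has_left_limits_def by blast
      define x where "x n = (of_int \<lceil>s * real (Suc n)\<rceil> - 1) / real (Suc n)" for n
      have x1: "x n < s" for n
      proof -
        have "of_int \<lceil>s * real (Suc n)\<rceil> - 1 < s * real (Suc n)" by linarith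
        then show ?thesis by (simp add: x_def divide_less_eq del: of_nat_Suc)
      qed
      have x2: "s - 1 / real (Suc n) \<le> x n" for n
      proof -
        have "s * real (Suc n) - 1 \<le> of_int \<lceil>s * real (Suc n)\<rceil> - 1" by linarith
        then have "(s * real (Suc n) - 1) / real (Suc n) \<le> x n"
          unfolding x_def by (intro divide_right_mono) simp_all
        then show ?thesis by (simp add: diff_divide_distrib del: of_nat_Suc)
      qed
      have "(\<lambda>n. s - 1 / real (Suc n)) \<longlonglongrightarrow> s - 0"
        by (intro tendsto_diff tendsto_const LIMSEQ_Suc[OF lim_1_over_n])
      then have "x \<longlonglongrightarrow> s"
        by (intro tendsto_sandwich[of "\<lambda>n. s - 1 / real (Suc n)" x _ "\<lambda>_. s"] always_eventually allI x2
            less_imp_le[OF x1]) simp_all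
      then have "filterlim x (at_left s) sequentially"
        using x1 by (simp add: filterlim_at less_le)
      then have "(\<lambda>n. f (x n)) \<longlonglongrightarrow> l" by (rule filterlim_compose[OF l])
      then show ?thesis using True left_limit_eq[OF l] by (simp add: u_def x_def)
    qed (simp add: u_def)
  next
    fix n
    have "(\<lambda>i::int. f ((of_int i - 1) / real (Suc n))) \<in> measurable (count_space UNIV) borel" by simp
    moreover have "(\<lambda>s. \<lceil>s * real (Suc n)\<rceil>) \<in> measurable borel (count_space UNIV)" by measurable
    ultimately have "(\<lambda>s. f ((of_int \<lceil>s * real (Suc n)\<rceil> - 1) / real (Suc n))) \<in> borel_measurable borel"
      by (rule measurable_compose[rotated])
    then show "u n \<in> borel_measurable borel" unfolding u_def by measurable
  qed
qed

definition young :: "(real \<Rightarrow> real) \<Rightarrow> real \<Rightarrow> real set" where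
  "young f t = {s \<in> {0..t}. f s < 1}"

text \<open>Valid also when \<open>young f t\<close> is not measurable, both sides then being 0 by
  convention. The equations of a solution do not assert measurability; it has to be derived from
  them.\<close>

lemma LBINT_young: "(LBINT s:{0..t}. of_bool (f s < 1)) = measure lborel (young f t)"
proof -
  have "(\<lambda>s. indicator {0..t} s *\<^sub>R of_bool (f s < 1)) = (indicator (young f t) :: real \<Rightarrow> real)"
    by (auto simp: fun_eq_iff young_def indicator_def)
  then show ?thesis by (simp add: set_lebesgue_integral_def)
qed

lemma bounded_fmeasurable: "B \<in> sets borel \<Longrightarrow> B \<subseteq> {a..b::real} \<Longrightarrow> B \<in> fmeasurable lborel"
  using fmeasurable_cbox[of a b] by (intro fmeasurableI2[of "{a..b}" lborel B]) (simp_all only: cbox_interval sets_lborel)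

lemma measure_lborel_Un:
  assumes "B \<in> sets borel" "C \<in> sets borel" "B \<subseteq> {a..b::real}" "C \<subseteq> {a..b}" "B \<inter> C = {}"
  shows "measure lborel (B \<union> C) = measure lborel B + measure lborel C"
proof (rule measure_Union)
  show "emeasure lborel B \<noteq> \<infinity>" "emeasure lborel C \<noteq> \<infinity>"
    using fmeasurableD2[OF bounded_fmeasurable[OF assms(1,3)]]
      fmeasurableD2[OF bounded_fmeasurable[OF assms(2,4)]] by simp_all
qed (use assms in simp_all)

text \<open>The integral of an unmeasurable indicator is \<open>0\<close>. After the last time up to which the
  indicator is measurable, \<open>f\<close> is therefore \<open>- N\<close>, and the indicator is measurable after all.\<close>

lemma young_measurable:
  assumes eq: "\<And>t. 0 \<le> t \<Longrightarrow> f t = measure lborel (young f t) - N t"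
    and N: "\<And>c t. 0 \<le> c \<Longrightarrow> {s \<in> {c<..t}. - N s < 1} \<in> sets borel" and "0 \<le> t0"
  shows "young f t0 \<in> sets borel"
proof (rule ccontr)
  assume no: "young f t0 \<notin> sets borel"
  define M where "M = {t. 0 \<le> t \<and> t \<le> t0 \<and> young f t \<in> sets borel}"
  have down: "young f s \<in> sets borel" if "t \<in> M" "s \<le> t" for s t
  proof -
    have "young f s = young f t \<inter> {..s}" using that by (auto simp: young_def)
    moreover have "young f t \<in> sets borel" using that(1) by (simp add: M_def)
    ultimately show ?thesis by simp
  qed
  have "young f 0 \<subseteq> {0}" by (auto simp: young_def)
  then have "finite (young f 0)" by (rule finite_subset) simp
  then have M0: "0 \<in> M" using assms(3) by (simp add: M_def finite_imp_closed borel_closed)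
  have bdd: "bdd_above M" by (rule bdd_aboveI[of _ t0]) (simp add: M_def)
  define c where "c = Sup M"
  have c: "0 \<le> c" "c \<le> t0"
    unfolding c_def using M0 bdd by (auto intro: cSup_upper cSup_least simp: M_def)
  \<comment> \<open>Measurability passes to the supremum \<open>c\<close>: the set is a countable
    union of earlier ones and possibly the point \<open>c\<close>.\<close>
  have yc: "young f c \<in> sets borel"
  proof -
    have "young f (c - 1 / real (Suc n)) \<in> sets borel" for n
    proof -
      have "c - 1 / real (Suc n) < Sup M" unfolding c_def by simp
      then obtain m where "m \<in> M" "c - 1 / real (Suc n) < m" using less_cSupE M0 by blast
      then show ?thesis using down[OF _ less_imp_le] by blast
    qed
    then have U: "(\<Union>n. young f (c - 1 / real (Suc n))) \<in> sets borel" by blast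
    have eq_Un: "young f c = (\<Union>n. young f (c - 1 / real (Suc n))) \<union> (if c \<in> young f c then {c} else {})"
    proof (intro equalityI subsetI)
      fix s assume s: "s \<in> young f c"
      show "s \<in> (\<Union>n. young f (c - 1 / real (Suc n))) \<union> (if c \<in> young f c then {c} else {})"
      proof (cases "s = c")
        case False
        then have "s < c" using s by (simp add: young_def)
        then obtain n where "1 / real (Suc n) < c - s" using nat_approx_posE[of "c - s"] by auto
        then have "s \<in> young f (c - 1 / real (Suc n))" using s by (simp add: young_def)
        then show ?thesis by blast
      qed (use s in simp)
    next
      fix s assume "s \<in> (\<Union>n. young f (c - 1 / real (Suc n))) \<union> (if c \<in> young f c then {c} else {})"
      then consider n where "s \<in> young f (c - 1 / real (Suc n))" | "s = c" "c \<in> young f c"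
        by (auto split: if_splits)
      then show "s \<in> young f c"
      proof cases
        case 1
        have "0 \<le> 1 / real (Suc n)" by simp
        moreover have "0 \<le> s" "s \<le> c - 1 / real (Suc n)" "f s < 1" using 1 by (simp_all add: young_def)
        moreover from calculation have "s \<le> c" by linarith
        ultimately show ?thesis by (simp add: young_def)
      qed simp
    qed
    have V: "(if c \<in> young f c then {c} else {}) \<in> sets borel" by simp
    show ?thesis by (subst eq_Un) (rule sets.Un[OF U V])
  qed
  have "young f s \<notin> sets borel" if "c < s" "s \<le> t0" for s
  proof
    assume "young f s \<in> sets borel"
    then have "s \<in> M" using that c by (simp add: M_def)
    then show False using cSup_upper[OF _ bdd, of s] that by (simp add: c_def)
  qed
  then have fs: "f s = - N s" if "c < s" "s \<le> t0" for s
    using eq[of s] that c by (simp add: measure_notin_sets)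
  have "young f t0 = young f c \<union> {s \<in> {c<..t0}. - N s < 1}"
  proof (rule set_eqI)
    fix s
    show "s \<in> young f t0 \<longleftrightarrow> s \<in> young f c \<union> {s \<in> {c<..t0}. - N s < 1}"
    proof (cases "c < s \<and> s \<le> t0")
      case True
      then show ?thesis using fs[of s] c by (simp add: young_def)
    qed (use c in \<open>auto simp: young_def\<close>)
  qed
  then show False using no yc N[OF c(1), of t0] by simp
qed

text \<open>The equation controls only the measure of the young times, so \<open>f\<close> is
  increasing and 1-Lipschitz. It cannot exceed 1: beyond the last time with \<open>f \<le> 1\<close>
  there are no young times, hence no growth.\<close>

lemma growth:
  assumes eq: "\<And>t. 0 \<le> t \<Longrightarrow> f t = measure lborel (young f t) - N t"
    and meas: "\<And>t. 0 \<le> t \<Longrightarrow> young f t \<in> sets borel"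
    and st: "0 \<le> s" "s \<le> t" and N: "\<And>u. s \<le> u \<Longrightarrow> u \<le> t \<Longrightarrow> N u = N s" and fs: "f s \<le> 1"
  shows "f t = min 1 (f s + (t - s))"
proof -
  have inc: "f v - f u = measure lborel {r \<in> {u<..v}. f r < 1} \<and> {r \<in> {u<..v}. f r < 1} \<in> sets borel"
    if "s \<le> u" "u \<le> v" "v \<le> t" for u v
  proof -
    have u: "0 \<le> u" "0 \<le> v" using that st by linarith+
    have sub: "young f u \<subseteq> young f v" using that by (auto simp: young_def)
    have "young f v \<in> fmeasurable lborel"
      by (rule bounded_fmeasurable[OF meas[OF u(2)], of 0 v]) (auto simp: young_def)
    then have "measure lborel (young f v - young f u) = measure lborel (young f v) - measure lborel (young f u)"
      using meas[OF u(1)] sub by (intro measurable_measure_Diff) simp_all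
    moreover have "young f v - young f u = {r \<in> {u<..v}. f r < 1}"
      using that u by (auto simp: young_def)
    moreover have "young f v - young f u \<in> sets borel" using meas[OF u(1)] meas[OF u(2)] by blast
    ultimately show ?thesis using eq[OF u(1)] eq[OF u(2)] N[of u] N[of v] that by simp
  qed
  have mono: "f u \<le> f v" if "s \<le> u" "u \<le> v" "v \<le> t" for u v
    using inc[OF that] measure_nonneg[of lborel "{r \<in> {u<..v}. f r < 1}"] by linarith
  have lip: "f v - f u \<le> v - u" if "s \<le> u" "u \<le> v" "v \<le> t" for u v
  proof -
    have "measure lborel {r \<in> {u<..v}. f r < 1} \<le> measure lborel {u<..v}"
      using inc[OF that] by (intro measure_mono_fmeasurable bounded_fmeasurable[of _ u v]) auto
    then show ?thesis using inc[OF that] that(2) by simp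
  qed
  have "f t \<le> 1"
  proof (rule ccontr)
    assume ft: "\<not> f t \<le> 1"
    define W where "W = {u. s \<le> u \<and> u \<le> t \<and> f u \<le> 1}"
    have bdd: "bdd_above W" by (rule bdd_aboveI[of _ t]) (simp add: W_def)
    have sW: "s \<in> W" using st fs by (simp add: W_def)
    define w where "w = Sup W"
    have w: "s \<le> w" "w \<le> t" unfolding w_def using sW bdd by (auto intro: cSup_upper cSup_least simp: W_def)
    \<comment> \<open>The bound by 1 passes to the supremum because of the Lipschitz
      estimate.\<close>
    have "f w \<le> 1 + e" if "e > 0" for e
    proof -
      have "w - e < Sup W" using that by (simp add: w_def)
      then obtain u where u: "u \<in> W" "w - e < u" using less_cSupE sW by blast
      have "u \<le> w" unfolding w_def using u(1) bdd by (rule cSup_upper)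
      then show ?thesis using lip[of u w] u w(2) by (simp add: W_def)
    qed
    then have fw: "f w \<le> 1" by (rule field_le_epsilon)
    have "1 < f r" if "w < r" "r \<le> t" for r
    proof (rule ccontr)
      assume "\<not> 1 < f r"
      then have "r \<in> W" using that w by (simp add: W_def)
      then show False using cSup_upper[OF _ bdd, of r] that by (simp add: w_def)
    qed
    then have E: "{r \<in> {w<..t}. f r < 1} = {}" by force
    show False using inc[OF w(1,2) order_refl, unfolded E] fw ft by simp
  qed
  show ?thesis
  proof (cases "f t < 1")
    case True
    then have "f r < 1" if "r \<in> {s<..t}" for r using mono[of r t] that by force
    then have "{r \<in> {s<..t}. f r < 1} = {s<..t}" by blast
    then have "f t - f s = t - s" using inc[OF order_refl st(2) order_refl] st(2) by simp
    then show ?thesis using True by simp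
  next
    case False
    then show ?thesis using \<open>f t \<le> 1\<close> lip[OF order_refl st(2) order_refl] by simp
  qed
qed

lemma last_before:
  fixes F :: "real set"
  assumes "finite {q \<in> F. q \<le> t}" "0 < t"
  obtains r where "0 \<le> r" "r < t" "\<And>q. q \<in> F \<Longrightarrow> r < q \<Longrightarrow> q < t \<Longrightarrow> False"
proof -
  let ?Q = "insert 0 {q \<in> F. 0 < q \<and> q < t}"
  have f: "finite ?Q" by (rule finite_subset[of _ "insert 0 {q \<in> F. q \<le> t}"]) (use assms(1) in auto)
  have "0 \<le> Max ?Q" by (rule Max_ge[OF f]) simp
  moreover have "Max ?Q < t" by (subst Max_less_iff[OF f]) (use assms(2) in auto)
  moreover have "False" if "q \<in> F" "Max ?Q < q" "q < t" for q
  proof -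
    have "0 < q" using \<open>0 \<le> Max ?Q\<close> that(2) by (rule le_less_trans)
    then have "q \<in> ?Q" using that(1,3) by simp
    then have "q \<le> Max ?Q" by (rule Max_ge[OF f])
    then show False using that(2) by linarith
  qed
  ultimately show ?thesis using that[of "Max ?Q"] by blast
qed

text \<open>One site seen in time: \<open>F\<close> is the set of its fires, each arriving when the
  left limit is 1. The fire integral is then the counting function \<open>cnt\<close>.\<close>

locale reset =
  fixes f :: "real \<Rightarrow> real" and F :: "real set"
  assumes pos: "\<And>q. q \<in> F \<Longrightarrow> 0 < q" and fin: "\<And>t. finite {q \<in> F. q \<le> t}"
    and full: "\<And>q. q \<in> F \<Longrightarrow> (f \<longlongrightarrow> 1) (at_left q)"
begin

definition "cnt t = real (card {q \<in> F. q \<le> t})"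

lemma cnt_0: "cnt 0 = 0"
proof -
  have "{q \<in> F. q \<le> 0} = {}" using pos by force
  then show ?thesis unfolding cnt_def by (simp only: card.empty of_nat_0)
qed

lemma cnt_const: "s \<le> t \<Longrightarrow> (\<And>q. q \<in> F \<Longrightarrow> s < q \<Longrightarrow> q \<le> t \<Longrightarrow> False) \<Longrightarrow> cnt t = cnt s"
  unfolding cnt_def by (rule arg_cong[where f = "\<lambda>S. real (card S)"]) force

lemma cnt_Suc:
  assumes "q \<in> F" "r < q" "\<And>p. p \<in> F \<Longrightarrow> r < p \<Longrightarrow> p < q \<Longrightarrow> False"
  shows "cnt q = cnt r + 1"
proof -
  have "{p \<in> F. p \<le> q} = insert q {p \<in> F. p \<le> r}"
  proof (rule set_eqI)
    fix p
    show "p \<in> {p \<in> F. p \<le> q} \<longleftrightarrow> p \<in> insert q {p \<in> F. p \<le> r}"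
      using assms(1,2) assms(3)[of p] by (cases p q rule: linorder_cases; cases "r < p") auto
  qed
  moreover have "q \<notin> {p \<in> F. p \<le> r}" using assms(2) by simp
  ultimately show ?thesis using fin[of r] by (simp add: cnt_def)
qed

lemma last_reset:
  assumes "0 \<le> t"
  obtains q where "0 \<le> q" "q \<le> t" "q = 0 \<or> q \<in> F" "\<And>p. p \<in> F \<Longrightarrow> q < p \<Longrightarrow> p \<le> t \<Longrightarrow> False"
proof (cases "t \<in> F")
  case True
  then show ?thesis using that[of t] assms by simp
next
  case False
  show ?thesis
  proof (cases "\<exists>q\<in>F. q \<le> t")
    case True
    let ?Q = "{q \<in> F. q \<le> t}"
    have ne: "?Q \<noteq> {}" using True by blast
    have m: "Max ?Q \<in> ?Q" by (rule Max_in[OF fin ne])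
    show ?thesis
    proof (rule that[of "Max ?Q"])
      show "0 \<le> Max ?Q" "Max ?Q \<le> t" "Max ?Q = 0 \<or> Max ?Q \<in> F"
        using m less_imp_le[OF pos] by blast+
      fix p assume "p \<in> F" "Max ?Q < p" "p \<le> t"
      moreover from this have "p \<le> Max ?Q" by (intro Max_ge[OF fin]) simp
      ultimately show False by linarith
    qed
  next
    case False
    then show ?thesis using that[of 0] assms by blast
  qed
qed

lemma young_sets:
  assumes "\<And>t. 0 \<le> t \<Longrightarrow> f t = measure lborel (young f t) - cnt t" "0 \<le> t"
  shows "young f t \<in> sets borel"
proof (rule young_measurable[OF assms(1) _ assms(2)])
  fix c t :: real
  have "0 \<le> cnt s" for s by (simp add: cnt_def)
  then have "- cnt s < 1" for s using less_le_trans[of "-1" 0 "cnt s"] by simp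
  then show "{s \<in> {c<..t}. - cnt s < 1} \<in> sets borel" by simp
qed

text \<open>The measure term is continuous, so at a fire \<open>f\<close> falls by exactly 1 from
  the left limit 1. This gives the value 0 at fires, from it the bound by 1, and only then the
  growth rule between fires. The last part says that nothing but a fire makes \<open>f\<close> fall
  from 1.\<close>

lemma reset_growth:
  assumes eq: "\<And>t. 0 \<le> t \<Longrightarrow> f t = measure lborel (young f t) - cnt t"
  shows "q \<in> F \<Longrightarrow> f q = 0" and "0 \<le> t \<Longrightarrow> f t \<le> 1"
    and "0 \<le> s \<Longrightarrow> s \<le> t \<Longrightarrow> (\<And>q. q \<in> F \<Longrightarrow> s < q \<Longrightarrow> q \<le> t \<Longrightarrow> False) \<Longrightarrow> f t = min 1 (f s + (t - s))"
    and "0 < q \<Longrightarrow> q \<notin> F \<Longrightarrow> (f \<longlongrightarrow> 1) (at_left q) \<Longrightarrow> f q = 1"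
proof -
  note meas = young_sets[OF eq]
  show zero: "f q = 0" if q: "q \<in> F" for q
  proof -
    obtain r where r: "0 \<le> r" "r < q" "\<And>p. p \<in> F \<Longrightarrow> r < p \<Longrightarrow> p < q \<Longrightarrow> False"
      using last_before[OF fin pos[OF q]] by blast
    \<comment> \<open>Exactly one fire is counted between \<open>u\<close> and \<open>q\<close>, so
      \<open>f q - f u + 1\<close> is the increase of the measure term, at most
      \<open>q - u\<close>.\<close>
    have bound: "norm (f q - f u + 1) \<le> q - u" if u: "r < u" "u < q" for u
    proof -
      have "cnt q = cnt u + 1" by (rule cnt_Suc[OF q u(2)]) (use r(3) u(1) in force)
      then have "f q - f u + 1 = measure lborel (young f q) - measure lborel (young f u)"
        using eq[of q] eq[of u] u r(1) by simp
      also have "\<dots> = measure lborel (young f q - young f u)"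
      proof (rule measurable_measure_Diff[symmetric])
        show "young f q \<in> fmeasurable lborel"
          by (rule bounded_fmeasurable[of _ 0 q]) (use meas[of q] u r(1) in \<open>auto simp: young_def\<close>)
        show "young f u \<in> sets lborel" using meas[of u] u r(1) by simp
        show "young f u \<subseteq> young f q" using u by (auto simp: young_def)
      qed
      finally have e: "f q - f u + 1 = measure lborel (young f q - young f u)" .
      have "measure lborel (young f q - young f u) \<le> measure lborel {u..q}"
      proof (rule measure_mono_fmeasurable)
        show "young f q - young f u \<subseteq> {u..q}" by (auto simp: young_def)
        show "young f q - young f u \<in> sets lborel" using meas[of u] meas[of q] u r(1) by simp
        show "{u..q} \<in> fmeasurable lborel" by (rule bounded_fmeasurable[of _ u q]) simp_all
      qed
      then show ?thesis using e u by simp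
    qed
    have "((\<lambda>u. f q - f u + 1) \<longlongrightarrow> f q - 1 + 1) (at_left q)"
      by (intro tendsto_intros full q)
    moreover have "((\<lambda>u. f q - f u + 1) \<longlongrightarrow> 0) (at_left q)"
    proof (rule Lim_null_comparison)
      show "\<forall>\<^sub>F u in at_left q. norm (f q - f u + 1) \<le> q - u"
        by (rule eventually_at_leftI[OF r(2)]) (rule bound)
      have "((\<lambda>u. q - u) \<longlongrightarrow> q - q) (at_left q)" by (intro tendsto_intros)
      then show "((\<lambda>u. q - u) \<longlongrightarrow> 0) (at_left q)" by simp
    qed
    ultimately have "f q - 1 + 1 = 0" by (rule tendsto_unique[OF trivial_limit_at_left_real])
    then show ?thesis by simp
  qed
  have f0: "f 0 = 0"
  proof -
    have "young f 0 \<subseteq> {0}" by (auto simp: young_def)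
    then have "measure lborel (young f 0) = 0"
      using measure_mono_fmeasurable[of "young f 0" "{0}" lborel] meas[of 0] bounded_fmeasurable[of "{0}" 0 0]
        measure_nonneg[of lborel "young f 0"] by simp
    then show ?thesis using eq[of 0] cnt_0 by simp
  qed
  have grow0: "f t = min 1 (f s + (t - s))"
    if "0 \<le> s" "s \<le> t" "\<And>q. q \<in> F \<Longrightarrow> s < q \<Longrightarrow> q \<le> t \<Longrightarrow> False" "f s \<le> 1" for s t
  proof (rule growth[OF eq meas that(1,2) _ that(4)])
    fix u assume "s \<le> u" "u \<le> t"
    then show "cnt u = cnt s" by (intro cnt_const) (use that(3) in force)+
  qed
  show le1: "f t \<le> 1" if t0: "0 \<le> t" for t
  proof -
    obtain q where q: "0 \<le> q" "q \<le> t" "q = 0 \<or> q \<in> F" "\<And>p. p \<in> F \<Longrightarrow> q < p \<Longrightarrow> p \<le> t \<Longrightarrow> False"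
      using last_reset[OF t0] by blast
    have "f q = 0" using q(3) zero f0 by blast
    then have "f t = min 1 (f q + (t - q))" by (intro grow0) (use q in auto)
    then show ?thesis by linarith
  qed
  show grow: "f t = min 1 (f s + (t - s))"
    if "0 \<le> s" "s \<le> t" "\<And>q. q \<in> F \<Longrightarrow> s < q \<Longrightarrow> q \<le> t \<Longrightarrow> False" for s t
    by (rule grow0[OF that(1,2) _ le1[OF that(1)]]) (use that(3) in blast)
  show "f q = 1" if q: "0 < q" "q \<notin> F" "(f \<longlongrightarrow> 1) (at_left q)"
  proof -
    obtain r where r: "0 \<le> r" "r < q" "\<And>p. p \<in> F \<Longrightarrow> r < p \<Longrightarrow> p < q \<Longrightarrow> False"
      using last_before[OF fin q(1)] by blast
    have e: "f u = min 1 (f r + (u - r))" if "r \<le> u" "u \<le> q" for u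
    proof (rule grow[OF r(1) that(1)])
      fix p assume "p \<in> F" "r < p" "p \<le> u"
      then show False using r(3)[of p] q(2) that(2) by (cases "p = q") auto
    qed
    have "(f \<longlongrightarrow> min 1 (f r + (q - r))) (at_left q)"
    proof (rule tendsto_at_leftI[OF r(2)])
      show "f u = min 1 (f r + (u - r))" if "r < u" "u < q" for u by (rule e) (use that in simp_all)
      show "((\<lambda>u. min 1 (f r + (u - r))) \<longlongrightarrow> min 1 (f r + (q - r))) (at_left q)" by (intro tendsto_intros)
    qed
    then have "min 1 (f r + (q - r)) = 1" using q(3) by (rule tendsto_unique[OF trivial_limit_at_left_real])
    moreover have "f q = min 1 (f r + (q - r))" by (rule e) (use r(2) in simp_all)
    ultimately show ?thesis by simp
  qed
qed

text \<open>Converse of \<open>reset_growth\<close>: between consecutive fires the site is young for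
  a total time of exactly 1, which cancels the unit counted for the fire.\<close>

lemma reset_integral:
  assumes f0: "f 0 = 0" and zero: "\<And>q. q \<in> F \<Longrightarrow> f q = 0" and le1: "\<And>t. 0 \<le> t \<Longrightarrow> f t \<le> 1"
    and grow: "\<And>s t. 0 \<le> s \<Longrightarrow> s \<le> t \<Longrightarrow> (\<And>q. q \<in> F \<Longrightarrow> s < q \<Longrightarrow> q \<le> t \<Longrightarrow> False) \<Longrightarrow>
       f t = min 1 (f s + (t - s))"
    and "0 \<le> t"
  shows "young f t \<in> sets borel \<and> f t = measure lborel (young f t) - cnt t"
  using \<open>0 \<le> t\<close>
proof (induction "card {q \<in> F. q \<le> t}" arbitrary: t rule: less_induct)
  case less
  obtain q where q: "0 \<le> q" "q \<le> t" "q = 0 \<or> q \<in> F" "\<And>p. p \<in> F \<Longrightarrow> q < p \<Longrightarrow> p \<le> t \<Longrightarrow> False"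
    using last_reset[OF less.prems] by blast
  have fq: "f q = 0" using q(3) zero f0 by blast
  have ft: "f u = min 1 (u - q)" if "q \<le> u" "u \<le> t" for u
    using grow[OF q(1) that(1)] q(4) that(2) fq by force
  \<comment> \<open>The young times before the last reset \<open>q\<close>. Their length is
    \<open>cnt q\<close>, one unit for each completed cycle.\<close>
  define J where "J = {s \<in> {0..<q}. f s < 1}"
  have J: "J \<in> sets borel \<and> measure lborel J = cnt q"
  proof (cases "q \<in> F")
    case False
    then have "q = 0" using q(3) by blast
    then show ?thesis using cnt_0 by (simp add: J_def)
  next
    case True
    obtain r where r: "0 \<le> r" "r < q" "\<And>p. p \<in> F \<Longrightarrow> r < p \<Longrightarrow> p < q \<Longrightarrow> False"
      using last_before[OF fin pos[OF True]] by blast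
    have "{p \<in> F. p \<le> r} \<subset> {p \<in> F. p \<le> t}" using True r(2) q(2) by force
    then have "card {p \<in> F. p \<le> r} < card {p \<in> F. p \<le> t}" by (intro psubset_card_mono fin)
    then have IH: "young f r \<in> sets borel" "f r = measure lborel (young f r) - cnt r"
      using less.hyps r(1) by blast+
    have fu: "f u = min 1 (f r + (u - r))" if "r \<le> u" "u < q" for u
      by (rule grow[OF r(1) that(1)]) (use r(3) that(2) in force)
    have "(f \<longlongrightarrow> min 1 (f r + (q - r))) (at_left q)"
    proof (rule tendsto_at_leftI[OF r(2)])
      show "f u = min 1 (f r + (u - r))" if "r < u" "u < q" for u by (rule fu) (use that in simp_all)
      show "((\<lambda>u. min 1 (f r + (u - r))) \<longlongrightarrow> min 1 (f r + (q - r))) (at_left q)" by (intro tendsto_intros)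
    qed
    then have "min 1 (f r + (q - r)) = 1" using full[OF True] by (rule tendsto_unique[OF trivial_limit_at_left_real])
    then have ge: "1 - f r \<le> q - r" by linarith
    have r1: "f r \<le> 1" by (rule le1[OF r(1)])
    \<comment> \<open>After \<open>r\<close> the site stays young for the missing time
      \<open>1 - f r\<close>, and by \<open>ge\<close> the fire at \<open>q\<close> comes no
      sooner.\<close>
    have JU: "J = young f r \<union> {r<..<r + (1 - f r)}"
    proof (rule set_eqI)
      fix s
      show "s \<in> J \<longleftrightarrow> s \<in> young f r \<union> {r<..<r + (1 - f r)}"
      proof (cases "r < s \<and> s < q")
        case True
        then have "f s < 1 \<longleftrightarrow> s < r + (1 - f r)" using fu[of s] by linarith
        then show ?thesis using True r(1) by (simp add: J_def young_def)
      next
        case False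
        then show ?thesis using ge r(2) by (auto simp: J_def young_def)
      qed
    qed
    have mU: "measure lborel (young f r \<union> {r<..<r + (1 - f r)}) = measure lborel (young f r) + measure lborel {r<..<r + (1 - f r)}"
    proof (rule measure_lborel_Un[OF IH(1)])
      show "{r<..<r + (1 - f r)} \<in> sets borel" by simp
      show "young f r \<subseteq> {0..q}" using r(2) by (auto simp: young_def)
      show "{r<..<r + (1 - f r)} \<subseteq> {0..q}" using r(1) ge by auto
      show "young f r \<inter> {r<..<r + (1 - f r)} = {}" by (auto simp: young_def)
    qed
    have c: "cnt q = cnt r + 1" by (rule cnt_Suc[OF True r(2)]) (use r(3) in blast)
    have "measure lborel {r<..<r + (1 - f r)} = 1 - f r" using r1 by simp
    then have "measure lborel J = cnt q" unfolding JU mU using IH(2) c by simp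
    moreover have "J \<in> sets borel" unfolding JU using IH(1) by simp
    ultimately show ?thesis by blast
  qed
  have e: "young f t = J \<union> {q..<min (q + 1) t} \<union> (if t < q + 1 then {t} else {})"
  proof (rule set_eqI)
    fix s
    show "s \<in> young f t \<longleftrightarrow> s \<in> J \<union> {q..<min (q + 1) t} \<union> (if t < q + 1 then {t} else {})"
    proof (cases "q \<le> s \<and> s \<le> t")
      case True
      then have "f s < 1 \<longleftrightarrow> s < q + 1" using ft[of s] by linarith
      then show ?thesis using True q(1) by (auto simp: J_def young_def)
    next
      case False
      then show ?thesis using q by (auto simp: J_def young_def)
    qed
  qed
  \<comment> \<open>The young times since \<open>q\<close>. The end \<open>t\<close> is itself young
    as long as \<open>t < q + 1\<close>, which makes this piece closed or half-open.\<close>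
  define C where "C = {q..<min (q + 1) t} \<union> (if t < q + 1 then {t} else {})"
  have C: "C = (if t < q + 1 then {q..t} else {q..<q + 1})" using q(2) by (auto simp: C_def)
  have Cb: "C \<in> sets borel" by (simp add: C)
  have mU: "measure lborel (J \<union> C) = measure lborel J + measure lborel C"
  proof (rule measure_lborel_Un[OF _ Cb])
    show "J \<in> sets borel" using J by blast
    show "J \<subseteq> {0..t}" using q(1,2) by (auto simp: J_def)
    show "C \<subseteq> {0..t}" using q(1,2) unfolding C_def by (auto split: if_splits)
    show "J \<inter> C = {}" using q(2) unfolding C_def by (auto simp: J_def split: if_splits)
  qed
  have "measure lborel C = f t"
  proof (cases "t < q + 1")
    case True
    then show ?thesis using ft[OF q(2) order_refl] q(2) by (simp add: C)
  next
    case False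
    then show ?thesis using ft[OF q(2) order_refl] by (simp add: C)
  qed
  moreover have "cnt t = cnt q" by (rule cnt_const[OF q(2)]) (use q(4) in blast)
  moreover have yJC: "young f t = J \<union> C" by (simp only: e C_def Un_assoc)
  moreover have "measure lborel J = cnt q" using J by blast
  ultimately have "f t = measure lborel (young f t) - cnt t" using mU by simp
  moreover have "young f t \<in> sets borel" unfolding yJC using J Cb by blast
  ultimately show ?case by blast
qed

end

section \<open>Realisations of the Poisson measure as sets of marks\<close>

definition atoms :: "(real \<times> real) measure \<Rightarrow> (real \<times> real) set" where
  "atoms m = {p. emeasure m {p} \<noteq> 0}"

lemma measure_lborel_singleton: "B \<in> sets borel \<Longrightarrow> B \<subseteq> {a::real} \<Longrightarrow> measure lborel B = 0"
  using measure_mono_fmeasurable[of B "{a}" lborel] bounded_fmeasurable[of "{a}" a a]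
    measure_nonneg[of lborel B] by simp

text \<open>The almost sure properties of one realisation on which the deterministic arguments rest.
  \<open>null\<close> is a separate demand because the masses of single points do not control
  uncountable sets.\<close>

locale realisation =
  fixes m :: "(real \<times> real) measure"
  assumes sets_m: "sets m = sets half_plane_lebesgue" and gen: "generic (atoms m)"
    and atom_1: "p \<in> atoms m \<Longrightarrow> emeasure m {p} = 1"
    and null: "emeasure m (space m - atoms m) = 0"
begin

abbreviation "A \<equiv> atoms m"

lemma space_m: "space m = {0..} \<times> UNIV"
  using sets_eq_imp_space_eq[OF sets_m] by (simp add: half_plane_lebesgue_def space_restrict_space)

lemma sets_mI: "B \<in> sets borel \<Longrightarrow> B \<subseteq> {0..} \<times> UNIV \<Longrightarrow> B \<in> sets m"
  unfolding sets_m half_plane_lebesgue_def sets_restrict_space by (auto intro!: rev_image_eqI[of B])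

lemma measurable_m: "f \<in> borel_measurable borel \<Longrightarrow> f \<in> borel_measurable m"
proof -
  assume "f \<in> borel_measurable borel"
  then have "f \<in> borel_measurable (restrict_space lborel ({0..} \<times> UNIV))"
    by (intro measurable_restrict_space1) simp
  then show ?thesis
    by (simp add: measurable_cong_sets[OF sets_m refl] half_plane_lebesgue_def)
qed

lemma A_sub: "p \<in> A \<Longrightarrow> {p} \<in> sets m" "A \<subseteq> space m"
proof -
  show *: "{p} \<in> sets m" if "p \<in> A" for p
    using that emeasure_notin_sets[of "{p}" m] by (auto simp: atoms_def)
  then show "A \<subseteq> space m" using sets.sets_into_space by blast
qed

lemma countable_A: "countable A"
proof -
  have "A \<subseteq> (\<Union>n::nat. A \<inter> {0..real n} \<times> {- real n..real n})"
  proof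
    fix p assume p: "p \<in> A"
    obtain n where n: "max (fst p) \<bar>snd p\<bar> \<le> real n" using real_arch_simple by blast
    have "0 \<le> fst p" using p A_sub(2) space_m by force
    then have "p \<in> {0..real n} \<times> {- real n..real n}" using n by (cases p) auto
    then show "p \<in> (\<Union>n::nat. A \<inter> {0..real n} \<times> {- real n..real n})" using p by blast
  qed
  moreover have "countable (\<Union>n::nat. A \<inter> {0..real n} \<times> {- real n..real n})"
    by (rule countable_UN) (simp, rule countable_finite[OF generic_finite[OF gen]])
  ultimately show ?thesis by (rule countable_subset)
qed

lemma A_sets: "C \<subseteq> A \<Longrightarrow> C \<in> sets m"
  by (rule sets.countable) (use A_sub(1) countable_subset[OF _ countable_A] in auto)

lemma emeasure_finite: "finite C \<Longrightarrow> C \<subseteq> A \<Longrightarrow> emeasure m C = of_nat (card C)"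
proof -
  assume C: "finite C" "C \<subseteq> A"
  have "emeasure m C = (\<Sum>p\<in>C. emeasure m {p})"
    by (rule emeasure_eq_sum_singleton[OF C(1)]) (use A_sub(1) C(2) in blast)
  also have "\<dots> = (\<Sum>p\<in>C. 1)" by (rule sum.cong) (use atom_1 C(2) in auto)
  finally show ?thesis by simp
qed

lemma AE_A: "AE p in m. p \<in> A"
proof (rule AE_I)
  show "{p \<in> space m. p \<notin> A} \<subseteq> space m - A" by blast
  show "space m - A \<in> sets m" using A_sets[of A] by blast
qed (rule null)

lemma emeasure_Int_A: "C \<in> sets m \<Longrightarrow> emeasure m C = emeasure m (C \<inter> A)"
  by (rule emeasure_eq_AE) (use AE_A A_sets[of "C \<inter> A"] in auto)

lemma emeasure_fin:
  assumes "C \<in> sets m" "finite (C \<inter> A)"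
  shows "emeasure m C = of_nat (card (C \<inter> A))" "measure m C = card (C \<inter> A)"
  using emeasure_Int_A[OF assms(1)] emeasure_finite[OF assms(2)] by (simp_all add: measure_def)

lemma finite_Int_A:
  assumes "C \<in> sets m" "emeasure m C < \<infinity>"
  shows "finite (C \<inter> A)"
proof (rule ccontr)
  assume inf: "infinite (C \<inter> A)"
  obtain n where n: "emeasure m C < of_nat n" using ennreal_Ex_less_of_nat assms(2) by auto
  obtain F where F: "F \<subseteq> C \<inter> A" "finite F" "card F = n" using infinite_arbitrarily_large[OF inf] by blast
  have "emeasure m F \<le> emeasure m C" using F(1) by (intro emeasure_mono assms(1)) blast
  moreover have "emeasure m F = of_nat n" using emeasure_finite[OF F(2)] F by blast
  ultimately show False using n by simp
qed

text \<open>Against a counting measure an indicator is integrable when it selects finitely many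
  marks. The fire integral thereby becomes a number of marks.\<close>

lemma integral_indicator_marks:
  assumes "\<And>p. indicator B p *\<^sub>R f p = (indicator C p :: real)"
  shows "set_integrable m B f \<longleftrightarrow> C \<inter> space m \<in> sets m \<and> finite (C \<inter> A)"
    and "set_integrable m B f \<Longrightarrow> (LINT p:B|m. f p) = card (C \<inter> A)"
proof -
  have CA: "(C \<inter> space m) \<inter> A = C \<inter> A" using A_sub(2) by blast
  have "set_integrable m B f \<longleftrightarrow> C \<inter> space m \<in> sets m \<and> emeasure m (C \<inter> space m) < \<infinity>"
    unfolding set_integrable_def assms integrable_indicator_iff ..
  also have "\<dots> \<longleftrightarrow> C \<inter> space m \<in> sets m \<and> finite (C \<inter> A)"
    using finite_Int_A[of "C \<inter> space m"] emeasure_fin(1)[of "C \<inter> space m"] unfolding CA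
    by (auto simp: of_nat_less_top)
  finally show *: "set_integrable m B f \<longleftrightarrow> C \<inter> space m \<in> sets m \<and> finite (C \<inter> A)" .
  assume "set_integrable m B f"
  then have "measure m (C \<inter> space m) = card (C \<inter> A)"
    using emeasure_fin(2)[of "C \<inter> space m"] unfolding * CA by blast
  then show "(LINT p:B|m. f p) = card (C \<inter> A)"
    unfolding set_lebesgue_integral_def assms by simp
qed

text \<open>The line at position \<open>x\<close> carries at most one mark, so the spark integral is
  a single value or 0.\<close>

lemma integral_line:
  fixes f :: "real \<times> real \<Rightarrow> real"
  assumes "set_integrable m ({0<..t} \<times> {x}) f"
  shows "(s, x) \<in> A \<Longrightarrow> s \<le> t \<Longrightarrow> (LINT p:({0<..t} \<times> {x})|m. f p) = f (s, x)"
    and "(\<And>s. (s, x) \<in> A \<Longrightarrow> t < s) \<Longrightarrow> (LINT p:({0<..t} \<times> {x})|m. f p) = 0"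
proof -
  let ?g = "\<lambda>p. indicator ({0<..t} \<times> {x}) p *\<^sub>R f p"
  have g: "?g \<in> borel_measurable m"
    using assms unfolding set_integrable_def by (rule borel_measurable_integrable)
  show "(LINT p:({0<..t} \<times> {x})|m. f p) = f (s, x)" if s: "(s, x) \<in> A" "s \<le> t"
  proof -
    have "0 < s" by (rule generic_pos[OF gen s(1)])
    have eq: "?g p = indicator {(s, x)} p *\<^sub>R f (s, x)" if "p \<in> A" for p
      using that generic_snd[OF gen s(1), of "fst p"] s(2) \<open>0 < s\<close>
      by (cases p) (auto simp: indicator_def)
    have "(\<integral>p. ?g p \<partial>m) = (\<integral>p. indicator {(s, x)} p *\<^sub>R f (s, x) \<partial>m)"
      by (rule integral_cong_AE[OF g]) (use A_sub(1)[OF s(1)] AE_A eq in auto)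
    also have "\<dots> = measure m {(s, x)} * f (s, x)"
      using A_sub(1)[OF s(1)] atom_1[OF s(1)] by (simp add: measure_def)
    also have "\<dots> = f (s, x)" using atom_1[OF s(1)] by (simp add: measure_def)
    finally show ?thesis by (simp add: set_lebesgue_integral_def)
  qed
  show "(LINT p:({0<..t} \<times> {x})|m. f p) = 0" if no: "\<And>s. (s, x) \<in> A \<Longrightarrow> t < s"
  proof -
    have z: "?g p = 0" if "p \<in> A" for p
      using that no[of "fst p"] by (cases p) (auto simp: indicator_def)
    have "AE p in m. ?g p = 0" using AE_A by eventually_elim (rule z)
    then have "(\<integral>p. ?g p \<partial>m) = (\<integral>p. 0 \<partial>m)"
      by (intro integral_cong_AE[OF g]) simp_all
    then show ?thesis by (simp add: set_lebesgue_integral_def)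
  qed
qed

text \<open>The domain contains positive times only, and left limits are meaningful only there;
  hence the truncated function in the hypothesis.\<close>

lemma integrable_line:
  assumes "(\<lambda>s. if 0 < s then f s else 0) \<in> borel_measurable borel"
  shows "set_integrable m ({0<..t} \<times> {x}) (\<lambda>(s, y). f s :: real)"
proof -
  let ?g = "\<lambda>p. indicator ({0<..t} \<times> {x}) p *\<^sub>R (case p of (s, y) \<Rightarrow> f s)"
  define h where "h s = (if 0 < s then f s else 0)" for s
  have h: "h \<in> borel_measurable borel" using assms by (simp add: h_def[abs_def])
  have "(\<lambda>p. indicator ({0<..t} \<times> {x}) p *\<^sub>R h (fst p)) \<in> borel_measurable borel"
  proof -
    have "{0<..t} \<times> {x} \<in> sets borel" by (simp add: borel_Times)
    moreover have "(fst :: real \<times> real \<Rightarrow> real) \<in> borel_measurable borel"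
      by (intro borel_measurable_continuous_onI continuous_intros)
    then have "(\<lambda>p :: real \<times> real. h (fst p)) \<in> borel_measurable borel"
      by (rule measurable_compose[OF _ h])
    ultimately show ?thesis by (intro borel_measurable_scaleR borel_measurable_indicator)
  qed
  moreover have "(\<lambda>p. indicator ({0<..t} \<times> {x}) p *\<^sub>R h (fst p)) = ?g"
    by (auto simp: fun_eq_iff h_def indicator_def)
  ultimately have g: "?g \<in> borel_measurable m" using measurable_m by simp
  have "\<exists>C c. finite C \<and> C \<subseteq> A \<and> (\<forall>p\<in>A. ?g p = indicator C p *\<^sub>R (c :: real))"
  proof (cases "\<exists>s. (s, x) \<in> A \<and> s \<le> t")
    case True
    then obtain s where s: "(s, x) \<in> A" "s \<le> t" by blast
    have "0 < s" by (rule generic_pos[OF gen s(1)])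
    have "?g p = indicator {(s, x)} p *\<^sub>R f s" if "p \<in> A" for p
      using that generic_snd[OF gen s(1), of "fst p"] s(2) \<open>0 < s\<close>
      by (cases p) (auto simp: indicator_def)
    then show ?thesis using s by (intro exI[of _ "{(s, x)}"] exI[of _ "f s"]) auto
  next
    case False
    then have "?g p = indicator {} p *\<^sub>R 0" if "p \<in> A" for p
      using that by (cases p) (auto simp: indicator_def)
    then show ?thesis by (intro exI[of _ "{}"] exI[of _ 0]) auto
  qed
  then obtain C c where C: "finite C" "C \<subseteq> A" and eq: "\<forall>p\<in>A. ?g p = indicator C p *\<^sub>R (c :: real)" by blast
  have "integrable m (\<lambda>p. indicator C p *\<^sub>R c)"
    using A_sets[OF C(2)] emeasure_finite[OF C] by (intro integrable_scaleR_left integrable_real_indicator) (simp_all add: of_nat_less_top)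
  moreover have "AE p in m. ?g p = indicator C p *\<^sub>R c" using AE_A by eventually_elim (use eq in blast)
  moreover have "(\<lambda>p. indicator C p *\<^sub>R c) \<in> borel_measurable m" using A_sets[OF C(2)] by simp
  ultimately show ?thesis unfolding set_integrable_def using integrable_cong_AE[OF g] by blast
qed

text \<open>With the integrals turned into sums over marks, each site is a \<open>reset\<close>; its
  fires \<open>F x\<close> are the times of marks that fall into the left limit of the cluster of
  \<open>x\<close> while \<open>x\<close> is full in the limit. \<open>reset_growth\<close>
  identifies these with the burnt times.\<close>

lemma fire_process_of_lffp_path:
  assumes path: "lffp_path m Z D H"
    and range: "\<And>t x. 0 \<le> t \<Longrightarrow> 0 \<le> Z t x \<and> D t x \<in> closed_intervals \<and> 0 \<le> H t x"
  shows "fire_process T A {} UNIV Z H"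
proof -
  define Zl where "Zl x = left_limit (\<lambda>r. Z r x)" for x
  define Dl where "Dl x = left_limit_interval (\<lambda>r. D r x)" for x
  define fire where "fire x = (\<lambda>(s, y). of_bool (Zl x s = 1 \<and> y \<in> Dl x s) :: real)" for x
  define spark where "spark x = (\<lambda>(s::real, y::real). Zl x s * of_bool (Zl x s < 1) :: real)" for x
  have lim: "has_left_limits (\<lambda>t. Z t x)" "has_left_limits (\<lambda>t. H t x)"
    "has_left_limits (\<lambda>t. Inf (D t x))" "has_left_limits (\<lambda>t. Sup (D t x))" for x
    using path unfolding lffp_path_def by blast+
  have eqs: "set_integrable m ({0<..t} \<times> UNIV) (fire x)"
    "Z t x = (LBINT s:{0..t}. of_bool (Z s x < 1)) - (LINT p:({0<..t} \<times> UNIV)|m. fire x p)"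
    "set_integrable m ({0<..t} \<times> {x}) (spark x)"
    "H t x = (LINT p:({0<..t} \<times> {x})|m. spark x p) - (LBINT s:{0..t}. of_bool (H s x > 0))"
    "D t x = cluster (Z t) (H t) x" if "0 \<le> t" for t x
    using path that unfolding lffp_path_def Let_def Zl_def Dl_def fire_def spark_def by blast+
  have Zlim: "((\<lambda>r. Z r x) \<longlongrightarrow> Zl x s) (at_left s)" if "0 < s" for s x
    using lim(1)[of x] that left_limit_eq unfolding has_left_limits_def Zl_def by metis
  have Llim: "((\<lambda>r. Inf (D r x)) \<longlongrightarrow> left_limit (\<lambda>r. Inf (D r x)) s) (at_left s)" if "0 < s" for s x
    using lim(3)[of x] that left_limit_eq unfolding has_left_limits_def by metis
  have Rlim: "((\<lambda>r. Sup (D r x)) \<longlongrightarrow> left_limit (\<lambda>r. Sup (D r x)) s) (at_left s)" if "0 < s" for s x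
    using lim(4)[of x] that left_limit_eq unfolding has_left_limits_def by metis
  define G where "G x = {p \<in> A. Zl x (fst p) = 1 \<and> snd p \<in> Dl x (fst p)}" for x
  define F where "F x = fst ` G x" for x
  have Gt: "finite {p \<in> G x. fst p \<le> t}"
    "(LINT p:({0<..t} \<times> UNIV)|m. fire x p) = card {p \<in> G x. fst p \<le> t}" if "0 \<le> t" for x t
  proof -
    let ?C = "{p. 0 < fst p \<and> fst p \<le> t \<and> Zl x (fst p) = 1 \<and> snd p \<in> Dl x (fst p)}"
    have ind: "indicator ({0<..t} \<times> UNIV) p *\<^sub>R fire x p = indicator ?C p" for p
      by (cases p) (auto simp: fire_def indicator_def)
    have "p \<in> A \<Longrightarrow> 0 < fst p" for p using generic_pos[OF gen, of "fst p" "snd p"] by simp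
    then have "?C \<inter> A = {p \<in> G x. fst p \<le> t}" unfolding G_def by blast
    then show "finite {p \<in> G x. fst p \<le> t}"
      "(LINT p:({0<..t} \<times> UNIV)|m. fire x p) = card {p \<in> G x. fst p \<le> t}"
      using integral_indicator_marks[of "{0<..t} \<times> UNIV" "fire x", OF ind] eqs(1)[OF that, of x] by auto
  qed
  have inj: "inj_on fst A" using gen unfolding generic_def by (elim conjE)
  have Fcard: "{q \<in> F x. q \<le> t} = fst ` {p \<in> G x. fst p \<le> t}"
    "card {q \<in> F x. q \<le> t} = card {p \<in> G x. fst p \<le> t}" for x t
  proof -
    show e: "{q \<in> F x. q \<le> t} = fst ` {p \<in> G x. fst p \<le> t}" unfolding F_def by blast
    have "inj_on fst {p \<in> G x. fst p \<le> t}" by (rule inj_on_subset[OF inj]) (auto simp: G_def)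
    then show "card {q \<in> F x. q \<le> t} = card {p \<in> G x. fst p \<le> t}" unfolding e by (rule card_image)
  qed
  have R: "reset (\<lambda>t. Z t x) (F x)" for x
  proof
    show "0 < q" if "q \<in> F x" for q
      using that generic_pos[OF gen] unfolding F_def G_def by force
    then show "((\<lambda>t. Z t x) \<longlongrightarrow> 1) (at_left q)" if "q \<in> F x" for q
    proof -
      have "Zl x q = 1" using that unfolding F_def G_def by force
      then show ?thesis using Zlim[of q x] \<open>\<And>q. q \<in> F x \<Longrightarrow> 0 < q\<close>[OF that] by simp
    qed
    fix t
    show "finite {q \<in> F x. q \<le> t}"
    proof (cases "0 \<le> t")
      case False
      then have "{q \<in> F x. q \<le> t} = {}" using \<open>\<And>q. q \<in> F x \<Longrightarrow> 0 < q\<close> by force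
      then show ?thesis by (simp only: finite.emptyI)
    qed (simp add: Fcard Gt)
  qed
  have eqZ: "Z t x = measure lborel (young (\<lambda>t. Z t x) t) - reset.cnt (F x) t" if "0 \<le> t" for t x
    using eqs(2)[OF that, of x] Gt(2)[OF that, of x] LBINT_young[of t "\<lambda>t. Z t x"]
    by (simp add: reset.cnt_def[OF R] Fcard(2))
  have RG1: "Z q x = 0" if "q \<in> F x" for q x
    by (rule reset.reset_growth(1)[OF R eqZ that])
  have RG3: "Z t x = min 1 (Z s x + (t - s))"
    if "0 \<le> s" "s \<le> t" "\<And>q. q \<in> F x \<Longrightarrow> s < q \<Longrightarrow> q \<le> t \<Longrightarrow> False" for s t x
    by (rule reset.reset_growth(3)[OF R eqZ that(1,2)]) (use that(3) in blast)+
  have RG4: "Z q x = 1" if "0 < q" "q \<notin> F x" "((\<lambda>r. Z r x) \<longlongrightarrow> 1) (at_left q)" for q x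
    by (rule reset.reset_growth(4)[OF R eqZ that])
  have FA: "q \<in> fst ` A \<and> burnt Z q x" if "q \<in> F x" for q x
  proof -
    have "((\<lambda>t. Z t x) \<longlongrightarrow> 1) (at_left q)" by (rule reset.full[OF R that])
    then show ?thesis using RG1[OF that] that unfolding burnt_def F_def G_def by blast
  qed
  \<comment> \<open>The converse of \<open>FA\<close>: at a time outside \<open>F x\<close> with
    left limit 1 the value stays 1.\<close>
  have burntF: "q \<in> F x" if "burnt Z q x" "0 < q" for q x
  proof (rule ccontr)
    assume "q \<notin> F x"
    then have "Z q x = 1" using RG4[OF that(2)] that(1) unfolding burnt_def by blast
    then show False using that(1) by (simp add: burnt_def)
  qed
  have H: "(\<And>r. (r, x) \<in> A \<Longrightarrow> s < r \<Longrightarrow> r \<le> t \<Longrightarrow> False) \<Longrightarrow> 0 \<le> s \<Longrightarrow> s \<le> t \<Longrightarrow> H t x = max 0 (H s x - (t - s))"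
    and H0: "(s, x) \<in> A \<Longrightarrow> H s x = Zl x s * of_bool (Zl x s < 1) \<and> (\<forall>r. 0 \<le> r \<longrightarrow> r < s \<longrightarrow> H r x = 0)" for s t x
  proof -
    define Sp where "Sp t = (LINT p:({0<..t} \<times> {x})|m. spark x p)" for t
    have Sp1: "Sp t = spark x (s, x)" if "(s, x) \<in> A" "s \<le> t" for s t
      using integral_line(1)[OF eqs(3) that] generic_pos[OF gen that(1)] that(2) unfolding Sp_def by simp
    have Sp0: "Sp t = 0" if "0 \<le> t" "\<And>s. (s, x) \<in> A \<Longrightarrow> t < s" for t
      using integral_line(2)[OF eqs(3)[OF that(1)] that(2)] unfolding Sp_def by simp
    \<comment> \<open>Decay of \<open>H\<close> to 0 becomes growth of \<open>g\<close> to 1, with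
      the spark integral minus 1 in place of the fire count, so \<open>young_measurable\<close> and
      \<open>growth\<close> apply again.\<close>
    define g where "g t = 1 - H t x" for t
    have "(\<lambda>s. of_bool (H s x > 0) :: real) = (\<lambda>s. of_bool (g s < 1))" by (simp add: g_def)
    then have eqg: "g t = measure lborel (young g t) - (Sp t - 1)" if "0 \<le> t" for t
      using eqs(4)[OF that, of x] LBINT_young[of t g] unfolding g_def[of t] Sp_def by simp
    have meas: "young g t \<in> sets borel" if "0 \<le> t" for t
    proof (rule young_measurable[OF eqg _ that])
      fix c t :: real assume c: "0 \<le> c"
      \<comment> \<open>The condition says \<open>0 < Sp s\<close>. As \<open>Sp\<close> changes at
        most once, at the single mark on the line, this is an interval or empty.\<close>
      show "{s \<in> {c<..t}. - (Sp s - 1) < 1} \<in> sets borel"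
      proof (cases "\<exists>s. (s, x) \<in> A \<and> 0 < spark x (s, x)")
        case True
        then obtain s where s: "(s, x) \<in> A" "0 < spark x (s, x)" by blast
        have "0 < Sp u \<longleftrightarrow> s \<le> u" if "c < u" for u
        proof (cases "s \<le> u")
          case False
          have "Sp u = 0"
          proof (rule Sp0)
            show "0 \<le> u" using that c by simp
            fix r assume "(r, x) \<in> A"
            then show "u < r" using generic_snd[OF gen s(1), of r] False by simp
          qed
          then show ?thesis using False by simp
        qed (use Sp1 s in simp)
        then have "{s \<in> {c<..t}. - (Sp s - 1) < 1} = {c<..t} \<inter> {s..}" by auto
        moreover have "{c<..t} \<inter> {s..} \<in> sets borel" by simp
        ultimately show ?thesis by (simp only:)
      next
        case False
        have "\<not> 0 < Sp u" if "c < u" for u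
        proof (cases "\<exists>s. (s, x) \<in> A \<and> s \<le> u")
          case True
          then show ?thesis using False Sp1 by auto
        next
          case no: False
          then have "Sp u = 0" using that c by (intro Sp0) (auto simp: not_le)
          then show ?thesis by simp
        qed
        then have "{s \<in> {c<..t}. - (Sp s - 1) < 1} = {}" by auto
        then show ?thesis by (simp only: sets.empty_sets)
      qed
    qed
    show dec: "H t x = max 0 (H s x - (t - s))"
      if no: "\<And>r. (r, x) \<in> A \<Longrightarrow> s < r \<Longrightarrow> r \<le> t \<Longrightarrow> False" and st: "0 \<le> s" "s \<le> t" for s t
    proof -
      have "g t = min 1 (g s + (t - s))"
      proof (rule growth[OF eqg meas st])
        show "g s \<le> 1" using range[OF st(1), of x] by (simp add: g_def)
        fix u assume u: "s \<le> u" "u \<le> t"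
        have "Sp u = Sp s"
        proof (cases "\<exists>r. (r, x) \<in> A \<and> r \<le> s")
          case True
          then obtain r where r: "(r, x) \<in> A" "r \<le> s" by blast
          then show ?thesis using Sp1[OF r] Sp1[OF r(1), of u] u by simp
        next
          case False
          then have "Sp s = 0" using st(1) by (intro Sp0) (auto simp: not_le)
          moreover have "Sp u = 0"
          proof (rule Sp0)
            show "0 \<le> u" using u st(1) by simp
            fix r assume r: "(r, x) \<in> A"
            then have "s < r" using False by (auto simp: not_le)
            then show "u < r" using no[OF r] u(2) by (cases "r \<le> t") auto
          qed
          ultimately show ?thesis by simp
        qed
        then show "Sp u - 1 = Sp s - 1" by simp
      qed
      then show ?thesis by (simp add: g_def)
    qed
    show "H s x = Zl x s * of_bool (Zl x s < 1) \<and> (\<forall>r. 0 \<le> r \<longrightarrow> r < s \<longrightarrow> H r x = 0)" if s: "(s, x) \<in> A" for s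
    proof -
      have s0: "0 < s" by (rule generic_pos[OF gen s])
      have "young g 0 \<subseteq> {0}" by (auto simp: young_def)
      then have "measure lborel (young g 0) = 0" by (rule measure_lborel_singleton[OF meas[OF order_refl]])
      moreover have "Sp 0 = 0" by (rule Sp0[OF order_refl]) (rule generic_pos[OF gen])
      ultimately have "g 0 = 1" using eqg[of 0] by simp
      then have "H 0 x = 0" by (simp add: g_def)
      then have pre: "H r x = 0" if r: "0 \<le> r" "r < s" for r
      proof -
        have "H r x = max 0 (H 0 x - (r - 0))"
        proof (rule dec[OF _ order_refl r(1)])
          fix q assume "(q, x) \<in> A" "q \<le> r"
          then show False using generic_snd[OF gen s, of q] r(2) by simp
        qed
        then show ?thesis using \<open>H 0 x = 0\<close> r(1) by simp
      qed
      \<comment> \<open>\<open>H\<close> vanishes before \<open>s\<close>, so the decay term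
        contributes nothing up to \<open>s\<close> and \<open>H s x\<close> is the spark
        itself.\<close>
      have "young g s \<subseteq> {s}"
      proof
        fix u assume "u \<in> young g s"
        then have u: "0 \<le> u" "u \<le> s" "g u < 1" by (auto simp: young_def)
        then show "u \<in> {s}" using pre[of u] by (cases "u < s") (auto simp: g_def)
      qed
      then have "measure lborel (young g s) = 0"
        by (rule measure_lborel_singleton[OF meas[OF less_imp_le[OF s0]]])
      then have "g s = 1 - Sp s" using eqg[of s] s0 by simp
      moreover have "Sp s = spark x (s, x)" by (rule Sp1[OF s order_refl])
      ultimately have "H s x = Zl x s * of_bool (Zl x s < 1)" by (simp add: g_def spark_def)
      then show ?thesis using pre by blast
    qed
  qed
  have Dab: "\<exists>a b. a \<le> b \<and> D t x = {a..b}" if "0 \<le> t" for t x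
    using range[OF that, of x] unfolding closed_intervals_def by blast
  have memD: "y \<in> D t x \<longleftrightarrow> Inf (D t x) \<le> y \<and> y \<le> Sup (D t x)" if t0: "0 \<le> t" for t x y
  proof -
    obtain a b where ab: "a \<le> b" "D t x = {a..b}" using Dab[OF t0, of x] by blast
    show ?thesis unfolding ab(2) using ab(1) by simp
  qed
  have InfD: "Inf (D t x) \<in> D t x" "Sup (D t x) \<in> D t x" if t0: "0 \<le> t" for t x
  proof -
    obtain a b where ab: "a \<le> b" "D t x = {a..b}" using Dab[OF t0, of x] by blast
    show "Inf (D t x) \<in> D t x" "Sup (D t x) \<in> D t x" unfolding ab(2) using ab(1) by simp_all
  qed
  show ?thesis
  proof (rule fire_process.intro)
    fix x
    show "Z 0 x = 0"
    proof -
      have "Z 0 x = measure lborel (young (\<lambda>t. Z t x) 0) - reset.cnt (F x) 0" using eqZ[of 0 x] by simp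
      moreover have "measure lborel (young (\<lambda>t. Z t x) 0) = 0"
        by (rule measure_lborel_singleton[OF reset.young_sets[OF R eqZ order_refl], of _ 0])
          (auto simp: young_def)
      ultimately show ?thesis using reset.cnt_0[OF R, of x] by simp
    qed
    show "H 0 x = 0"
    proof (cases "\<exists>s. (s, x) \<in> A")
      case True
      then obtain s where s: "(s, x) \<in> A" by blast
      then show ?thesis using H0[OF s] generic_pos[OF gen s] by simp
    next
      case False
      have "H 0 x = - (LBINT s:{0..0}. of_bool (H s x > 0))"
        unfolding eqs(4)[OF order_refl]
        by (subst integral_line(2)[OF eqs(3)[OF order_refl]]) (use False in simp_all)
      \<comment> \<open>Without a mark on the line \<open>H 0 x\<close> is minus a nonnegative
        integral, while the range condition makes it nonnegative.\<close>
      moreover have "0 \<le> (LBINT s:{0..0::real}. of_bool (H s x > 0) :: real)"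
        unfolding set_lebesgue_integral_def by (intro integral_nonneg_AE) simp
      ultimately show ?thesis using range[of 0 x] by simp
    qed
  next
    fix x s t assume a: "0 \<le> s" "s \<le> t" "t \<le> T"
      and nb: "\<And>r. r \<in> fst ` A \<Longrightarrow> s < r \<Longrightarrow> r \<le> t \<Longrightarrow> \<not> burnt Z r x"
    show "Z t x = min 1 (Z s x + (t - s))"
      by (rule RG3[OF a(1,2)]) (use nb FA in blast)
  next
    fix x
    have "{r \<in> fst ` A. r \<le> T \<and> burnt Z r x} \<subseteq> {q \<in> F x. q \<le> T}"
    proof
      fix r assume r: "r \<in> {r \<in> fst ` A. r \<le> T \<and> burnt Z r x}"
      then obtain y where "(r, y) \<in> A" by force
      then show "r \<in> {q \<in> F x. q \<le> T}" using burntF[OF _ generic_pos[OF gen]] r by blast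
    qed
    then show "finite {r \<in> fst ` A. r \<le> T \<and> burnt Z r x}" by (rule finite_subset[OF _ reset.fin[OF R]])
  next
    fix x s t assume a: "0 \<le> s" "s \<le> t" "t \<le> T"
      and no: "\<And>r. (r, x) \<in> A \<Longrightarrow> s < r \<Longrightarrow> r \<le> t \<Longrightarrow> False"
    show "H t x = max 0 (H s x - (t - s))" by (rule H[OF _ a(1,2)]) (use no in blast)
  next
    fix s x assume sx: "(s, x) \<in> A"
    have s0: "0 < s" by (rule generic_pos[OF gen sx])
    have "((\<lambda>r. H r x) \<longlongrightarrow> 0) (at_left s)"
      by (rule tendsto_at_leftI[OF s0, of _ "\<lambda>_. 0"]) (use H0[OF sx] in \<open>simp_all add: tendsto_const\<close>)
    then show "\<exists>z h. ((\<lambda>r. Z r x) \<longlongrightarrow> z) (at_left s) \<and> ((\<lambda>r. H r x) \<longlongrightarrow> h) (at_left s) \<and>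
        H s x = h + (if z < 1 then z else 0)"
      using Zlim[OF s0, of x] H0[OF sx] by (intro exI[of _ "Zl x s"] exI[of _ 0]) auto
  next
    fix s y x u assume a: "(s, y) \<in> A" "burnt Z s x" "y < u" "u \<le> x"
    have s0: "0 < s" by (rule generic_pos[OF gen a(1)])
    show "\<not> (\<forall>\<^sub>F r in at_left s. bar {} Z H r \<inter> {u..x} \<noteq> {})"
    proof
      assume ev: "\<forall>\<^sub>F r in at_left s. bar {} Z H r \<inter> {u..x} \<noteq> {}"
      moreover have "\<forall>\<^sub>F r in at_left s. 0 \<le> r" by (rule eventually_at_leftI[OF s0]) simp
      ultimately have "\<forall>\<^sub>F r in at_left s. u \<le> Inf (D r x)"
      proof eventually_elim
        case (elim r)
        then obtain v where v: "v \<in> barriers (Z r) (H r)" "u \<le> v" "v \<le> x" by (auto simp: bar_def)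
        \<comment> \<open>The left end belongs to the cluster, so no barrier separates it from
          \<open>x\<close> and it is at least \<open>v\<close>. In the limit the cluster would begin
          at or after \<open>u\<close>, yet it contains \<open>y < u\<close>.\<close>
        have "Inf (D r x) \<in> cluster (Z r) (H r) x" using InfD(1)[OF elim(2)] eqs(5)[OF elim(2)] by simp
        then have "\<not> Inf (D r x) < v" using v unfolding mem_cluster by blast
        then show ?case using v(2) by simp
      qed
      then have "u \<le> left_limit (\<lambda>r. Inf (D r x)) s"
        by (rule tendsto_lowerbound[OF Llim[OF s0] _ trivial_limit_at_left_real])
      moreover obtain y' where "(s, y') \<in> G x" using burntF[OF a(2) s0] unfolding F_def by force
      then have "y \<in> Dl x s" using generic_fst[OF gen a(1), of y'] unfolding G_def by auto
      ultimately show False using a(3) by (auto simp: Dl_def left_limit_interval_def)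
    qed
  next
    fix s y x u assume a: "(s, y) \<in> A" "burnt Z s x" "u < y" "x \<le> u"
    have s0: "0 < s" by (rule generic_pos[OF gen a(1)])
    show "\<not> (\<forall>\<^sub>F r in at_left s. bar {} Z H r \<inter> {x..u} \<noteq> {})"
    proof
      assume ev: "\<forall>\<^sub>F r in at_left s. bar {} Z H r \<inter> {x..u} \<noteq> {}"
      moreover have "\<forall>\<^sub>F r in at_left s. 0 \<le> r" by (rule eventually_at_leftI[OF s0]) simp
      ultimately have "\<forall>\<^sub>F r in at_left s. Sup (D r x) \<le> u"
      proof eventually_elim
        case (elim r)
        then obtain v where v: "v \<in> barriers (Z r) (H r)" "x \<le> v" "v \<le> u" by (auto simp: bar_def)
        have "Sup (D r x) \<in> cluster (Z r) (H r) x" using InfD(2)[OF elim(2)] eqs(5)[OF elim(2)] by simp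
        then have "\<not> v < Sup (D r x)" using v unfolding mem_cluster by blast
        then show ?case using v(3) by simp
      qed
      then have "left_limit (\<lambda>r. Sup (D r x)) s \<le> u"
        by (rule tendsto_upperbound[OF Rlim[OF s0] _ trivial_limit_at_left_real])
      moreover obtain y' where "(s, y') \<in> G x" using burntF[OF a(2) s0] unfolding F_def by force
      then have "y \<in> Dl x s" using generic_fst[OF gen a(1), of y'] unfolding G_def by auto
      ultimately show False using a(3) by (auto simp: Dl_def left_limit_interval_def)
    qed
  next
    fix s y x assume a: "(s, y) \<in> A"
      and ev: "\<forall>\<^sub>F r in at_left s. Z r x = 1 \<and> bar {} Z H r \<inter> ({y<..x} \<union> {x..<y}) = {}"
    have s0: "0 < s" by (rule generic_pos[OF gen a(1)])
    have "\<forall>\<^sub>F r in at_left s. Z r x = 1" using ev by eventually_elim simp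
    then have Z1: "((\<lambda>r. Z r x) \<longlongrightarrow> 1) (at_left s)" by (rule tendsto_eventually)
    have "\<forall>\<^sub>F r in at_left s. 0 \<le> r" by (rule eventually_at_leftI[OF s0]) simp
    with ev have "\<forall>\<^sub>F r in at_left s. Inf (D r x) \<le> y \<and> y \<le> Sup (D r x)"
    proof eventually_elim
      case (elim r)
      have "y \<in> cluster (Z r) (H r) x"
        unfolding mem_cluster using elim(1) by (fastforce simp: bar_def)
      then show ?case using memD[OF elim(2)] eqs(5)[OF elim(2)] by simp
    qed
    then have "\<forall>\<^sub>F r in at_left s. Inf (D r x) \<le> y" "\<forall>\<^sub>F r in at_left s. y \<le> Sup (D r x)"
      by (auto elim: eventually_mono)
    then have "left_limit (\<lambda>r. Inf (D r x)) s \<le> y" "y \<le> left_limit (\<lambda>r. Sup (D r x)) s"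
      using tendsto_upperbound[OF Llim[OF s0] _ trivial_limit_at_left_real]
        tendsto_lowerbound[OF Rlim[OF s0] _ trivial_limit_at_left_real] by blast+
    then have "y \<in> Dl x s" by (simp add: Dl_def left_limit_interval_def)
    moreover have "Zl x s = 1" unfolding Zl_def by (rule left_limit_eq[OF Z1])
    ultimately have "(s, y) \<in> G x" using a by (simp add: G_def)
    then have "s \<in> F x" unfolding F_def by force
    then show "burnt Z s x" using FA by blast
  qed
qed

end

section \<open>The process on the line\<close>

text \<open>The interface alone does not give left limits of clusters. \<open>bounded\<close> and
  \<open>const\<close> do: shortly before any time the barriers of a bounded region stand still, so
  the cluster is constant. \<open>full\<close> turns a left limit 1 into actual fullness before the
  mark, as \<open>burn\<close> demands.\<close>

lemma (in realisation) lffp_path_of_fire_process: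
  assumes fp: "\<And>T. fire_process T A {} UNIV Z H"
    and limZ: "\<And>s x. 0 < s \<Longrightarrow> \<exists>z. ((\<lambda>r. Z r x) \<longlongrightarrow> z) (at_left s)"
    and limH: "\<And>s x. 0 < s \<Longrightarrow> \<exists>h. ((\<lambda>r. H r x) \<longlongrightarrow> h) (at_left s)"
    and D: "\<And>t x. 0 \<le> t \<Longrightarrow> D t x = cluster (Z t) (H t) x"
    and bounded: "\<And>T x. \<exists>K. \<forall>t\<in>{0..T}. \<exists>a b. -K \<le> a \<and> a \<le> b \<and> b \<le> K \<and> cluster (Z t) (H t) x = {a..b}"
    and const: "\<And>s K. 0 < s \<Longrightarrow> \<exists>r B. 0 \<le> r \<and> r < s \<and> (\<forall>q\<in>{r..<s}. barriers (Z q) (H q) \<inter> {-K..K} = B)"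
    and full: "\<And>s y x. (s, y) \<in> A \<Longrightarrow> ((\<lambda>r. Z r x) \<longlongrightarrow> 1) (at_left s) \<Longrightarrow> \<forall>\<^sub>F q in at_left s. Z q x = 1"
  shows "lffp_path m Z D H"
proof -
  have Dconst: "\<exists>r a b. 0 \<le> r \<and> r < s \<and> a \<le> b \<and> (\<forall>q\<in>{r..<s}. D q x = {a..b})" if s: "0 < s" for s x
  proof -
    obtain K where K: "\<forall>t\<in>{0..s}. \<exists>a b. -K \<le> a \<and> a \<le> b \<and> b \<le> K \<and> cluster (Z t) (H t) x = {a..b}"
      using bounded by blast
    define L where "L = max K \<bar>x\<bar>"
    obtain r B where r: "0 \<le> r" "r < s" and B: "\<forall>q\<in>{r..<s}. barriers (Z q) (H q) \<inter> {-L..L} = B"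
      using const[OF s] by blast
    \<comment> \<open>Only barriers between \<open>x\<close> and a point of the bounded cluster
      matter; they lie in \<open>{-L..L}\<close>, where the barriers do not change.\<close>
    have sub: "cluster (Z q) (H q) x \<subseteq> cluster (Z q') (H q') x" if q: "q \<in> {r..<s}" "q' \<in> {r..<s}" for q q'
    proof
      fix y assume y: "y \<in> cluster (Z q) (H q) x"
      have "q \<in> {0..s}" using q(1) r by simp
      then have yK: "-K \<le> y" "y \<le> K" using K y by force+
      have "v \<in> barriers (Z q) (H q)" if "v \<in> barriers (Z q') (H q')" "y < v \<and> v \<le> x \<or> x \<le> v \<and> v < y" for v
      proof -
        have "v \<in> {-L..L}" using that(2) yK by (auto simp: L_def)
        then have "v \<in> barriers (Z q') (H q') \<inter> {-L..L}" using that(1) by blast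
        then show ?thesis using B q by blast
      qed
      then show "y \<in> cluster (Z q') (H q') x" using y unfolding mem_cluster by blast
    qed
    have "r \<in> {0..s}" using r by simp
    then obtain a b where ab: "a \<le> b" "cluster (Z r) (H r) x = {a..b}" using K by blast
    have "D q x = {a..b}" if "q \<in> {r..<s}" for q
    proof -
      have "r \<in> {r..<s}" using r by simp
      then have "cluster (Z q) (H q) x = {a..b}" using sub[of q r] sub[of r q] that ab(2) by blast
      then show ?thesis using D[of q x] that r by simp
    qed
    then show ?thesis using r ab(1) by blast
  qed
  have Dl: "\<exists>r a b. 0 \<le> r \<and> r < s \<and> a \<le> b \<and> (\<forall>q\<in>{r..<s}. D q x = {a..b}) \<and>
      ((\<lambda>r. Inf (D r x)) \<longlongrightarrow> a) (at_left s) \<and> ((\<lambda>r. Sup (D r x)) \<longlongrightarrow> b) (at_left s)" if s: "0 < s" for s x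
  proof -
    obtain r a b where r: "0 \<le> r" "r < s" "a \<le> b" "\<forall>q\<in>{r..<s}. D q x = {a..b}" using Dconst[OF s] by blast
    have "((\<lambda>r. Inf (D r x)) \<longlongrightarrow> a) (at_left s)"
      by (rule tendsto_at_leftI[OF r(2), of _ "\<lambda>_. a"]) (use r(3,4) in \<open>simp_all add: tendsto_const\<close>)
    moreover have "((\<lambda>r. Sup (D r x)) \<longlongrightarrow> b) (at_left s)"
      by (rule tendsto_at_leftI[OF r(2), of _ "\<lambda>_. b"]) (use r(3,4) in \<open>simp_all add: tendsto_const\<close>)
    ultimately show ?thesis using r by blast
  qed
  have left: "has_left_limits (\<lambda>t. Z t x)" "has_left_limits (\<lambda>t. H t x)"
    "has_left_limits (\<lambda>t. Inf (D t x))" "has_left_limits (\<lambda>t. Sup (D t x))" for x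
    unfolding has_left_limits_def using limZ limH Dl by blast+
  define zl where "zl x = left_limit (\<lambda>r. Z r x)" for x
  define dl where "dl x = left_limit_interval (\<lambda>r. D r x)" for x
  have zl: "((\<lambda>r. Z r x) \<longlongrightarrow> zl x s) (at_left s)" if "0 < s" for s x
    using limZ[OF that, of x] left_limit_eq unfolding zl_def by metis
  have inj: "inj_on fst A" using gen unfolding generic_def by (elim conjE)
  \<comment> \<open>One direction is \<open>burn\<close>. For the other, a barrier between
    \<open>x\<close> and \<open>y\<close> at time \<open>q\<close> would persist up to
    \<open>s\<close>, against \<open>burnt_left\<close> or \<open>burnt_right\<close>.\<close>
  have burnt: "zl x s = 1 \<and> y \<in> dl x s \<longleftrightarrow> burnt Z s x" if sy: "(s, y) \<in> A" for s y x
  proof -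
    have s: "0 < s" by (rule generic_pos[OF gen sy])
    interpret P: fire_process s A "{}" UNIV Z H by (rule fp)
    obtain r a b where r: "0 \<le> r" "r < s" "a \<le> b" "\<forall>q\<in>{r..<s}. D q x = {a..b}"
      and l: "((\<lambda>r. Inf (D r x)) \<longlongrightarrow> a) (at_left s)" "((\<lambda>r. Sup (D r x)) \<longlongrightarrow> b) (at_left s)"
      using Dl[OF s] by blast
    have dl: "dl x s = {a..b}"
      unfolding dl_def left_limit_interval_def using left_limit_eq[OF l(1)] left_limit_eq[OF l(2)] by simp
    have cl: "cluster (Z q) (H q) x = {a..b}" if "r \<le> q" "q < s" for q
      using r(4) that D[of q x] r(1) by simp
    show ?thesis
    proof
      assume h: "zl x s = 1 \<and> y \<in> dl x s"
      then have "((\<lambda>r. Z r x) \<longlongrightarrow> 1) (at_left s)" using zl[OF s, of x] by simp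
      then have "\<forall>\<^sub>F q in at_left s. Z q x = 1" by (rule full[OF sy])
      moreover have "\<forall>\<^sub>F q in at_left s. bar {} Z H q \<inter> ({y<..x} \<union> {x..<y}) = {}"
      proof (rule eventually_at_leftI[OF r(2)])
        fix q assume "r < q" "q < s"
        then have "y \<in> cluster (Z q) (H q) x" using cl[of q] h dl by simp
        then show "bar {} Z H q \<inter> ({y<..x} \<union> {x..<y}) = {}" unfolding mem_cluster by (auto simp: bar_def)
      qed
      ultimately have "\<forall>\<^sub>F q in at_left s. Z q x = 1 \<and> bar {} Z H q \<inter> ({y<..x} \<union> {x..<y}) = {}"
        by (rule eventually_conj)
      then show "burnt Z s x" by (rule P.burn[OF sy UNIV_I order_refl])
    next
      assume b: "burnt Z s x"
      then have "zl x s = 1"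
        using zl[OF s, of x] tendsto_unique[OF trivial_limit_at_left_real] unfolding burnt_def by blast
      define K where "K = max \<bar>x\<bar> \<bar>y\<bar>"
      obtain r' B where r': "0 \<le> r'" "r' < s" and B: "\<forall>q\<in>{r'..<s}. barriers (Z q) (H q) \<inter> {-K..K} = B"
        using const[OF s] by blast
      define q where "q = max r r'"
      have q: "r \<le> q" "r' \<le> q" "q < s" using r r' by (auto simp: q_def)
      have ev: "\<forall>\<^sub>F p in at_left s. v \<in> bar {} Z H p" if "v \<in> barriers (Z q) (H q)" "v \<in> {-K..K}" for v
      proof (rule eventually_at_leftI[OF r'(2)])
        fix p assume "r' < p" "p < s"
        then have "barriers (Z p) (H p) \<inter> {-K..K} = barriers (Z q) (H q) \<inter> {-K..K}" using B q by simp
        then have "v \<in> barriers (Z p) (H p)" using that by blast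
        then show "v \<in> bar {} Z H p" by (simp add: bar_def)
      qed
      have "y \<in> cluster (Z q) (H q) x"
        unfolding mem_cluster
      proof (intro ballI conjI notI)
        fix v assume v: "v \<in> barriers (Z q) (H q)" "y < v \<and> v \<le> x"
        then have "v \<in> {-K..K}" by (auto simp: K_def)
        from ev[OF v(1) this] have "\<forall>\<^sub>F p in at_left s. bar {} Z H p \<inter> {v..x} \<noteq> {}"
          by eventually_elim (use v(2) in auto)
        then show False using P.burnt_left[OF sy UNIV_I order_refl b] v(2) by blast
      next
        fix v assume v: "v \<in> barriers (Z q) (H q)" "x \<le> v \<and> v < y"
        then have "v \<in> {-K..K}" by (auto simp: K_def)
        from ev[OF v(1) this] have "\<forall>\<^sub>F p in at_left s. bar {} Z H p \<inter> {x..v} \<noteq> {}"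
          by eventually_elim (use v(2) in auto)
        then show False using P.burnt_right[OF sy UNIV_I order_refl b] v(2) by blast
      qed
      then show "zl x s = 1 \<and> y \<in> dl x s" using cl[OF q(1,3)] dl \<open>zl x s = 1\<close> by simp
    qed
  qed
  have Zeq: "set_integrable m ({0<..t} \<times> UNIV) (\<lambda>(s, y). of_bool (zl x s = 1 \<and> y \<in> dl x s) :: real) \<and>
    Z t x = (LBINT s:{0..t}. of_bool (Z s x < 1)) -
      (LINT p:({0<..t} \<times> UNIV)|m. (\<lambda>(s, y). of_bool (zl x s = 1 \<and> y \<in> dl x s)) p)" if t: "0 \<le> t" for t x
  proof -
    define F where "F = {q \<in> fst ` A. burnt Z q x}"
    interpret P: fire_process t A "{}" UNIV Z H by (rule fp)
    have R: "reset (\<lambda>t. Z t x) F"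
    proof
      show "0 < q" if "q \<in> F" for q using that generic_pos[OF gen] unfolding F_def by force
      show "((\<lambda>t. Z t x) \<longlongrightarrow> 1) (at_left q)" if "q \<in> F" for q using that unfolding F_def burnt_def by blast
      fix u
      have "{q \<in> F. q \<le> u} = {r \<in> fst ` A. r \<le> u \<and> burnt Z r x}" unfolding F_def by blast
      then show "finite {q \<in> F. q \<le> u}" using fire_process.finite_burnt[OF fp UNIV_I, of u x] by (simp only:)
    qed
    have "young (\<lambda>t. Z t x) t \<in> sets borel \<and> Z t x = measure lborel (young (\<lambda>t. Z t x) t) - reset.cnt F t"
    proof (rule reset.reset_integral[OF R _ _ _ _ t])
      show "Z 0 x = 0" by (rule P.init) simp
      show "Z q x = 0" if "q \<in> F" for q using that unfolding F_def burnt_def by blast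
      show "Z u x \<le> 1" if "0 \<le> u" for u by (rule fire_process.Z_bounds(2)[OF fp UNIV_I that order_refl])
      fix s u assume su: "0 \<le> s" "s \<le> u" and no: "\<And>q. q \<in> F \<Longrightarrow> s < q \<Longrightarrow> q \<le> u \<Longrightarrow> False"
      show "Z u x = min 1 (Z s x + (u - s))"
        by (rule fire_process.grow[OF fp UNIV_I su order_refl]) (use no F_def in blast)
    qed
    then have eqZ: "Z t x = (LBINT s:{0..t}. of_bool (Z s x < 1)) - reset.cnt F t"
      unfolding LBINT_young[of t "\<lambda>t. Z t x"] by blast
    define C where "C = {p. 0 < fst p \<and> fst p \<le> t \<and> zl x (fst p) = 1 \<and> snd p \<in> dl x (fst p)}"
    have ind: "indicator ({0<..t} \<times> UNIV) p *\<^sub>R (case p of (s, y) \<Rightarrow> of_bool (zl x s = 1 \<and> y \<in> dl x s)) = (indicator C p :: real)" for p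
      by (cases p) (auto simp: C_def indicator_def)
    have CA: "C \<inter> A = {p \<in> A. fst p \<le> t \<and> burnt Z (fst p) x}"
    proof (rule set_eqI)
      fix p
      show "p \<in> C \<inter> A \<longleftrightarrow> p \<in> {p \<in> A. fst p \<le> t \<and> burnt Z (fst p) x}"
      proof (cases "p \<in> A")
        case True
        then show ?thesis using burnt[of "fst p" "snd p" x] generic_pos[OF gen, of "fst p" "snd p"]
          by (simp add: C_def)
      qed simp
    qed
    have Fim: "{q \<in> F. q \<le> t} = fst ` (C \<inter> A)" unfolding CA F_def by blast
    have injC: "inj_on fst (C \<inter> A)" by (rule inj_on_subset[OF inj]) simp
    have card: "reset.cnt F t = card (C \<inter> A)"
      unfolding reset.cnt_def[OF R] Fim card_image[OF injC] ..
    have fin: "finite (C \<inter> A)"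
      using reset.fin[OF R, of t] injC unfolding Fim by (rule finite_imageD)
    have [measurable]: "(fst :: real \<times> real \<Rightarrow> real) \<in> borel_measurable borel" "(snd :: real \<times> real \<Rightarrow> real) \<in> borel_measurable borel"
      by (intro borel_measurable_continuous_onI continuous_intros)+
    define z where "z s = (if 0 < s then left_limit (\<lambda>r. Z r x) s else 0)" for s
    define a where "a s = (if 0 < s then left_limit (\<lambda>r. Inf (D r x)) s else 0)" for s
    define b where "b s = (if 0 < s then left_limit (\<lambda>r. Sup (D r x)) s else 0)" for s
    have [measurable]: "z \<in> borel_measurable borel" "a \<in> borel_measurable borel" "b \<in> borel_measurable borel"
      using borel_measurable_left_limit[OF left(1)] borel_measurable_left_limit[OF left(3)]
        borel_measurable_left_limit[OF left(4)] unfolding z_def[abs_def] a_def[abs_def] b_def[abs_def] by blast+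
    have "{p \<in> space borel. 0 < fst p \<and> fst p \<le> t \<and> z (fst p) = 1 \<and> a (fst p) \<le> snd p \<and> snd p \<le> b (fst p)} \<in> sets borel"
      by measurable
    \<comment> \<open>With left limits replaced by their truncations to positive times,
      \<open>C\<close> is described by Borel functions.\<close>
    moreover have "C = {p \<in> space borel. 0 < fst p \<and> fst p \<le> t \<and> z (fst p) = 1 \<and> a (fst p) \<le> snd p \<and> snd p \<le> b (fst p)}"
      unfolding C_def z_def a_def b_def zl_def dl_def left_limit_interval_def by auto
    ultimately have "C \<in> sets borel" by (simp only:)
    then have "C \<in> sets m" by (rule sets_mI) (auto simp: C_def)
    moreover from this have "C \<inter> space m = C" using sets.sets_into_space by blast
    ultimately have si: "set_integrable m ({0<..t} \<times> UNIV) (\<lambda>(s, y). of_bool (zl x s = 1 \<and> y \<in> dl x s) :: real)"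
      using integral_indicator_marks(1)[OF ind] fin by simp
    then show ?thesis using integral_indicator_marks(2)[OF ind si] eqZ card by simp
  qed
  have Heq: "set_integrable m ({0<..t} \<times> {x}) (\<lambda>(s, y). zl x s * of_bool (zl x s < 1)) \<and>
    H t x = (LINT p:({0<..t} \<times> {x})|m. (\<lambda>(s, y). zl x s * of_bool (zl x s < 1)) p) -
      (LBINT s:{0..t}. of_bool (H s x > 0))" if t: "0 \<le> t" for t x
  proof -
    interpret P: fire_process t A "{}" UNIV Z H by (rule fp)
    have si: "set_integrable m ({0<..t} \<times> {x}) (\<lambda>(s, y). zl x s * of_bool (zl x s < 1))"
    proof (rule integrable_line)
      have [measurable]: "(\<lambda>s. if 0 < s then zl x s else 0) \<in> borel_measurable borel"
        unfolding zl_def by (rule borel_measurable_left_limit[OF left(1)])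
      have "(\<lambda>s. if 0 < s then zl x s * of_bool (zl x s < 1) else 0) =
          (\<lambda>s. if (if 0 < s then zl x s else 0) < 1 then (if 0 < s then zl x s else 0) else 0)"
        by (auto simp: fun_eq_iff)
      moreover have "\<dots> \<in> borel_measurable borel" by measurable
      ultimately show "(\<lambda>s. if 0 < s then zl x s * of_bool (zl x s < 1) else 0) \<in> borel_measurable borel" by simp
    qed
    have J: "(LBINT s:{0..t}. of_bool (H s x > 0)) = measure lborel {s \<in> {0..t}. 0 < H s x}"
      using LBINT_young[of t "\<lambda>s. 1 - H s x"] by (simp add: young_def)
    have pre: "H u x = 0" if "0 \<le> u" "u \<le> t" "\<And>r. (r, x) \<in> A \<Longrightarrow> r \<le> u \<Longrightarrow> False" for u
      by (rule P.H_before[OF UNIV_I that])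
    show ?thesis
    proof (cases "\<exists>s. (s, x) \<in> A \<and> s \<le> t")
      case True
      then obtain s where s: "(s, x) \<in> A" "s \<le> t" by blast
      have s0: "0 < s" by (rule generic_pos[OF gen s(1)])
      obtain z where z: "((\<lambda>r. Z r x) \<longlongrightarrow> z) (at_left s)" "H s x = (if z < 1 then z else 0)"
        by (rule P.H_spark[OF gen s(1) UNIV_I s(2)])
      have zl: "zl x s = z" unfolding zl_def by (rule left_limit_eq[OF z(1)])
      have "\<forall>\<^sub>F r in at_left s. 0 \<le> Z r x"
        by (rule eventually_at_leftI[OF s0]) (use P.Z_bounds(1) s(2) in simp)
      then have "0 \<le> z" by (rule tendsto_lowerbound[OF z(1) _ trivial_limit_at_left_real])
      define v where "v = H s x"
      have v: "0 \<le> v" "v = zl x s * of_bool (zl x s < 1)" using z(2) zl \<open>0 \<le> z\<close> by (auto simp: v_def)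
      have int: "(LINT p:({0<..t} \<times> {x})|m. (\<lambda>(s, y). zl x s * of_bool (zl x s < 1)) p) = v"
        using integral_line(1)[OF si s] v(2) by simp
      have after: "H u x = max 0 (v - (u - s))" if "s \<le> u" "u \<le> t" for u
        unfolding v_def by (rule P.H_after[OF gen s(1) UNIV_I that])
      have before: "H u x = 0" if "0 \<le> u" "u < s" for u
      proof (rule pre[OF that(1)])
        show "u \<le> t" using that s(2) by simp
        fix r assume "(r, x) \<in> A" "r \<le> u"
        then show False using generic_snd[OF gen s(1), of r] that(2) by simp
      qed
      \<comment> \<open>\<open>H\<close> is positive from the spark at \<open>s\<close> until it has
        lost its height \<open>v\<close>, so the decay integral equals
        \<open>min (t - s) v\<close>.\<close>
      have "{u \<in> {0..t}. 0 < H u x} = {u \<in> {s..t}. u < s + v}"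
      proof (rule set_eqI)
        fix u
        show "u \<in> {u \<in> {0..t}. 0 < H u x} \<longleftrightarrow> u \<in> {u \<in> {s..t}. u < s + v}"
        proof (cases "s \<le> u \<and> u \<le> t")
          case True
          then show ?thesis using after[of u] s0 by auto
        next
          case False
          then show ?thesis using before[of u] by auto
        qed
      qed
      also have "\<dots> = (if t < s + v then {s..t} else {s..<s + v})" using s(2) by auto
      finally have "measure lborel {u \<in> {0..t}. 0 < H u x} = min (t - s) v" using s(2) v(1) by simp
      moreover have "H t x = v - min (t - s) v" using after[OF s(2) order_refl] by linarith
      ultimately show ?thesis using si int J by simp
    next
      case False
      then have no: "(s, x) \<in> A \<Longrightarrow> t < s" for s by (meson not_le)
      have "(LINT p:({0<..t} \<times> {x})|m. (\<lambda>(s, y). zl x s * of_bool (zl x s < 1)) p) = 0"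
        by (rule integral_line(2)[OF si no])
      moreover have z: "H u x = 0" if "0 \<le> u" "u \<le> t" for u
        by (rule pre[OF that]) (use no that(2) in fastforce)
      then have "{s \<in> {0..t}. 0 < H s x} = {}" by force
      then have "measure lborel {s \<in> {0..t}. 0 < H s x} = 0" by (simp only: measure_empty)
      ultimately show ?thesis using si J z[OF t order_refl] by simp
    qed
  qed
  show ?thesis
    unfolding lffp_path_def Let_def zl_def[symmetric] dl_def[symmetric]
    using left Zeq Heq D by blast
qed

section \<open>Growing boxes and their limit\<close>

text \<open>All conditions concern marks with positions in \<open>]l,u[\<close>, and there the two
  sets coincide.\<close>

lemma wall_superset:
  "wall T S n b l u \<Longrightarrow> S \<subseteq> S' \<Longrightarrow> (\<And>g. g \<in> S' \<Longrightarrow> l < snd g \<Longrightarrow> snd g < u \<Longrightarrow> g \<in> S) \<Longrightarrow> wall T S' n b l u"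
proof (induction n arbitrary: b l u)
  case (Suc n)
  show ?case
  proof (cases "T < b + 1")
    case False
    then obtain p q where pq: "p \<in> S" "q \<in> S" "l < snd p" "snd p < snd q" "snd q < u"
       "b + 3/4 < fst p" "fst p < b + 1" "b + 3/4 < fst q" "fst q < b + 1"
      and alt: "T < b + 3/2 \<and> (\<forall>g\<in>S. snd p < snd g \<and> snd g < snd q \<longrightarrow> fst g \<le> b) \<or>
        (\<exists>f\<in>S. snd p < snd f \<and> snd f < snd q \<and> b + 1 < fst f \<and> fst f < b + 3/2 \<and>
           (\<forall>g\<in>S. snd p < snd g \<and> snd g < snd q \<longrightarrow> fst g \<le> b \<or> fst f \<le> fst g) \<and>
           wall T S n (fst f) (snd p) (snd q))"
      using Suc.prems(1) by (simp only: wall.simps simp_thms False) (elim bexE conjE, rule that)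
    have inS: "g \<in> S" if "g \<in> S'" "snd p < snd g \<and> snd g < snd q" for g
      by (rule Suc.prems(3)[OF that(1)]) (use that(2) pq(3,5) in linarith)+
    have "T < b + 3/2 \<and> (\<forall>g\<in>S'. snd p < snd g \<and> snd g < snd q \<longrightarrow> fst g \<le> b) \<or>
        (\<exists>f\<in>S'. snd p < snd f \<and> snd f < snd q \<and> b + 1 < fst f \<and> fst f < b + 3/2 \<and>
           (\<forall>g\<in>S'. snd p < snd g \<and> snd g < snd q \<longrightarrow> fst g \<le> b \<or> fst f \<le> fst g) \<and>
           wall T S' n (fst f) (snd p) (snd q))"
      using alt
    proof
      assume "\<exists>f\<in>S. snd p < snd f \<and> snd f < snd q \<and> b + 1 < fst f \<and> fst f < b + 3/2 \<and>
           (\<forall>g\<in>S. snd p < snd g \<and> snd g < snd q \<longrightarrow> fst g \<le> b \<or> fst f \<le> fst g) \<and>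
           wall T S n (fst f) (snd p) (snd q)"
      then obtain f where f: "f \<in> S" "snd p < snd f" "snd f < snd q" "b + 1 < fst f" "fst f < b + 3/2"
        "\<forall>g\<in>S. snd p < snd g \<and> snd g < snd q \<longrightarrow> fst g \<le> b \<or> fst f \<le> fst g"
        "wall T S n (fst f) (snd p) (snd q)" by blast
      have "wall T S' n (fst f) (snd p) (snd q)"
        by (rule Suc.IH[OF f(7) Suc.prems(2)]) (use inS in blast)
      then show ?thesis using f(1-6) inS Suc.prems(2) by blast
    qed (use inS in blast)
    then show ?thesis using pq Suc.prems(2) unfolding wall.simps by blast
  qed simp
qed simp

text \<open>A larger box adds only marks at positions outside \<open>{-k..k}\<close>, hence outside
  the walls.\<close>

lemma walled_mono:
  assumes "walled T N (A \<inter> {0..T} \<times> {-k..k}) a" "k \<le> k'"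
  shows "walled T N (A \<inter> {0..T} \<times> {-k'..k'}) a"
proof -
  let ?S = "A \<inter> {0..T} \<times> {-k..k}" and ?S' = "A \<inter> {0..T} \<times> {-k'..k'}"
  have sub: "?S \<subseteq> ?S'" using assms(2) by auto
  have "wall T ?S' N 0 (snd p) (snd q)" if "p \<in> ?S" "q \<in> ?S" "wall T ?S N 0 (snd p) (snd q)" for p q
    by (rule wall_superset[OF that(3) sub]) (use that(1,2) in force)
  then show ?thesis using assms(1) sub unfolding walled_def by blast
qed

text \<open>Marks after \<open>t\<close> are filtered away. With the horizon equal to
  \<open>t\<close> the state visibly depends on marks up to \<open>t\<close> only, as adaptedness
  requires.\<close>

lemma (in box) box_state_restrict:
  assumes "t \<le> T"
  shows "box_state A k T t = box_state A k t t"
proof -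
  interpret B: box A k t by unfold_locales (rule gen)
  let ?l = "sorted_key_list_of_set fst S" and ?l' = "sorted_key_list_of_set fst B.S"
  have inj: "inj_on fst A" using gen unfolding generic_def by (elim conjE)
  have injS: "inj_on fst S" "inj_on fst B.S"
    by (rule inj_on_subset[OF inj], simp add: S_def B.S_def)+
  have "?l' = [p \<leftarrow> ?l. fst p \<le> t]"
  proof (rule sorted_key_list_of_set_strict(3)[OF injS(2) B.finite_S])
    show "set [p \<leftarrow> ?l. fst p \<le> t] = B.S"
      unfolding set_filter mark_list(3) using assms by (auto simp: S_def B.S_def)
    have "sorted_wrt (<) (map fst ?l)" by (rule sorted_key_list_of_set_strict(1)[OF injS(1) finite_S])
    then show "sorted_wrt (<) (map fst [p \<leftarrow> ?l. fst p \<le> t])"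
      unfolding sorted_wrt_map by (rule sorted_wrt_filter)
  qed
  moreover have "[p \<leftarrow> ?l'. fst p \<le> t] = ?l'"
  proof (rule filter_True)
    show "\<forall>p\<in>set ?l'. fst p \<le> t" unfolding B.mark_list(3) by (auto simp: B.S_def)
  qed
  ultimately show ?thesis unfolding st_eq B.st_eq by (simp only:)
qed

text \<open>The deterministic situation that will hold almost surely: walls around every bounded
  region and for every positive horizon.\<close>

locale confined =
  fixes A :: "(real \<times> real) set"
  assumes gen: "generic A"
    and walls: "\<And>T a. 0 < T \<Longrightarrow> \<exists>N k. walled T N (A \<inter> {0..T} \<times> {- real k..real k}) a"
begin

text \<open>The sequence is eventually constant by \<open>limit_eq\<close>. As a limit over all
  boxes it involves no random choice of a good box, and the horizon \<open>t\<close> excludes later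
  marks.\<close>

definition "Z t x = lim (\<lambda>k. box_Z A (real k) t t x)"
definition "H t x = lim (\<lambda>k. box_H A (real k) t t x)"

text \<open>A larger box is itself a \<open>fire_process\<close> whose own walls lie outside the
  walled box, so \<open>walled_agree\<close> shows that it gives the same values.\<close>

lemma limit_eq:
  assumes "walled T N (A \<inter> {0..T} \<times> {- real k..real k}) a" "t \<in> {0..T}" "x \<in> {-a..a}"
  shows "Z t x = box_Z A k T t x" "H t x = box_H A k T t x"
proof -
  have eq: "box_Z A j t t x = box_Z A k T t x \<and> box_H A j t t x = box_H A k T t x" if "k \<le> j" for j
  proof -
    interpret B: box A "real j" T by unfold_locales (rule gen)
    have kj: "{- real k<..<real k} \<subseteq> {- real j<..<real j}" "{- real j, real j} \<inter> {- real k<..<real k} = {}"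
      using that by auto
    have "t \<le> T" using assms(2) by simp
    then show ?thesis
      using walled_agree(1,2)[OF gen B.fire_process_box assms(1) kj assms(2,3)] B.box_state_restrict
      by (simp add: box_Z_def box_H_def)
  qed
  have e: "\<forall>\<^sub>F j in sequentially. box_Z A (real j) t t x = box_Z A k T t x"
    "\<forall>\<^sub>F j in sequentially. box_H A (real j) t t x = box_H A k T t x"
    by (rule eventually_sequentiallyI[of k], use eq in blast)+
  show "Z t x = box_Z A k T t x" "H t x = box_H A k T t x"
    unfolding Z_def H_def by (rule limI[OF tendsto_eventually[OF e(1)]], rule limI[OF tendsto_eventually[OF e(2)]])
qed

lemma local:
  fixes a T :: real
  assumes "0 < T"
  obtains k :: nat where "a < k"
    "\<forall>t\<in>{0..T}. \<forall>x\<in>{-a..a}. Z t x = box_Z A k T t x \<and> H t x = box_H A k T t x"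
proof -
  obtain N k where w: "walled T N (A \<inter> {0..T} \<times> {- real k..real k}) a" using walls[OF assms] by blast
  then obtain p where "p \<in> A \<inter> {0..T} \<times> {- real k..real k}" "a < snd p" unfolding walled_def by blast
  then have "a < k" by auto
  then show ?thesis by (rule that) (use limit_eq[OF w] in blast)
qed

context
  fixes k :: nat and a T :: real
  assumes ak: "a < k"
    and eqs: "\<forall>t\<in>{0..T}. \<forall>x\<in>{-a..a}. Z t x = box_Z A k T t x \<and> H t x = box_H A k T t x"
begin

lemma local_tendsto:
  assumes "x \<in> {-a..a}" "0 < s" "s \<le> T"
  shows "((\<lambda>r. Z r x) \<longlongrightarrow> z) (at_left s) \<longleftrightarrow> ((\<lambda>r. box_Z A k T r x) \<longlongrightarrow> z) (at_left s)"
    "((\<lambda>r. H r x) \<longlongrightarrow> z) (at_left s) \<longleftrightarrow> ((\<lambda>r. box_H A k T r x) \<longlongrightarrow> z) (at_left s)"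
proof -
  have e: "\<forall>\<^sub>F r in at_left s. Z r x = box_Z A k T r x" "\<forall>\<^sub>F r in at_left s. H r x = box_H A k T r x"
    by (rule eventually_at_leftI[OF assms(2)], use assms eqs in simp)+
  show "((\<lambda>r. Z r x) \<longlongrightarrow> z) (at_left s) \<longleftrightarrow> ((\<lambda>r. box_Z A k T r x) \<longlongrightarrow> z) (at_left s)"
    by (rule filterlim_cong[OF refl refl e(1)])
  show "((\<lambda>r. H r x) \<longlongrightarrow> z) (at_left s) \<longleftrightarrow> ((\<lambda>r. box_H A k T r x) \<longlongrightarrow> z) (at_left s)"
    by (rule filterlim_cong[OF refl refl e(2)])
qed

lemma local_burnt:
  assumes "x \<in> {-a..a}" "0 < s" "s \<le> T"
  shows "burnt Z s x \<longleftrightarrow> burnt (box_Z A k T) s x"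
proof -
  have "Z s x = box_Z A k T s x" using eqs assms by simp
  then show ?thesis unfolding burnt_def local_tendsto(1)[OF assms] by simp
qed

lemma local_bar:
  assumes "t \<in> {0..T}" "v \<in> {-a..a}"
  shows "v \<in> bar {} Z H t \<longleftrightarrow> v \<in> bar {- real k, real k} (box_Z A k T) (box_H A k T) t"
  using eqs[rule_format, OF assms] assms(2) ak by (auto simp: bar_def barriers_def)

end

text \<open>Each axiom concerns a bounded region up to time \<open>T\<close> and is inherited from
  one box in which the limit is already attained there.\<close>

lemma fire_process: "fire_process T A {} UNIV Z H"
proof (rule fire_process.intro)
  fix x :: real
  \<comment> \<open>\<open>walls\<close> speaks of positive horizons, hence
    \<open>max 1 T\<close>.\<close>
  obtain k :: nat where k: "\<bar>x\<bar> < k" "\<forall>t\<in>{0..max 1 T}. \<forall>z\<in>{-\<bar>x\<bar>..\<bar>x\<bar>}. Z t z = box_Z A k (max 1 T) t z \<and> H t z = box_H A k (max 1 T) t z"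
    by (rule local[of "max 1 T" "\<bar>x\<bar>"], simp, rule that; (assumption | blast))
  interpret B: box A "real k" "max 1 T" by unfold_locales (rule gen)
  interpret P: fire_process "max 1 T" A "{- real k, real k}" "{- real k<..<real k}" "box_Z A k (max 1 T)" "box_H A k (max 1 T)"
    by (rule B.fire_process_box)
  have x: "x \<in> {-\<bar>x\<bar>..\<bar>x\<bar>}" "x \<in> {- real k<..<real k}" using k(1) by auto
  have eqZ: "Z t x = box_Z A k (max 1 T) t x" and eqH: "H t x = box_H A k (max 1 T) t x" if "0 \<le> t" "t \<le> max 1 T" for t
    using k(2) x(1) that by auto
  have eqb: "burnt Z s x \<longleftrightarrow> burnt (box_Z A k (max 1 T)) s x" if "0 < s" "s \<le> max 1 T" for s
    by (rule local_burnt[OF k x(1) that])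
  show "Z 0 x = 0" "H 0 x = 0" using eqZ[of 0] eqH[of 0] P.init[OF x(2)] by simp_all
  show "finite {r \<in> fst ` A. r \<le> T \<and> burnt Z r x}"
  proof (rule finite_subset[OF _ P.finite_burnt[OF x(2)]])
    show "{r \<in> fst ` A. r \<le> T \<and> burnt Z r x} \<subseteq> {r \<in> fst ` A. r \<le> max 1 T \<and> burnt (box_Z A k (max 1 T)) r x}"
    proof
      fix r assume r: "r \<in> {r \<in> fst ` A. r \<le> T \<and> burnt Z r x}"
      then have "0 < r" using generic_pos[OF gen] by force
      moreover have "r \<le> max 1 T" using r by auto
      ultimately show "r \<in> {r \<in> fst ` A. r \<le> max 1 T \<and> burnt (box_Z A k (max 1 T)) r x}" using r eqb[of r] by simp
    qed
  qed
  {
    fix s t assume st: "0 \<le> s" "s \<le> t" "t \<le> T"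
    then have T: "t \<le> max 1 T" by simp
    {
      assume nb: "\<And>r. r \<in> fst ` A \<Longrightarrow> s < r \<Longrightarrow> r \<le> t \<Longrightarrow> \<not> burnt Z r x"
      have "box_Z A k (max 1 T) t x = min 1 (box_Z A k (max 1 T) s x + (t - s))"
      proof (rule P.grow[OF x(2) st(1,2) T])
        fix r assume r: "r \<in> fst ` A" "s < r" "r \<le> t"
        then show "\<not> burnt (box_Z A k (max 1 T)) r x" using nb[OF r] eqb[of r] st T by simp
      qed
      then show "Z t x = min 1 (Z s x + (t - s))" using eqZ[of t] eqZ[of s] st T by simp
    next
      assume no: "\<And>r. (r, x) \<in> A \<Longrightarrow> s < r \<Longrightarrow> r \<le> t \<Longrightarrow> False"
      have "box_H A k (max 1 T) t x = max 0 (box_H A k (max 1 T) s x - (t - s))"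
        by (rule P.decay[OF x(2) st(1,2) T]) (use no in blast)
      then show "H t x = max 0 (H s x - (t - s))" using eqH[of t] eqH[of s] st T by simp
    }
  }
  {
    fix s assume s: "(s, x) \<in> A" "s \<le> T"
    have s0: "0 < s" by (rule generic_pos[OF gen s(1)])
    have sT: "s \<le> max 1 T" using s by simp
    obtain z h where zh: "((\<lambda>r. box_Z A k (max 1 T) r x) \<longlongrightarrow> z) (at_left s)"
        "((\<lambda>r. box_H A k (max 1 T) r x) \<longlongrightarrow> h) (at_left s)"
        "box_H A k (max 1 T) s x = h + (if z < 1 then z else 0)"
      using P.spark[OF s(1) x(2) sT] by blast
    have "((\<lambda>r. Z r x) \<longlongrightarrow> z) (at_left s)" by (rule local_tendsto(1)[OF k x(1) s0 sT, THEN iffD2, OF zh(1)])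
    moreover have "((\<lambda>r. H r x) \<longlongrightarrow> h) (at_left s)" by (rule local_tendsto(2)[OF k x(1) s0 sT, THEN iffD2, OF zh(2)])
    moreover have "H s x = h + (if z < 1 then z else 0)" by (rule trans[OF eqH[OF less_imp_le[OF s0] sT] zh(3)])
    ultimately show "\<exists>z h. ((\<lambda>r. Z r x) \<longlongrightarrow> z) (at_left s) \<and> ((\<lambda>r. H r x) \<longlongrightarrow> h) (at_left s) \<and>
        H s x = h + (if z < 1 then z else 0)"
      by blast
  }
next
  fix s y x assume sy: "(s, y) \<in> A" and sT: "s \<le> T"
  have s0: "0 < s" by (rule generic_pos[OF gen sy])
  \<comment> \<open>Large enough to contain every interval between \<open>x\<close> and
    \<open>y\<close> on which barriers are compared.\<close>
  define a where "a = max \<bar>x\<bar> \<bar>y\<bar>"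
  obtain k :: nat where k: "a < k" "\<forall>t\<in>{0..T}. \<forall>z\<in>{-a..a}. Z t z = box_Z A k T t z \<and> H t z = box_H A k T t z"
    by (rule local[of T a], use s0 sT in simp, rule that; (assumption | blast))
  interpret B: box A "real k" T by unfold_locales (rule gen)
  interpret P: fire_process T A "{- real k, real k}" "{- real k<..<real k}" "box_Z A k T" "box_H A k T"
    by (rule B.fire_process_box)
  have x: "x \<in> {-a..a}" "x \<in> {- real k<..<real k}" using k(1) by (auto simp: a_def)
  have eqb: "burnt Z s x \<longleftrightarrow> burnt (box_Z A k T) s x" by (rule local_burnt[OF k x(1) s0 sT])
  have ev: "\<forall>\<^sub>F r in at_left s. r \<in> {0..T}" by (rule eventually_at_leftI[OF s0]) (use sT in simp)
  have bar: "bar {} Z H r \<inter> C = bar {- real k, real k} (box_Z A k T) (box_H A k T) r \<inter> C" if "r \<in> {0..T}" "C \<subseteq> {-a..a}" for r C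
    using local_bar[OF k that(1)] that(2) by blast
  {
    fix u assume b: "burnt Z s x" and u: "y < u" "u \<le> x"
    have C: "{u..x} \<subseteq> {-a..a}" using u by (auto simp: a_def)
    have "\<not> (\<forall>\<^sub>F r in at_left s. bar {- real k, real k} (box_Z A k T) (box_H A k T) r \<inter> {u..x} \<noteq> {})"
      using P.burnt_left[OF sy x(2) sT _ u] b eqb by blast
    moreover have "\<forall>\<^sub>F r in at_left s. bar {- real k, real k} (box_Z A k T) (box_H A k T) r \<inter> {u..x} \<noteq> {}"
      if "\<forall>\<^sub>F r in at_left s. bar {} Z H r \<inter> {u..x} \<noteq> {}"
      using that ev by eventually_elim (simp only: bar[OF _ C] not_False_eq_True)
    ultimately show "\<not> (\<forall>\<^sub>F r in at_left s. bar {} Z H r \<inter> {u..x} \<noteq> {})" by blast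
  next
    fix u assume b: "burnt Z s x" and u: "u < y" "x \<le> u"
    have C: "{x..u} \<subseteq> {-a..a}" using u by (auto simp: a_def)
    have "\<not> (\<forall>\<^sub>F r in at_left s. bar {- real k, real k} (box_Z A k T) (box_H A k T) r \<inter> {x..u} \<noteq> {})"
      using P.burnt_right[OF sy x(2) sT _ u] b eqb by blast
    moreover have "\<forall>\<^sub>F r in at_left s. bar {- real k, real k} (box_Z A k T) (box_H A k T) r \<inter> {x..u} \<noteq> {}"
      if "\<forall>\<^sub>F r in at_left s. bar {} Z H r \<inter> {x..u} \<noteq> {}"
      using that ev by eventually_elim (simp only: bar[OF _ C] not_False_eq_True)
    ultimately show "\<not> (\<forall>\<^sub>F r in at_left s. bar {} Z H r \<inter> {x..u} \<noteq> {})" by blast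
  next
    assume h: "\<forall>\<^sub>F r in at_left s. Z r x = 1 \<and> bar {} Z H r \<inter> ({y<..x} \<union> {x..<y}) = {}"
    have C: "{y<..x} \<union> {x..<y} \<subseteq> {-a..a}" by (auto simp: a_def)
    have "\<forall>\<^sub>F r in at_left s. box_Z A k T r x = 1 \<and> bar {- real k, real k} (box_Z A k T) (box_H A k T) r \<inter> ({y<..x} \<union> {x..<y}) = {}"
      using h ev
    proof eventually_elim
      case (elim r)
      then show ?case using k(2) x(1) bar[OF elim(2) C] by simp
    qed
    then show "burnt Z s x" using P.burn[OF sy x(2) sT] eqb by blast
  }
qed

lemma limits:
  assumes "0 < s"
  shows "\<exists>z. ((\<lambda>r. Z r x) \<longlongrightarrow> z) (at_left s)" "\<exists>h. ((\<lambda>r. H r x) \<longlongrightarrow> h) (at_left s)"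
proof -
  obtain k :: nat where k: "\<bar>x\<bar> < k" "\<forall>t\<in>{0..s}. \<forall>z\<in>{-\<bar>x\<bar>..\<bar>x\<bar>}. Z t z = box_Z A k s t z \<and> H t z = box_H A k s t z"
    by (rule local[OF assms, of "\<bar>x\<bar>"], rule that; (assumption | blast))
  interpret B: box A "real k" s by unfold_locales (rule gen)
  have x: "x \<in> {-\<bar>x\<bar>..\<bar>x\<bar>}" by auto
  show "\<exists>z. ((\<lambda>r. Z r x) \<longlongrightarrow> z) (at_left s)" "\<exists>h. ((\<lambda>r. H r x) \<longlongrightarrow> h) (at_left s)"
    unfolding local_tendsto[OF k x assms order_refl] using B.left_limits[OF assms] by blast+
qed

text \<open>One pair of walls works for all times up to the horizon, so the bound is uniform in
  \<open>t\<close>.\<close>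

lemma cluster_bounded:
  "\<exists>K. \<forall>t\<in>{0..T}. \<exists>a b. -K \<le> a \<and> a \<le> b \<and> b \<le> K \<and> cluster (Z t) (H t) x = {a..b}"
proof -
  define U where "U = max 1 T"
  have "0 < U" by (simp add: U_def)
  obtain N k where w: "walled U N (A \<inter> {0..U} \<times> {- real k..real k}) \<bar>x\<bar>" using walls[OF \<open>0 < U\<close>] by blast
  then obtain p where "p \<in> A \<inter> {0..U} \<times> {- real k..real k}" "\<bar>x\<bar> < snd p" unfolding walled_def by blast
  then have xk: "- real k \<le> x" "x \<le> k" by auto
  have "\<exists>a b. - real k \<le> a \<and> a \<le> b \<and> b \<le> k \<and> cluster (Z t) (H t) x = {a..b}" if t: "t \<in> {0..U}" for t
  proof -
    define a where "a = Sup (insert (-real k) {y \<in> barriers (box_Z A k U t) (box_H A k U t). - real k \<le> y \<and> y \<le> x})"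
    define b where "b = Inf (insert (real k) {y \<in> barriers (box_Z A k U t) (box_H A k U t). x \<le> y \<and> y \<le> k})"
    have "cluster (Z t) (H t) x = box_cluster k (box_Z A k U t) (box_H A k U t) x"
      by (rule walled_agree(3)[OF gen fire_process w _ _ t]) auto
    then have "cluster (Z t) (H t) x = {a..b}" by (simp only: box_cluster_def a_def b_def)
    moreover have "- real k \<le> a" unfolding a_def by (rule cSup_upper) (auto intro!: bdd_aboveI[of _ x] simp: xk)
    moreover have "a \<le> x" unfolding a_def by (rule cSup_least) (use xk in auto)
    moreover have "x \<le> b" unfolding b_def by (rule cInf_greatest) (use xk in auto)
    moreover have "b \<le> k" unfolding b_def by (rule cInf_lower) (auto intro!: bdd_belowI[of _ x] simp: xk)
    ultimately show ?thesis by (meson order_trans)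
  qed
  then show ?thesis by (intro exI[of _ "real k"]) (auto simp: U_def)
qed

text \<open>Inherited from a box with \<open>K < k\<close>, so that its artificial walls stay
  outside the region considered.\<close>

lemma barriers_const:
  assumes "0 < s"
  shows "\<exists>r B. 0 \<le> r \<and> r < s \<and> (\<forall>q\<in>{r..<s}. barriers (Z q) (H q) \<inter> {-K..K} = B)"
proof -
  obtain k :: nat where k: "K < k" "\<forall>t\<in>{0..s}. \<forall>z\<in>{-K..K}. Z t z = box_Z A k s t z \<and> H t z = box_H A k s t z"
    by (rule local[OF assms, of K], rule that; (assumption | blast))
  interpret B: box A "real k" s by unfold_locales (rule gen)
  obtain r B where r: "0 \<le> r" "r < s" "\<And>q. r \<le> q \<Longrightarrow> q < s \<Longrightarrow> bar {- real k, real k} (box_Z A k s) (box_H A k s) q = B"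
    by (rule B.bar_const[OF assms, where E = "{- real k, real k}"], rule that; (assumption | blast))
  have "barriers (Z q) (H q) \<inter> {-K..K} = B \<inter> {-K..K}" if "q \<in> {r..<s}" for q
  proof -
    have q: "q \<in> {0..s}" "bar {- real k, real k} (box_Z A k s) (box_H A k s) q = B" using that r by simp_all
    show ?thesis
    proof (rule set_eqI)
      fix v
      have "v \<in> {-K..K} \<Longrightarrow> v \<in> barriers (Z q) (H q) \<longleftrightarrow> v \<in> B"
        using local_bar[OF k q(1), of v] unfolding q(2) by (simp add: bar_def)
      then show "v \<in> barriers (Z q) (H q) \<inter> {-K..K} \<longleftrightarrow> v \<in> B \<inter> {-K..K}" by blast
    qed
  qed
  then show ?thesis using r(1,2) by blast
qed

text \<open>By genericity no point becomes full exactly at the time of a mark; this is contained in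
  \<open>mark_char\<close>.\<close>

lemma full_before:
  assumes "(s, y) \<in> A" "((\<lambda>r. Z r x) \<longlongrightarrow> 1) (at_left s)"
  shows "\<forall>\<^sub>F q in at_left s. Z q x = 1"
proof -
  have s0: "0 < s" by (rule generic_pos[OF gen assms(1)])
  obtain k :: nat where k: "\<bar>x\<bar> < k" "\<forall>t\<in>{0..s}. \<forall>z\<in>{-\<bar>x\<bar>..\<bar>x\<bar>}. Z t z = box_Z A k s t z \<and> H t z = box_H A k s t z"
    by (rule local[OF s0, of "\<bar>x\<bar>"], rule that; (assumption | blast))
  interpret B: box A "real k" s by unfold_locales (rule gen)
  have x: "x \<in> {-\<bar>x\<bar>..\<bar>x\<bar>}" by auto
  obtain U where U: "\<forall>x\<in>U. \<forall>\<^sub>F q in at_left s. box_Z A k s q x = 1"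
    "\<forall>x\<in>-U. \<not> ((\<lambda>q. box_Z A k s q x) \<longlongrightarrow> 1) (at_left s)"
    by (rule B.mark_char[OF assms(1) order_refl])
  have "x \<in> U" using U(2) local_tendsto(1)[OF k x s0 order_refl, THEN iffD1, OF assms(2)] by blast
  then have "\<forall>\<^sub>F q in at_left s. box_Z A k s q x = 1" using U(1) by blast
  moreover have "\<forall>\<^sub>F q in at_left s. Z q x = box_Z A k s q x"
    by (rule eventually_at_leftI[OF s0]) (use k(2) x in simp)
  ultimately show ?thesis by eventually_elim simp
qed

end

section \<open>Clusters tested at countably many positions\<close>

text \<open>\<open>x\<close> is added to \<open>Q\<close> because it may itself be a barrier without
  belonging to the countable set.\<close>

definition unblocked :: "real \<Rightarrow> real set \<Rightarrow> (real \<Rightarrow> real) \<Rightarrow> (real \<Rightarrow> real) \<Rightarrow> real \<Rightarrow> real \<Rightarrow> bool" where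
  "unblocked k Q z h y x \<longleftrightarrow> -k \<le> y \<and> y \<le> k \<and>
     (\<forall>v\<in>insert x Q. v \<in> barriers z h \<longrightarrow> \<not> (y < v \<and> v \<le> x) \<and> \<not> (x \<le> v \<and> v < y))"

fun test_ignite :: "real \<Rightarrow> real set \<Rightarrow> real \<Rightarrow> state \<Rightarrow> state" where
  "test_ignite k Q y (s, z, h) =
     (s, \<lambda>x. if z x = 1 \<and> unblocked k Q z h y x then 0 else z x,
      if z y < 1 then h(y := h y + z y) else h)"

text \<open>The graphical construction with the search for barriers restricted to the marks, the
  rationals and the point itself, which makes it measurable in the marks.\<close>

primrec test_state :: "real \<Rightarrow> (nat \<Rightarrow> real \<times> real) \<Rightarrow> nat \<Rightarrow> state" where
  "test_state k \<tau> 0 = (0, \<lambda>_. 0, \<lambda>_. 0)"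
| "test_state k \<tau> (Suc i) =
     test_ignite k (range (\<lambda>j. snd (\<tau> j)) \<union> \<rat>) (snd (\<tau> i)) (evolve (fst (\<tau> i)) (test_state k \<tau> i))"

text \<open>Away from the finitely many marks the state is locally constant, so arbitrarily near a
  barrier there is a rational one, still strictly between \<open>y\<close> and
  \<open>x\<close>.\<close>

lemma flat_barrier:
  assumes "finite Y" "Y \<union> \<rat> \<subseteq> Q" and flat: "\<And>I. is_interval I \<Longrightarrow> I \<inter> Y = {} \<Longrightarrow> flat_on I (s, z, h)"
    and v: "v \<in> barriers z h" "y < v" "v < x"
  shows "\<exists>w\<in>Q. w \<in> barriers z h \<and> y < w \<and> w < x"
proof (cases "v \<in> Y")
  case True
  then show ?thesis using assms(2) v by blast
next
  case False
  have "open ({y<..<x} - Y)" using assms(1) by (intro open_Diff) (auto intro: finite_imp_closed)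
  then obtain e where e: "e > 0" "ball v e \<subseteq> {y<..<x} - Y"
    using v False open_contains_ball by (metis DiffI greaterThanLessThan_iff)
  have "flat_on (ball v e) (s, z, h)"
    by (rule flat) (use e(2) in \<open>auto intro: is_interval_ball_real\<close>)
  then obtain c where c: "\<And>u. u \<in> ball v e \<Longrightarrow> z u = c \<and> h u = 0" unfolding flat_on_def by auto
  obtain w where w: "w \<in> \<rat>" "v - e < w" "w < v" using Rats_dense_in_real[of "v - e" v] e(1) by auto
  have "w \<in> ball v e" "v \<in> ball v e" using w e(1) by (auto simp: dist_real_def)
  then have "w \<in> barriers z h" "w \<in> {y<..<x}" using c[of w] c[of v] v(1) e(2) by (auto simp: barriers_def)
  then show ?thesis using w(1) assms(2) by auto
qed

lemma unblocked_iff: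
  assumes "finite Y" "Y \<union> \<rat> \<subseteq> Q" and flat: "\<And>I. is_interval I \<Longrightarrow> I \<inter> Y = {} \<Longrightarrow> flat_on I (s, z, h)"
    and x: "-k \<le> x" "x \<le> k"
  shows "unblocked k Q z h y x \<longleftrightarrow> y \<in> box_cluster k z h x"
proof -
  have "\<exists>w\<in>insert x Q. w \<in> barriers z h \<and> (y < w \<and> w \<le> x \<or> x \<le> w \<and> w < y)"
    if v: "v \<in> barriers z h" "y < v \<and> v \<le> x \<or> x \<le> v \<and> v < y" for v
  proof (cases "v = x")
    case False
    then consider "y < v" "v < x" | "x < v" "v < y" using v(2) by linarith
    then show ?thesis
    proof cases
      case 1
      then show ?thesis using flat_barrier[OF assms(1,2) flat v(1)] by force
    next
      case 2
      then show ?thesis using flat_barrier[OF assms(1,2) flat v(1)] by force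
    qed
  qed (use v in blast)
  then show ?thesis unfolding unblocked_def mem_box_cluster[OF x] by blast
qed

text \<open>Equality is claimed on \<open>{-k..k}\<close>, where \<open>unblocked_iff\<close>
  applies. Entries of \<open>\<tau>\<close> beyond the list may be arbitrary: they only enlarge the
  set of tested positions, and testing more positions does not change the outcome.\<close>

lemma test_state_eq:
  assumes l: "sorted (map fst l)" "\<forall>p\<in>set l. 0 \<le> fst p" and \<tau>: "\<And>i. i < length l \<Longrightarrow> \<tau> i = l ! i"
    and i: "i \<le> length l"
  shows "\<exists>z h z' h' s. test_state k \<tau> i = (s, z, h) \<and>
    fold (\<lambda>(s, y). ignite k y \<circ> evolve s) (take i l) (0, \<lambda>_. 0, \<lambda>_. 0) = (s, z', h') \<and>
    (\<forall>x\<in>{-k..k}. z x = z' x \<and> h x = h' x)"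
  using i
proof (induction i)
  case (Suc i)
  let ?f = "\<lambda>(s, y). ignite k y \<circ> evolve s"
  define Q where "Q = range (\<lambda>j. snd (\<tau> j)) \<union> \<rat>"
  obtain z h z' h' s where st: "test_state k \<tau> i = (s, z, h)"
    "fold ?f (take i l) (0, \<lambda>_. 0, \<lambda>_. 0) = (s, z', h')" and eq: "\<forall>x\<in>{-k..k}. z x = z' x \<and> h x = h' x"
    using Suc.IH[OF Suc_leD[OF Suc.prems]] by (elim exE conjE) (rule that)
  obtain t y where ty: "l ! i = (t, y)" by (cases "l ! i")
  have il: "i < length l" using Suc.prems by simp
  have \<tau>i: "\<tau> i = (t, y)" using \<tau>[OF il] ty by simp
  define e where "e = (\<lambda>x. min 1 (z x + (t - s)))"
  define g where "g = (\<lambda>x. max 0 (h x - (t - s)))"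
  define e' where "e' = (\<lambda>x. min 1 (z' x + (t - s)))"
  define g' where "g' = (\<lambda>x. max 0 (h' x - (t - s)))"
  have eg: "e x = e' x" "g x = g' x" if "x \<in> {-k..k}" for x
    using eq that by (simp_all add: e_def g_def e'_def g'_def)
  have le: "fst p \<le> t" if p: "p \<in> set (take i l)" for p
  proof -
    obtain j where j: "j < i" "p = l ! j" using p il by (auto simp: in_set_conv_nth)
    then have "map fst l ! j \<le> map fst l ! i" using il by (intro sorted_nth_mono l(1)) simp_all
    then show ?thesis using j il ty by simp
  qed
  have flat: "flat_on I (t, e', g')" if I: "is_interval I" "I \<inter> snd ` set (take i l) = {}" for I
  proof -
    have "[p \<leftarrow> take i l. fst p \<le> t] = take i l" using le by simp
    then have "graphical k (take i l) t = (t, e', g')"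
      unfolding graphical_def by (simp only: st evolve.simps e'_def g'_def)
    moreover have "flat_on I (graphical k (take i l) t)"
    proof (rule graphical_flat_on[OF _ _ _ I])
      show "sorted (map fst (take i l))" using l(1) by (simp add: take_map[symmetric] sorted_wrt_take)
      show "\<forall>p\<in>set (take i l). 0 \<le> fst p" using l(2) in_set_takeD by fast
      show "0 \<le> t" using l(2) nth_mem[OF il] ty by force
    qed
    ultimately show ?thesis by simp
  qed
  have Y: "snd ` set (take i l) \<union> \<rat> \<subseteq> Q"
  proof -
    have "snd p \<in> Q" if p: "p \<in> set (take i l)" for p
    proof -
      obtain j where j: "j < i" "p = l ! j" using p il by (auto simp: in_set_conv_nth)
      then have "snd p = snd (\<tau> j)" using \<tau>[of j] il by simp
      then show ?thesis unfolding Q_def by blast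
    qed
    then show ?thesis unfolding Q_def by blast
  qed
  have ub: "unblocked k Q e g y x \<longleftrightarrow> y \<in> box_cluster k e' g' x" if x: "x \<in> {-k..k}" for x
  proof -
    have "unblocked k Q e g y x \<longleftrightarrow> unblocked k Q e' g' y x"
    proof (cases "-k \<le> y \<and> y \<le> k")
      case True
      have "v \<in> barriers e g \<longleftrightarrow> v \<in> barriers e' g'" if "y < v \<and> v \<le> x \<or> x \<le> v \<and> v < y" for v
      proof -
        have "v \<in> {-k..k}" using that True x by auto
        then show ?thesis using eg[of v] by (simp add: barriers_def)
      qed
      then show ?thesis unfolding unblocked_def by blast
    qed (auto simp: unblocked_def)
    also have "\<dots> \<longleftrightarrow> y \<in> box_cluster k e' g' x"
      by (rule unblocked_iff[OF _ Y flat]) (use x in auto)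
    finally show ?thesis .
  qed
  have 1: "test_state k \<tau> (Suc i) = (t, \<lambda>x. if e x = 1 \<and> unblocked k Q e g y x then 0 else e x,
      if e y < 1 then g(y := g y + e y) else g)"
    unfolding test_state.simps \<tau>i st fst_conv snd_conv evolve.simps test_ignite.simps Q_def e_def g_def ..
  have 2: "fold ?f (take (Suc i) l) (0, \<lambda>_. 0, \<lambda>_. 0) = (t, \<lambda>x. if e' x = 1 \<and> y \<in> box_cluster k e' g' x then 0 else e' x,
      if e' y < 1 then g'(y := g' y + e' y) else g')"
    unfolding take_Suc_conv_app_nth[OF il] fold_append ty
    by (simp only: comp_apply fold.simps id_apply st split evolve.simps ignite.simps e'_def g'_def)
  show ?case
  proof (intro exI conjI, rule 1, rule 2, intro ballI conjI)
    fix x assume x: "x \<in> {-k..k}"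
    show "(if e x = 1 \<and> unblocked k Q e g y x then 0 else e x) = (if e' x = 1 \<and> y \<in> box_cluster k e' g' x then 0 else e' x)"
      using ub[OF x] eg(1)[OF x] by simp
    show "(if e y < 1 then g(y := g y + e y) else g) x = (if e' y < 1 then g'(y := g' y + e' y) else g') x"
    proof (cases "x = y")
      case True
      then show ?thesis using eg[of y] x by simp
    qed (use eg(2)[OF x] in simp)
  qed
qed simp

section \<open>Adaptedness\<close>

lemma pred_conj: "Measurable.pred F P \<Longrightarrow> Measurable.pred F Q \<Longrightarrow> Measurable.pred F (\<lambda>\<omega>. P \<omega> \<and> Q \<omega>)"
  by (rule pred_intros_logic)

lemma pred_all: "(\<And>i::'i::countable. Measurable.pred F (P i)) \<Longrightarrow> Measurable.pred F (\<lambda>\<omega>. \<forall>i. P i \<omega>)"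
  by (rule pred_intros_countable)

text \<open>\<open>F\<close> is any \<sigma>-algebra for which the counts up to time
  \<open>t\<close> are measurable. It will be the filtration at \<open>t\<close>, and all
  measurability is derived from these counts.\<close>

locale counts =
  fixes F :: "'w measure" and M :: "'w \<Rightarrow> (real \<times> real) measure" and t k :: real
  assumes counts: "\<And>B. B \<in> sets borel \<Longrightarrow> B \<subseteq> {0..t} \<times> UNIV \<Longrightarrow> (\<lambda>\<omega>. emeasure (M \<omega>) B) \<in> borel_measurable F"
    and t0: "0 \<le> t"
begin

text \<open>A cell is named by a corner of its grid square, so the name of an occupied cell is
  itself an approximation of the mark in it.\<close>

definition "grid n p = (of_int \<lfloor>fst p * real (Suc n)\<rfloor> / real (Suc n), of_int \<lfloor>snd p * real (Suc n)\<rfloor> / real (Suc n))"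
definition "cell n i = {p \<in> {0..t} \<times> {-k..k}. grid n p = i}"
definition "occupied n \<omega> = {i \<in> grid n ` ({0..t} \<times> {-k..k}). emeasure (M \<omega>) (cell n i) \<noteq> 0}"

lemma finite_grid: "finite (grid n ` ({0..t} \<times> {-k..k}))"
proof -
  have "grid n ` ({0..t} \<times> {-k..k}) \<subseteq>
    (\<lambda>(i, j). (of_int i / real (Suc n), of_int j / real (Suc n))) `
      ({\<lfloor>0 * real (Suc n)\<rfloor>..\<lfloor>t * real (Suc n)\<rfloor>} \<times> {\<lfloor>-k * real (Suc n)\<rfloor>..\<lfloor>k * real (Suc n)\<rfloor>})"
  proof
    fix i assume "i \<in> grid n ` ({0..t} \<times> {-k..k})"
    then obtain s y where sy: "0 \<le> s" "s \<le> t" "-k \<le> y" "y \<le> k" "i = grid n (s, y)" by auto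
    have "\<lfloor>s * real (Suc n)\<rfloor> \<in> {\<lfloor>0 * real (Suc n)\<rfloor>..\<lfloor>t * real (Suc n)\<rfloor>}"
      using sy by (auto intro!: floor_mono mult_right_mono simp del: of_nat_Suc)
    moreover have "\<lfloor>y * real (Suc n)\<rfloor> \<in> {\<lfloor>-k * real (Suc n)\<rfloor>..\<lfloor>k * real (Suc n)\<rfloor>}"
      unfolding atLeastAtMost_iff using sy by (intro conjI floor_mono mult_right_mono) simp_all
    ultimately show "i \<in> (\<lambda>(i, j). (of_int i / real (Suc n), of_int j / real (Suc n))) `
      ({\<lfloor>0 * real (Suc n)\<rfloor>..\<lfloor>t * real (Suc n)\<rfloor>} \<times> {\<lfloor>-k * real (Suc n)\<rfloor>..\<lfloor>k * real (Suc n)\<rfloor>})"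
      unfolding sy(5) grid_def by (intro image_eqI[of _ _ "(\<lfloor>s * real (Suc n)\<rfloor>, \<lfloor>y * real (Suc n)\<rfloor>)"]) simp_all
  qed
  then show ?thesis by (rule finite_subset) (intro finite_imageI finite_cartesian_product finite_atLeastAtMost_int)
qed

lemma cell_borel: "cell n i \<in> sets borel"
proof -
  have [measurable]: "(fst :: real \<times> real \<Rightarrow> real) \<in> borel_measurable borel" "(snd :: real \<times> real \<Rightarrow> real) \<in> borel_measurable borel"
    by (intro borel_measurable_continuous_onI continuous_intros)+
  have "{p \<in> space borel. 0 \<le> fst p \<and> fst p \<le> t \<and> -k \<le> snd p \<and> snd p \<le> k \<and>
      of_int \<lfloor>fst p * real (Suc n)\<rfloor> / real (Suc n) = fst i \<and> of_int \<lfloor>snd p * real (Suc n)\<rfloor> / real (Suc n) = snd i} \<in> sets borel"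
    by measurable
  moreover have "cell n i = {p \<in> space borel. 0 \<le> fst p \<and> fst p \<le> t \<and> -k \<le> snd p \<and> snd p \<le> k \<and>
      of_int \<lfloor>fst p * real (Suc n)\<rfloor> / real (Suc n) = fst i \<and> of_int \<lfloor>snd p * real (Suc n)\<rfloor> / real (Suc n) = snd i}"
    by (rule set_eqI) (simp add: cell_def grid_def prod_eq_iff mem_Times_iff conj_ac del: of_nat_Suc)
  ultimately show ?thesis by (simp only:)
qed

text \<open>The set of occupied cells takes finitely many values, so every function of it, sorting
  included, is measurable.\<close>

lemma measurable_occupied: "(\<lambda>\<omega>. f (occupied n \<omega>) :: real) \<in> borel_measurable F"
proof -
  let ?I = "grid n ` ({0..t} \<times> {-k..k})"
  have [measurable]: "(\<lambda>\<omega>. emeasure (M \<omega>) (cell n i)) \<in> borel_measurable F" for i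
    by (rule counts[OF cell_borel]) (auto simp: cell_def)
  have "occupied n \<in> measurable F (count_space (Pow ?I))"
  proof (subst measurable_count_space_eq2)
    show "finite (Pow ?I)" using finite_grid by simp
    show "occupied n \<in> space F \<rightarrow> Pow ?I \<and> (\<forall>J\<in>Pow ?I. occupied n -` {J} \<inter> space F \<in> sets F)"
    proof (intro conjI ballI)
      show "occupied n \<in> space F \<rightarrow> Pow ?I" by (auto simp: occupied_def)
      fix J assume "J \<in> Pow ?I"
      then have "occupied n -` {J} \<inter> space F = {\<omega> \<in> space F. \<forall>i\<in>?I. emeasure (M \<omega>) (cell n i) \<noteq> 0 \<longleftrightarrow> i \<in> J}"
        unfolding occupied_def by blast
      also have "\<dots> \<in> sets F" using finite_grid by measurable
      finally show "occupied n -` {J} \<inter> space F \<in> sets F" .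
    qed
  qed
  then show ?thesis by (rule measurable_compose) simp
qed

text \<open>Defined for every \<open>\<omega>\<close>: off the good realisations the values are
  arbitrary, but the functions stay measurable.\<close>

definition "mark_fst i \<omega> = lim (\<lambda>n. fst (sorted_key_list_of_set fst (occupied n \<omega>) ! i))"
definition "mark_snd i \<omega> = lim (\<lambda>n. snd (sorted_key_list_of_set fst (occupied n \<omega>) ! i))"
definition "mark_count \<omega> = lim (\<lambda>n. real (card (occupied n \<omega>)))"
definition "mark \<omega> i = (mark_fst i \<omega>, mark_snd i \<omega>)"

lemma measurable_mark [measurable]:
  "mark_fst i \<in> borel_measurable F" "mark_snd i \<in> borel_measurable F" "mark_count \<in> borel_measurable F"
  unfolding mark_fst_def[abs_def] mark_snd_def[abs_def] mark_count_def[abs_def]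
  by (rule borel_measurable_lim_metric, rule measurable_occupied)+

lemma grid_tendsto: "(\<lambda>n. fst (grid n p)) \<longlonglongrightarrow> fst p" "(\<lambda>n. snd (grid n p)) \<longlonglongrightarrow> snd p"
proof -
  have *: "(\<lambda>n. of_int \<lfloor>a * real (Suc n)\<rfloor> / real (Suc n)) \<longlonglongrightarrow> a" for a :: real
  proof (rule tendsto_sandwich[of "\<lambda>n. a - 1 / real (Suc n)" _ _ "\<lambda>_. a"])
    have "a - 1 / real (Suc n) \<le> of_int \<lfloor>a * real (Suc n)\<rfloor> / real (Suc n)" for n
    proof -
      have "a * real (Suc n) - 1 \<le> of_int \<lfloor>a * real (Suc n)\<rfloor>" by linarith
      then have "(a * real (Suc n) - 1) / real (Suc n) \<le> of_int \<lfloor>a * real (Suc n)\<rfloor> / real (Suc n)"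
        by (intro divide_right_mono) simp_all
      then show ?thesis by (simp add: diff_divide_distrib del: of_nat_Suc)
    qed
    then show "\<forall>\<^sub>F n in sequentially. a - 1 / real (Suc n) \<le> of_int \<lfloor>a * real (Suc n)\<rfloor> / real (Suc n)" by simp
    have "of_int \<lfloor>a * real (Suc n)\<rfloor> / real (Suc n) \<le> a" for n
    proof -
      have "of_int \<lfloor>a * real (Suc n)\<rfloor> / real (Suc n) \<le> a * real (Suc n) / real (Suc n)"
        by (intro divide_right_mono of_int_floor_le) simp
      then show ?thesis by (simp del: of_nat_Suc)
    qed
    then show "\<forall>\<^sub>F n in sequentially. of_int \<lfloor>a * real (Suc n)\<rfloor> / real (Suc n) \<le> a" by simp
    have "(\<lambda>n. a - 1 / real (Suc n)) \<longlonglongrightarrow> a - 0"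
      by (intro tendsto_diff tendsto_const LIMSEQ_Suc[OF lim_1_over_n])
    then show "(\<lambda>n. a - 1 / real (Suc n)) \<longlonglongrightarrow> a" by simp
  qed simp
  show "(\<lambda>n. fst (grid n p)) \<longlonglongrightarrow> fst p" "(\<lambda>n. snd (grid n p)) \<longlonglongrightarrow> snd p"
    unfolding grid_def fst_conv snd_conv by (rule *)+
qed

context
  fixes \<omega> :: 'w
  assumes good: "realisation (M \<omega>)"
begin

definition "S = atoms (M \<omega>) \<inter> {0..t} \<times> {-k..k}"

lemma gen: "generic (atoms (M \<omega>))" by (rule realisation.gen[OF good])

lemma S_facts: "finite S" "inj_on fst S"
proof -
  show "finite S" unfolding S_def by (rule generic_finite[OF gen])
  have "inj_on fst (atoms (M \<omega>))" using gen unfolding generic_def by (elim conjE)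
  then show "inj_on fst S" by (rule inj_on_subset) (simp add: S_def)
qed

lemma occupied_eq: "occupied n \<omega> = grid n ` S"
proof -
  have iff: "emeasure (M \<omega>) (cell n i) \<noteq> 0 \<longleftrightarrow> cell n i \<inter> atoms (M \<omega>) \<noteq> {}" for i
  proof -
    have "cell n i \<in> sets (M \<omega>)"
      by (rule realisation.sets_mI[OF good cell_borel]) (auto simp: cell_def)
    moreover have fin: "finite (cell n i \<inter> atoms (M \<omega>))"
      by (rule finite_subset[OF _ S_facts(1)]) (auto simp: cell_def S_def)
    ultimately have "emeasure (M \<omega>) (cell n i) = of_nat (card (cell n i \<inter> atoms (M \<omega>)))"
      by (rule realisation.emeasure_fin(1)[OF good])
    then show ?thesis using fin by simp
  qed
  show ?thesis
  proof (intro set_eqI iffI)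
    fix i assume "i \<in> occupied n \<omega>"
    then have "cell n i \<inter> atoms (M \<omega>) \<noteq> {}" using iff[of i] unfolding occupied_def by blast
    then obtain p where "p \<in> atoms (M \<omega>)" "p \<in> {0..t} \<times> {-k..k}" "grid n p = i" unfolding cell_def by blast
    then show "i \<in> grid n ` S" unfolding S_def by blast
  next
    fix i assume "i \<in> grid n ` S"
    then obtain p where p: "p \<in> S" "i = grid n p" by blast
    then have "p \<in> cell n i \<inter> atoms (M \<omega>)" unfolding cell_def S_def by blast
    then have "emeasure (M \<omega>) (cell n i) \<noteq> 0" using iff[of i] by blast
    moreover have "i \<in> grid n ` ({0..t} \<times> {-k..k})" using p unfolding S_def by blast
    ultimately show "i \<in> occupied n \<omega>" unfolding occupied_def by blast
  qed
qed

abbreviation "ml \<equiv> sorted_key_list_of_set fst S"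

lemma ml: "sorted_wrt (<) (map fst ml)" "set ml = S" "length ml = card S"
proof -
  show 1: "sorted_wrt (<) (map fst ml)" by (rule sorted_key_list_of_set_strict(1)[OF S_facts(2,1)])
  show 2: "set ml = S" by (rule sorted_key_list_of_set_strict(2)[OF S_facts(2,1)])
  have "distinct ml" using 1 by (simp add: strict_sorted_iff distinct_map)
  from distinct_card[OF this] show "length ml = card S" unfolding 2 by (rule sym)
qed

text \<open>Distinct times are eventually separated by the grid. From then on rounding preserves
  their strict order and commutes with sorting.\<close>

lemma ev_list:
  "\<forall>\<^sub>F n in sequentially. sorted_key_list_of_set fst (occupied n \<omega>) = map (grid n) ml \<and> card (occupied n \<omega>) = card S"
proof -
  have "\<forall>\<^sub>F n in sequentially. \<forall>p\<in>S. \<forall>q\<in>S. fst p < fst q \<longrightarrow> fst (grid n p) < fst (grid n q)"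
  proof (intro eventually_ball_finite S_facts(1) ballI)
    fix p q
    show "\<forall>\<^sub>F n in sequentially. fst p < fst q \<longrightarrow> fst (grid n p) < fst (grid n q)"
    proof (cases "fst p < fst q")
      case True
      obtain c where c: "fst p < c" "c < fst q" using dense[OF True] by blast
      have "\<forall>\<^sub>F n in sequentially. fst (grid n p) < c" "\<forall>\<^sub>F n in sequentially. c < fst (grid n q)"
        using order_tendstoD(2)[OF grid_tendsto(1) c(1)] order_tendstoD(1)[OF grid_tendsto(1) c(2)] by blast+
      then show ?thesis by eventually_elim simp
    qed simp
  qed
  then show ?thesis
  proof eventually_elim
    case (elim n)
    have inj: "inj_on fst (grid n ` S)" "inj_on (grid n) S"
    proof -
      have ne: "fst (grid n p) \<noteq> fst (grid n q)" if "p \<in> S" "q \<in> S" "p \<noteq> q" for p q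
      proof -
        have "fst p \<noteq> fst q" using S_facts(2) that by (auto simp: inj_on_def)
        then show ?thesis using elim that by (metis less_irrefl linorder_neqE_linordered_idom)
      qed
      show "inj_on fst (grid n ` S)" "inj_on (grid n) S" using ne unfolding inj_on_def by (blast, metis)
    qed
    have "sorted_wrt (\<lambda>p q. fst p < fst q) ml" using ml(1) by (simp add: sorted_wrt_map)
    then have "sorted_wrt (\<lambda>p q. fst (grid n p) < fst (grid n q)) ml"
      by (rule sorted_wrt_mono_rel[rotated]) (use elim ml(2) in blast)
    then have "sorted_wrt (<) (map fst (map (grid n) ml))" by (simp add: sorted_wrt_map)
    moreover have "set (map (grid n) ml) = grid n ` S" using ml(2) by simp
    ultimately have "sorted_key_list_of_set fst (grid n ` S) = map (grid n) ml"
      by (rule sorted_key_list_of_set_strict(3)[OF inj(1) finite_imageI[OF S_facts(1)]])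
    then show ?case unfolding occupied_eq using card_image[OF inj(2)] by simp
  qed
qed

lemma mark_eq: "mark_count \<omega> = card S" "i < card S \<Longrightarrow> mark \<omega> i = ml ! i"
proof -
  have "\<forall>\<^sub>F n in sequentially. real (card (occupied n \<omega>)) = card S" using ev_list by eventually_elim simp
  then show "mark_count \<omega> = card S" unfolding mark_count_def by (intro limI tendsto_eventually)
  assume i: "i < card S"
  have e: "\<forall>\<^sub>F n in sequentially. fst (grid n (ml ! i)) = fst (sorted_key_list_of_set fst (occupied n \<omega>) ! i)"
    "\<forall>\<^sub>F n in sequentially. snd (grid n (ml ! i)) = snd (sorted_key_list_of_set fst (occupied n \<omega>) ! i)"
    using ev_list by (eventually_elim, use i ml(3) in simp)+
  note l = Lim_transform_eventually[OF grid_tendsto(1) e(1)] Lim_transform_eventually[OF grid_tendsto(2) e(2)]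
  show "mark \<omega> i = ml ! i"
    unfolding mark_def mark_fst_def mark_snd_def limI[OF l(1)] limI[OF l(2)] by simp
qed

lemma mark_state:
  obtains s z h where "test_state k (mark \<omega>) (nat \<lfloor>mark_count \<omega>\<rfloor>) = (s, z, h)"
    "\<And>x. x \<in> {-k..k} \<Longrightarrow> box_Z (atoms (M \<omega>)) k t t x = min 1 (z x + (t - s))"
    "\<And>x. x \<in> {-k..k} \<Longrightarrow> box_H (atoms (M \<omega>)) k t t x = max 0 (h x - (t - s))"
proof -
  have N: "nat \<lfloor>mark_count \<omega>\<rfloor> = length ml" using mark_eq(1) ml(3) by simp
  have srt: "sorted (map fst ml)" using ml(1) by (simp add: strict_sorted_iff)
  have "\<exists>z h z' h' s. test_state k (mark \<omega>) (length ml) = (s, z, h) \<and>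
    fold (\<lambda>(s, y). ignite k y \<circ> evolve s) (take (length ml) ml) (0, \<lambda>_. 0, \<lambda>_. 0) = (s, z', h') \<and>
    (\<forall>x\<in>{-k..k}. z x = z' x \<and> h x = h' x)"
  proof (rule test_state_eq[OF srt])
    show "\<forall>p\<in>set ml. 0 \<le> fst p" unfolding ml(2) by (auto simp: S_def)
    show "mark \<omega> i = ml ! i" if "i < length ml" for i using mark_eq(2) that ml(3) by simp
  qed simp
  then obtain z h z' h' s where st: "test_state k (mark \<omega>) (length ml) = (s, z, h)"
    and fo: "fold (\<lambda>(s, y). ignite k y \<circ> evolve s) ml (0, \<lambda>_. 0, \<lambda>_. 0) = (s, z', h')"
    and eq: "\<forall>x\<in>{-k..k}. z x = z' x \<and> h x = h' x"
    unfolding take_all[OF order_refl] by (elim exE conjE) (rule that)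
  have "[p \<leftarrow> ml. fst p \<le> t] = ml" by (rule filter_True) (unfold ml(2), auto simp: S_def)
  then have b: "box_state (atoms (M \<omega>)) k t t = (t, \<lambda>x. min 1 (z' x + (t - s)), \<lambda>x. max 0 (h' x - (t - s)))"
    unfolding box_state_def graphical_def S_def[symmetric] by (simp only: fo evolve.simps)
  show ?thesis
    by (rule that[of s z h]) (use st N b eq in \<open>simp_all add: box_Z_def box_H_def\<close>)
qed

lemma flat_box: "is_interval I \<Longrightarrow> I \<inter> snd ` S = {} \<Longrightarrow>
    flat_on I (t, box_Z (atoms (M \<omega>)) k t t, box_H (atoms (M \<omega>)) k t t)"
proof -
  assume I: "is_interval I" "I \<inter> snd ` S = {}"
  interpret B: box "atoms (M \<omega>)" k t by unfold_locales (rule gen)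
  have "flat_on I (graphical k ml t)"
  proof (rule graphical_flat_on[OF _ _ t0 I(1)])
    show "sorted (map fst ml)" using ml(1) by (simp add: strict_sorted_iff)
    show "\<forall>p\<in>set ml. 0 \<le> fst p" unfolding ml(2) by (auto simp: S_def)
    show "I \<inter> snd ` set ml = {}" unfolding ml(2) by (rule I(2))
  qed
  then show ?thesis using B.st_split[of t] by (simp add: box_state_def S_def)
qed

end

text \<open>The next mark sits at a random position, where the current state has to be evaluated.
  Hence the induction runs with all measurable evaluation points \<open>U\<close> instead of fixed
  positions.\<close>

lemma measurable_test_state:
  "(\<lambda>\<omega>. fst (test_state k (mark \<omega>) i)) \<in> borel_measurable F \<and>
   (\<forall>U\<in>borel_measurable F. (\<lambda>\<omega>. fst (snd (test_state k (mark \<omega>) i)) (U \<omega>)) \<in> borel_measurable F \<and>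
     (\<lambda>\<omega>. snd (snd (test_state k (mark \<omega>) i)) (U \<omega>)) \<in> borel_measurable F)"
proof (induction i)
  case (Suc i)
  define s where "s \<omega> = fst (test_state k (mark \<omega>) i)" for \<omega>
  define z where "z \<omega> = fst (snd (test_state k (mark \<omega>) i))" for \<omega>
  define h where "h \<omega> = snd (snd (test_state k (mark \<omega>) i))" for \<omega>
  have st: "test_state k (mark \<omega>) i = (s \<omega>, z \<omega>, h \<omega>)" for \<omega> by (simp add: s_def z_def h_def)
  have [measurable]: "s \<in> borel_measurable F" using Suc by (simp add: s_def[abs_def])
  have zh: "(\<lambda>\<omega>. z \<omega> (U \<omega>)) \<in> borel_measurable F" "(\<lambda>\<omega>. h \<omega> (U \<omega>)) \<in> borel_measurable F"
    if "U \<in> borel_measurable F" for U :: "'w \<Rightarrow> real"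
    using Suc that by (simp_all add: z_def h_def)
  define e where "e \<omega> x = min 1 (z \<omega> x + (mark_fst i \<omega> - s \<omega>))" for \<omega> x
  define g where "g \<omega> x = max 0 (h \<omega> x - (mark_fst i \<omega> - s \<omega>))" for \<omega> x
  have eg: "(\<lambda>\<omega>. e \<omega> (U \<omega>)) \<in> borel_measurable F" "(\<lambda>\<omega>. g \<omega> (U \<omega>)) \<in> borel_measurable F"
    if "U \<in> borel_measurable F" for U :: "'w \<Rightarrow> real"
    unfolding e_def g_def using zh[OF that, measurable] by measurable
  define y where "y = mark_snd i"
  have [measurable]: "y \<in> borel_measurable F" by (simp add: y_def)
  have step: "test_state k (mark \<omega>) (Suc i) = (mark_fst i \<omega>,
      \<lambda>x. if e \<omega> x = 1 \<and> unblocked k (range (\<lambda>j. mark_snd j \<omega>) \<union> \<rat>) (e \<omega>) (g \<omega>) (y \<omega>) x then 0 else e \<omega> x,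
      if e \<omega> (y \<omega>) < 1 then (g \<omega>)(y \<omega> := g \<omega> (y \<omega>) + e \<omega> (y \<omega>)) else g \<omega>)" for \<omega>
    unfolding test_state.simps st evolve.simps mark_def fst_conv snd_conv test_ignite.simps e_def g_def y_def ..
  have blk: "Measurable.pred F (\<lambda>\<omega>. V \<omega> \<in> barriers (e \<omega>) (g \<omega>) \<longrightarrow>
      \<not> (y \<omega> < V \<omega> \<and> V \<omega> \<le> U \<omega>) \<and> \<not> (U \<omega> \<le> V \<omega> \<and> V \<omega> < y \<omega>))"
    if [measurable]: "U \<in> borel_measurable F" "V \<in> borel_measurable F" for U V :: "'w \<Rightarrow> real"
    unfolding barriers_def mem_Collect_eq using eg[OF that(2), measurable] by measurable
  show ?case
  proof (intro conjI ballI)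
    show "(\<lambda>\<omega>. fst (test_state k (mark \<omega>) (Suc i))) \<in> borel_measurable F" unfolding step by simp
    fix U :: "'w \<Rightarrow> real" assume U [measurable]: "U \<in> borel_measurable F"
    \<comment> \<open>The test over the countable set splits into countable conjunctions, one over
      the marks and one over the rationals.\<close>
    have ub: "unblocked k (range (\<lambda>j. mark_snd j \<omega>) \<union> \<rat>) (e \<omega>) (g \<omega>) (y \<omega>) (U \<omega>) \<longleftrightarrow> -k \<le> y \<omega> \<and> y \<omega> \<le> k \<and>
        (U \<omega> \<in> barriers (e \<omega>) (g \<omega>) \<longrightarrow> \<not> (y \<omega> < U \<omega> \<and> U \<omega> \<le> U \<omega>) \<and> \<not> (U \<omega> \<le> U \<omega> \<and> U \<omega> < y \<omega>)) \<and>
        (\<forall>j. mark_snd j \<omega> \<in> barriers (e \<omega>) (g \<omega>) \<longrightarrow>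
          \<not> (y \<omega> < mark_snd j \<omega> \<and> mark_snd j \<omega> \<le> U \<omega>) \<and> \<not> (U \<omega> \<le> mark_snd j \<omega> \<and> mark_snd j \<omega> < y \<omega>)) \<and>
        (\<forall>q::rat. of_rat q \<in> barriers (e \<omega>) (g \<omega>) \<longrightarrow>
          \<not> (y \<omega> < of_rat q \<and> of_rat q \<le> U \<omega>) \<and> \<not> (U \<omega> \<le> of_rat q \<and> of_rat q < y \<omega>))" for \<omega>
      unfolding unblocked_def Rats_def by blast
    have [measurable]: "Measurable.pred F (\<lambda>\<omega>. unblocked k (range (\<lambda>j. mark_snd j \<omega>) \<union> \<rat>) (e \<omega>) (g \<omega>) (y \<omega>) (U \<omega>))"
      unfolding ub
    proof (intro pred_conj)
      show "Measurable.pred F (\<lambda>\<omega>. -k \<le> y \<omega>)" "Measurable.pred F (\<lambda>\<omega>. y \<omega> \<le> k)" by measurable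
    qed (rule blk[OF U U] pred_all blk[OF U measurable_mark(2)] blk[OF U borel_measurable_const])+
    note [measurable] = eg[OF U]
    have "(\<lambda>\<omega>. if e \<omega> (U \<omega>) = 1 \<and> unblocked k (range (\<lambda>j. mark_snd j \<omega>) \<union> \<rat>) (e \<omega>) (g \<omega>) (y \<omega>) (U \<omega>) then 0 else e \<omega> (U \<omega>)) \<in> borel_measurable F"
      by measurable
    then show "(\<lambda>\<omega>. fst (snd (test_state k (mark \<omega>) (Suc i))) (U \<omega>)) \<in> borel_measurable F" unfolding step by simp
    note [measurable] = eg[OF \<open>y \<in> borel_measurable F\<close>]
    have "(\<lambda>\<omega>. if e \<omega> (y \<omega>) < 1 \<and> U \<omega> = y \<omega> then g \<omega> (y \<omega>) + e \<omega> (y \<omega>) else g \<omega> (U \<omega>)) \<in> borel_measurable F"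
      by measurable
    moreover have "(\<lambda>\<omega>. snd (snd (test_state k (mark \<omega>) (Suc i))) (U \<omega>)) =
        (\<lambda>\<omega>. if e \<omega> (y \<omega>) < 1 \<and> U \<omega> = y \<omega> then g \<omega> (y \<omega>) + e \<omega> (y \<omega>) else g \<omega> (U \<omega>))"
      unfolding step by (auto simp: fun_eq_iff)
    ultimately show "(\<lambda>\<omega>. snd (snd (test_state k (mark \<omega>) (Suc i))) (U \<omega>)) \<in> borel_measurable F" by simp
  qed
qed simp

text \<open>The number of steps is random but takes countably many values.\<close>

lemma measurable_at_count:
  assumes "\<And>i. (\<lambda>\<omega>. f i \<omega>) \<in> measurable F N"
  shows "(\<lambda>\<omega>. f (nat \<lfloor>mark_count \<omega>\<rfloor>) \<omega>) \<in> measurable F N"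
proof (rule measurable_compose_countable[OF assms])
  have "(\<lambda>r :: real. nat \<lfloor>r\<rfloor>) \<in> measurable borel (count_space UNIV)" by measurable
  then show "(\<lambda>\<omega>. nat \<lfloor>mark_count \<omega>\<rfloor>) \<in> measurable F (count_space UNIV)"
    by (rule measurable_compose[OF measurable_mark(3)])
qed

definition "Zv \<omega> x = (case test_state k (mark \<omega>) (nat \<lfloor>mark_count \<omega>\<rfloor>) of (s, z, h) \<Rightarrow> min 1 (z x + (t - s)))"
definition "Hv \<omega> x = (case test_state k (mark \<omega>) (nat \<lfloor>mark_count \<omega>\<rfloor>) of (s, z, h) \<Rightarrow> max 0 (h x - (t - s)))"

lemma measurable_Zv:
  assumes "U \<in> borel_measurable F"
  shows "(\<lambda>\<omega>. Zv \<omega> (U \<omega>)) \<in> borel_measurable F" "(\<lambda>\<omega>. Hv \<omega> (U \<omega>)) \<in> borel_measurable F"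
proof -
  have [measurable]: "(\<lambda>\<omega>. fst (test_state k (mark \<omega>) i)) \<in> borel_measurable F"
    "(\<lambda>\<omega>. fst (snd (test_state k (mark \<omega>) i)) (U \<omega>)) \<in> borel_measurable F"
    "(\<lambda>\<omega>. snd (snd (test_state k (mark \<omega>) i)) (U \<omega>)) \<in> borel_measurable F" for i
    using measurable_test_state[of i] assms by blast+
  show "(\<lambda>\<omega>. Zv \<omega> (U \<omega>)) \<in> borel_measurable F"
    unfolding Zv_def case_prod_beta by (rule measurable_at_count) measurable
  show "(\<lambda>\<omega>. Hv \<omega> (U \<omega>)) \<in> borel_measurable F"
    unfolding Hv_def case_prod_beta by (rule measurable_at_count) measurable
qed

definition "incl \<omega> x q \<longleftrightarrow> unblocked k (range (\<lambda>j. mark_snd j \<omega>) \<union> \<rat>) (Zv \<omega>) (Hv \<omega>) q x"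
text \<open>The left end is recovered from the rational points of the cluster; other rationals
  contribute \<open>x\<close>, which also settles the one-point cluster.\<close>

definition "Lv \<omega> x = (INF q::rat. if of_rat q \<in> {-k..x} \<and> incl \<omega> x (of_rat q) then of_rat q else x)"
definition "Rv \<omega> x = (SUP q::rat. if of_rat q \<in> {x..k} \<and> incl \<omega> x (of_rat q) then of_rat q else x)"

lemma measurable_incl [measurable]: "Measurable.pred F (\<lambda>\<omega>. incl \<omega> x q)"
proof -
  have blk: "Measurable.pred F (\<lambda>\<omega>. V \<omega> \<in> barriers (Zv \<omega>) (Hv \<omega>) \<longrightarrow>
      \<not> (q < V \<omega> \<and> V \<omega> \<le> x) \<and> \<not> (x \<le> V \<omega> \<and> V \<omega> < q))"
    if [measurable]: "V \<in> borel_measurable F" for V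
    unfolding barriers_def mem_Collect_eq using measurable_Zv[OF that, measurable] by measurable
  have "incl \<omega> x q \<longleftrightarrow> -k \<le> q \<and> q \<le> k \<and>
        (x \<in> barriers (Zv \<omega>) (Hv \<omega>) \<longrightarrow> \<not> (q < x \<and> x \<le> x) \<and> \<not> (x \<le> x \<and> x < q)) \<and>
        (\<forall>j. mark_snd j \<omega> \<in> barriers (Zv \<omega>) (Hv \<omega>) \<longrightarrow>
          \<not> (q < mark_snd j \<omega> \<and> mark_snd j \<omega> \<le> x) \<and> \<not> (x \<le> mark_snd j \<omega> \<and> mark_snd j \<omega> < q)) \<and>
        (\<forall>r::rat. of_rat r \<in> barriers (Zv \<omega>) (Hv \<omega>) \<longrightarrow>
          \<not> (q < of_rat r \<and> of_rat r \<le> x) \<and> \<not> (x \<le> of_rat r \<and> of_rat r < q))" for \<omega>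
    unfolding incl_def unblocked_def Rats_def by blast
  note e = this
  show ?thesis
    unfolding e
  proof (intro pred_conj)
    show "Measurable.pred F (\<lambda>\<omega>. -k \<le> q)" "Measurable.pred F (\<lambda>\<omega>. q \<le> k)" by simp_all
  qed (rule blk[OF borel_measurable_const] pred_all blk[OF measurable_mark(2)])+
qed

lemma measurable_ends: "(\<lambda>\<omega>. Lv \<omega> x) \<in> borel_measurable F" "(\<lambda>\<omega>. Rv \<omega> x) \<in> borel_measurable F"
proof -
  show "(\<lambda>\<omega>. Lv \<omega> x) \<in> borel_measurable F"
    unfolding Lv_def
  proof (rule borel_measurable_cINF)
    fix \<omega>
    show "bdd_below ((\<lambda>q::rat. if of_rat q \<in> {-k..x} \<and> incl \<omega> x (of_rat q) then of_rat q else x) ` UNIV)"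
      by (rule bdd_belowI[of _ "min (-k) x"]) auto
  qed (simp_all, measurable)
  show "(\<lambda>\<omega>. Rv \<omega> x) \<in> borel_measurable F"
    unfolding Rv_def
  proof (rule borel_measurable_cSUP)
    fix \<omega>
    show "bdd_above ((\<lambda>q::rat. if of_rat q \<in> {x..k} \<and> incl \<omega> x (of_rat q) then of_rat q else x) ` UNIV)"
      by (rule bdd_aboveI[of _ "max k x"]) auto
  qed (simp_all, measurable)
qed

lemma values_eq:
  assumes good: "realisation (M \<omega>)" and x: "x \<in> {-k..k}"
  shows "Zv \<omega> x = box_Z (atoms (M \<omega>)) k t t x" "Hv \<omega> x = box_H (atoms (M \<omega>)) k t t x"
    "box_cluster k (box_Z (atoms (M \<omega>)) k t t) (box_H (atoms (M \<omega>)) k t t) x = {Lv \<omega> x..Rv \<omega> x}"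
proof -
  obtain s z h where st: "test_state k (mark \<omega>) (nat \<lfloor>mark_count \<omega>\<rfloor>) = (s, z, h)"
    "\<And>x. x \<in> {-k..k} \<Longrightarrow> box_Z (atoms (M \<omega>)) k t t x = min 1 (z x + (t - s))"
    "\<And>x. x \<in> {-k..k} \<Longrightarrow> box_H (atoms (M \<omega>)) k t t x = max 0 (h x - (t - s))"
    by (rule mark_state[OF good], rule that; (assumption | blast))
  have ZH: "Zv \<omega> u = box_Z (atoms (M \<omega>)) k t t u" "Hv \<omega> u = box_H (atoms (M \<omega>)) k t t u" if "u \<in> {-k..k}" for u
    using st(1) st(2,3)[OF that] by (simp_all add: Zv_def Hv_def)
  show "Zv \<omega> x = box_Z (atoms (M \<omega>)) k t t x" "Hv \<omega> x = box_H (atoms (M \<omega>)) k t t x" using ZH[OF x] .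
  let ?C = "box_cluster k (box_Z (atoms (M \<omega>)) k t t) (box_H (atoms (M \<omega>)) k t t) x"
  let ?Q = "range (\<lambda>j. mark_snd j \<omega>) \<union> \<rat>"
  \<comment> \<open>The marks are among the tested positions because the limits
    \<open>mark_snd\<close> find all of them.\<close>
  have Y: "snd ` S \<omega> \<union> \<rat> \<subseteq> ?Q"
  proof -
    have "snd p \<in> range (\<lambda>j. mark_snd j \<omega>)" if "p \<in> S \<omega>" for p
    proof -
      have "p \<in> set (sorted_key_list_of_set fst (S \<omega>))" using ml(2)[OF good] that by simp
      then obtain i where "i < card (S \<omega>)" "p = sorted_key_list_of_set fst (S \<omega>) ! i"
        using ml(3)[OF good] by (auto simp: in_set_conv_nth)
      then have "snd p = mark_snd i \<omega>" using mark_eq(2)[OF good, of i] by (simp add: mark_def prod_eq_iff)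
      then show ?thesis by blast
    qed
    then show ?thesis by blast
  qed
  have mem: "incl \<omega> x q \<longleftrightarrow> q \<in> ?C" for q
  proof -
    have "incl \<omega> x q \<longleftrightarrow> unblocked k ?Q (box_Z (atoms (M \<omega>)) k t t) (box_H (atoms (M \<omega>)) k t t) q x"
    proof (cases "-k \<le> q \<and> q \<le> k")
      case True
      have "v \<in> barriers (Zv \<omega>) (Hv \<omega>) \<longleftrightarrow> v \<in> barriers (box_Z (atoms (M \<omega>)) k t t) (box_H (atoms (M \<omega>)) k t t)"
        if "q < v \<and> v \<le> x \<or> x \<le> v \<and> v < q" for v
      proof -
        have "v \<in> {-k..k}" using that True x by auto
        then show ?thesis using ZH[of v] by (simp add: barriers_def)
      qed
      then show ?thesis unfolding incl_def unblocked_def by blast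
    qed (auto simp: incl_def unblocked_def)
    also have "\<dots> \<longleftrightarrow> q \<in> ?C"
      by (rule unblocked_iff[OF _ Y flat_box[OF good]]) (use x S_facts(1)[OF good] in auto)
    finally show ?thesis .
  qed
  obtain a b where ab: "?C = {a..b}" unfolding box_cluster_def by blast
  have "x \<in> ?C" "?C \<subseteq> {-k..k}" using x by (auto simp: mem_box_cluster)
  then have axb: "a \<le> x" "x \<le> b" "-k \<le> a" "b \<le> k" unfolding ab by auto
  have "Lv \<omega> x = a"
    unfolding Lv_def
  proof (rule cInf_eq_non_empty)
    fix u assume "u \<in> range (\<lambda>q::rat. if of_rat q \<in> {-k..x} \<and> incl \<omega> x (of_rat q) then of_rat q else x)"
    then show "a \<le> u" using axb(1) unfolding mem ab by (auto split: if_splits)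
  next
    fix w assume w: "\<And>u. u \<in> range (\<lambda>q::rat. if of_rat q \<in> {-k..x} \<and> incl \<omega> x (of_rat q) then of_rat q else x) \<Longrightarrow> w \<le> u"
    show "w \<le> a"
    proof (rule ccontr)
      assume wa: "\<not> w \<le> a"
      show False
      proof (cases "a = x")
        case True
        \<comment> \<open>For \<open>a = x\<close> every term of the infimum is \<open>x\<close>, so
          any rational serves; 0 is taken.\<close>
        have "w \<le> (if of_rat 0 \<in> {-k..x} \<and> incl \<omega> x (of_rat 0) then of_rat 0 else x)" by (rule w) blast
        then show False using True wa unfolding mem ab by (auto split: if_splits)
      next
        case False
        then have "a < min w x" using wa axb(1) by simp
        then obtain r where r: "r \<in> \<rat>" "a < r" "r < min w x" using Rats_dense_in_real by blast
        then obtain q :: rat where q: "r = of_rat q" by (auto elim: Rats_cases)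
        have "w \<le> (if of_rat q \<in> {-k..x} \<and> incl \<omega> x (of_rat q) then of_rat q else x)" by (rule w) blast
        moreover have "of_rat q \<in> {-k..x}" "incl \<omega> x (of_rat q)"
          using r axb unfolding mem ab q by auto
        ultimately show False using r q by simp
      qed
    qed
  qed blast
  moreover have "Rv \<omega> x = b"
    unfolding Rv_def
  proof (rule cSup_eq_non_empty)
    fix u assume "u \<in> range (\<lambda>q::rat. if of_rat q \<in> {x..k} \<and> incl \<omega> x (of_rat q) then of_rat q else x)"
    then show "u \<le> b" using axb(2) unfolding mem ab by (auto split: if_splits)
  next
    fix w assume w: "\<And>u. u \<in> range (\<lambda>q::rat. if of_rat q \<in> {x..k} \<and> incl \<omega> x (of_rat q) then of_rat q else x) \<Longrightarrow> u \<le> w"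
    show "b \<le> w"
    proof (rule ccontr)
      assume wb: "\<not> b \<le> w"
      show False
      proof (cases "b = x")
        case True
        have "(if of_rat 0 \<in> {x..k} \<and> incl \<omega> x (of_rat 0) then of_rat 0 else x) \<le> w" by (rule w) blast
        then show False using True wb unfolding mem ab by (auto split: if_splits)
      next
        case False
        then have "max w x < b" using wb axb(2) by simp
        then obtain r where r: "r \<in> \<rat>" "max w x < r" "r < b" using Rats_dense_in_real by blast
        then obtain q :: rat where q: "r = of_rat q" by (auto elim: Rats_cases)
        have "(if of_rat q \<in> {x..k} \<and> incl \<omega> x (of_rat q) then of_rat q else x) \<le> w" by (rule w) blast
        moreover have "of_rat q \<in> {x..k}" "incl \<omega> x (of_rat q)"
          using r axb unfolding mem ab q by auto
        ultimately show False using r q by simp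
      qed
    qed
  qed blast
  ultimately show "?C = {Lv \<omega> x..Rv \<omega> x}" using ab by simp
qed

end

section \<open>The atoms of the Poisson measure\<close>

text \<open>Masses are integers. Around any point the mass outside the atoms tends to 0 as balls
  shrink, so it drops below 1 and is then exactly 0; by compactness finitely many such balls cover a
  box.\<close>

lemma null_of_locally_null:
  fixes m :: "(real \<times> real) measure"
  assumes sets: "sets m = sets half_plane_lebesgue"
    and int: "\<And>B. B \<in> sets m \<Longrightarrow> emeasure m B \<in> range of_nat \<union> {\<top>}"
    and fin: "\<And>K::nat. emeasure m ({0..real K} \<times> {- real K..real K}) < \<infinity>"
    and atoms: "atoms m \<in> sets m"
  shows "emeasure m (space m - atoms m) = 0"
proof -
  have sp: "space m = {0..} \<times> UNIV"
    using sets_eq_imp_space_eq[OF sets] by (simp add: half_plane_lebesgue_def space_restrict_space)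
  have meas: "B \<in> sets m" if "B \<in> sets borel" "B \<subseteq> {0..} \<times> UNIV" for B
    unfolding sets half_plane_lebesgue_def sets_restrict_space using that by (auto intro!: rev_image_eqI[of B])
  have box0: "emeasure m ({0..real K} \<times> {- real K..real K} - atoms m) = 0" for K
  proof -
    define Bx where "Bx = {0..real K} \<times> {- real K..real K}"
    have Bx: "Bx \<in> sets borel" "Bx \<in> sets m" "compact Bx"
      unfolding Bx_def by (auto intro!: meas compact_Times borel_Times)
    have loc: "\<exists>e>0. emeasure m (ball p e \<inter> Bx - atoms m) = 0" if p: "p \<in> Bx" for p
    proof -
      define C where "C n = ball p (1 / real (Suc n)) \<inter> Bx - atoms m" for n
      have C: "C n \<in> sets m" for n
      proof -
        have "ball p (1 / real (Suc n)) \<inter> Bx \<in> sets m" using Bx(1) by (intro meas) (auto simp: Bx_def)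
        then show ?thesis unfolding C_def using atoms by blast
      qed
      have "(\<lambda>n. emeasure m (C n)) \<longlonglongrightarrow> emeasure m (\<Inter>n. C n)"
      proof (rule Lim_emeasure_decseq)
        show "range C \<subseteq> sets m" using C by blast
        have "ball p (1 / real (Suc n)) \<subseteq> ball p (1 / real (Suc j))" if "j \<le> n" for j n
          using that by (intro subset_ball divide_left_mono) simp_all
        then show "decseq C" unfolding decseq_def C_def by blast
        fix n
        have "emeasure m (C n) \<le> emeasure m Bx" by (rule emeasure_mono[OF _ Bx(2)]) (auto simp: C_def)
        then show "emeasure m (C n) \<noteq> \<infinity>" using fin[of K] unfolding Bx_def by (auto simp: top_unique)
      qed
      moreover have "emeasure m (\<Inter>n. C n) = 0"
      proof -
        have "(\<Inter>n. C n) \<subseteq> {p} - atoms m"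
        proof
          fix q assume q: "q \<in> (\<Inter>n. C n)"
          have "q = p"
          proof (rule ccontr)
            assume "q \<noteq> p"
            then obtain n where "1 / real (Suc n) < dist p q" using nat_approx_posE[of "dist p q"] by auto
            moreover have "q \<in> C n" using q by blast
            ultimately show False by (simp add: C_def)
          qed
          then show "q \<in> {p} - atoms m" using q by (auto simp: C_def)
        qed
        then consider "(\<Inter>n. C n) = {}" | "p \<notin> atoms m" "(\<Inter>n. C n) = {p}" by blast
        then show ?thesis by cases (auto simp: atoms_def)
      qed
      ultimately have "(\<lambda>n. emeasure m (C n)) \<longlonglongrightarrow> 0" by simp
      then have "\<forall>\<^sub>F n in sequentially. emeasure m (C n) < 1" by (rule order_tendstoD(2)) simp
      then obtain n where n: "emeasure m (C n) < 1" by (auto simp: eventually_sequentially)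
      have "emeasure m (C n) \<in> range of_nat \<union> {\<top>}" by (rule int[OF C])
      then obtain i :: nat where "emeasure m (C n) = of_nat i" using n by auto
      then have "emeasure m (C n) = 0" using n by (cases i) (auto simp: not_less)
      then show ?thesis unfolding C_def by (intro exI[of _ "1 / real (Suc n)"]) simp
    qed
    then obtain e where e: "\<And>p. p \<in> Bx \<Longrightarrow> 0 < e p \<and> emeasure m (ball p (e p) \<inter> Bx - atoms m) = 0" by metis
    have "Bx \<subseteq> (\<Union>p\<in>Bx. ball p (e p))" using e by force
    then obtain D where D: "D \<subseteq> Bx" "finite D" "Bx \<subseteq> (\<Union>p\<in>D. ball p (e p))"
      using compactE_image[OF Bx(3), of Bx "\<lambda>p. ball p (e p)"] by auto
    have "ball p (e p) \<inter> Bx - atoms m \<in> null_sets m" if "p \<in> D" for p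
    proof -
      have "ball p (e p) \<inter> Bx \<in> sets m" using Bx(1) by (intro meas) (auto simp: Bx_def)
      then show ?thesis using e[of p] D(1) that atoms by (auto simp: null_sets_def)
    qed
    then have N: "(\<Union>p\<in>D. ball p (e p) \<inter> Bx - atoms m) \<in> null_sets m"
      using D(2) by (intro null_sets_UN') (auto intro: countable_finite)
    have sub: "Bx - atoms m \<subseteq> (\<Union>p\<in>D. ball p (e p) \<inter> Bx - atoms m)" using D(3) by blast
    have "Bx - atoms m \<in> null_sets m" by (rule null_sets_subset[OF N _ sub]) (use Bx(2) atoms in blast)
    then show ?thesis unfolding Bx_def by (simp add: null_sets_def)
  qed
  have "(\<Union>K::nat. {0..real K} \<times> {- real K..real K} - atoms m) \<in> null_sets m"
  proof (rule null_sets_UN)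
    fix K :: nat
    have "{0..real K} \<times> {- real K..real K} \<in> sets m" by (intro meas) (auto intro!: borel_Times)
    then show "{0..real K} \<times> {- real K..real K} - atoms m \<in> null_sets m" using box0 atoms by (auto simp: null_sets_def)
  qed
  moreover have "space m - atoms m = (\<Union>K::nat. {0..real K} \<times> {- real K..real K} - atoms m)"
  proof (intro equalityI subsetI)
    fix p assume p: "p \<in> space m - atoms m"
    obtain K :: nat where "max (fst p) \<bar>snd p\<bar> \<le> real K" using real_arch_simple by blast
    then have "p \<in> {0..real K} \<times> {- real K..real K}" using p sp by (cases p) auto
    then show "p \<in> (\<Union>K::nat. {0..real K} \<times> {- real K..real K} - atoms m)" using p by blast
  qed (auto simp: sp)
  ultimately show ?thesis by (simp add: null_sets_def)
qed

locale poisson = prob_space P for P :: "'w measure" +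
  fixes M :: "'w \<Rightarrow> (real \<times> real) measure"
  assumes poisson: "poisson_measure P half_plane_lebesgue M"
begin

lemma sets_M: "\<omega> \<in> space P \<Longrightarrow> sets (M \<omega>) = sets half_plane_lebesgue"
  and int_M: "\<omega> \<in> space P \<Longrightarrow> B \<in> sets half_plane_lebesgue \<Longrightarrow> emeasure (M \<omega>) B \<in> range of_nat \<union> {\<top>}"
  using poisson unfolding poisson_measure_def by blast+

lemma count_measurable [measurable]:
  "B \<in> sets half_plane_lebesgue \<Longrightarrow> (\<lambda>\<omega>. emeasure (M \<omega>) B) \<in> borel_measurable P"
  using poisson unfolding poisson_measure_def by blast

lemma half_planeI: "B \<in> sets borel \<Longrightarrow> B \<subseteq> {0..} \<times> UNIV \<Longrightarrow> B \<in> sets half_plane_lebesgue"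
  unfolding half_plane_lebesgue_def sets_restrict_space by (auto intro!: rev_image_eqI[of B])

lemma half_plane_measure:
  assumes "B \<in> sets borel" "B \<subseteq> {0..} \<times> UNIV"
  shows "emeasure half_plane_lebesgue B = emeasure lborel B" "measure half_plane_lebesgue B = measure lborel B"
proof -
  show "emeasure half_plane_lebesgue B = emeasure lborel B"
    unfolding half_plane_lebesgue_def by (rule emeasure_restrict_space) (use assms in \<open>auto intro!: borel_Times\<close>)
  then show "measure half_plane_lebesgue B = measure lborel B" by (simp add: measure_def)
qed

lemma prob_count:
  assumes "B \<in> sets borel" "B \<subseteq> {0..} \<times> UNIV" "emeasure lborel B < \<infinity>"
  shows "prob {\<omega> \<in> space P. emeasure (M \<omega>) B = of_nat j} =
    measure lborel B ^ j / fact j * exp (- measure lborel B)"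
  using poisson half_planeI[OF assms(1,2)] assms(3) unfolding poisson_measure_def half_plane_measure[OF assms(1,2), symmetric]
  by blast

lemma count_event [measurable]:
  assumes "B \<in> sets borel" "B \<subseteq> {0..} \<times> UNIV" "V \<in> sets borel"
  shows "{\<omega> \<in> space P. emeasure (M \<omega>) B \<in> V} \<in> events"
  using measurable_sets[OF count_measurable[OF half_planeI[OF assms(1,2)]] assms(3)]
  by (simp add: vimage_def Int_def conj_commute)

lemma prob_nonzero:
  assumes "B \<in> sets borel" "B \<subseteq> {0..} \<times> UNIV" "emeasure lborel B < \<infinity>"
  shows "prob {\<omega> \<in> space P. emeasure (M \<omega>) B \<noteq> 0} = 1 - exp (- measure lborel B)"
    and "prob {\<omega> \<in> space P. emeasure (M \<omega>) B \<noteq> 0} \<le> measure lborel B"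
proof -
  have ev: "{\<omega> \<in> space P. emeasure (M \<omega>) B = 0} \<in> events"
    using count_event[OF assms(1,2), of "{0}"] by simp
  have "{\<omega> \<in> space P. emeasure (M \<omega>) B \<noteq> 0} = space P - {\<omega> \<in> space P. emeasure (M \<omega>) B = 0}" by blast
  then show *: "prob {\<omega> \<in> space P. emeasure (M \<omega>) B \<noteq> 0} = 1 - exp (- measure lborel B)"
    using prob_compl[OF ev] prob_count[OF assms, of 0] by simp
  show "prob {\<omega> \<in> space P. emeasure (M \<omega>) B \<noteq> 0} \<le> measure lborel B"
    using exp_ge_add_one_self[of "- measure lborel B"] unfolding * by simp
qed

text \<open>The probability is \<open>1 - (1 + v) * exp (- v)\<close>, and
  \<open>exp (- v) \<ge> 1 - v\<close>.\<close>

lemma prob_many: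
  assumes "B \<in> sets borel" "B \<subseteq> {0..} \<times> UNIV" "emeasure lborel B < \<infinity>"
  shows "prob {\<omega> \<in> space P. emeasure (M \<omega>) B \<notin> {0, 1}} \<le> measure lborel B ^ 2"
proof -
  define v where "v = measure lborel B"
  have ev: "{\<omega> \<in> space P. emeasure (M \<omega>) B \<in> {c}} \<in> events" for c
    by (rule count_event[OF assms(1,2)]) simp
  have "prob ({\<omega> \<in> space P. emeasure (M \<omega>) B \<in> {0}} \<union> {\<omega> \<in> space P. emeasure (M \<omega>) B \<in> {1}}) =
      prob {\<omega> \<in> space P. emeasure (M \<omega>) B \<in> {0}} + prob {\<omega> \<in> space P. emeasure (M \<omega>) B \<in> {1}}"
    by (rule finite_measure_Union[OF ev ev]) auto
  also have "\<dots> = exp (- v) + v * exp (- v)"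
    using prob_count[OF assms, of 0] prob_count[OF assms, of 1] by (simp add: v_def)
  finally have "prob ({\<omega> \<in> space P. emeasure (M \<omega>) B \<in> {0}} \<union> {\<omega> \<in> space P. emeasure (M \<omega>) B \<in> {1}}) = (1 + v) * exp (- v)"
    by (simp add: algebra_simps)
  moreover have "{\<omega> \<in> space P. emeasure (M \<omega>) B \<notin> {0, 1}} =
      space P - ({\<omega> \<in> space P. emeasure (M \<omega>) B \<in> {0}} \<union> {\<omega> \<in> space P. emeasure (M \<omega>) B \<in> {1}})" by blast
  ultimately have "prob {\<omega> \<in> space P. emeasure (M \<omega>) B \<notin> {0, 1}} = 1 - (1 + v) * exp (- v)"
    using prob_compl[OF sets.Un[OF ev[of 0] ev[of 1]]] by simp
  also have "\<dots> \<le> 1 - (1 + v) * (1 - v)"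
    using exp_ge_add_one_self[of "- v"] by (intro diff_left_mono mult_left_mono) (simp_all add: v_def)
  finally show ?thesis by (simp add: v_def power2_eq_square algebra_simps)
qed

text \<open>Infinite counts are allowed by \<open>poisson_measure\<close>, but the Poisson weights
  of the finite ones already sum to 1.\<close>

lemma AE_finite:
  assumes "B \<in> sets borel" "B \<subseteq> {0..} \<times> UNIV" "emeasure lborel B < \<infinity>"
  shows "AE \<omega> in P. emeasure (M \<omega>) B < \<infinity>"
proof -
  define v where "v = measure lborel B"
  define E where "E j = {\<omega> \<in> space P. emeasure (M \<omega>) B \<in> {of_nat j}}" for j :: nat
  have E: "E j \<in> events" for j unfolding E_def by (rule count_event[OF assms(1,2)]) simp
  have "(\<lambda>j. v ^ j /\<^sub>R fact j) sums exp v" by (rule exp_converges)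
  then have "(\<lambda>j. v ^ j /\<^sub>R fact j * exp (- v)) sums (exp v * exp (- v))" by (rule sums_mult2)
  then have "(\<lambda>j. prob (E j)) sums 1"
    using prob_count[OF assms] by (simp add: E_def v_def exp_minus_inverse divide_inverse mult_ac)
  moreover have "(\<lambda>j. prob (E j)) sums prob (\<Union>j. E j)"
    by (rule finite_measure_UNION) (use E in \<open>auto simp: disjoint_family_on_def E_def\<close>)
  ultimately have "prob (\<Union>j. E j) = 1" using sums_unique2 by blast
  then have "AE \<omega> in P. \<omega> \<in> (\<Union>j. E j)" using prob_eq_1[of "\<Union>j. E j"] E by blast
  then show ?thesis by eventually_elim (auto simp: E_def of_nat_less_top)
qed

lemma prob_INT:
  fixes B :: "nat \<Rightarrow> (real \<times> real) set"
  assumes "finite J" "J \<noteq> {}" "\<And>j. j \<in> J \<Longrightarrow> B j \<in> sets borel \<and> B j \<subseteq> {0..} \<times> UNIV"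
    "disjoint_family_on B J" "\<And>j. j \<in> J \<Longrightarrow> V j \<in> sets borel"
  shows "prob (\<Inter>j\<in>J. {\<omega> \<in> space P. emeasure (M \<omega>) (B j) \<in> V j}) =
    (\<Prod>j\<in>J. prob {\<omega> \<in> space P. emeasure (M \<omega>) (B j) \<in> V j})"
proof -
  have "B ` J \<subseteq> sets half_plane_lebesgue" using assms(3) half_planeI by blast
  then have "indep_vars (\<lambda>_. borel) (\<lambda>j \<omega>. emeasure (M \<omega>) (B j)) J"
    using poisson assms(1,4) unfolding poisson_measure_def by blast
  from indep_varsD[OF this assms(2,1) order_refl assms(5)] show ?thesis
    by (simp add: vimage_def Int_def conj_commute)
qed

definition "box_nat K = {0..real K} \<times> {- real K..real K}"
text \<open>Slices of width \<open>1 / n\<close> in one coordinate. \<open>f\<close> will be the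
  time, or the position shifted by \<open>real K\<close>; both are nonnegative on the box, so
  \<open>nat\<close> truncates nothing.\<close>

definition "strip f K n i = {p \<in> box_nat K. nat \<lfloor>f p * real n\<rfloor> = i}" for f :: "real \<times> real \<Rightarrow> real"

lemma box_nat: "box_nat K \<in> sets borel" "box_nat K \<subseteq> {0..} \<times> UNIV" "emeasure lborel (box_nat K) < \<infinity>"
proof -
  show "box_nat K \<in> sets borel" unfolding box_nat_def by (intro borel_Times) simp_all
  show "box_nat K \<subseteq> {0..} \<times> UNIV" unfolding box_nat_def by auto
  have "bounded (box_nat K)" unfolding box_nat_def by (intro bounded_Times) simp_all
  then show "emeasure lborel (box_nat K) < \<infinity>" by (rule emeasure_bounded_finite)
qed

lemma strip:
  assumes "f \<in> {fst, \<lambda>p. snd p + real K}" "1 \<le> n"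
  shows "strip f K n i \<in> sets borel" "strip f K n i \<subseteq> {0..} \<times> UNIV" "emeasure lborel (strip f K n i) < \<infinity>"
    "measure lborel (strip f K n i) \<le> 2 * real K / real n"
proof -
  have [measurable]: "(fst :: real \<times> real \<Rightarrow> real) \<in> borel_measurable borel" "(snd :: real \<times> real \<Rightarrow> real) \<in> borel_measurable borel"
    by (intro borel_measurable_continuous_onI continuous_intros)+
  have [measurable]: "f \<in> borel_measurable borel" using assms(1) by auto
  have "{p \<in> space borel. nat \<lfloor>f p * real n\<rfloor> = i} \<in> sets borel" by measurable
  then have "box_nat K \<inter> {p \<in> space borel. nat \<lfloor>f p * real n\<rfloor> = i} \<in> sets borel" using box_nat(1) by blast
  moreover have "box_nat K \<inter> {p \<in> space borel. nat \<lfloor>f p * real n\<rfloor> = i} = strip f K n i" by (auto simp: strip_def)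
  ultimately show S: "strip f K n i \<in> sets borel" by simp
  show "strip f K n i \<subseteq> {0..} \<times> UNIV" using box_nat(2) by (auto simp: strip_def)
  have n: "0 < real n" using assms(2) by simp
  have fl: "real i / real n \<le> f p" "f p \<le> (real i + 1) / real n" if "p \<in> strip f K n i" for p
  proof -
    have "0 \<le> f p" using that assms(1) by (auto simp: strip_def box_nat_def)
    then have "0 \<le> f p * real n" using n by simp
    then have "real i \<le> f p * real n" "f p * real n \<le> real i + 1" using that by (auto simp: strip_def)
    then show "real i / real n \<le> f p" "f p \<le> (real i + 1) / real n" using n by (simp_all add: field_simps)
  qed
  have mb: "measure lborel (strip f K n i) \<le> (b - a) * (d - c)"
    if "a \<le> b" "c \<le> d" "strip f K n i \<subseteq> {a..b} \<times> {c..d}" for a b c d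
  proof -
    have cb: "cbox (a, c) (b, d) = {a..b} \<times> {c..d}" by (simp add: cbox_Pair_eq)
    have "measure lborel (strip f K n i) \<le> measure lborel (cbox (a, c) (b, d))"
      by (rule measure_mono_fmeasurable[OF _ _ fmeasurable_cbox]) (simp_all only: cb that(3) S sets_lborel)
    also have "\<dots> = (b - a) * (d - c)"
      using that(1,2) by (subst content_Pair) simp
    finally show ?thesis .
  qed
  from assms(1) have "f = fst \<or> f = (\<lambda>p. snd p + real K)" by blast
  then show "measure lborel (strip f K n i) \<le> 2 * real K / real n"
  proof
    assume f: "f = fst"
    have "measure lborel (strip f K n i) \<le> ((real i + 1) / real n - real i / real n) * (real K - (- real K))"
    proof (rule mb)
      show "real i / real n \<le> (real i + 1) / real n" using n by (intro divide_right_mono) simp_all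
      show "strip f K n i \<subseteq> {real i / real n..(real i + 1) / real n} \<times> {- real K..real K}"
      proof
        fix p assume p: "p \<in> strip f K n i"
        then have "p \<in> box_nat K" by (simp add: strip_def)
        then show "p \<in> {real i / real n..(real i + 1) / real n} \<times> {- real K..real K}"
          using fl[OF p] f by (cases p) (auto simp: box_nat_def)
      qed
    qed simp
    also have "\<dots> = 2 * real K / real n" by (simp add: diff_divide_distrib[symmetric])
    finally show ?thesis .
  next
    assume f: "f = (\<lambda>p. snd p + real K)"
    have "measure lborel (strip f K n i) \<le> (real K - 0) * (((real i + 1) / real n - real K) - (real i / real n - real K))"
    proof (rule mb)
      show "real i / real n - real K \<le> (real i + 1) / real n - real K" using n by (intro diff_right_mono divide_right_mono) simp_all
      show "strip f K n i \<subseteq> {0..real K} \<times> {real i / real n - real K..(real i + 1) / real n - real K}"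
      proof
        fix p assume p: "p \<in> strip f K n i"
        then have "p \<in> box_nat K" by (simp add: strip_def)
        then show "p \<in> {0..real K} \<times> {real i / real n - real K..(real i + 1) / real n - real K}"
          using fl[OF p] f by (cases p) (auto simp: box_nat_def)
      qed
    qed simp
    also have "\<dots> = real K / real n" by (simp add: diff_divide_distrib[symmetric])
    also have "\<dots> \<le> 2 * real K / real n" using n by (intro divide_right_mono) simp_all
    finally show ?thesis .
  qed
  have "emeasure lborel (strip f K n i) \<le> emeasure lborel (box_nat K)"
    by (rule emeasure_mono) (use box_nat(1) in \<open>auto simp: strip_def\<close>)
  then show "emeasure lborel (strip f K n i) < \<infinity>" using box_nat(3)[of K] by (rule le_less_trans)
qed

definition "many f K n = (\<Union>i\<in>{..2 * K * n}. {\<omega> \<in> space P. emeasure (M \<omega>) (strip f K n i) \<notin> {0, 1}})"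

text \<open>If times of marks satisfy a coincidence excluded by \<open>generic\<close>, the indices
  of their strips satisfy it up to rounding: \<open>u = b + 1\<close> gives
  \<open>{i, i + n}\<close>, \<open>u = 2 * s\<close> gives \<open>{i, 2 * i}\<close> or
  \<open>{i, 2 * i + 1}\<close>, and \<open>u = 2 * s - b\<close> gives the index
  \<open>2 * j + e - i - 1\<close>, where \<open>e\<close> is the rounding error shifted by
  1.\<close>

definition "patterns K n = ((\<lambda>i. {i, i + n}) ` {..2 * K * n} \<union> (\<lambda>i. {i, 2 * i}) ` {..2 * K * n} \<union> (\<lambda>i. {i, 2 * i + 1}) ` {..2 * K * n},
  (\<lambda>(i, j, e). {i, j, 2 * j + e - i - 1}) ` ({..2 * K * n} \<times> {..2 * K * n} \<times> {..2 :: nat}))"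

definition "hit K n J = (\<Inter>i\<in>J. {\<omega> \<in> space P. emeasure (M \<omega>) (strip fst K n i) \<in> - {0}})"

lemma hit_event: "1 \<le> n \<Longrightarrow> finite J \<Longrightarrow> J \<noteq> {} \<Longrightarrow> hit K n J \<in> events"
  unfolding hit_def by (intro sets.finite_INT count_event strip) auto

text \<open>Distinct strips are disjoint, hence independent, and each is hit with probability at
  most its area.\<close>

lemma prob_hit:
  assumes "1 \<le> n" "finite J" "J \<noteq> {}"
  shows "prob (hit K n J) \<le> (2 * real K / real n) ^ card J"
proof -
  have "prob (hit K n J) = (\<Prod>i\<in>J. prob {\<omega> \<in> space P. emeasure (M \<omega>) (strip fst K n i) \<in> - {0}})"
    unfolding hit_def
  proof (rule prob_INT[OF assms(2,3)])
    show "disjoint_family_on (strip fst K n) J" by (auto simp: disjoint_family_on_def strip_def)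
  qed (use strip[of fst K n] assms(1) in auto)
  also have "\<dots> \<le> (\<Prod>i\<in>J. 2 * real K / real n)"
  proof (intro prod_mono conjI measure_nonneg)
    fix i
    have "prob {\<omega> \<in> space P. emeasure (M \<omega>) (strip fst K n i) \<in> - {0}} \<le> measure lborel (strip fst K n i)"
      using prob_nonzero(2)[of "strip fst K n i"] strip[of fst K n i] assms(1) by simp
    also have "\<dots> \<le> 2 * real K / real n" using strip(4)[of fst K n i] assms(1) by simp
    finally show "prob {\<omega> \<in> space P. emeasure (M \<omega>) (strip fst K n i) \<in> - {0}} \<le> 2 * real K / real n" .
  qed
  finally show ?thesis by simp
qed

text \<open>At most \<open>3 * K * n\<close> strips, each with probability at most
  \<open>(2 * K / n) ^ 2\<close>.\<close>

lemma prob_many_strips: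
  assumes "1 \<le> n" "1 \<le> K" "f \<in> {fst, \<lambda>p. snd p + real K}"
  shows "many f K n \<in> events" "prob (many f K n) \<le> 12 * real K ^ 3 / real n"
proof -
  have ev: "{\<omega> \<in> space P. emeasure (M \<omega>) (strip f K n i) \<notin> {0, 1}} \<in> events" for i
    using count_event[OF strip(1,2)[OF assms(3,1)], of "- {0, 1}"] by simp
  then show "many f K n \<in> events" unfolding many_def by blast
  have "prob (many f K n) \<le> (\<Sum>i\<in>{..2 * K * n}. prob {\<omega> \<in> space P. emeasure (M \<omega>) (strip f K n i) \<notin> {0, 1}})"
    unfolding many_def by (rule finite_measure_subadditive_finite) (use ev in auto)
  also have "\<dots> \<le> (\<Sum>i\<in>{..2 * K * n}. (2 * real K / real n) ^ 2)"
  proof (rule sum_mono)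
    fix i
    have "prob {\<omega> \<in> space P. emeasure (M \<omega>) (strip f K n i) \<notin> {0, 1}} \<le> measure lborel (strip f K n i) ^ 2"
      by (rule prob_many[OF strip(1-3)[OF assms(3,1)]])
    also have "\<dots> \<le> (2 * real K / real n) ^ 2" by (rule power_mono[OF strip(4)[OF assms(3,1)]]) simp
    finally show "prob {\<omega> \<in> space P. emeasure (M \<omega>) (strip f K n i) \<notin> {0, 1}} \<le> (2 * real K / real n) ^ 2" .
  qed
  also have "\<dots> = (2 * real K * real n + 1) * (2 * real K / real n) ^ 2" by simp
  also have "\<dots> \<le> (3 * real K * real n) * (2 * real K / real n) ^ 2"
  proof (rule mult_right_mono)
    have "1 \<le> K * n" using assms(1,2) by simp
    then have "1 \<le> real K * real n" by (metis of_nat_1 of_nat_le_iff of_nat_mult)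
    then show "2 * real K * real n + 1 \<le> 3 * real K * real n" by simp
  qed simp
  also have "\<dots> = 12 * real K ^ 3 / real n" using assms(1) by (simp add: field_simps power2_eq_square power3_eq_cube)
  finally show "prob (many f K n) \<le> 12 * real K ^ 3 / real n" .
qed

definition "coincide K n = (\<Union>J\<in>{J \<in> fst (patterns K n). card J = 2}. hit K n J) \<union> (\<Union>J\<in>{J \<in> snd (patterns K n). card J = 3}. hit K n J)"

text \<open>There are of order \<open>n\<close> patterns with two strips and of order
  \<open>n ^ 2\<close> with three, of probabilities of order \<open>1 / n ^ 2\<close> and
  \<open>1 / n ^ 3\<close>. The cardinality conditions in \<open>coincide\<close> keep just the
  patterns for which these orders hold.\<close>

lemma prob_coincide:
  assumes "1 \<le> n" "1 \<le> K"
  shows "coincide K n \<in> events" "prob (coincide K n) \<le> (36 * real K ^ 3 + 216 * real K ^ 5) / real n"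
proof -
  let ?I = "{..2 * K * n}"
  have I: "real (card ?I) \<le> 3 * real K * real n"
  proof -
    have "1 \<le> K * n" using assms(1,2) by simp
    then have "1 \<le> real K * real n" by (metis of_nat_1 of_nat_le_iff of_nat_mult)
    then show ?thesis by simp
  qed
  have fin: "finite (fst (patterns K n))" "finite (snd (patterns K n))" by (simp_all add: patterns_def)
  have "card (fst (patterns K n)) \<le> card ?I + card ?I + card ?I"
    unfolding patterns_def fst_conv
    by (intro order_trans[OF card_Un_le] add_mono card_image_le) simp_all
  then have c2: "real (card (fst (patterns K n))) \<le> 9 * real K * real n" using I by linarith
  have "card (snd (patterns K n)) \<le> card (?I \<times> ?I \<times> {..2::nat})"
    unfolding patterns_def snd_conv by (rule card_image_le) simp
  also have "card (?I \<times> ?I \<times> {..2::nat}) = card ?I * card ?I * 3"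
    by (simp only: card_cartesian_product card_atMost mult.assoc) simp
  finally have "card (snd (patterns K n)) \<le> card ?I * card ?I * 3" .
  then have "real (card (snd (patterns K n))) \<le> real (card ?I) * real (card ?I) * 3"
    by (metis of_nat_le_iff of_nat_mult of_nat_numeral)
  also have "\<dots> \<le> (3 * real K * real n) * (3 * real K * real n) * 3" by (intro mult_right_mono mult_mono I) simp_all
  finally have c3: "real (card (snd (patterns K n))) \<le> 27 * (real K * real n) ^ 2" by (simp add: power2_eq_square)
  have un: "(\<Union>J\<in>{J \<in> C. card J = d}. hit K n J) \<in> events \<and>
      prob (\<Union>J\<in>{J \<in> C. card J = d}. hit K n J) \<le> real (card C) * (2 * real K / real n) ^ d"
    if "finite C" "0 < d" for C d
  proof
    have J: "finite J" "J \<noteq> {}" if "J \<in> {J \<in> C. card J = d}" for J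
      using that \<open>0 < d\<close> by (auto intro: card_ge_0_finite)
    have ev: "hit K n J \<in> events" if "J \<in> {J \<in> C. card J = d}" for J
      by (rule hit_event[OF assms(1) J[OF that]])
    then show "(\<Union>J\<in>{J \<in> C. card J = d}. hit K n J) \<in> events" using that(1) by (intro sets.finite_UN) auto
    have "prob (\<Union>J\<in>{J \<in> C. card J = d}. hit K n J) \<le> (\<Sum>J\<in>{J \<in> C. card J = d}. prob (hit K n J))"
      by (rule finite_measure_subadditive_finite) (use that(1) ev in auto)
    also have "\<dots> \<le> (\<Sum>J\<in>{J \<in> C. card J = d}. (2 * real K / real n) ^ d)"
    proof (rule sum_mono)
      fix J assume a: "J \<in> {J \<in> C. card J = d}"
      show "prob (hit K n J) \<le> (2 * real K / real n) ^ d" using prob_hit[OF assms(1) J[OF a], of K] a by simp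
    qed
    also have "\<dots> = real (card {J \<in> C. card J = d}) * (2 * real K / real n) ^ d" by simp
    also have "\<dots> \<le> real (card C) * (2 * real K / real n) ^ d"
      by (intro mult_right_mono of_nat_mono card_mono that(1)) auto
    finally show "prob (\<Union>J\<in>{J \<in> C. card J = d}. hit K n J) \<le> real (card C) * (2 * real K / real n) ^ d" .
  qed
  have u2: "(\<Union>J\<in>{J \<in> fst (patterns K n). card J = 2}. hit K n J) \<in> events"
      "prob (\<Union>J\<in>{J \<in> fst (patterns K n). card J = 2}. hit K n J) \<le> real (card (fst (patterns K n))) * (2 * real K / real n) ^ 2"
    using un[OF fin(1), of 2] by simp_all
  have u3: "(\<Union>J\<in>{J \<in> snd (patterns K n). card J = 3}. hit K n J) \<in> events"
      "prob (\<Union>J\<in>{J \<in> snd (patterns K n). card J = 3}. hit K n J) \<le> real (card (snd (patterns K n))) * (2 * real K / real n) ^ 3"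
    using un[OF fin(2), of 3] by simp_all
  show "coincide K n \<in> events" unfolding coincide_def using u2(1) u3(1) by blast
  have "prob (coincide K n) \<le> prob (\<Union>J\<in>{J \<in> fst (patterns K n). card J = 2}. hit K n J) + prob (\<Union>J\<in>{J \<in> snd (patterns K n). card J = 3}. hit K n J)"
    unfolding coincide_def by (rule measure_Un_le[OF u2(1) u3(1)])
  also have "\<dots> \<le> real (card (fst (patterns K n))) * (2 * real K / real n) ^ 2 + real (card (snd (patterns K n))) * (2 * real K / real n) ^ 3"
    by (rule add_mono[OF u2(2) u3(2)])
  also have "\<dots> \<le> 9 * real K * real n * (2 * real K / real n) ^ 2 + 27 * (real K * real n) ^ 2 * (2 * real K / real n) ^ 3"
    by (intro add_mono mult_right_mono c2 c3) simp_all
  also have "\<dots> = (36 * real K ^ 3 + 216 * real K ^ 5) / real n"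
    using assms(1) by (simp add: field_simps power2_eq_square power3_eq_cube eval_nat_numeral)
  finally show "prob (coincide K n) \<le> (36 * real K ^ 3 + 216 * real K ^ 5) / real n" .
qed

text \<open>The grid of step \<open>1 / n\<close> is bad with probability at most
  \<open>D / n\<close>, so all grids being bad is a null event. One good grid per box
  suffices.\<close>

lemma AE_good_grid:
  assumes "1 \<le> K"
  shows "AE \<omega> in P. \<exists>n\<ge>1. \<omega> \<notin> many fst K n \<and> \<omega> \<notin> many (\<lambda>p. snd p + real K) K n \<and> \<omega> \<notin> coincide K n"
proof -
  define Bad where "Bad n = many fst K (Suc n) \<union> many (\<lambda>p. snd p + real K) K (Suc n) \<union> coincide K (Suc n)" for n
  define D where "D = 12 * real K ^ 3 + 12 * real K ^ 3 + (36 * real K ^ 3 + 216 * real K ^ 5)"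
  have 1: "1 \<le> Suc n" for n by simp
  have ev: "Bad n \<in> events" for n
    unfolding Bad_def using prob_many_strips(1)[OF 1 assms] prob_coincide(1)[OF 1 assms] by blast
  have bd: "prob (Bad n) \<le> D / real (Suc n)" for n
  proof -
    have "prob (Bad n) \<le> prob (many fst K (Suc n) \<union> many (\<lambda>p. snd p + real K) K (Suc n)) + prob (coincide K (Suc n))"
      unfolding Bad_def by (rule measure_Un_le) (use prob_many_strips(1)[OF 1 assms] prob_coincide(1)[OF 1 assms] in blast)+
    also have "prob (many fst K (Suc n) \<union> many (\<lambda>p. snd p + real K) K (Suc n)) \<le> prob (many fst K (Suc n)) + prob (many (\<lambda>p. snd p + real K) K (Suc n))"
      by (rule measure_Un_le) (use prob_many_strips(1)[OF 1 assms] in blast)+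
    finally have "prob (Bad n) \<le> prob (many fst K (Suc n)) + prob (many (\<lambda>p. snd p + real K) K (Suc n)) + prob (coincide K (Suc n))"
      by simp
    also have "\<dots> \<le> 12 * real K ^ 3 / real (Suc n) + 12 * real K ^ 3 / real (Suc n) + (36 * real K ^ 3 + 216 * real K ^ 5) / real (Suc n)"
      by (intro add_mono prob_many_strips(2)[OF 1 assms] prob_coincide(2)[OF 1 assms]) simp_all
    also have "\<dots> = D / real (Suc n)" by (simp only: D_def add_divide_distrib)
    finally show ?thesis .
  qed
  have "(\<lambda>n. D / real (Suc n)) \<longlonglongrightarrow> 0" by (rule LIMSEQ_Suc[OF lim_const_over_n])
  have "prob (\<Inter>n. Bad n) \<le> D / real (Suc n)" for n
    by (rule order_trans[OF finite_measure_mono bd]) (use ev in auto)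
  then have "prob (\<Inter>n. Bad n) \<le> 0"
    by (intro LIMSEQ_le_const[OF \<open>(\<lambda>n. D / real (Suc n)) \<longlonglongrightarrow> 0\<close>]) blast
  then have "prob (\<Inter>n. Bad n) = 0" by (rule antisym[OF _ measure_nonneg])
  then have "(\<Inter>n. Bad n) \<in> null_sets P" using ev by (simp add: null_sets_def emeasure_eq_measure)
  from AE_not_in[OF this] show ?thesis
  proof eventually_elim
    case (elim \<omega>)
    then obtain n where "\<omega> \<notin> Bad n" by blast
    then show ?case unfolding Bad_def by (intro exI[of _ "Suc n"]) simp
  qed
qed

end

section \<open>From good grids to generic realisations\<close>

lemma nat_floor_bounds: "0 \<le> x \<Longrightarrow> real (nat \<lfloor>x\<rfloor>) \<le> x \<and> x < real (nat \<lfloor>x\<rfloor>) + 1" for x :: real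
  by linarith

context poisson
begin

lemma AE_zero:
  assumes "B \<in> sets borel" "B \<subseteq> {0..} \<times> UNIV" "emeasure lborel B = 0"
  shows "AE \<omega> in P. emeasure (M \<omega>) B = 0"
proof -
  have ev: "{\<omega> \<in> space P. emeasure (M \<omega>) B = 0} \<in> events"
    using count_event[OF assms(1,2), of "{0}"] by simp
  have "prob {\<omega> \<in> space P. emeasure (M \<omega>) B = 0} = 1"
    using prob_count[OF assms(1,2), of 0] assms(3) by (simp add: measure_def)
  then have "AE \<omega> in P. \<omega> \<in> {\<omega> \<in> space P. emeasure (M \<omega>) B = 0}" using prob_eq_1[OF ev] by blast
  then show ?thesis by eventually_elim simp
qed

text \<open>Applied at times 0 and 1, for the two deterministic demands of \<open>generic\<close>:
  \<open>0 < u\<close> and \<open>u \<noteq> 0 + 1\<close>.\<close>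

lemma AE_vertical:
  assumes "0 \<le> c"
  shows "AE \<omega> in P. \<forall>K::nat. emeasure (M \<omega>) ({c} \<times> {- real K..real K}) = 0"
  unfolding AE_all_countable
proof
  fix K :: nat
  have "{c} \<times> {- real K..real K} = cbox (c, - real K) (c, real K)" by (simp add: cbox_Pair_eq)
  moreover have "emeasure lborel (cbox (c, - real K) (c, real K)) = 0"
    by (subst emeasure_lborel_cbox_eq) (simp add: Basis_prod_def)
  ultimately have z: "emeasure lborel ({c} \<times> {- real K..real K}) = 0" by simp
  show "AE \<omega> in P. emeasure (M \<omega>) ({c} \<times> {- real K..real K}) = 0"
    by (rule AE_zero[OF _ _ z]) (use assms in \<open>auto intro!: borel_Times\<close>)
qed

text \<open>A grid with at most unit mass in each strip forces atoms of mass 1 with distinct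
  coordinates. Each excluded coincidence would make all strips of some pattern occupied, which a
  good grid rules out.\<close>

lemma realisation_of_grid:
  assumes \<omega>: "\<omega> \<in> space P"
    and grid: "\<And>K. 1 \<le> K \<Longrightarrow> \<exists>n\<ge>1. \<omega> \<notin> many fst K n \<and> \<omega> \<notin> many (\<lambda>p. snd p + real K) K n \<and> \<omega> \<notin> coincide K n"
    and fin: "\<And>K. emeasure (M \<omega>) (box_nat K) < \<infinity>"
    and z: "\<And>K::nat. emeasure (M \<omega>) ({0} \<times> {- real K..real K}) = 0" "\<And>K::nat. emeasure (M \<omega>) ({1} \<times> {- real K..real K}) = 0"
  shows "realisation (M \<omega>)"
proof -
  let ?A = "atoms (M \<omega>)"
  note sets = sets_M[OF \<omega>]
  have meas: "B \<in> sets (M \<omega>)" if "B \<in> sets borel" "B \<subseteq> {0..} \<times> UNIV" for B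
    using half_planeI[OF that] sets by simp
  have pt: "{p} \<in> sets (M \<omega>)" "0 \<le> fst p" if "p \<in> ?A" for p
  proof -
    show *: "{p} \<in> sets (M \<omega>)" using that emeasure_notin_sets[of "{p}" "M \<omega>"] by (auto simp: atoms_def)
    have "space (M \<omega>) = {0..} \<times> UNIV"
      using sets_eq_imp_space_eq[OF sets] by (simp add: half_plane_lebesgue_def space_restrict_space)
    then show "0 \<le> fst p" using sets.sets_into_space[OF *] by (cases p) auto
  qed
  have ge1: "1 \<le> emeasure (M \<omega>) {p}" if "p \<in> ?A" for p
  proof -
    have "emeasure (M \<omega>) {p} \<in> range of_nat \<union> {\<top>}" using int_M[OF \<omega>] pt(1)[OF that] sets by blast
    then show ?thesis
    proof
      assume "emeasure (M \<omega>) {p} \<in> range of_nat"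
      then obtain i :: nat where i: "emeasure (M \<omega>) {p} = of_nat i" by blast
      then have "i \<noteq> 0" using that by (auto simp: atoms_def)
      then show ?thesis using i by (cases i) auto
    qed simp
  qed
  \<comment> \<open>One box contains any given finite set of atoms, so one grid serves for all of
    them.\<close>
  have inside: "\<exists>K\<ge>1. \<forall>p\<in>F. p \<in> box_nat K" if "finite F" "F \<subseteq> ?A" for F
  proof -
    obtain K :: nat where K: "Max (insert 1 ((\<lambda>p. fst p + \<bar>snd p\<bar>) ` F)) \<le> real K" using real_arch_simple by blast
    have K': "v \<le> real K" if "v \<in> insert 1 ((\<lambda>p. fst p + \<bar>snd p\<bar>) ` F)" for v
      using order_trans[OF Max_ge[OF _ that] K] \<open>finite F\<close> by blast
    have "p \<in> box_nat K" if "p \<in> F" for p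
    proof -
      have "fst p + \<bar>snd p\<bar> \<le> real K" using K'[of "fst p + \<bar>snd p\<bar>"] that by blast
      moreover have "0 \<le> fst p" using pt(2) that \<open>F \<subseteq> ?A\<close> by blast
      ultimately show ?thesis unfolding box_nat_def mem_Times_iff atLeastAtMost_iff by linarith
    qed
    moreover have "1 \<le> K" using K'[of 1] by simp
    ultimately show ?thesis by blast
  qed
  have at_strip: "p \<in> strip f K n (nat \<lfloor>f p * real n\<rfloor>)" "nat \<lfloor>f p * real n\<rfloor> \<in> {..2 * K * n}"
    if "p \<in> box_nat K" "f \<in> {fst, \<lambda>p. snd p + real K}" for p f K n
  proof -
    show "p \<in> strip f K n (nat \<lfloor>f p * real n\<rfloor>)" using that(1) by (simp add: strip_def)
    have "0 \<le> f p" "f p \<le> 2 * real K" using that by (auto simp: box_nat_def)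
    then have fn: "0 \<le> f p * real n" "f p * real n \<le> 2 * real K * real n" by (simp_all add: mult_right_mono)
    have "real (nat \<lfloor>f p * real n\<rfloor>) \<le> 2 * real K * real n"
      by (rule order_trans[OF conjunct1[OF nat_floor_bounds[OF fn(1)]] fn(2)])
    then have "real (nat \<lfloor>f p * real n\<rfloor>) \<le> real (2 * K * n)" by simp
    then show "nat \<lfloor>f p * real n\<rfloor> \<in> {..2 * K * n}" by (simp only: of_nat_le_iff atMost_iff)
  qed
  have count: "emeasure (M \<omega>) (strip f K n (nat \<lfloor>f p * real n\<rfloor>)) \<in> {0, 1}"
    if "p \<in> box_nat K" "f \<in> {fst, \<lambda>p. snd p + real K}" "\<omega> \<notin> many f K n" for p f K n
    using that(3) at_strip(2)[OF that(1,2)] \<omega> unfolding many_def by blast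
  have sep: "nat \<lfloor>f p * real n\<rfloor> \<noteq> nat \<lfloor>f q * real n\<rfloor>"
    if p: "p \<in> ?A" "p \<in> box_nat K" "q \<in> ?A" "q \<in> box_nat K" "p \<noteq> q"
      and f: "f \<in> {fst, \<lambda>p. snd p + real K}" "\<omega> \<notin> many f K n" "1 \<le> n" for p q f K n
  proof
    assume eq: "nat \<lfloor>f p * real n\<rfloor> = nat \<lfloor>f q * real n\<rfloor>"
    let ?s = "strip f K n (nat \<lfloor>f p * real n\<rfloor>)"
    have pq: "{p, q} \<subseteq> ?s" using at_strip(1)[OF p(2) f(1), of n] at_strip(1)[OF p(4) f(1), of n] eq by simp
    have "1 + 1 \<le> emeasure (M \<omega>) {p} + emeasure (M \<omega>) {q}" by (intro add_mono ge1 p)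
    also have "\<dots> = emeasure (M \<omega>) ({p} \<union> {q})" by (rule plus_emeasure) (use pt(1) p in auto)
    also have "\<dots> \<le> emeasure (M \<omega>) ?s"
      by (rule emeasure_mono) (use pq meas[OF strip(1,2)[OF f(1,3)]] in auto)
    finally show False using count[OF p(2) f(1,2)] by auto
  qed
  have mass: "emeasure (M \<omega>) {p} = 1" if p: "p \<in> ?A" for p
  proof -
    obtain K where K: "1 \<le> K" "p \<in> box_nat K" using inside[of "{p}"] p by blast
    obtain n where n: "1 \<le> n" "\<omega> \<notin> many fst K n" using grid[OF K(1)] by blast
    have "emeasure (M \<omega>) {p} \<le> emeasure (M \<omega>) (strip fst K n (nat \<lfloor>fst p * real n\<rfloor>))"
      by (rule emeasure_mono) (use at_strip(1)[OF K(2), of fst n] meas[OF strip(1,2)[OF _ n(1)], of fst] in auto)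
    also have "\<dots> \<le> 1" using count[OF K(2) _ n(2)] by auto
    finally show ?thesis using ge1[OF p] by (rule antisym)
  qed
  have inj: "p = q" if pq: "p \<in> ?A" "q \<in> ?A" and eq: "fst p = fst q \<or> snd p = snd q" for p q
  proof (rule ccontr)
    assume "p \<noteq> q"
    obtain K where K: "1 \<le> K" "p \<in> box_nat K" "q \<in> box_nat K" using inside[of "{p, q}"] pq by blast
    obtain n where n: "1 \<le> n" "\<omega> \<notin> many fst K n" "\<omega> \<notin> many (\<lambda>p. snd p + real K) K n" using grid[OF K(1)] by blast
    have "nat \<lfloor>fst p * real n\<rfloor> \<noteq> nat \<lfloor>fst q * real n\<rfloor>"
      by (rule sep[OF pq(1) K(2) pq(2) K(3) \<open>p \<noteq> q\<close> _ n(2) n(1)]) simp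
    moreover have "nat \<lfloor>(snd p + real K) * real n\<rfloor> \<noteq> nat \<lfloor>(snd q + real K) * real n\<rfloor>"
      by (rule sep[OF pq(1) K(2) pq(2) K(3) \<open>p \<noteq> q\<close> _ n(3) n(1)]) simp
    ultimately show False using eq by force
  qed
  have hitJ: False if K: "1 \<le> K" "1 \<le> n" "\<omega> \<notin> coincide K n" and J: "J \<noteq> {}"
    and pat: "J \<in> fst (patterns K n) \<and> card J = 2 \<or> J \<in> snd (patterns K n) \<and> card J = 3"
    and occ: "\<forall>i\<in>J. \<exists>p\<in>?A. p \<in> box_nat K \<and> i = nat \<lfloor>fst p * real n\<rfloor>" for K n J
  proof -
    have "emeasure (M \<omega>) (strip fst K n i) \<in> - {0}" if "i \<in> J" for i
    proof -
      obtain p where p: "p \<in> ?A" "p \<in> box_nat K" "i = nat \<lfloor>fst p * real n\<rfloor>" using occ \<open>i \<in> J\<close> by blast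
      have "emeasure (M \<omega>) {p} \<le> emeasure (M \<omega>) (strip fst K n i)"
        by (rule emeasure_mono) (use at_strip(1)[OF p(2), of fst n] p(3) meas[OF strip(1,2)[OF _ K(2)], of fst] in auto)
      then show ?thesis using ge1[OF p(1)] by auto
    qed
    then have "\<omega> \<in> hit K n J" using \<omega> J unfolding hit_def by blast
    then have "\<omega> \<in> coincide K n" using pat unfolding coincide_def by blast
    then show False using K(3) by blast
  qed
  have gen: "generic ?A"
    unfolding generic_def
  proof (intro conjI allI ballI impI)
    fix T k :: real
    obtain K :: nat where K: "max 1 (max T k) \<le> real K" using real_arch_simple by blast
    then have K1: "1 \<le> K" by simp
    obtain n where n: "1 \<le> n" "\<omega> \<notin> many fst K n" using grid[OF K1] by blast
    have sub: "?A \<inter> {0..T} \<times> {-k..k} \<subseteq> ?A \<inter> box_nat K" using K by (auto simp: box_nat_def)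
    have "inj_on (\<lambda>p. nat \<lfloor>fst p * real n\<rfloor>) (?A \<inter> box_nat K)"
      by (rule inj_onI) (use sep[of _ K _ fst n] n in blast)
    moreover have "(\<lambda>p. nat \<lfloor>fst p * real n\<rfloor>) ` (?A \<inter> box_nat K) \<subseteq> {..2 * K * n}"
      using at_strip(2)[of _ K fst n] by blast
    ultimately have "finite (?A \<inter> box_nat K)" by (rule inj_on_finite) simp
    then show "finite (?A \<inter> {0..T} \<times> {-k..k})" using sub by (rule rev_finite_subset)
  next
    show "inj_on fst ?A" "inj_on snd ?A" by (rule inj_onI; use inj in blast)+
  next
    fix u assume "u \<in> fst ` ?A"
    then obtain p where p: "p \<in> ?A" "u = fst p" by blast
    obtain K where K: "1 \<le> K" "p \<in> box_nat K" using inside[of "{p}"] p by blast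
    have away: "u \<noteq> c" if c: "emeasure (M \<omega>) ({c} \<times> {- real K..real K}) = 0" "0 \<le> c" for c
    proof
      assume "u = c"
      have "emeasure (M \<omega>) {p} \<le> emeasure (M \<omega>) ({c} \<times> {- real K..real K})"
        by (rule emeasure_mono) (use \<open>u = c\<close> p K(2) c(2) in \<open>auto simp: box_nat_def intro!: meas borel_Times\<close>)
      then show False using c ge1[OF p(1)] by simp
    qed
    show "0 < u" using away[OF z(1)] pt(2)[OF p(1)] p(2) by simp
    have pos: "0 < fst q" if "q \<in> ?A" for q
    proof -
      obtain K where K: "1 \<le> K" "q \<in> box_nat K" using inside[of "{q}"] \<open>q \<in> ?A\<close> by blast
      have "fst q \<noteq> 0"
      proof
        assume "fst q = 0"
        have "emeasure (M \<omega>) {q} \<le> emeasure (M \<omega>) ({0} \<times> {- real K..real K})"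
          by (rule emeasure_mono) (use \<open>fst q = 0\<close> K(2) in \<open>auto simp: box_nat_def intro!: meas borel_Times\<close>)
        then show False using z(1)[of K] ge1[OF \<open>q \<in> ?A\<close>] by simp
      qed
      then show ?thesis using pt(2)[OF \<open>q \<in> ?A\<close>] by simp
    qed
    fix b assume "b \<in> insert 0 (fst ` ?A)"
    then consider "b = 0" | q where "q \<in> ?A" "b = fst q" by blast
    note b_cases = this
    show "u \<noteq> b + 1"
    proof (cases rule: b_cases)
      case 1
      then show ?thesis using away[OF z(2)] by simp
    next
      case (2 q)
      show ?thesis
      proof
        assume u: "u = b + 1"
        obtain K where K: "1 \<le> K" "p \<in> box_nat K" "q \<in> box_nat K" using inside[of "{p, q}"] p 2 by blast
        obtain n where n: "1 \<le> n" "\<omega> \<notin> coincide K n" using grid[OF K(1)] by blast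
        define i where "i = nat \<lfloor>fst q * real n\<rfloor>"
        define l where "l = nat \<lfloor>fst p * real n\<rfloor>"
        have i: "real i \<le> fst q * real n" "fst q * real n < real i + 1"
          using nat_floor_bounds[of "fst q * real n"] pos[OF 2(1)] by (auto simp: i_def)
        have l: "real l \<le> fst p * real n" "fst p * real n < real l + 1"
          using nat_floor_bounds[of "fst p * real n"] pos[OF p(1)] by (auto simp: l_def)
        \<comment> \<open>Adding the integer \<open>n\<close> commutes with rounding down, so the
          index is exactly \<open>i + n\<close>.\<close>
        have "fst p * real n = fst q * real n + real n" using u p(2) 2(2) by (simp add: algebra_simps)
        then have "real l < real (i + n + 1)" "real (i + n) < real (l + 1)" using i l by simp_all
        then have "l < i + n + 1" "i + n < l + 1" by (simp_all only: of_nat_less_iff)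
        then have li: "l = i + n" by simp
        have "i \<in> {..2 * K * n}" unfolding i_def using at_strip(2)[OF K(3), of fst n] by blast
        then have "{i, l} \<in> fst (patterns K n)" unfolding patterns_def fst_conv li by blast
        moreover have "card {i, l} = 2" using li n(1) by simp
        ultimately show False using hitJ[OF K(1) n, of "{i, l}"] p(1) 2(1) K i_def l_def by blast
      qed
    qed
    fix s assume "s \<in> fst ` ?A" and bs: "b < s"
    then obtain r where r: "r \<in> ?A" "s = fst r" by blast
    show "u \<noteq> 2 * s - b"
    proof
      assume u: "u = 2 * s - b"
      show False
      proof (cases rule: b_cases)
        case 1
        obtain K where K: "1 \<le> K" "p \<in> box_nat K" "r \<in> box_nat K" using inside[of "{p, r}"] p r by blast
        obtain n where n: "1 \<le> n" "\<omega> \<notin> coincide K n" "\<omega> \<notin> many fst K n" using grid[OF K(1)] by blast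
        define i where "i = nat \<lfloor>fst r * real n\<rfloor>"
        define l where "l = nat \<lfloor>fst p * real n\<rfloor>"
        have i: "real i \<le> fst r * real n" "fst r * real n < real i + 1"
          using nat_floor_bounds[of "fst r * real n"] pos[OF r(1)] by (auto simp: i_def)
        have l: "real l \<le> fst p * real n" "fst p * real n < real l + 1"
          using nat_floor_bounds[of "fst p * real n"] pos[OF p(1)] by (auto simp: l_def)
        have "fst p * real n = 2 * (fst r * real n)" using u p(2) r(2) 1 by (simp add: algebra_simps)
        then have "real l < real (2 * i + 2)" "real (2 * i) < real (l + 1)"
          using i l unfolding of_nat_add of_nat_mult of_nat_numeral of_nat_1 by linarith+
        then have "l < 2 * i + 2" "2 * i < l + 1" by (simp_all only: of_nat_less_iff)
        then have li: "l = 2 * i \<or> l = 2 * i + 1" by arith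
        have I: "i \<in> {..2 * K * n}" unfolding i_def using at_strip(2)[OF K(3), of fst n] by blast
        have "{i, l} \<in> fst (patterns K n)" using li
        proof
          assume e: "l = 2 * i"
          show ?thesis unfolding patterns_def fst_conv e using I by blast
        next
          assume e: "l = 2 * i + 1"
          show ?thesis unfolding patterns_def fst_conv e using I by blast
        qed
        moreover have "p \<noteq> r" using u 1 bs p(2) r(2) by auto
        \<comment> \<open>Different marks lie in different strips, so the pattern has its full
          cardinality.\<close>
        then have "l \<noteq> i" unfolding l_def i_def by (intro sep[OF p(1) K(2) r(1) K(3) _ _ n(3,1)]) simp_all
        then have "card {i, l} = 2" by simp
        ultimately show False using hitJ[OF K(1) n(1,2), of "{i, l}"] p(1) r(1) K i_def l_def by blast
      next
        case (2 q)
        obtain K where K: "1 \<le> K" "p \<in> box_nat K" "q \<in> box_nat K" "r \<in> box_nat K" using inside[of "{p, q, r}"] p r 2 by blast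
        obtain n where n: "1 \<le> n" "\<omega> \<notin> coincide K n" "\<omega> \<notin> many fst K n" using grid[OF K(1)] by blast
        define i where "i = nat \<lfloor>fst q * real n\<rfloor>"
        define j where "j = nat \<lfloor>fst r * real n\<rfloor>"
        define l where "l = nat \<lfloor>fst p * real n\<rfloor>"
        have i: "real i \<le> fst q * real n" "fst q * real n < real i + 1"
          using nat_floor_bounds[of "fst q * real n"] pos[OF 2(1)] by (auto simp: i_def)
        have j: "real j \<le> fst r * real n" "fst r * real n < real j + 1"
          using nat_floor_bounds[of "fst r * real n"] pos[OF r(1)] by (auto simp: j_def)
        have l: "real l \<le> fst p * real n" "fst p * real n < real l + 1"
          using nat_floor_bounds[of "fst p * real n"] pos[OF p(1)] by (auto simp: l_def)
        have "fst p * real n + fst q * real n = 2 * (fst r * real n)"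
          by (simp add: u[unfolded p(2) r(2) 2(2)] algebra_simps)
        then have "real (l + i) < real (2 * j + 2)" "real (2 * j) < real (l + i + 2)"
          using i j l unfolding of_nat_add of_nat_mult of_nat_numeral of_nat_1 by linarith+
        then have lij: "l + i < 2 * j + 2" "2 * j < l + i + 2" by (simp_all only: of_nat_less_iff)
        \<comment> \<open>Rounding leaves \<open>l + i - 2 * j\<close> between -1 and 1; adding 1
          makes it a natural number.\<close>
        define e where "e = l + i + 1 - 2 * j"
        have e: "e \<in> {..2}" "l = 2 * j + e - i - 1" using lij unfolding e_def by auto
        have I: "i \<in> {..2 * K * n}" "j \<in> {..2 * K * n}"
          unfolding i_def j_def using at_strip(2)[OF K(3), of fst n] at_strip(2)[OF K(4), of fst n] by blast+
        have "{i, j, 2 * j + e - i - 1} \<in> snd (patterns K n)"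
          unfolding patterns_def snd_conv by (rule image_eqI[of _ _ "(i, j, e)"]) (use I e(1) in auto)
        then have pat: "{i, j, l} \<in> snd (patterns K n)" using e(2) by simp
        have "fst p \<noteq> fst r" "fst p \<noteq> fst q" "fst q \<noteq> fst r" using u bs p(2) r(2) 2(2) by auto
        then have ne: "p \<noteq> r" "p \<noteq> q" "q \<noteq> r" by blast+
        have "l \<noteq> j" "l \<noteq> i" "i \<noteq> j" unfolding l_def i_def j_def
          by (intro sep[OF p(1) K(2) r(1) K(4) ne(1) _ n(3,1)] sep[OF p(1) K(2) 2(1) K(3) ne(2) _ n(3,1)]
              sep[OF 2(1) K(3) r(1) K(4) ne(3) _ n(3,1)]; simp)+
        then have "card {i, j, l} = 3" by simp
        then show False using hitJ[OF K(1) n(1,2), of "{i, j, l}"] pat p(1) r(1) 2(1) K i_def l_def j_def by blast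
      qed
    qed
  qed
  have box_atoms: "finite (?A \<inter> box_nat K)" for K
    using gen unfolding generic_def box_nat_def by blast
  have UA: "?A = (\<Union>K::nat. ?A \<inter> box_nat K)" using inside[of "{p}" for p] by blast
  have "countable ?A" by (subst UA) (rule countable_UN[OF _ countable_finite[OF box_atoms]], simp)
  then have "(\<Union>p\<in>?A. {p}) \<in> sets (M \<omega>)" by (intro sets.countable_UN') (use pt(1) in auto)
  then have A: "?A \<in> sets (M \<omega>)" by simp
  show ?thesis
  proof
    show "emeasure (M \<omega>) (space (M \<omega>) - ?A) = 0"
      by (rule null_of_locally_null[OF sets _ _ A]) (use int_M[OF \<omega>] sets fin in \<open>auto simp: box_nat_def\<close>)
  qed (use sets gen mass in auto)
qed

lemma AE_realisation: "AE \<omega> in P. realisation (M \<omega>)"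
proof -
  have "AE \<omega> in P. \<forall>K. 1 \<le> K \<longrightarrow> (\<exists>n\<ge>1. \<omega> \<notin> many fst K n \<and> \<omega> \<notin> many (\<lambda>p. snd p + real K) K n \<and> \<omega> \<notin> coincide K n)"
    unfolding AE_all_countable using AE_good_grid by (simp add: AE_impI)
  moreover have "AE \<omega> in P. \<forall>K. emeasure (M \<omega>) (box_nat K) < \<infinity>"
    unfolding AE_all_countable by (intro allI AE_finite box_nat)
  moreover note AE_vertical[of 0, OF order_refl] AE_vertical[of 1, OF zero_le_one] AE_space
  ultimately show ?thesis
  proof eventually_elim
    case (elim \<omega>)
    show ?case by (rule realisation_of_grid) (use elim in blast)+
  qed
qed

text \<open>For different \<open>j\<close> the events are independent, each of probability at least
  \<open>e ^ card C\<close>. By the zero-one law infinitely many of them occur almost surely, in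
  particular one.\<close>

lemma AE_some_block:
  fixes G :: "nat \<Rightarrow> nat \<Rightarrow> (real \<times> real) set" and V :: "nat \<Rightarrow> ennreal set"
  assumes C: "finite C" "C \<noteq> {}"
    and G: "\<And>j c. c \<in> C \<Longrightarrow> G j c \<in> sets borel \<and> G j c \<subseteq> {0..} \<times> UNIV"
    and disj: "\<And>j c j' c'. c \<in> C \<Longrightarrow> c' \<in> C \<Longrightarrow> (j, c) \<noteq> (j', c') \<Longrightarrow> G j c \<inter> G j' c' = {}"
    and V: "\<And>c. c \<in> C \<Longrightarrow> V c \<in> sets borel"
    and e: "0 < e" "\<And>j c. c \<in> C \<Longrightarrow> e \<le> prob {\<omega> \<in> space P. emeasure (M \<omega>) (G j c) \<in> V c}"
  shows "AE \<omega> in P. \<exists>j. \<forall>c\<in>C. emeasure (M \<omega>) (G j c) \<in> V c"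
proof -
  define pr where "pr j c = prob {\<omega> \<in> space P. emeasure (M \<omega>) (G j c) \<in> V c}" for j c
  define B where "B j = (\<Inter>c\<in>C. {\<omega> \<in> space P. emeasure (M \<omega>) (G j c) \<in> V c})" for j
  have ev: "B j \<in> events" for j
    unfolding B_def using C by (intro sets.finite_INT count_event) (use G V in blast)+
  have INT: "prob (\<Inter>j\<in>J. B j) = (\<Prod>j\<in>J. \<Prod>c\<in>C. pr j c)" if J: "finite J" "J \<noteq> {}" for J
  proof -
    \<comment> \<open>\<open>poisson_measure\<close> states independence for families indexed by
      natural numbers, hence the pairing of \<open>j\<close> and \<open>c\<close>.\<close>
    define G' where "G' i = G (fst (prod_decode i)) (snd (prod_decode i))" for i
    define V' where "V' i = V (snd (prod_decode i))" for i
    let ?I = "prod_encode ` (J \<times> C)"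
    have "(\<Inter>j\<in>J. B j) = (\<Inter>i\<in>?I. {\<omega> \<in> space P. emeasure (M \<omega>) (G' i) \<in> V' i})"
      unfolding B_def by (auto simp: G'_def V'_def)
    also have "prob \<dots> = (\<Prod>i\<in>?I. prob {\<omega> \<in> space P. emeasure (M \<omega>) (G' i) \<in> V' i})"
    proof (rule prob_INT)
      show "disjoint_family_on G' ?I"
      proof (unfold disjoint_family_on_def, intro ballI impI)
        fix a b assume ab: "a \<in> ?I" "b \<in> ?I" "a \<noteq> b"
        then obtain j c j' c' where "a = prod_encode (j, c)" "b = prod_encode (j', c')" "c \<in> C" "c' \<in> C" by blast
        then show "G' a \<inter> G' b = {}" using disj[of c c' j j'] ab(3) by (auto simp: G'_def)
      qed
      show "finite ?I" "?I \<noteq> {}" using C J by simp_all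
      fix i assume "i \<in> ?I"
      then obtain j c where i: "i = prod_encode (j, c)" "c \<in> C" by blast
      show "G' i \<in> sets borel \<and> G' i \<subseteq> {0..} \<times> UNIV" using G[OF i(2)] by (simp add: G'_def i(1))
      show "V' i \<in> sets borel" using V[OF i(2)] by (simp add: V'_def i(1))
    qed
    also have "\<dots> = (\<Prod>q\<in>J \<times> C. pr (fst q) (snd q))"
      by (simp add: prod.reindex[OF inj_prod_encode] comp_def G'_def V'_def pr_def)
    also have "\<dots> = (\<Prod>j\<in>J. \<Prod>c\<in>C. pr j c)"
      by (simp add: prod.cartesian_product split_def)
    finally show ?thesis .
  qed
  have one: "prob (B j) = (\<Prod>c\<in>C. pr j c)" for j using INT[of "{j}"] by simp
  have indep: "indep_events B UNIV"
  proof (unfold indep_events_def, intro conjI allI impI)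
    show "range B \<subseteq> events" using ev by blast
    fix J :: "nat set" assume "J \<noteq> {}" "finite J"
    then show "prob (\<Inter>j\<in>J. B j) = (\<Prod>j\<in>J. prob (B j))" unfolding one by (intro INT)
  qed
  have low: "e ^ card C \<le> prob (B j)" for j
  proof -
    have "(\<Prod>c\<in>C. e) \<le> (\<Prod>c\<in>C. pr j c)" by (rule prod_mono) (use e in \<open>auto simp: pr_def\<close>)
    then show ?thesis by (simp add: one)
  qed
  define U where "U n = (\<Union>m\<in>{n..}. B m)" for n
  have U: "U n \<in> events" for n unfolding U_def by (intro sets.countable_UN') (use ev in auto)
  have "decseq U" unfolding decseq_def U_def by (intro allI impI UN_mono) simp_all
  then have "(\<lambda>n. prob (U n)) \<longlonglongrightarrow> prob (\<Inter>n. U n)"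
    by (intro finite_Lim_measure_decseq) (use U in blast)+
  moreover have "e ^ card C \<le> prob (U n)" for n
    by (rule order_trans[OF low[of n]]) (rule finite_measure_mono[OF _ U], auto simp: U_def)
  ultimately have "e ^ card C \<le> prob (\<Inter>n. U n)" by (intro LIMSEQ_le_const) blast+
  moreover have "prob (\<Inter>n. U n) = 0 \<or> prob (\<Inter>n. U n) = 1" using borel_0_1_law[OF indep] unfolding U_def .
  moreover have "0 < e ^ card C" using e(1) by simp
  ultimately have "prob (\<Inter>n. U n) = 1" by linarith
  then have "AE \<omega> in P. \<omega> \<in> (\<Inter>n. U n)" using prob_eq_1[of "\<Inter>n. U n"] U by blast
  then show ?thesis
  proof eventually_elim
    case (elim \<omega>)
    then have "\<omega> \<in> U 0" by blast
    then show ?case unfolding U_def B_def by blast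
  qed
qed

end

section \<open>Almost sure existence of walls\<close>

text \<open>\<open>R\<close> columns fit into each outer quarter of a unit interval;
  \<open>R + 1\<close> in place of \<open>R\<close> leaves room between them and the middle.\<close>

definition cell_width :: "nat \<Rightarrow> real" where "cell_width R = 1 / (4 * (real R + 1))"

text \<open>Indices below \<open>R\<close> are left sparks, below \<open>2 * R\<close> right sparks,
  below \<open>3 * R\<close> fires. Round \<open>i\<close> starts at some \<open>b\<close> between
  \<open>5i/4\<close> and \<open>5i/4 + 1/16\<close>. For each such \<open>b\<close> the windows of
  length 1/16 at \<open>5i/4 + 7/8\<close> and at \<open>5i/4 + 5/4\<close> lie within
  \<open>]b + 3/4, b + 1[\<close> and \<open>]b + 1, b + 3/2[\<close>. The second is the starting
  window of the next round, so delays do not accumulate.\<close>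

definition cell_time :: "nat \<Rightarrow> nat \<Rightarrow> real" where
  "cell_time R c = (if c < R then 5 * real c / 4 + 7/8 else if c < 2 * R then 5 * real (c - R) / 4 + 7/8
     else 5 * real (c - 2 * R) / 4 + 5/4)"

text \<open>From round to round the left sparks move right and the right sparks move left, which
  nests the rounds; all fires fall into a narrow column around 1/2.\<close>

definition cell_pos :: "nat \<Rightarrow> nat \<Rightarrow> real" where
  "cell_pos R c = (if c < R then real c * cell_width R else if c < 2 * R then 1 - (real (c - R) + 1) * cell_width R
     else 1/2 - cell_width R / 4)"

definition wall_cell :: "nat \<Rightarrow> real \<Rightarrow> nat \<Rightarrow> (real \<times> real) set" where
  "wall_cell R d c = {cell_time R c..cell_time R c + 1/16} \<times> {d + cell_pos R c..d + cell_pos R c + cell_width R / 2}"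

text \<open>Block \<open>3 * R\<close> is the rest of the rectangle. One mark in each cell and none
  in the rest leave precisely the marks of a wall; the duration \<open>2 * R\<close> covers all
  cells and any horizon up to \<open>R\<close>.\<close>

definition wall_block :: "nat \<Rightarrow> real \<Rightarrow> nat \<Rightarrow> (real \<times> real) set" where
  "wall_block R d c = (if c < 3 * R then wall_cell R d c
     else {0..2 * real R} \<times> {d..<d + 1} - (\<Union>c<3 * R. wall_cell R d c))"

lemma cell_width:
  assumes "1 \<le> R"
  shows "0 < cell_width R" "cell_width R \<le> 1/8"
    "i < R \<Longrightarrow> 0 \<le> real i * cell_width R \<and> real i * cell_width R + cell_width R \<le> 1/4"
    "i < j \<Longrightarrow> real i * cell_width R + cell_width R \<le> real j * cell_width R"
proof -
  show pos: "0 < cell_width R" by (simp add: cell_width_def)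
  have "1 \<le> real R" using assms by simp
  then show "cell_width R \<le> 1/8" unfolding cell_width_def by (intro frac_le) simp_all
  have mono: "real i * cell_width R + cell_width R \<le> real j * cell_width R" if "i < j" for i j
  proof -
    have "(real i + 1) * cell_width R \<le> real j * cell_width R"
      using that pos by (intro mult_right_mono) simp_all
    then show ?thesis by (simp add: algebra_simps)
  qed
  then show "i < j \<Longrightarrow> real i * cell_width R + cell_width R \<le> real j * cell_width R" .
  assume "i < R"
  have "(real R + 1) * cell_width R = 1/4" by (simp add: cell_width_def field_simps)
  then have "real R * cell_width R + cell_width R = 1/4" by (simp add: algebra_simps)
  moreover have "0 \<le> real i * cell_width R" using pos by simp
  ultimately show "0 \<le> real i * cell_width R \<and> real i * cell_width R + cell_width R \<le> 1/4"
    using mono[OF \<open>i < R\<close>] pos by linarith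
qed

lemma cell_pos:
  assumes "1 \<le> R"
  shows "c < R \<Longrightarrow> 0 \<le> cell_pos R c \<and> cell_pos R c + cell_width R \<le> 1/4"
    "R \<le> c \<Longrightarrow> c < 2 * R \<Longrightarrow> 3/4 \<le> cell_pos R c \<and> cell_pos R c + cell_width R \<le> 1"
    "2 * R \<le> c \<Longrightarrow> cell_pos R c = 1/2 - cell_width R / 4"
proof -
  show "c < R \<Longrightarrow> 0 \<le> cell_pos R c \<and> cell_pos R c + cell_width R \<le> 1/4"
    using cell_width(3)[OF assms] by (simp add: cell_pos_def)
  show "2 * R \<le> c \<Longrightarrow> cell_pos R c = 1/2 - cell_width R / 4" using assms by (simp add: cell_pos_def)
  assume c: "R \<le> c" "c < 2 * R"
  then have "c - R < R" by linarith
  from cell_width(3)[OF assms this] have "0 \<le> real (c - R) * cell_width R \<and> real (c - R) * cell_width R + cell_width R \<le> 1/4" .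
  moreover have "cell_pos R c = 1 - (real (c - R) * cell_width R + cell_width R)"
    using c by (simp add: cell_pos_def algebra_simps)
  ultimately show "3/4 \<le> cell_pos R c \<and> cell_pos R c + cell_width R \<le> 1" by linarith
qed

lemma cell_time:
  assumes "1 \<le> R" "c < 3 * R"
  shows "0 \<le> cell_time R c" "cell_time R c + 1/16 \<le> 2 * real R"
proof -
  have R: "1 \<le> real R" using assms(1) by simp
  consider "c < R" | "R \<le> c" "c < 2 * R" | "2 * R \<le> c" by linarith
  then have "0 \<le> cell_time R c \<and> cell_time R c + 1/16 \<le> 2 * real R"
  proof cases
    case 1
    then have "real c + 1 \<le> real R" by linarith
    moreover have "cell_time R c = 5 * real c / 4 + 7/8" using 1 by (simp add: cell_time_def)
    ultimately show ?thesis using R of_nat_0_le_iff[of c, where 'a=real] by linarith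
  next
    case 2
    define i where "i = c - R"
    have "i + 1 \<le> R" using 2 by (simp add: i_def)
    then have "real i + 1 \<le> real R" by linarith
    moreover have "cell_time R c = 5 * real i / 4 + 7/8" using 2 by (simp add: cell_time_def i_def)
    ultimately show ?thesis using R of_nat_0_le_iff[of i, where 'a=real] by linarith
  next
    case 3
    define i where "i = c - 2 * R"
    have "i + 1 \<le> R" using 3 assms(2) by (simp add: i_def)
    then have "real i + 1 \<le> real R" by linarith
    moreover have "cell_time R c = 5 * real i / 4 + 5/4" using 3 assms(1) by (simp add: cell_time_def i_def)
    ultimately show ?thesis using R of_nat_0_le_iff[of i, where 'a=real] by linarith
  qed
  then show "0 \<le> cell_time R c" "cell_time R c + 1/16 \<le> 2 * real R" by blast+
qed

lemma cell_pos_bounds: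
  assumes "1 \<le> R"
  shows "0 \<le> cell_pos R c" "cell_pos R c + cell_width R / 2 < 1"
proof -
  consider "c < R" | "R \<le> c" "c < 2 * R" | "2 * R \<le> c" by linarith
  then have "0 \<le> cell_pos R c \<and> cell_pos R c + cell_width R / 2 < 1"
    by cases (use cell_pos[OF assms, of c] cell_width(1,2)[OF assms] in linarith)+
  then show "0 \<le> cell_pos R c" "cell_pos R c + cell_width R / 2 < 1" by blast+
qed

lemma mem_wall_cell:
  "p \<in> wall_cell R d c \<longleftrightarrow> cell_time R c \<le> fst p \<and> fst p \<le> cell_time R c + 1/16 \<and>
     d + cell_pos R c \<le> snd p \<and> snd p \<le> d + cell_pos R c + cell_width R / 2"
  by (auto simp: wall_cell_def mem_Times_iff)

lemma wall_cell_sub: "1 \<le> R \<Longrightarrow> c < 3 * R \<Longrightarrow> wall_cell R d c \<subseteq> {0..2 * real R} \<times> {d..<d + 1}"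
proof
  fix p assume R: "1 \<le> R" and c: "c < 3 * R" and "p \<in> wall_cell R d c"
  then have "cell_time R c \<le> fst p" "fst p \<le> cell_time R c + 1/16"
    "d + cell_pos R c \<le> snd p" "snd p \<le> d + cell_pos R c + cell_width R / 2" by (simp_all only: mem_wall_cell)
  then have "0 \<le> fst p" "fst p \<le> 2 * real R" "d \<le> snd p" "snd p < d + 1"
    using cell_time[OF R c] cell_pos_bounds[OF R, of c] by linarith+
  then show "p \<in> {0..2 * real R} \<times> {d..<d + 1}" by (simp add: mem_Times_iff)
qed

text \<open>Two cells are separated by position, or by time if both are fires.\<close>

lemma wall_cell_disjoint:
  assumes R: "1 \<le> R" and c: "c < c'" "c' < 3 * R" and p: "p \<in> wall_cell R d c" "p \<in> wall_cell R d c'"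
  shows False
proof -
  note b = p[unfolded mem_wall_cell]
  note w = cell_width(1,2)[OF R]
  consider "c' < R" | "c < R" "R \<le> c'" "c' < 2 * R" | "c < R" "2 * R \<le> c'" | "R \<le> c" "c' < 2 * R"
    | "R \<le> c" "c < 2 * R" "2 * R \<le> c'" | "2 * R \<le> c" by linarith
  then show False
  proof cases
    case 1
    have "cell_pos R c = real c * cell_width R" "cell_pos R c' = real c' * cell_width R"
      using 1 c by (simp_all add: cell_pos_def)
    then show False using b w cell_width(4)[OF R c(1)] by linarith
  next
    case 2
    then show False using b w cell_pos(1)[OF R 2(1)] cell_pos(2)[OF R 2(2,3)] by linarith
  next
    case 3
    then show False using b w cell_pos(1)[OF R 3(1)] cell_pos(3)[OF R 3(2)] by linarith
  next
    case 4
    have "cell_pos R c = 1 - (real (c - R) * cell_width R + cell_width R)"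
      "cell_pos R c' = 1 - (real (c' - R) * cell_width R + cell_width R)"
      using 4 c by (simp_all add: cell_pos_def algebra_simps)
    moreover have "c - R < c' - R" using 4 c by linarith
    ultimately show False using b w cell_width(4)[OF R, of "c - R" "c' - R"] by linarith
  next
    case 5
    then show False using b w cell_pos(2)[OF R 5(1,2)] cell_pos(3)[OF R 5(3)] by linarith
  next
    case 6
    define i where "i = c - 2 * R"
    define j where "j = c' - 2 * R"
    have "i < j" using 6 c by (simp add: i_def j_def)
    then have "real i + 1 \<le> real j" by linarith
    moreover have "cell_time R c = 5 * real i / 4 + 5/4" "cell_time R c' = 5 * real j / 4 + 5/4"
      using 6 c R by (simp_all add: cell_time_def i_def j_def)
    ultimately show False using b by linarith
  qed
qed

lemma wall_cell_borel: "wall_cell R d c \<in> sets borel" "wall_block R d c \<in> sets borel"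
proof -
  show *: "wall_cell R d c \<in> sets borel" for c unfolding wall_cell_def by (intro borel_Times) simp_all
  have "{0..2 * real R} \<times> {d..<d + 1} \<in> sets borel" by (intro borel_Times) simp_all
  then show "wall_block R d c \<in> sets borel" unfolding wall_block_def using * by (auto intro!: sets.Diff sets.finite_UN)
qed

lemma wall_block_sub: "1 \<le> R \<Longrightarrow> wall_block R d c \<subseteq> {0..2 * real R} \<times> {d..<d + 1}"
  unfolding wall_block_def using wall_cell_sub[of R c d] by auto

lemma wall_block_disjoint:
  assumes "1 \<le> R" "c \<le> 3 * R" "c' \<le> 3 * R" "c \<noteq> c'"
  shows "wall_block R d c \<inter> wall_block R d c' = {}"
proof -
  have *: "wall_block R d c \<inter> wall_block R d c' = {}" if "c < c'" "c' \<le> 3 * R" for c c'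
  proof (cases "c' < 3 * R")
    case True
    then show ?thesis using wall_cell_disjoint[OF assms(1) that(1) True] that(1) unfolding wall_block_def by auto
  next
    case False
    then show ?thesis using that unfolding wall_block_def by auto
  qed
  show ?thesis using *[of c c'] *[of c' c] assms by (cases "c < c'") auto
qed

text \<open>The horizon may cut off late marks. The recursion of \<open>wall\<close> then stops:
  either \<open>T < b + 1\<close>, or the sparks are present and the fire comes after
  \<open>T\<close>, which forces \<open>T < b + 3/2\<close>.\<close>

lemma wall_of_marks:
  fixes P Q F :: "nat \<Rightarrow> real \<times> real"
  assumes P: "\<And>i. i < R \<Longrightarrow> 5 * real i / 4 + 7/8 \<le> fst (P i) \<and> fst (P i) \<le> 5 * real i / 4 + 15/16"
    and Q: "\<And>i. i < R \<Longrightarrow> 5 * real i / 4 + 7/8 \<le> fst (Q i) \<and> fst (Q i) \<le> 5 * real i / 4 + 15/16"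
    and F: "\<And>i. i < R \<Longrightarrow> 5 * real i / 4 + 5/4 \<le> fst (F i) \<and> fst (F i) \<le> 5 * real i / 4 + 21/16"
    and PFQ: "\<And>i j. i < R \<Longrightarrow> j < R \<Longrightarrow> snd (P i) < snd (F j) \<and> snd (F j) < snd (Q i)"
    and ord: "\<And>i j. i < j \<Longrightarrow> j < R \<Longrightarrow> snd (P i) < snd (P j) \<and> snd (Q j) < snd (Q i)"
    and ends: "\<And>i. i < R \<Longrightarrow> d \<le> snd (P i) \<and> snd (Q i) < d + 1"
    and only: "\<And>g. g \<in> S \<Longrightarrow> d \<le> snd g \<Longrightarrow> snd g < d + 1 \<Longrightarrow> \<exists>i<R. g \<in> {P i, Q i, F i}"
    and inS: "\<And>i g. i < R \<Longrightarrow> g \<in> {P i, Q i, F i} \<Longrightarrow> fst g \<le> T \<Longrightarrow> g \<in> S"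
    and late: "\<And>g. g \<in> S \<Longrightarrow> fst g \<le> T"
    and T: "T \<le> real R" and lu: "l < d" "d + 1 \<le> u"
  shows "wall T S R 0 l u"
proof -
  have "wall T S n b l u"
    if "i + n = R" "5 * real i / 4 \<le> b" "b \<le> 5 * real i / 4 + 1/16" "\<And>j. j < i \<Longrightarrow> fst (F j) \<le> b"
      "\<And>j. i \<le> j \<Longrightarrow> j < R \<Longrightarrow> l < snd (P j) \<and> snd (Q j) < u" for n i b l u
    using that
  proof (induction n arbitrary: i b l u)
    case 0
    \<comment> \<open>After \<open>R\<close> rounds the time is at least \<open>5 * R / 4\<close>,
      beyond \<open>T \<le> R\<close>.\<close>
    then have "T < b + 1" using T by simp
    then show ?case by simp
  next
    case (Suc n)
    show ?case
    proof (cases "T < b + 1")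
      case False
      have i: "i < R" using Suc.prems(1) by simp
      have tP: "b + 3/4 < fst (P i)" "fst (P i) < b + 1" and tQ: "b + 3/4 < fst (Q i)" "fst (Q i) < b + 1"
        and tF: "b + 1 < fst (F i)" "fst (F i) < b + 3/2"
        using P[OF i] Q[OF i] F[OF i] Suc.prems(2,3) by linarith+
      have inPQ: "P i \<in> S" "Q i \<in> S" by (rule inS[OF i]; use False tP tQ in force)+
      have pos: "l < snd (P i)" "snd (Q i) < u" "snd (P i) < snd (F i)" "snd (F i) < snd (Q i)"
        using Suc.prems(5)[of i] PFQ[OF i i] i by blast+
      \<comment> \<open>Earlier sparks lie outside by nesting, earlier fires are at or before
        \<open>b\<close>, and all marks of later rounds come after the fire
        \<open>F i\<close>.\<close>
      have others: "fst g \<le> b \<or> fst (F i) \<le> fst g" if g: "g \<in> S" "snd (P i) < snd g" "snd g < snd (Q i)" for g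
      proof -
        have "d \<le> snd g" "snd g < d + 1" using ends[OF i] g by linarith+
        then obtain j where j: "j < R" "g \<in> {P j, Q j, F j}" using only[OF g(1)] by blast
        consider "j < i" | "j = i" | "i < j" by linarith
        then show ?thesis
        proof cases
          case 1
          have "g \<noteq> P j" "g \<noteq> Q j" using ord[OF 1 i] g by force+
          then have "g = F j" using j by blast
          then show ?thesis using Suc.prems(4)[OF 1] by simp
        next
          case 2
          have "g \<noteq> P j" "g \<noteq> Q j" using 2 g by auto
          then show ?thesis using j 2 by auto
        next
          case 3
          then have "real i + 1 \<le> real j" by linarith
          then have "fst (F i) \<le> fst (P j)" "fst (F i) \<le> fst (Q j)" "fst (F i) \<le> fst (F j)"
            using P[OF j(1)] Q[OF j(1)] F[OF j(1)] F[OF i] by linarith+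
          then show ?thesis using j(2) by auto
        qed
      qed
      have alt: "(T < b + 3/2 \<and> (\<forall>g\<in>S. snd (P i) < snd g \<and> snd g < snd (Q i) \<longrightarrow> fst g \<le> b)) \<or>
        (F i \<in> S \<and> wall T S n (fst (F i)) (snd (P i)) (snd (Q i)))"
      proof (cases "fst (F i) \<le> T")
        case True
        have "wall T S n (fst (F i)) (snd (P i)) (snd (Q i))"
        proof (rule Suc.IH[of "Suc i"])
          show "Suc i + n = R" using Suc.prems(1) by simp
          show "5 * real (Suc i) / 4 \<le> fst (F i)" "fst (F i) \<le> 5 * real (Suc i) / 4 + 1/16"
            using F[OF i] by (simp_all add: add_divide_distrib distrib_left)
          show "fst (F j) \<le> fst (F i)" if "j < Suc i" for j
          proof (cases "j = i")
            case False
            then show ?thesis using Suc.prems(4)[of j] that tF by simp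
          qed simp
          show "snd (P i) < snd (P j) \<and> snd (Q j) < snd (Q i)" if "Suc i \<le> j" "j < R" for j
            using ord[of i j] that by simp
        qed
        then show ?thesis using inS[OF i _ True] by blast
      next
        case False
        have "fst g \<le> b" if "g \<in> S" "snd (P i) < snd g" "snd g < snd (Q i)" for g
          using others[OF that] late[OF that(1)] False by linarith
        then show ?thesis using False tF by auto
      qed
      have mid: "snd (P i) < snd (Q i)" using pos by linarith
      from alt show ?thesis
      proof
        assume "T < b + 3/2 \<and> (\<forall>g\<in>S. snd (P i) < snd g \<and> snd g < snd (Q i) \<longrightarrow> fst g \<le> b)"
        then show ?thesis unfolding wall.simps using inPQ pos(1,2) mid tP tQ by blast
      next
        assume "F i \<in> S \<and> wall T S n (fst (F i)) (snd (P i)) (snd (Q i))"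
        then show ?thesis unfolding wall.simps using inPQ pos mid tP tQ tF others by blast
      qed
    qed simp
  qed
  from this[of 0 R 0 l u] show ?thesis using ends lu by force
qed

context realisation
begin

lemma atom_in:
  assumes "B \<in> sets m" "emeasure m B \<noteq> 0"
  shows "\<exists>p\<in>A. p \<in> B"
proof (rule ccontr)
  assume "\<not> (\<exists>p\<in>A. p \<in> B)"
  then have "B \<subseteq> space m - A" using sets.sets_into_space[OF assms(1)] by blast
  then have "emeasure m B \<le> emeasure m (space m - A)" by (rule emeasure_mono) (use A_sets[of A] in blast)
  then show False using null assms(2) by simp
qed

lemma atoms_eq:
  assumes "B \<in> sets m" "emeasure m B = 1" "p \<in> A" "q \<in> A" "p \<in> B" "q \<in> B"
  shows "p = q"
proof (rule ccontr)
  assume "p \<noteq> q"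
  then have "emeasure m {p, q} = 2" using emeasure_finite[of "{p, q}"] assms by simp
  moreover have "emeasure m {p, q} \<le> emeasure m B" by (rule emeasure_mono) (use assms in auto)
  ultimately show False using assms(2) by simp
qed

lemma not_atom:
  assumes "B \<in> sets m" "emeasure m B = 0" "p \<in> B"
  shows "p \<notin> A"
proof
  assume "p \<in> A"
  have "emeasure m {p} \<le> emeasure m B" by (rule emeasure_mono) (use assms in auto)
  then show False using atom_1[OF \<open>p \<in> A\<close>] assms(2) by simp
qed

lemma wall_of_block:
  assumes R: "1 \<le> R" and T: "T \<le> real R"
    and one: "\<And>c. c < 3 * R \<Longrightarrow> emeasure m (wall_block R d c) = 1"
    and none: "emeasure m (wall_block R d (3 * R)) = 0"
    and lu: "l < d" "d + 1 \<le> u" and k: "-k \<le> d" "d + 1 \<le> k"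
  shows "wall T (A \<inter> {0..T} \<times> {-k..k}) R 0 l u"
proof -
  have blk: "wall_block R d c \<in> sets m" for c
    by (rule sets_mI[OF wall_cell_borel(2)]) (use wall_block_sub[OF R, of d c] in auto)
  have "\<exists>p\<in>A. p \<in> wall_block R d c" if "c < 3 * R" for c using atom_in[OF blk] one[OF that] by simp
  then obtain f where f: "\<And>c. c < 3 * R \<Longrightarrow> f c \<in> A \<and> f c \<in> wall_block R d c" by metis
  have mem: "cell_time R c \<le> fst (f c) \<and> fst (f c) \<le> cell_time R c + 1/16 \<and>
     d + cell_pos R c \<le> snd (f c) \<and> snd (f c) \<le> d + cell_pos R c + cell_width R / 2" if "c < 3 * R" for c
    using f[OF that] that by (simp add: wall_block_def mem_wall_cell)
  note w = cell_width(1,2)[OF R]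
  have times: "cell_time R i = 5 * real i / 4 + 7/8" "cell_time R (R + i) = 5 * real i / 4 + 7/8"
    "cell_time R (2 * R + i) = 5 * real i / 4 + 5/4" if "i < R" for i
    using that by (simp_all add: cell_time_def)
  have posi: "cell_pos R i = real i * cell_width R" "cell_pos R (R + i) = 1 - (real i * cell_width R + cell_width R)"
    "cell_pos R (2 * R + i) = 1/2 - cell_width R / 4" if "i < R" for i
    using that by (simp_all add: cell_pos_def algebra_simps)
  have mem': "cell_time R i \<le> fst (f i)" "fst (f i) \<le> cell_time R i + 1/16"
      "d + cell_pos R i \<le> snd (f i)" "snd (f i) \<le> d + cell_pos R i + cell_width R / 2"
      "cell_time R (R + i) \<le> fst (f (R + i))" "fst (f (R + i)) \<le> cell_time R (R + i) + 1/16"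
      "d + cell_pos R (R + i) \<le> snd (f (R + i))" "snd (f (R + i)) \<le> d + cell_pos R (R + i) + cell_width R / 2"
      "cell_time R (2 * R + i) \<le> fst (f (2 * R + i))" "fst (f (2 * R + i)) \<le> cell_time R (2 * R + i) + 1/16"
      "d + cell_pos R (2 * R + i) \<le> snd (f (2 * R + i))" "snd (f (2 * R + i)) \<le> d + cell_pos R (2 * R + i) + cell_width R / 2"
    if "i < R" for i
    using mem[of i] mem[of "R + i"] mem[of "2 * R + i"] that by simp_all
  show ?thesis
  proof (rule wall_of_marks[where P = f and Q = "\<lambda>i. f (R + i)" and F = "\<lambda>i. f (2 * R + i)" and d = d])
    fix i assume i: "i < R"
    note b = mem'[OF i] times[OF i] posi[OF i] cell_width(3)[OF R i]
    show "5 * real i / 4 + 7/8 \<le> fst (f i) \<and> fst (f i) \<le> 5 * real i / 4 + 15/16" using b by linarith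
    show "5 * real i / 4 + 7/8 \<le> fst (f (R + i)) \<and> fst (f (R + i)) \<le> 5 * real i / 4 + 15/16" using b by linarith
    show "5 * real i / 4 + 5/4 \<le> fst (f (2 * R + i)) \<and> fst (f (2 * R + i)) \<le> 5 * real i / 4 + 21/16" using b by linarith
    show "d \<le> snd (f i) \<and> snd (f (R + i)) < d + 1" using b w by linarith
    fix j assume j: "j < R"
    show "snd (f i) < snd (f (2 * R + j)) \<and> snd (f (2 * R + j)) < snd (f (R + i))"
      using b w mem'(11,12)[OF j] posi(3)[OF j] by linarith
  next
    fix i j assume ij: "i < j" "j < R"
    then have i: "i < R" by simp
    show "snd (f i) < snd (f j) \<and> snd (f (R + j)) < snd (f (R + i))"
      using mem'(3,4,7,8)[OF i] mem'(3,4,7,8)[OF ij(2)] posi[OF i] posi[OF ij(2)] w cell_width(4)[OF R ij(1)] by linarith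
  next
    fix g assume g: "g \<in> A \<inter> {0..T} \<times> {-k..k}" "d \<le> snd g" "snd g < d + 1"
    show "\<exists>i<R. g \<in> {f i, f (R + i), f (2 * R + i)}"
    proof -
      have "g \<in> {0..2 * real R} \<times> {d..<d + 1}" using g T R by (auto simp: mem_Times_iff)
      moreover have "g \<notin> wall_block R d (3 * R)" using not_atom[OF blk none] g(1) by blast
      ultimately obtain c where c: "c < 3 * R" "g \<in> wall_cell R d c" unfolding wall_block_def by auto
      then have "g \<in> wall_block R d c" by (simp add: wall_block_def)
      then have gc: "g = f c" using atoms_eq[OF blk one[OF c(1)]] f[OF c(1)] g(1) by blast
      consider "c < R" | "R \<le> c" "c < 2 * R" | "2 * R \<le> c" by linarith
      then show ?thesis
      proof cases
        case 1
        then show ?thesis using gc by blast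
      next
        case 2
        then show ?thesis using gc by (intro exI[of _ "c - R"]) auto
      next
        case 3
        then show ?thesis using gc c(1) by (intro exI[of _ "c - 2 * R"]) auto
      qed
    qed
  next
    fix i g assume i: "i < R" and g: "g \<in> {f i, f (R + i), f (2 * R + i)}" and T': "fst g \<le> T"
    then obtain c where c: "c < 3 * R" "g = f c" by (elim insertE emptyE) (rule that; simp)+
    have "f c \<in> {0..2 * real R} \<times> {d..<d + 1}" using f[OF c(1)] wall_block_sub[OF R, of d c] by blast
    then have "f c \<in> {0..T} \<times> {-k..k}" using T' c(2) k by (auto simp: mem_Times_iff)
    with conjunct1[OF f[OF c(1)]] show "g \<in> A \<inter> {0..T} \<times> {-k..k}" unfolding c(2) by (rule IntI)
  qed (use lu T in \<open>auto simp: mem_Times_iff\<close>)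
qed

end

text \<open>Left ends of unit intervals beyond distance \<open>a\<close> from the origin, to the
  right or to the left. For different \<open>j\<close> the intervals are disjoint and give
  independent trials.\<close>

definition strip_base :: "nat \<Rightarrow> bool \<Rightarrow> nat \<Rightarrow> real" where
  "strip_base a s j = of_int (if s then int a + 1 + int j else - (int a + 2 + int j))"

lemma strip_base: "strip_base a True j = real a + 1 + real j" "strip_base a False j = - (real a + 2 + real j)"
  by (simp_all add: strip_base_def)

lemma strip_base_disjoint:
  assumes "j \<noteq> j'" "strip_base a s j \<le> x" "x < strip_base a s j + 1" "strip_base a s j' \<le> x" "x < strip_base a s j' + 1"
  shows False
proof -
  have "real j < real j' + 1" "real j' < real j + 1"
    using assms(2-5) by (cases s; simp only: strip_base; linarith)+
  then show False using assms(1) by linarith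
qed

lemma rectangle:
  fixes t y h v :: real
  assumes "0 \<le> h" "0 \<le> v"
  shows "{t..t + h} \<times> {y..y + v} = cbox (t, y) (t + h, y + v)"
    "measure lborel ({t..t + h} \<times> {y..y + v}) = h * v" "emeasure lborel ({t..t + h} \<times> {y..y + v}) < \<infinity>"
proof -
  show eq: "{t..t + h} \<times> {y..y + v} = cbox (t, y) (t + h, y + v)" by (simp add: cbox_Pair_eq)
  show "measure lborel ({t..t + h} \<times> {y..y + v}) = h * v"
    unfolding eq using assms by (subst content_Pair) simp
  show "emeasure lborel ({t..t + h} \<times> {y..y + v}) < \<infinity>"
    unfolding eq by (rule emeasure_bounded_finite[OF bounded_cbox])
qed

context poisson
begin

text \<open>Supplies the outer ends of walls, which must be marks with time at most
  \<open>T\<close>; hence a short duration \<open>1 / Suc n\<close>, chosen below \<open>T\<close>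
  later.\<close>

lemma AE_mark:
  "AE \<omega> in P. \<exists>j. emeasure (M \<omega>) ({0..0 + 1 / real (Suc n)} \<times> {strip_base a s j..strip_base a s j + 1/2}) \<noteq> 0"
proof -
  define G where "G j c = {0..0 + 1 / real (Suc n)} \<times> {strip_base a s j..strip_base a s j + 1/2}" for j c :: nat
  define v where "v = 1 / real (Suc n) * (1/2)"
  have v: "0 < v" by (simp add: v_def)
  have G: "G j c \<in> sets borel" "G j c \<subseteq> {0..} \<times> UNIV" "emeasure lborel (G j c) < \<infinity>" "measure lborel (G j c) = v" for j c
  proof -
    show "G j c \<in> sets borel" unfolding G_def by (intro borel_Times) simp_all
    show "G j c \<subseteq> {0..} \<times> UNIV" unfolding G_def by auto
    have h: "0 \<le> 1 / real (Suc n)" "0 \<le> (1/2 :: real)" by simp_all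
    show "emeasure lborel (G j c) < \<infinity>" unfolding G_def by (rule rectangle(3)[OF h])
    show "measure lborel (G j c) = v" unfolding G_def v_def by (rule rectangle(2)[OF h])
  qed
  have "AE \<omega> in P. \<exists>j. \<forall>c\<in>{0}. emeasure (M \<omega>) (G j c) \<in> - {0}"
  proof (rule AE_some_block[where e = "1 - exp (- v)"])
    fix j c j' c' :: nat assume c: "c \<in> {0}" "c' \<in> {0}" "(j, c) \<noteq> (j', c')"
    then have jj: "j \<noteq> j'" by auto
    show "G j c \<inter> G j' c' = {}"
    proof (rule ccontr)
      assume "G j c \<inter> G j' c' \<noteq> {}"
      then obtain p where "p \<in> G j c" "p \<in> G j' c'" by blast
      then have "strip_base a s j \<le> snd p" "snd p \<le> strip_base a s j + 1/2" "strip_base a s j' \<le> snd p" "snd p \<le> strip_base a s j' + 1/2"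
        by (simp_all only: G_def mem_Times_iff atLeastAtMost_iff)
      then show False by (intro strip_base_disjoint[OF jj, of a s "snd p"]) linarith+
    qed
  next
    fix j c :: nat
    have "{\<omega> \<in> space P. emeasure (M \<omega>) (G j c) \<in> - {0}} = {\<omega> \<in> space P. emeasure (M \<omega>) (G j c) \<noteq> 0}" by blast
    then show "1 - exp (- v) \<le> prob {\<omega> \<in> space P. emeasure (M \<omega>) (G j c) \<in> - {0}}"
      using prob_nonzero(1)[OF G(1-3), of j c] G(4)[of j c] by simp
  qed (use G v in auto)
  then show ?thesis by (simp add: G_def)
qed

lemma AE_block:
  assumes R: "1 \<le> R"
  shows "AE \<omega> in P. \<exists>j. (\<forall>c<3 * R. emeasure (M \<omega>) (wall_block R (strip_base a s j) c) = 1) \<and>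
    emeasure (M \<omega>) (wall_block R (strip_base a s j) (3 * R)) = 0"
proof -
  define G where "G j c = wall_block R (strip_base a s j) c" for j c
  define V where "V c = (if c < 3 * R then {1} else {0 :: ennreal})" for c
  define v where "v = 1/16 * (cell_width R / 2)"
  \<comment> \<open>A cell of area \<open>v\<close> has exactly one mark with probability
    \<open>v * exp (- v)\<close>. The rest has area at most \<open>2 * R\<close>, hence is empty
    with probability at least \<open>exp (- (2 * R))\<close>.\<close>
  define e where "e = min (v * exp (- v)) (exp (- (2 * real R)))"
  note w = cell_width(1)[OF R]
  have v: "0 < v" using w by (simp add: v_def)
  have sub: "G j c \<subseteq> {0..0 + 2 * real R} \<times> {strip_base a s j..strip_base a s j + 1}" for j c
  proof
    fix p assume "p \<in> G j c"
    then have "p \<in> {0..2 * real R} \<times> {strip_base a s j..<strip_base a s j + 1}"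
      using wall_block_sub[OF R] unfolding G_def by blast
    then show "p \<in> {0..0 + 2 * real R} \<times> {strip_base a s j..strip_base a s j + 1}" by (auto simp: mem_Times_iff)
  qed
  have R0: "0 \<le> 2 * real R" "0 \<le> (1 :: real)" by simp_all
  have G: "G j c \<in> sets borel" "G j c \<subseteq> {0..} \<times> UNIV" "emeasure lborel (G j c) < \<infinity>" for j c
  proof -
    show g: "G j c \<in> sets borel" unfolding G_def by (rule wall_cell_borel)
    show "G j c \<subseteq> {0..} \<times> UNIV" using sub[of j c] by auto
    show "emeasure lborel (G j c) < \<infinity>"
      by (rule emeasure_bounded_finite, rule bounded_subset[OF bounded_cbox sub[of j c, unfolded rectangle(1)[OF R0]]])
  qed
  have "AE \<omega> in P. \<exists>j. \<forall>c\<in>{..3 * R}. emeasure (M \<omega>) (G j c) \<in> V c"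
  proof (rule AE_some_block[where e = e])
    fix j c j' c' :: nat assume c: "c \<in> {..3 * R}" "c' \<in> {..3 * R}" "(j, c) \<noteq> (j', c')"
    show "G j c \<inter> G j' c' = {}"
    proof (cases "j = j'")
      case True
      then show ?thesis using wall_block_disjoint[OF R, of c c'] c unfolding G_def by auto
    next
      case False
      show ?thesis
      proof (rule ccontr)
        assume "G j c \<inter> G j' c' \<noteq> {}"
        then obtain p where "p \<in> G j c" "p \<in> G j' c'" by blast
        then have "p \<in> {0..2 * real R} \<times> {strip_base a s j..<strip_base a s j + 1}"
          "p \<in> {0..2 * real R} \<times> {strip_base a s j'..<strip_base a s j' + 1}"
          using wall_block_sub[OF R] unfolding G_def by blast+
        then show False by (intro strip_base_disjoint[OF False, of a s "snd p"]) (simp_all add: mem_Times_iff)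
      qed
    qed
  next
    fix j c :: nat assume "c \<in> {..3 * R}"
    show "e \<le> prob {\<omega> \<in> space P. emeasure (M \<omega>) (G j c) \<in> V c}"
    proof (cases "c < 3 * R")
      case True
      have "G j c = wall_cell R (strip_base a s j) c" using True by (simp add: G_def wall_block_def)
      then have "measure lborel (G j c) = v"
        using rectangle(2)[of "1/16" "cell_width R / 2"] w by (simp add: wall_cell_def v_def)
      moreover have "{\<omega> \<in> space P. emeasure (M \<omega>) (G j c) \<in> V c} = {\<omega> \<in> space P. emeasure (M \<omega>) (G j c) = of_nat 1}"
        using True by (simp add: V_def)
      ultimately have "prob {\<omega> \<in> space P. emeasure (M \<omega>) (G j c) \<in> V c} = v * exp (- v)"
        using prob_count[OF G, of j c 1] by simp
      then show ?thesis by (simp add: e_def)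
    next
      case False
      have "measure lborel (G j c) \<le> measure lborel (cbox (0, strip_base a s j) (0 + 2 * real R, strip_base a s j + 1))"
        by (rule measure_mono_fmeasurable[OF _ _ fmeasurable_cbox])
          (use sub[of j c, unfolded rectangle(1)[OF R0]] G(1) in \<open>simp_all only: sets_lborel\<close>)
      also have "\<dots> = 2 * real R * 1" unfolding rectangle(1)[OF R0, symmetric] by (rule rectangle(2)[OF R0])
      finally have "measure lborel (G j c) \<le> 2 * real R" by simp
      then have le: "exp (- (2 * real R)) \<le> exp (- measure lborel (G j c))" by simp
      have "{\<omega> \<in> space P. emeasure (M \<omega>) (G j c) \<in> V c} = {\<omega> \<in> space P. emeasure (M \<omega>) (G j c) = of_nat 0}"
        using False by (simp add: V_def)
      then have pr: "prob {\<omega> \<in> space P. emeasure (M \<omega>) (G j c) \<in> V c} = exp (- measure lborel (G j c))"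
        using prob_count[OF G, of j c 0] by simp
      show ?thesis unfolding pr e_def by (rule min.coboundedI2[OF le])
    qed
  next
    fix c :: nat show "V c \<in> sets borel" by (simp add: V_def)
  next
    fix j c :: nat show "G j c \<in> sets borel \<and> G j c \<subseteq> {0..} \<times> UNIV" using G by blast
  next
    show "0 < e" using v by (simp add: e_def)
  qed simp_all
  then show ?thesis
  proof eventually_elim
    case (elim \<omega>)
    then obtain j where j: "\<forall>c\<in>{..3 * R}. emeasure (M \<omega>) (G j c) \<in> V c" by blast
    have "emeasure (M \<omega>) (wall_block R (strip_base a s j) c) = 1" if "c < 3 * R" for c
      using bspec[OF j, of c] \<open>c < 3 * R\<close> by (simp add: V_def G_def)
    moreover have "emeasure (M \<omega>) (wall_block R (strip_base a s j) (3 * R)) = 0"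
      using bspec[OF j, of "3 * R"] by (simp add: V_def G_def)
    ultimately show ?case by blast
  qed
qed

text \<open>The exceptional event must not depend on the real numbers \<open>T\<close> and
  \<open>a\<close>, so the random statements are quantified over natural numbers and the rounding is
  done afterwards.\<close>

lemma AE_walled:
  "AE \<omega> in P. realisation (M \<omega>) \<and>
     (\<forall>T>0. \<forall>a. \<exists>k::nat. walled T (nat \<lceil>T\<rceil>) (atoms (M \<omega>) \<inter> {0..T} \<times> {- real k..real k}) a)"
proof -
  have "AE \<omega> in P. \<forall>n a s. \<exists>j. emeasure (M \<omega>) ({0..0 + 1 / real (Suc n)} \<times> {strip_base a s j..strip_base a s j + 1/2}) \<noteq> 0"
    unfolding AE_all_countable by (intro allI AE_mark)
  moreover have "AE \<omega> in P. \<forall>i a s. \<exists>j. (\<forall>c<3 * Suc i. emeasure (M \<omega>) (wall_block (Suc i) (strip_base a s j) c) = 1) \<and>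
    emeasure (M \<omega>) (wall_block (Suc i) (strip_base a s j) (3 * Suc i)) = 0"
    unfolding AE_all_countable by (intro allI AE_block) simp
  ultimately show ?thesis using AE_realisation
  proof eventually_elim
    case (elim \<omega>)
    interpret realisation "M \<omega>" by (rule elim(3))
    have "\<exists>k::nat. walled T (nat \<lceil>T\<rceil>) (A \<inter> {0..T} \<times> {- real k..real k}) a" if T: "0 < T" for T a
    proof -
      define R where "R = nat \<lceil>T\<rceil>"
      have R: "1 \<le> R" "T \<le> real R" using T unfolding R_def by linarith+
      then obtain i where i: "R = Suc i" using not0_implies_Suc by (metis not_one_le_zero)
      obtain n where n: "1 / real (Suc n) < T" using nat_approx_posE[OF T] by blast
      obtain a0 :: nat where a0: "\<bar>a\<bar> \<le> real a0" using real_arch_simple by blast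
      have mark: "\<exists>j p. p \<in> A \<and> 0 \<le> fst p \<and> fst p \<le> T \<and> strip_base b s j \<le> snd p \<and> snd p \<le> strip_base b s j + 1/2" for b s
      proof -
        obtain j where j: "emeasure (M \<omega>) ({0..0 + 1 / real (Suc n)} \<times> {strip_base b s j..strip_base b s j + 1/2}) \<noteq> 0"
          using elim(1) by blast
        have "{0..0 + 1 / real (Suc n)} \<times> {strip_base b s j..strip_base b s j + 1/2} \<in> sets (M \<omega>)"
          by (rule sets_mI) (auto intro!: borel_Times)
        then obtain p where p: "p \<in> A" "p \<in> {0..0 + 1 / real (Suc n)} \<times> {strip_base b s j..strip_base b s j + 1/2}"
          using atom_in[OF _ j] by blast
        have "0 \<le> fst p" "fst p \<le> 0 + 1 / real (Suc n)" "strip_base b s j \<le> snd p" "snd p \<le> strip_base b s j + 1/2"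
          using p(2) unfolding mem_Times_iff atLeastAtMost_iff by blast+
        then show ?thesis using p(1) n by (intro exI[of _ j] exI[of _ p]) linarith
      qed
      have block: "\<exists>j. \<forall>l u k. l < strip_base b s j \<longrightarrow> strip_base b s j + 1 \<le> u \<longrightarrow> -k \<le> l \<longrightarrow> u \<le> k \<longrightarrow>
        wall T (A \<inter> {0..T} \<times> {-k..k}) R 0 l u" for b s
      proof -
        obtain j where j: "\<forall>c<3 * R. emeasure (M \<omega>) (wall_block R (strip_base b s j) c) = 1"
          "emeasure (M \<omega>) (wall_block R (strip_base b s j) (3 * R)) = 0" using elim(2) unfolding i by blast
        show ?thesis
        proof (intro exI[of _ j] allI impI)
          fix l u k assume h: "l < strip_base b s j" "strip_base b s j + 1 \<le> u" "-k \<le> l" "u \<le> k"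
          show "wall T (A \<inter> {0..T} \<times> {-k..k}) R 0 l u"
            by (rule wall_of_block[OF R _ j(2) h(1,2)]) (use j(1) h in auto)
        qed
      qed
      \<comment> \<open>From \<open>a\<close> outwards: a mark \<open>p1\<close>, a block with a
        wall, a mark \<open>q1\<close>; then the same to the left. The offsets \<open>2 + j1\<close>
        and \<open>4 + j1 + j2\<close> start each search beyond the previous find.\<close>
      obtain j1 p1 where p1: "p1 \<in> A" "0 \<le> fst p1" "fst p1 \<le> T" "strip_base a0 True j1 \<le> snd p1" "snd p1 \<le> strip_base a0 True j1 + 1/2"
        using mark by blast
      obtain j2 where j2: "\<forall>l u k. l < strip_base (a0 + 2 + j1) True j2 \<longrightarrow> strip_base (a0 + 2 + j1) True j2 + 1 \<le> u \<longrightarrow> -k \<le> l \<longrightarrow> u \<le> k \<longrightarrow>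
        wall T (A \<inter> {0..T} \<times> {-k..k}) R 0 l u" using block by blast
      obtain j3 q1 where q1: "q1 \<in> A" "0 \<le> fst q1" "fst q1 \<le> T" "strip_base (a0 + 4 + j1 + j2) True j3 \<le> snd q1"
        using mark by blast
      obtain j4 q2 where q2: "q2 \<in> A" "0 \<le> fst q2" "fst q2 \<le> T" "strip_base a0 False j4 \<le> snd q2" "snd q2 \<le> strip_base a0 False j4 + 1/2"
        using mark by blast
      obtain j5 where j5: "\<forall>l u k. l < strip_base (a0 + 2 + j4) False j5 \<longrightarrow> strip_base (a0 + 2 + j4) False j5 + 1 \<le> u \<longrightarrow> -k \<le> l \<longrightarrow> u \<le> k \<longrightarrow>
        wall T (A \<inter> {0..T} \<times> {-k..k}) R 0 l u" using block by blast
      obtain j6 p2 where p2: "p2 \<in> A" "0 \<le> fst p2" "fst p2 \<le> T" "snd p2 \<le> strip_base (a0 + 4 + j4 + j5) False j6 + 1/2"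
        using mark by blast
      obtain k :: nat where k: "\<bar>snd p1\<bar> + \<bar>snd q1\<bar> + \<bar>snd p2\<bar> + \<bar>snd q2\<bar> \<le> real k" using real_arch_simple by blast
      note sb = strip_base of_nat_add of_nat_numeral
      have right: "a < snd p1" "snd p1 < strip_base (a0 + 2 + j1) True j2" "strip_base (a0 + 2 + j1) True j2 + 1 \<le> snd q1"
        using p1(4,5) q1(4) a0 unfolding sb by linarith+
      have left: "snd q2 < - a" "snd p2 < strip_base (a0 + 2 + j4) False j5" "strip_base (a0 + 2 + j4) False j5 + 1 \<le> snd q2"
        using q2(4,5) p2(4) a0 unfolding sb by linarith+
      have mem: "p \<in> A \<inter> {0..T} \<times> {- real k..real k}" if p: "p \<in> A" "0 \<le> fst p" "fst p \<le> T" "\<bar>snd p\<bar> \<le> real k" for p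
        using p by (simp add: mem_Times_iff abs_le_iff)
      have bd: "\<bar>snd p1\<bar> \<le> real k" "\<bar>snd q1\<bar> \<le> real k" "\<bar>snd p2\<bar> \<le> real k" "\<bar>snd q2\<bar> \<le> real k" using k by linarith+
      have wr: "wall T (A \<inter> {0..T} \<times> {- real k..real k}) R 0 (snd p1) (snd q1)"
        using j2 right bd by (simp add: abs_le_iff)
      have wl: "wall T (A \<inter> {0..T} \<times> {- real k..real k}) R 0 (snd p2) (snd q2)"
        using j5 left bd by (simp add: abs_le_iff)
      have "snd p1 < snd q1" "snd p2 < snd q2" using right left by linarith+
      then have "walled T R (A \<inter> {0..T} \<times> {- real k..real k}) a"
        unfolding walled_def
        using wr wl right(1) left(1) mem[OF p1(1-3) bd(1)] mem[OF q1(1-3) bd(2)] mem[OF p2(1-3) bd(3)] mem[OF q2(1-3) bd(4)] by blast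
      then show ?thesis unfolding R_def by blast
    qed
    then show ?case using elim(3) by blast
  qed
qed

end

section \<open>The stopping test as a formula\<close>

definition "test_lt u v = Neg (Leq v u)"
definition "test_or \<phi> \<psi> = Neg (Conj (Neg \<phi>) (Neg \<psi>))"

text \<open>The environment holds the right mark, the left mark and the last fire, in this order.\<close>

fun wall_test :: "real \<Rightarrow> nat \<Rightarrow> test" where
  "wall_test T 0 = test_lt (Const T) (Plus (Time 2) (Const 1))"
| "wall_test T (Suc n) = test_or (test_lt (Const T) (Plus (Time 2) (Const 1))) (SomeMark (SomeMark (SomeMark
     (Conj (Conj (Conj (test_lt (Pos 4) (Pos 1)) (Conj (test_lt (Pos 1) (Pos 0)) (test_lt (Pos 0) (Pos 3))))
       (Conj (Conj (test_lt (Plus (Time 5) (Const (3/4))) (Time 1)) (test_lt (Time 1) (Plus (Time 5) (Const 1))))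
         (Conj (test_lt (Plus (Time 5) (Const (3/4))) (Time 0)) (test_lt (Time 0) (Plus (Time 5) (Const 1))))))
       (test_or
         (Conj (test_lt (Const T) (Plus (Time 5) (Const (3/2))))
           (Neg (SomeMark (Conj (Conj (test_lt (Pos 2) (Pos 0)) (test_lt (Pos 0) (Pos 1))) (test_lt (Time 6) (Time 0))))))
         (Conj (Conj (Conj (test_lt (Pos 1) (Pos 2)) (test_lt (Pos 2) (Pos 0)))
             (Conj (test_lt (Plus (Time 5) (Const 1)) (Time 2)) (test_lt (Time 2) (Plus (Time 5) (Const (3/2))))))
           (Conj (Neg (SomeMark (Conj (Conj (test_lt (Pos 2) (Pos 0)) (test_lt (Pos 0) (Pos 1)))
               (Conj (test_lt (Time 6) (Time 0)) (test_lt (Time 0) (Time 3))))))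
             (wall_test T n))))))))"

definition walled_test :: "real \<Rightarrow> nat \<Rightarrow> real \<Rightarrow> test" where
  "walled_test T n a = Conj
     (SomeMark (SomeMark (Conj (Conj (test_lt (Pos 1) (Pos 0)) (test_lt (Pos 0) (Const (- a)))) (wall_test T n))))
     (SomeMark (SomeMark (Conj (Conj (test_lt (Const a) (Pos 1)) (test_lt (Pos 1) (Pos 0))) (wall_test T n))))"

lemma test_val_lt: "test_val S e (test_lt u v) \<longleftrightarrow> aff_val e u < aff_val e v"
  and test_val_or: "test_val S e (test_or \<phi> \<psi>) \<longleftrightarrow> test_val S e \<phi> \<or> test_val S e \<psi>"
  by (auto simp: test_lt_def test_or_def)

text \<open>The fire is quantified first, so that below the two sparks the environment has the
  layout expected by the recursive call. It thus stands outside the disjunction; in the alternative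
  without a fire any mark, such as a spark, is a witness.\<close>

lemma test_val_wall: "test_val S e (wall_test T n) \<longleftrightarrow> wall T S n (fst (e 2)) (snd (e 1)) (snd (e 0))"
proof (induction n arbitrary: e)
  case 0
  then show ?case by (simp add: test_val_lt)
next
  case (Suc n)
  have none: "(\<forall>g\<in>S. l < snd g \<and> snd g < u \<longrightarrow> fst g \<le> b) \<longleftrightarrow>
      \<not> (\<exists>g\<in>S. (l < snd g \<and> snd g < u) \<and> b < fst g)"
    "(\<forall>g\<in>S. l < snd g \<and> snd g < u \<longrightarrow> fst g \<le> b \<or> c \<le> fst g) \<longleftrightarrow>
      \<not> (\<exists>g\<in>S. (l < snd g \<and> snd g < u) \<and> b < fst g \<and> fst g < c)" for l u b c :: real
    unfolding not_less[symmetric] by blast+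
  show ?case
    unfolding wall.simps none
    by (simp only: wall_test.simps test_val.simps test_val_lt test_val_or aff_val.simps Suc.IH
        eval_nat_numeral BitM.simps One_nat_def nat.case) blast
qed

text \<open>Below the two quantified marks the environment is \<open>(0, 0)\<close>, whose time is
  the initial reset time \<open>b = 0\<close> of a wall.\<close>

lemma passes_walled_test: "passes S (walled_test T n a) \<longleftrightarrow> walled T n S a"
  unfolding walled_def
  by (simp only: passes_def walled_test_def test_val.simps test_val_lt test_val_wall aff_val.simps
      eval_nat_numeral BitM.simps One_nat_def nat.case fst_conv) blast

section \<open>The solution as an adapted limit of boxes\<close>

lemma lim_const_eventually: "(\<And>j. k0 \<le> j \<Longrightarrow> f j = c) \<Longrightarrow> lim f = (c :: real)"
  by (rule limI[OF tendsto_eventually[OF eventually_sequentiallyI[of k0]]])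

text \<open>Negative times have no meaning for the process, but paths are functions on all reals.
  These values let the final process equal \<open>confined.Z\<close> and \<open>confined.H\<close>
  as functions.\<close>

lemma box_negative_time:
  assumes "t < 0"
  shows "box_Z A k t t x = t" "box_H A k t t x = - t"
proof -
  have e: "A \<inter> {0..t} \<times> {-k..k} = {}" using assms by simp
  have "sorted_key_list_of_set fst {} = ([] :: (real \<times> real) list)"
    by (rule sorted_key_list_of_set_strict(3)) simp_all
  then have "box_state A k t t = (t, \<lambda>x. min 1 (0 + (t - 0)), \<lambda>x. max 0 (0 - (t - 0)))"
    by (simp only: box_state_def graphical_def e filter.simps fold_simps evolve.simps)
  then show "box_Z A k t t x = t" "box_H A k t t x = - t" using assms by (simp_all add: box_Z_def box_H_def)
qed

text \<open>Every solution coincides at \<open>(t, x)\<close> with every large box. This gives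
  uniqueness, and for the constructed solution the values of the limits.\<close>

lemma (in confined) agree:
  assumes fp: "\<And>T. fire_process T A {} UNIV Z' H'" and t: "0 \<le> t"
  shows "\<exists>k0. \<forall>j\<ge>k0. Z' t x = box_Z A (real j) t t x \<and> H' t x = box_H A (real j) t t x \<and>
    cluster (Z' t) (H' t) x = box_cluster (real j) (box_Z A (real j) t t) (box_H A (real j) t t) x"
proof -
  have "0 < t + 1" using t by simp
  then obtain N k where w: "walled (t + 1) N (A \<inter> {0..t + 1} \<times> {- real k..real k}) \<bar>x\<bar>"
    using walls[of "t + 1" "\<bar>x\<bar>"] by blast
  have "Z' t x = box_Z A (real j) t t x \<and> H' t x = box_H A (real j) t t x \<and>
    cluster (Z' t) (H' t) x = box_cluster (real j) (box_Z A (real j) t t) (box_H A (real j) t t) x" if j: "k \<le> j" for j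
  proof -
    interpret B: box A "real j" "t + 1" by unfold_locales (rule gen)
    have wj: "walled (t + 1) N (A \<inter> {0..t + 1} \<times> {- real j..real j}) \<bar>x\<bar>"
      by (rule walled_mono[OF w]) (use j in simp)
    have tx: "t \<in> {0..t + 1}" "x \<in> {- \<bar>x\<bar>..\<bar>x\<bar>}" using t by auto
    have X: "{- real j<..<real j} \<subseteq> UNIV" "{} \<inter> {- real j<..<real j} = {}" by simp_all
    have le: "t \<le> t + 1" by simp
    have e: "box_Z A (real j) (t + 1) t = box_Z A (real j) t t" "box_H A (real j) (t + 1) t = box_H A (real j) t t"
      by (simp_all only: box_Z_def box_H_def B.box_state_restrict[OF le])
    note a = walled_agree[OF gen fp wj X tx, unfolded e]
    show ?thesis using a(1,2) a(3)[OF refl] by blast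
  qed
  then show ?thesis by blast
qed

theorem theorem3:
  fixes P :: "'w measure" and M :: "'w \<Rightarrow> (real \<times> real) measure"
  assumes "prob_space P"
    and "poisson_measure P half_plane_lebesgue M"
  shows "\<exists>Z D H. lffp P M Z D H \<and>
    (\<forall>Z' D' H'. lffp P M Z' D' H' \<longrightarrow>
       (AE \<omega> in P. \<forall>t\<ge>0. \<forall>x. Z' \<omega> t x = Z \<omega> t x \<and> D' \<omega> t x = D \<omega> t x \<and> H' \<omega> t x = H \<omega> t x)) \<and>
    (\<forall>T>0. \<forall>n. perfectly_simulated P M Z D H T n)"
proof -
  interpret poisson P M by (intro poisson.intro poisson_axioms.intro assms)
  define Zl where "Zl \<omega> t x = lim (\<lambda>k. counts.Zv M t (real k) \<omega> x)" for \<omega> t x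
  define Hl where "Hl \<omega> t x = lim (\<lambda>k. counts.Hv M t (real k) \<omega> x)" for \<omega> t x
  define L where "L \<omega> t x = lim (\<lambda>k. counts.Lv M t (real k) \<omega> x)" for \<omega> t x
  define U where "U \<omega> t x = lim (\<lambda>k. counts.Rv M t (real k) \<omega> x)" for \<omega> t x
  \<comment> \<open>The truncations enforce the required ranges on exceptional
    \<open>\<omega>\<close>, where the limits are arbitrary, and change nothing on good ones. The
    values at negative times are those of \<open>box_negative_time\<close>.\<close>
  define Z where "Z \<omega> t x = (if t < 0 then t else max 0 (Zl \<omega> t x))" for \<omega> t x
  define H where "H \<omega> t x = (if t < 0 then - t else max 0 (Hl \<omega> t x))" for \<omega> t x
  define D where "D \<omega> t x = {L \<omega> t x..max (L \<omega> t x) (U \<omega> t x)}" for \<omega> t x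
  have cnt: "counts (poisson_filtration P M t) M t" if t: "0 \<le> t" for t
  proof (rule counts.intro)
    fix B :: "(real \<times> real) set" assume B: "B \<in> sets borel" "B \<subseteq> {0..t} \<times> UNIV"
    let ?G = "{(\<lambda>\<omega>. emeasure (M \<omega>) B) -` C \<inter> space P | B C. B \<in> sets borel \<and> B \<subseteq> {0..t} \<times> UNIV \<and> C \<in> sets borel}"
    have G: "?G \<subseteq> Pow (space P)" by blast
    show "(\<lambda>\<omega>. emeasure (M \<omega>) B) \<in> borel_measurable (poisson_filtration P M t)"
    proof (rule measurableI)
      fix C :: "ennreal set" assume C: "C \<in> sets borel"
      have "(\<lambda>\<omega>. emeasure (M \<omega>) B) -` C \<inter> space P \<in> ?G" using B C by blast
      then show "(\<lambda>\<omega>. emeasure (M \<omega>) B) -` C \<inter> space (poisson_filtration P M t) \<in> sets (poisson_filtration P M t)"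
        unfolding poisson_filtration_def space_measure_of[OF G] by (rule in_measure_of[OF G])
    qed simp
  qed (rule t)
  have conf: "confined (atoms (M \<omega>))"
    if g: "realisation (M \<omega>)" and w: "\<forall>T>0. \<forall>a. \<exists>k::nat. walled T (nat \<lceil>T\<rceil>) (atoms (M \<omega>) \<inter> {0..T} \<times> {- real k..real k}) a" for \<omega>
    by (rule confined.intro[OF realisation.gen[OF g]]) (use w in blast)
  \<comment> \<open>The adapted limits are matched with the construction: \<open>values_eq\<close>
    holds in every box containing \<open>x\<close>, and by \<open>C.agree\<close> large boxes
    already have the final values.\<close>
  have vals: "Z \<omega> = confined.Z (atoms (M \<omega>)) \<and> H \<omega> = confined.H (atoms (M \<omega>)) \<and>
      (\<forall>t\<ge>0. \<forall>x. D \<omega> t x = cluster (confined.Z (atoms (M \<omega>)) t) (confined.H (atoms (M \<omega>)) t) x)"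
    if good: "realisation (M \<omega>)" and conf: "confined (atoms (M \<omega>))" for \<omega>
  proof -
    interpret C: confined "atoms (M \<omega>)" by (rule conf)
    have main: "Z \<omega> t x = C.Z t x \<and> H \<omega> t x = C.H t x \<and> D \<omega> t x = cluster (C.Z t) (C.H t) x" if t: "0 \<le> t" for t x
    proof -
      obtain k0 where k0: "\<forall>j\<ge>k0. C.Z t x = box_Z (atoms (M \<omega>)) (real j) t t x \<and> C.H t x = box_H (atoms (M \<omega>)) (real j) t t x \<and>
        cluster (C.Z t) (C.H t) x = box_cluster (real j) (box_Z (atoms (M \<omega>)) (real j) t t) (box_H (atoms (M \<omega>)) (real j) t t) x"
        using C.agree[OF C.fire_process t] by blast
      obtain k1 :: nat where k1: "\<bar>x\<bar> \<le> real k1" using real_arch_simple by blast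
      have "t \<in> {0..t}" using t by simp
      then obtain a b where ab: "a \<le> b" "cluster (C.Z t) (C.H t) x = {a..b}"
        using C.cluster_bounded[where T = t and x = x] by blast
      have ev: "counts.Zv M t (real j) \<omega> x = C.Z t x \<and> counts.Hv M t (real j) \<omega> x = C.H t x \<and>
        counts.Lv M t (real j) \<omega> x = a \<and> counts.Rv M t (real j) \<omega> x = b" if j: "max k0 k1 \<le> j" for j
      proof -
        have xj: "x \<in> {- real j..real j}" using k1 j by auto
        note v = counts.values_eq[OF cnt[OF t] good xj]
        have "k0 \<le> j" using j by simp
        note kj = k0[rule_format, OF this]
        have "{counts.Lv M t (real j) \<omega> x..counts.Rv M t (real j) \<omega> x} = {a..b}"
          using v(3) kj ab(2) by metis
        then have "counts.Lv M t (real j) \<omega> x = a \<and> counts.Rv M t (real j) \<omega> x = b"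
          using ab(1) unfolding Icc_eq_Icc by auto
        then show ?thesis using v(1,2) kj by metis
      qed
      have lims: "Zl \<omega> t x = C.Z t x" "Hl \<omega> t x = C.H t x" "L \<omega> t x = a" "U \<omega> t x = b"
        unfolding Zl_def Hl_def L_def U_def by (rule lim_const_eventually[of "max k0 k1"]; use ev in blast)+
      have "0 \<le> C.Z t x" by (rule fire_process.Z_bounds(1)[OF C.fire_process[of t]]) (use t in simp_all)
      moreover have "0 \<le> C.H t x"
      proof -
        interpret B: box "atoms (M \<omega>)" "real k0" t by unfold_locales (rule C.gen)
        have "C.H t x = B.H t x" using k0 by blast
        then show ?thesis using B.H_nonneg[OF t, of x] by simp
      qed
      ultimately show ?thesis using t ab by (simp add: Z_def H_def D_def lims)
    qed
    have neg: "Z \<omega> t x = C.Z t x \<and> H \<omega> t x = C.H t x" if t: "t < 0" for t x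
      unfolding C.Z_def C.H_def box_negative_time[OF t] using t by (simp add: Z_def H_def)
    have "Z \<omega> t x = C.Z t x \<and> H \<omega> t x = C.H t x" for t x using main[of t x] neg[of t x] by (cases "t < 0") simp_all
    then have "Z \<omega> = C.Z" "H \<omega> = C.H" by (intro ext; blast)+
    then show ?thesis using main by blast
  qed
  have ex: "lffp P M Z D H"
    unfolding lffp_def
  proof (intro conjI ballI allI impI)
    fix \<omega> t x assume t: "(0 :: real) \<le> t"
    show "0 \<le> Z \<omega> t x" "0 \<le> H \<omega> t x" using t by (simp_all add: Z_def H_def)
    show "D \<omega> t x \<in> closed_intervals" unfolding D_def closed_intervals_def using max.cobounded1 by blast
  next
    fix t x :: real assume t: "0 \<le> t"
    let ?F = "poisson_filtration P M t"
    have m: "(\<lambda>\<omega>. Zl \<omega> t x) \<in> borel_measurable ?F" "(\<lambda>\<omega>. Hl \<omega> t x) \<in> borel_measurable ?F"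
      "(\<lambda>\<omega>. L \<omega> t x) \<in> borel_measurable ?F" "(\<lambda>\<omega>. U \<omega> t x) \<in> borel_measurable ?F"
      unfolding Zl_def Hl_def L_def U_def
      by (intro borel_measurable_lim_metric counts.measurable_Zv[OF cnt[OF t] borel_measurable_const] counts.measurable_ends[OF cnt[OF t]])+
    note [measurable] = m
    have nt: "\<not> t < 0" using t by simp
    show "(\<lambda>\<omega>. Z \<omega> t x) \<in> borel_measurable ?F" unfolding Z_def if_not_P[OF nt] by measurable
    show "(\<lambda>\<omega>. H \<omega> t x) \<in> borel_measurable ?F" unfolding H_def if_not_P[OF nt] by measurable
    have "Inf (D \<omega> t x) = L \<omega> t x" "Sup (D \<omega> t x) = max (L \<omega> t x) (U \<omega> t x)" for \<omega>
      unfolding D_def by (rule cInf_atLeastAtMost[OF max.cobounded1], rule cSup_atLeastAtMost[OF max.cobounded1])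
    note ends = this
    show "(\<lambda>\<omega>. Inf (D \<omega> t x)) \<in> borel_measurable ?F" unfolding ends by measurable
    show "(\<lambda>\<omega>. Sup (D \<omega> t x)) \<in> borel_measurable ?F" unfolding ends by measurable
  next
    show "AE \<omega> in P. lffp_path (M \<omega>) (Z \<omega>) (D \<omega>) (H \<omega>)"
      using AE_walled
    proof eventually_elim
      case (elim \<omega>)
      interpret realisation "M \<omega>" using elim by blast
      interpret C: confined A using conf elim by blast
      note v = vals[OF conjunct1[OF elim] C.confined_axioms]
      have Z: "Z \<omega> = C.Z" and H: "H \<omega> = C.H" using v by blast+
      have D: "\<forall>t\<ge>0. \<forall>x. D \<omega> t x = cluster (C.Z t) (C.H t) x" using v by blast
      show ?case unfolding Z H
        by (rule lffp_path_of_fire_process[OF C.fire_process C.limits(1) C.limits(2) _ C.cluster_bounded C.barriers_const C.full_before])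
          (use D in blast)+
    qed
  qed
  have uniq: "AE \<omega> in P. \<forall>t\<ge>0. \<forall>x. Z' \<omega> t x = Z \<omega> t x \<and> D' \<omega> t x = D \<omega> t x \<and> H' \<omega> t x = H \<omega> t x"
    if l: "lffp P M Z' D' H'" for Z' D' H'
  proof -
    have "AE \<omega> in P. lffp_path (M \<omega>) (Z' \<omega>) (D' \<omega>) (H' \<omega>)" using l unfolding lffp_def by blast
    then show ?thesis using AE_walled AE_space
    proof eventually_elim
      case (elim \<omega>)
      interpret realisation "M \<omega>" using elim by blast
      interpret C: confined A using conf elim by blast
      \<comment> \<open>Any solution satisfies the interface, so it equals every large box, as does
        the constructed one.\<close>
      have fp: "fire_process T A {} UNIV (Z' \<omega>) (H' \<omega>)" for T
        by (rule fire_process_of_lffp_path[OF elim(1)]) (use l elim(3) in \<open>unfold lffp_def, blast\<close>)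
      note v = vals[OF conjunct1[OF elim(2)] C.confined_axioms]
      have Z: "Z \<omega> = C.Z" and H: "H \<omega> = C.H" using v by blast+
      show ?case
      proof (intro allI impI)
        fix t x :: real assume t: "0 \<le> t"
        obtain k0 where k0: "\<forall>j\<ge>k0. C.Z t x = box_Z A (real j) t t x \<and> C.H t x = box_H A (real j) t t x \<and>
          cluster (C.Z t) (C.H t) x = box_cluster (real j) (box_Z A (real j) t t) (box_H A (real j) t t) x"
          using C.agree[OF C.fire_process t] by blast
        obtain k1 where k1: "\<forall>j\<ge>k1. Z' \<omega> t x = box_Z A (real j) t t x \<and> H' \<omega> t x = box_H A (real j) t t x \<and>
          cluster (Z' \<omega> t) (H' \<omega> t) x = box_cluster (real j) (box_Z A (real j) t t) (box_H A (real j) t t) x"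
          using C.agree[OF fp t] by blast
        note a = k0[rule_format, of "max k0 k1", OF max.cobounded1] k1[rule_format, of "max k0 k1", OF max.cobounded2]
        have "D' \<omega> t x = cluster (Z' \<omega> t) (H' \<omega> t) x"
          using elim(1) t unfolding lffp_path_def Let_def by blast
        moreover have "D \<omega> t x = cluster (C.Z t) (C.H t) x" using v t by blast
        ultimately show "Z' \<omega> t x = Z \<omega> t x \<and> D' \<omega> t x = D \<omega> t x \<and> H' \<omega> t x = H \<omega> t x"
          unfolding Z H using a by metis
      qed
    qed
  qed
  have sim: "perfectly_simulated P M Z D H T n" if T: "0 < T" for T n
    unfolding perfectly_simulated_def
  \<comment> \<open>The test looks for walls on both sides of \<open>{- real n..real n}\<close> with
    \<open>nat \<lceil>T\<rceil>\<close> rounds at most. Once it succeeds,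
    \<open>walled_agree\<close> makes the output of the box exact.\<close>
  proof (rule exI[of _ "walled_test T (nat \<lceil>T\<rceil>) (real n)"])
    show "AE \<omega> in P.
        (\<forall>k. finite (marks (M \<omega>) T k) \<and> inj_on fst (marks (M \<omega>) T k)) \<and>
        (\<exists>k\<ge>n. passes (marks (M \<omega>) T k) (walled_test T (nat \<lceil>T\<rceil>) (real n))) \<and>
        (\<forall>k\<ge>n. passes (marks (M \<omega>) T k) (walled_test T (nat \<lceil>T\<rceil>) (real n)) \<longrightarrow>
           (\<forall>t\<in>{0..T}. \<forall>x\<in>{- real n..real n}.
              (case graphical (real k) (sorted_key_list_of_set fst (marks (M \<omega>) T k)) t of
                 (_, z, h) \<Rightarrow>
                   Z \<omega> t x = z x \<and> D \<omega> t x = box_cluster (real k) z h x \<and> H \<omega> t x = h x)))"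
      using AE_walled
    proof eventually_elim
      case (elim \<omega>)
      interpret realisation "M \<omega>" using elim by blast
      interpret C: confined A using conf elim by blast
      note v = vals[OF conjunct1[OF elim] C.confined_axioms]
      have Z: "Z \<omega> = C.Z" and H: "H \<omega> = C.H" using v by blast+
      have marks: "marks (M \<omega>) T k = A \<inter> {0..T} \<times> {- real k..real k}" for k
        unfolding marks_def atoms_def by blast
      have "inj_on fst A" using gen unfolding generic_def by blast
      then have fin: "\<forall>k. finite (marks (M \<omega>) T k) \<and> inj_on fst (marks (M \<omega>) T k)"
        unfolding marks using generic_finite[OF gen] inj_on_subset[OF _ Int_lower1] by blast
      obtain k :: nat where k: "walled T (nat \<lceil>T\<rceil>) (A \<inter> {0..T} \<times> {- real k..real k}) (real n)"
        using elim T by blast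
      \<comment> \<open>The walls may be found in a box smaller than \<open>n\<close>; enlarging the
        box keeps them.\<close>
      have "walled T (nat \<lceil>T\<rceil>) (A \<inter> {0..T} \<times> {- real (max k n)..real (max k n)}) (real n)"
        by (rule walled_mono[OF k]) simp
      then have stop: "\<exists>k\<ge>n. passes (marks (M \<omega>) T k) (walled_test T (nat \<lceil>T\<rceil>) (real n))"
        unfolding passes_walled_test marks by (intro exI[of _ "max k n"]) simp
      have out: "case graphical (real k) (sorted_key_list_of_set fst (marks (M \<omega>) T k)) t of
          (_, z, h) \<Rightarrow> Z \<omega> t x = z x \<and> D \<omega> t x = box_cluster (real k) z h x \<and> H \<omega> t x = h x"
        if p: "passes (marks (M \<omega>) T k) (walled_test T (nat \<lceil>T\<rceil>) (real n))"
          and tx: "t \<in> {0..T}" "x \<in> {- real n..real n}" for k t x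
      proof -
        interpret B: box A "real k" T by unfold_locales (rule gen)
        note w = p[unfolded passes_walled_test marks]
        have X: "{- real k<..<real k} \<subseteq> UNIV" "{} \<inter> {- real k<..<real k} = {}" by simp_all
        note a = walled_agree[OF gen C.fire_process w X tx]
        have "D \<omega> t x = cluster (C.Z t) (C.H t) x" using v tx(1) by simp
        then have D: "D \<omega> t x = box_cluster (real k) (box_Z A (real k) T t) (box_H A (real k) T t) x"
          using a(3)[OF refl] by (rule trans)
        show ?thesis
          unfolding marks box_state_def[symmetric] B.st_split prod.case Z H using a(1,2) D by blast
      qed
      show ?case
        by (rule conjI[OF fin conjI[OF stop]]) (intro allI impI ballI, rule out)
    qed
  qed
  show ?thesis
  proof (rule exI[of _ Z], rule exI[of _ D], rule exI[of _ H], intro conjI allI impI)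
    show "lffp P M Z D H" by (rule ex)
    show "AE \<omega> in P. \<forall>t\<ge>0. \<forall>x. Z' \<omega> t x = Z \<omega> t x \<and> D' \<omega> t x = D \<omega> t x \<and> H' \<omega> t x = H \<omega> t x"
      if "lffp P M Z' D' H'" for Z' D' H' by (rule uniq[OF that])
    show "perfectly_simulated P M Z D H T n" if "0 < T" for T n by (rule sim[OF that])
  qed
qed

end
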